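(* Let $X$ be a normal surface singularity, let $\mathcal{F}$ be a finite set of branches on $X$ and let $L\in\mathcal{F}$. Let $\pi$ be an embedded resolution of the sum of the branches in $\mathcal{F}$, and let $\Gamma$ be the dual graph of the total transform of this sum by $\pi$. Let $\mathrm{Conv}(\mathcal{F})$ be the convex hull of the branches of $\mathcal{F}$ (seen as vertices) in the brick-vertex tree of $\Gamma$. If $\mathrm{Conv}(\mathcal{F})$ does not contain any brick-vertex whose valency in $\mathrm{Conv}(\mathcal{F})$ is at least $4$, then $u_L$ is an ultrametric in restriction to $\mathcal{F}\setminus\{L\}$. Moreover, in this case the rooted tree of $u_L$ restricted to $\mathcal{F}\setminus\{L\}$ is isomorphic, as a rooted $\mathcal{F}$-tree, to $\mathrm{Conv}(\mathcal{F})$ rooted at the vertex corresponding to $L$.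
   Context: A normal surface singularity $(X,x_0)$ is a germ of normal complex analytic surface. A branch on $X$ is an irreducible germ at $x_0$ of formal curve lying on $X$. A resolution of $X$ is a proper bimeromorphic morphism $\pi:X_\pi\to X$ with $X_\pi$ smooth and $\pi$ an isomorphism over $X\setminus\{x_0\}$. Intersection numbers (Mumford): let $\pi$ be a resolution with exceptional components $(E_u)_u$; the intersection matrix $(E_u\cdot E_v)$ is negative definite. For a divisor $A$ on $X$, its total transform $\pi^*A$ is the unique $\mathbb{Q}$-divisor on $X_\pi$ which is the sum of the strict transform of $A$ and of an exceptional $\mathbb{Q}$-divisor, with $\pi^*A\cdot E_u=0$ for all $u$. For $A,B$ without common branches, $A\cdot B:=\pi^*A\cdot\pi^*B$ (independent of $\pi$). For branches $A,B$ different from $L$, $u_L(A,B):=\dfrac{(L\cdot A)(L\cdot B)}{A\cdot B}$ if $A\ne B$, and $u_L(A,A):=0$. $\pi$ is an embedded resolution of a divisor if the total transform of the divisor has normal crossings; the irreducible components of the exceptional divisor are taken to be smooth. The dual graph of the total transform has as vertices the exceptional components and the branches of the divisor (i.e. their strict transforms), its edges being in bijection with the intersection points of pairs of these components. Graphs are finite cell complexes of dimension at most $1$ (loops and multiple edges allowed). A cut-vertex of a connected graph is a vertex whose removal (as a point) disconnects it; a connected graph is nonseparable if it has no cut-vertex. The blocks of a connected graph $\Gamma$ are its maximal nonseparable subgraphs. A bridge is an edge such that the removal of its interior disconnects $\Gamma$; bridges are blocks, and a brick is a block which is not a bridge. The brick-vertex tree of $\Gamma$ is the tree whose vertex set is the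 union of the set of vertices of $\Gamma$ and of the set of bricks of $\Gamma$ (called brick-vertices), and whose edges are the bridges of $\Gamma$ together with one edge joining a brick to a vertex of $\Gamma$ whenever the brick contains this vertex. The convex hull of a set of vertices of a tree is the union of the paths joining them pairwise; the valency of a vertex in a subtree is the number of edges of the subtree adjacent to it. For a finite set $S$, an $S$-tree is a finite tree whose set of vertices contains $S$ and all of whose vertices of valency $1$ or $2$ belong to $S$; isomorphisms of $S$-trees are the identity on $S$. $\mathrm{Conv}(\mathcal{F})$ is viewed as an $\mathcal{F}$-tree by forgetting its vertices of valency $2$ which are not in $\mathcal{F}$ (merging the two adjacent edges). The rooted tree of an ultrametric $d$ on the finite set $S=\mathcal{F}\setminus\{L\}$: its vertices are the closed balls $\{y\in S: d(x,y)\le r\}$ ($x\in S$, $r\geq 0$), together with an extra root vertex labeled $L$ (thought of as a ball of infinite radius). Two balls are joined by an edge when one strictly contains the other and no ball lies strictly in between; the root is joined by an edge to the ball $S$. Each $A\in S$ is identified with the ball $\{A\}$. *)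

theory Defs
  imports "HOL-Complex_Analysis.Complex_Analysis"
begin

section \<open>Holomorphic functions of several variables\<close>

text \<open>Both notions are only used on open sets.\<close>

definition holo_fun :: "(complex ^ 'n \<Rightarrow> complex) \<Rightarrow> (complex ^ 'n) set \<Rightarrow> bool" where
  "holo_fun f U \<longleftrightarrow>
     (\<forall>z\<in>U. \<exists>f'. (f has_derivative f') (at z) \<and> (\<forall>c v. f' (c *s v) = c * f' v))"

definition holo_map :: "(complex ^ 'n \<Rightarrow> complex ^ 'k) \<Rightarrow> (complex ^ 'n) set \<Rightarrow> bool" where
  "holo_map f U \<longleftrightarrow> (\<forall>i. holo_fun (\<lambda>z. f z $ i) U)"


section \<open>Normal surfaces\<close>

text \<open>A germ of a reduced complex analytic space is given by a representative, a locally closed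
  analytic subset of some \<open>\<complex>\<^sup>n\<close>.\<close>

definition analytic_set :: "(complex ^ 'n) set \<Rightarrow> bool" where
  "analytic_set X \<longleftrightarrow>
     (\<forall>x\<in>X. \<exists>U F. open U \<and> x \<in> U \<and> finite F \<and> (\<forall>f\<in>F. holo_fun f U) \<and>
        X \<inter> U = {z\<in>U. \<forall>f\<in>F. f z = 0})"

text \<open>The points near which the set is an embedded complex submanifold of dimension 2: \<open>f\<close> is a
  parametrization and \<open>g\<close> a holomorphic left inverse defined on the ambient open set.\<close>

definition reg :: "(complex ^ 'n) set \<Rightarrow> (complex ^ 'n) set" where
  "reg X = {x\<in>X. \<exists>U (D :: (complex ^ 2) set) f g. open U \<and> x \<in> U \<and> open D \<and>
      holo_map f D \<and> holo_map g U \<and> f ` D = X \<inter> U \<and> (\<forall>w\<in>D. g (f w) = w)}"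

definition holo_on_set :: "(complex ^ 'n \<Rightarrow> complex) \<Rightarrow> (complex ^ 'n) set \<Rightarrow> bool" where
  "holo_on_set q Y \<longleftrightarrow>
     (\<forall>x\<in>Y. \<exists>V f. open V \<and> x \<in> V \<and> holo_fun f V \<and> (\<forall>y\<in>Y \<inter> V. q y = f y))"

text \<open>Pure dimension 2 is expressed by density of the 2-dimensional smooth points; normality says
  that every weakly holomorphic function is holomorphic.\<close>

definition normal_surface :: "(complex ^ 'n) set \<Rightarrow> bool" where
  "normal_surface X \<longleftrightarrow> analytic_set X \<and> X \<subseteq> closure (reg X) \<and>
     (\<forall>W q. open W \<and> holo_on_set q (reg X \<inter> W) \<and> bounded (q ` (reg X \<inter> W)) \<longrightarrow>
        (\<exists>Q. holo_on_set Q (X \<inter> W) \<and> (\<forall>y\<in>reg X \<inter> W. Q y = q y)))"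


section \<open>Smooth complex surfaces and resolutions\<close>

text \<open>The underlying space of a smooth surface is a whole Hausdorff type \<open>'m\<close>.\<close>

type_synonym 'm atlas = "('m set \<times> ('m \<Rightarrow> complex ^ 2)) set"

definition chart :: "('m::t2_space) atlas \<Rightarrow> 'm set \<Rightarrow> ('m \<Rightarrow> complex ^ 2) \<Rightarrow> bool" where
  "chart \<A> U \<phi> \<longleftrightarrow> open U \<and> open (\<phi> ` U) \<and> homeomorphism U (\<phi> ` U) \<phi> (inv_into U \<phi>) \<and>
     (\<forall>(V, \<psi>)\<in>\<A>. holo_map (\<phi> \<circ> inv_into V \<psi>) (\<psi> ` (U \<inter> V)) \<and>
        holo_map (\<psi> \<circ> inv_into U \<phi>) (\<phi> ` (U \<inter> V)))"

definition complex_surface :: "('m::t2_space) atlas \<Rightarrow> bool" where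
  "complex_surface \<A> \<longleftrightarrow> (\<Union>(U, \<phi>)\<in>\<A>. U) = UNIV \<and> (\<forall>(U, \<phi>)\<in>\<A>. chart \<A> U \<phi>)"

text \<open>In the fifth conjunct \<open>g\<close> expresses, in the chart \<open>\<phi>\<close>, the inverse of \<open>\<pi>\<close> near \<open>\<pi> p\<close>; with the
  preceding one it says that \<open>\<pi>\<close> is an isomorphism over the complement of \<open>x0\<close>.\<close>

definition resolution ::
  "(complex ^ 'n) set \<Rightarrow> complex ^ 'n \<Rightarrow> ('m::t2_space) atlas \<Rightarrow> ('m \<Rightarrow> complex ^ 'n) \<Rightarrow> bool" where
  "resolution X x0 \<A> \<pi> \<longleftrightarrow> complex_surface \<A> \<and>
     (range \<pi> \<subseteq> X \<and> (\<forall>(U, \<phi>)\<in>\<A>. holo_map (\<pi> \<circ> inv_into U \<phi>) (\<phi> ` U))) \<and>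
     (\<forall>K. compact K \<and> K \<subseteq> X \<longrightarrow> compact (\<pi> -` K)) \<and>
     bij_betw \<pi> (\<pi> -` (X - {x0})) (X - {x0}) \<and>
     (\<forall>p. \<pi> p \<noteq> x0 \<longrightarrow> (\<exists>U \<phi> V g. chart \<A> U \<phi> \<and> p \<in> U \<and> open V \<and> \<pi> p \<in> V \<and> holo_map g V \<and>
        (\<forall>q. \<pi> q \<in> V \<longrightarrow> q \<in> U \<and> g (\<pi> q) = \<phi> q))) \<and>
     closure (\<pi> -` (X - {x0})) = UNIV"


section \<open>Smooth curves and their self-intersection\<close>

definition adapted :: "('m::t2_space) atlas \<Rightarrow> 'm set \<Rightarrow> 'm set \<Rightarrow> ('m \<Rightarrow> complex ^ 2) \<Rightarrow> bool" where
  "adapted \<A> E U \<phi> \<longleftrightarrow> chart \<A> U \<phi> \<and> E \<inter> U = {q\<in>U. \<phi> q $ 1 = 0}"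

definition smooth_curve :: "('m::t2_space) atlas \<Rightarrow> 'm set \<Rightarrow> bool" where
  "smooth_curve \<A> E \<longleftrightarrow> closed E \<and> connected E \<and> E \<noteq> {} \<and> (\<forall>p\<in>E. \<exists>U \<phi>. adapted \<A> E U \<phi> \<and> p \<in> U)"

text \<open>Smooth connected curves are irreducible, so \<open>\<E>\<close> is the set of irreducible components of the
  exceptional divisor. It is empty when \<open>\<pi>\<close> is an isomorphism (and \<open>x0\<close> is a smooth point).\<close>

definition exceptional_components ::
  "('m::t2_space) atlas \<Rightarrow> ('m \<Rightarrow> complex ^ 'n) \<Rightarrow> complex ^ 'n \<Rightarrow> 'm set set \<Rightarrow> bool" where
  "exceptional_components \<A> \<pi> x0 \<E> \<longleftrightarrow> finite \<E> \<and> (\<forall>E\<in>\<E>. smooth_curve \<A> E) \<and>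
     (\<Union>\<E> = \<pi> -` {x0} \<or> \<E> = {} \<and> (\<exists>p. \<pi> -` {x0} = {p}))"

text \<open>If \<open>\<phi>\<close> and \<open>\<psi>\<close> are adapted to \<open>E\<close>, then \<open>\<phi>\<^sub>1 = h \<psi>\<^sub>1\<close> with \<open>h\<close> invertible, and \<open>h\<close> restricted
  to \<open>E\<close> is the following transition function of the normal bundle of \<open>E\<close>.\<close>

definition normal_transition ::
  "('m \<Rightarrow> complex ^ 2) \<Rightarrow> 'm set \<Rightarrow> ('m \<Rightarrow> complex ^ 2) \<Rightarrow> 'm \<Rightarrow> complex" where
  "normal_transition \<phi> V \<psi> p = deriv (\<lambda>t. \<phi> (inv_into V \<psi> (\<psi> p + axis 1 t)) $ 1) 0"

text \<open>\<open>s U \<phi>\<close>, a function on \<open>E \<inter> U\<close>, as a function of the coordinate \<open>\<phi>\<^sub>2\<close> of \<open>E\<close>.\<close>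

definition along :: "('m set \<Rightarrow> ('m \<Rightarrow> complex ^ 2) \<Rightarrow> 'm \<Rightarrow> complex) \<Rightarrow>
    'm set \<Rightarrow> ('m \<Rightarrow> complex ^ 2) \<Rightarrow> complex \<Rightarrow> complex" where
  "along s U \<phi> w = s U \<phi> (inv_into U \<phi> (vector [0, w]))"

text \<open>Nonzero meromorphic sections of the \<open>m\<close>-th tensor power of the normal bundle of \<open>E\<close>, given
  by their expressions in all adapted charts (with value 0 at poles).\<close>

definition normal_section :: "('m::t2_space) atlas \<Rightarrow> 'm set \<Rightarrow> int \<Rightarrow>
    ('m set \<Rightarrow> ('m \<Rightarrow> complex ^ 2) \<Rightarrow> 'm \<Rightarrow> complex) \<Rightarrow> bool" where
  "normal_section \<A> E m s \<longleftrightarrow>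
     (\<forall>U \<phi>. adapted \<A> E U \<phi> \<longrightarrow>
        along s U \<phi> nicely_meromorphic_on {w. vector [0, w] \<in> \<phi> ` U} \<and>
        (\<forall>w. vector [0, w] \<in> \<phi> ` U \<longrightarrow> (\<forall>\<^sub>F z in at w. along s U \<phi> z \<noteq> 0))) \<and>
     (\<forall>U \<phi> V \<psi> p. adapted \<A> E U \<phi> \<and> adapted \<A> E V \<psi> \<and> p \<in> E \<inter> U \<inter> V \<longrightarrow>
        s U \<phi> p = normal_transition \<phi> V \<psi> p powi m * s V \<psi> p)"

text \<open>\<open>E \<cdot> E\<close> is the degree \<open>k\<close> of the normal bundle \<open>N\<close> of the compact curve \<open>E\<close>: the divisor of any
  nonzero meromorphic section of any tensor power \<open>N\<^sup>m\<close> has degree \<open>m k\<close>. All powers are included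
  so that uniqueness of \<open>k\<close> does not rest on the existence of sections of \<open>N\<close> itself.\<close>

definition self_intersection :: "('m::t2_space) atlas \<Rightarrow> 'm set \<Rightarrow> int \<Rightarrow> bool" where
  "self_intersection \<A> E k \<longleftrightarrow>
     (\<forall>m s ord. normal_section \<A> E m s \<and>
        (\<forall>U \<phi> p. adapted \<A> E U \<phi> \<and> p \<in> E \<inter> U \<longrightarrow> ord p = zorder (along s U \<phi>) (\<phi> p $ 2)) \<longrightarrow>
        (\<Sum>p | p \<in> E \<and> ord p \<noteq> 0. ord p) = m * k)"


section \<open>Formal branches and their strict transforms\<close>

text \<open>The formal power series \<open>f \<circ> \<gamma>\<close>, for \<open>f\<close> holomorphic near the origin \<open>\<gamma>(0)\<close> of the formal arc
  \<open>\<gamma>\<close>. Its \<open>k\<close>-th coefficient only depends on the truncation of \<open>\<gamma>\<close> at order \<open>k\<close>.\<close>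

definition arc_compose :: "(complex ^ 'n \<Rightarrow> complex) \<Rightarrow> complex fps ^ 'n \<Rightarrow> complex fps" where
  "arc_compose f \<gamma> =
     Abs_fps (\<lambda>k. (deriv ^^ k) (\<lambda>t. f (\<chi> i. \<Sum>j\<le>k. fps_nth (\<gamma> $ i) j * t ^ j)) 0 / fact k)"

text \<open>An arc is primitive if it is nonconstant (case \<open>\<tau> = 0\<close>) and generically injective.\<close>

definition primitive_arc :: "complex fps ^ 'n \<Rightarrow> bool" where
  "primitive_arc \<gamma> \<longleftrightarrow>
     (\<forall>\<delta> \<tau>. fps_nth \<tau> 0 = 0 \<and> (\<forall>i. \<gamma> $ i = fps_compose (\<delta> $ i) \<tau>) \<longrightarrow> subdegree \<tau> = 1)"

text \<open>An irreducible formal curve germ is encoded by its normalization, that is, by the set of all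
  its primitive parametrizations, which differ by formal changes of parameter.\<close>

type_synonym 'n formal_branch = "(complex fps ^ 'n) set"

definition branch :: "(complex ^ 'n) set \<Rightarrow> complex ^ 'n \<Rightarrow> 'n formal_branch \<Rightarrow> bool" where
  "branch X x0 A \<longleftrightarrow> (\<exists>\<gamma>. primitive_arc \<gamma> \<and> (\<forall>i. fps_nth (\<gamma> $ i) 0 = x0 $ i) \<and>
     (\<forall>W f. open W \<and> x0 \<in> W \<and> holo_fun f W \<and> (\<forall>x\<in>X \<inter> W. f x = 0) \<longrightarrow> arc_compose f \<gamma> = 0) \<and>
     A = {(\<chi> i. fps_compose (\<gamma> $ i) \<tau>) | \<tau>. fps_nth \<tau> 0 = 0 \<and> fps_nth \<tau> 1 \<noteq> 0})"

text \<open>\<open>\<delta>\<close> is the expression in the chart \<open>\<phi>\<close> of a parametrization, with origin \<open>p\<close>, of the strict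
  transform of the branch \<open>A\<close>.\<close>

definition lift :: "('m::t2_space) atlas \<Rightarrow> ('m \<Rightarrow> complex ^ 'n) \<Rightarrow> 'n formal_branch \<Rightarrow> 'm \<Rightarrow>
    'm set \<Rightarrow> ('m \<Rightarrow> complex ^ 2) \<Rightarrow> complex fps ^ 2 \<Rightarrow> bool" where
  "lift \<A> \<pi> A p U \<phi> \<delta> \<longleftrightarrow> chart \<A> U \<phi> \<and> p \<in> U \<and> (\<forall>i. fps_nth (\<delta> $ i) 0 = \<phi> p $ i) \<and>
     (\<chi> i. arc_compose (\<lambda>z. \<pi> (inv_into U \<phi> z) $ i) \<delta>) \<in> A"

definition strict_point ::
  "('m::t2_space) atlas \<Rightarrow> ('m \<Rightarrow> complex ^ 'n) \<Rightarrow> 'n formal_branch \<Rightarrow> 'm" where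
  "strict_point \<A> \<pi> A = (THE p. \<exists>U \<phi> \<delta>. lift \<A> \<pi> A p U \<phi> \<delta>)"


section \<open>Embedded resolutions, intersection numbers, \<open>u\<^sub>L\<close>\<close>

text \<open>The components of the total transform: \<open>Inl E\<close> for an exceptional component \<open>E\<close>, and \<open>Inr A\<close>
  for the strict transform of the branch \<open>A\<close>, whose only point is \<open>strict_point \<A> \<pi> A\<close>.\<close>

type_synonym ('m, 'n) comp = "'m set + 'n formal_branch"

definition comps :: "'m set set \<Rightarrow> 'n formal_branch set \<Rightarrow> ('m, 'n) comp set" where
  "comps \<E> \<F> = Inl ` \<E> \<union> Inr ` \<F>"

definition support ::
  "('m::t2_space) atlas \<Rightarrow> ('m \<Rightarrow> complex ^ 'n) \<Rightarrow> ('m, 'n) comp \<Rightarrow> 'm set" where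
  "support \<A> \<pi> C = (case C of Inl E \<Rightarrow> E | Inr A \<Rightarrow> {strict_point \<A> \<pi> A})"

text \<open>Normal crossings of the total transform: two exceptional components cross transversally,
  strict transforms are smooth, they are transversal to the exceptional components, two of them
  through the same point are transversal, and no three components share a point.\<close>

definition embedded_resolution :: "('m::t2_space) atlas \<Rightarrow> ('m \<Rightarrow> complex ^ 'n) \<Rightarrow>
    'm set set \<Rightarrow> 'n formal_branch set \<Rightarrow> bool" where
  "embedded_resolution \<A> \<pi> \<E> \<F> \<longleftrightarrow>
     (\<forall>E\<in>\<E>. \<forall>E'\<in>\<E>. E \<noteq> E' \<longrightarrow> (\<forall>p\<in>E \<inter> E'. \<exists>U \<phi>. adapted \<A> E U \<phi> \<and> p \<in> U \<and>
        E' \<inter> U = {q\<in>U. \<phi> q $ 2 = 0})) \<and>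
     (\<forall>A\<in>\<F>. \<exists>U \<phi> \<delta>. lift \<A> \<pi> A (strict_point \<A> \<pi> A) U \<phi> \<delta> \<and> (\<exists>i. fps_nth (\<delta> $ i) 1 \<noteq> 0)) \<and>
     (\<forall>A\<in>\<F>. \<forall>E\<in>\<E>. strict_point \<A> \<pi> A \<in> E \<longrightarrow>
        (\<exists>U \<phi> \<delta>. adapted \<A> E U \<phi> \<and> lift \<A> \<pi> A (strict_point \<A> \<pi> A) U \<phi> \<delta> \<and>
           subdegree (\<delta> $ 1) = 1)) \<and>
     (\<forall>A\<in>\<F>. \<forall>B\<in>\<F>. A \<noteq> B \<and> strict_point \<A> \<pi> A = strict_point \<A> \<pi> B \<longrightarrow>
        (\<exists>U \<phi> \<delta> \<epsilon>. lift \<A> \<pi> A (strict_point \<A> \<pi> A) U \<phi> \<delta> \<and> lift \<A> \<pi> B (strict_point \<A> \<pi> A) U \<phi> \<epsilon> \<and>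
           fps_nth (\<delta> $ 1) 1 * fps_nth (\<epsilon> $ 2) 1 \<noteq> fps_nth (\<delta> $ 2) 1 * fps_nth (\<epsilon> $ 1) 1)) \<and>
     (\<forall>p. card {C \<in> comps \<E> \<F>. p \<in> support \<A> \<pi> C} \<le> 2)"

text \<open>Intersection numbers of the components of a total transform with normal crossings: every
  intersection point of two distinct components is transversal and hence counts for 1. The number
  \<open>self E\<close> is the self-intersection of \<open>E\<close>. The value 0 for a strict transform with itself is
  a dummy which does not contribute to intersection numbers of distinct branches.\<close>

definition comp_inter :: "('m::t2_space) atlas \<Rightarrow> ('m \<Rightarrow> complex ^ 'n) \<Rightarrow> ('m set \<Rightarrow> int) \<Rightarrow>
    ('m, 'n) comp \<Rightarrow> ('m, 'n) comp \<Rightarrow> int" where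
  "comp_inter \<A> \<pi> self C D =
     (if C = D then (case C of Inl E \<Rightarrow> self E | Inr A \<Rightarrow> 0)
      else int (card (support \<A> \<pi> C \<inter> support \<A> \<pi> D)))"

definition div_inter :: "('c \<Rightarrow> 'c \<Rightarrow> int) \<Rightarrow> 'c set \<Rightarrow> ('c \<Rightarrow> rat) \<Rightarrow> ('c \<Rightarrow> rat) \<Rightarrow> rat" where
  "div_inter I V D D' = (\<Sum>C\<in>V. \<Sum>C'\<in>V. D C * D' C' * of_int (I C C'))"

definition total_transform :: "(('m, 'n) comp \<Rightarrow> ('m, 'n) comp \<Rightarrow> int) \<Rightarrow> 'm set set \<Rightarrow>
    'n formal_branch set \<Rightarrow> 'n formal_branch \<Rightarrow> ('m, 'n) comp \<Rightarrow> rat" where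
  "total_transform I \<E> \<F> A = (THE D.
     (\<forall>B. D (Inr B) = (if B = A then 1 else 0)) \<and> (\<forall>E. E \<notin> \<E> \<longrightarrow> D (Inl E) = 0) \<and>
     (\<forall>E\<in>\<E>. div_inter I (comps \<E> \<F>) D (\<lambda>C. if C = Inl E then 1 else 0) = 0))"

definition branch_inter :: "(('m, 'n) comp \<Rightarrow> ('m, 'n) comp \<Rightarrow> int) \<Rightarrow> 'm set set \<Rightarrow>
    'n formal_branch set \<Rightarrow> 'n formal_branch \<Rightarrow> 'n formal_branch \<Rightarrow> rat" where
  "branch_inter I \<E> \<F> A B =
     div_inter I (comps \<E> \<F>) (total_transform I \<E> \<F> A) (total_transform I \<E> \<F> B)"

definition u_fun :: "(('m, 'n) comp \<Rightarrow> ('m, 'n) comp \<Rightarrow> int) \<Rightarrow> 'm set set \<Rightarrow>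
    'n formal_branch set \<Rightarrow> 'n formal_branch \<Rightarrow> 'n formal_branch \<Rightarrow> 'n formal_branch \<Rightarrow> real" where
  "u_fun I \<E> \<F> L A B = (if A = B then 0 else
     of_rat (branch_inter I \<E> \<F> L A * branch_inter I \<E> \<F> L B / branch_inter I \<E> \<F> A B))"


section \<open>Blocks and bricks of a finite graph\<close>

text \<open>A finite graph is given by its sets \<open>W\<close> of vertices and \<open>F\<close> of edges; \<open>ends e\<close> is the set of
  ends of the edge \<open>e\<close>, a singleton for a loop.\<close>

type_synonym ('v, 'e) graph = "'v set \<times> 'e set"

text \<open>Connectedness of the union of the cells (vertices and open edges) in \<open>W\<close> and \<open>F\<close>. The ends of
  the edges in \<open>F\<close> need not be in \<open>W\<close>, which allows to remove a vertex as a point.\<close>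

definition cells_connected :: "('e \<Rightarrow> 'v set) \<Rightarrow> 'v set \<Rightarrow> 'e set \<Rightarrow> bool" where
  "cells_connected ends W F \<longleftrightarrow>
     (let R = {(Inl v, Inr e) | v e. v \<in> W \<and> e \<in> F \<and> v \<in> ends e}
      in \<forall>a \<in> W <+> F. \<forall>b \<in> W <+> F. (a, b) \<in> (R \<union> R\<inverse>)\<^sup>*)"

definition nonseparable :: "('e \<Rightarrow> 'v set) \<Rightarrow> ('v, 'e) graph \<Rightarrow> bool" where
  "nonseparable ends G \<longleftrightarrow> fst G \<noteq> {} \<and> cells_connected ends (fst G) (snd G) \<and>
     (\<forall>v\<in>fst G. cells_connected ends (fst G - {v}) (snd G))"

definition subgraph :: "('e \<Rightarrow> 'v set) \<Rightarrow> ('v, 'e) graph \<Rightarrow> ('v, 'e) graph \<Rightarrow> bool" where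
  "subgraph ends H G \<longleftrightarrow> fst H \<subseteq> fst G \<and> snd H \<subseteq> snd G \<and> (\<forall>e\<in>snd H. ends e \<subseteq> fst H)"

definition block :: "('e \<Rightarrow> 'v set) \<Rightarrow> ('v, 'e) graph \<Rightarrow> ('v, 'e) graph \<Rightarrow> bool" where
  "block ends G H \<longleftrightarrow> subgraph ends H G \<and> nonseparable ends H \<and>
     (\<forall>H'. subgraph ends H' G \<and> nonseparable ends H' \<and> subgraph ends H H' \<longrightarrow> H' = H)"

definition bridge :: "('e \<Rightarrow> 'v set) \<Rightarrow> ('v, 'e) graph \<Rightarrow> 'e \<Rightarrow> bool" where
  "bridge ends G e \<longleftrightarrow> e \<in> snd G \<and> \<not> cells_connected ends (fst G) (snd G - {e})"

definition brick :: "('e \<Rightarrow> 'v set) \<Rightarrow> ('v, 'e) graph \<Rightarrow> ('v, 'e) graph \<Rightarrow> bool" where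
  "brick ends G H \<longleftrightarrow> block ends G H \<and> \<not> (\<exists>e. bridge ends G e \<and> H = (ends e, {e}))"


section \<open>Trees\<close>

text \<open>Simple graphs, with edges given by the sets of their two ends.\<close>

type_synonym 'v sgraph = "'v set \<times> 'v set set"

definition brick_vertex_tree ::
  "('e \<Rightarrow> 'v set) \<Rightarrow> ('v, 'e) graph \<Rightarrow> ('v + ('v, 'e) graph) sgraph" where
  "brick_vertex_tree ends G =
     (Inl ` fst G \<union> Inr ` {H. brick ends G H},
      {Inl ` ends e | e. bridge ends G e} \<union> {{Inr H, Inl v} | H v. brick ends G H \<and> v \<in> fst H})"

definition spath :: "'v sgraph \<Rightarrow> 'v \<Rightarrow> 'v list \<Rightarrow> 'v \<Rightarrow> bool" where
  "spath T x p y \<longleftrightarrow> p \<noteq> [] \<and> distinct p \<and> set p \<subseteq> fst T \<and> hd p = x \<and> last p = y \<and>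
     (\<forall>i. Suc i < length p \<longrightarrow> {p ! i, p ! Suc i} \<in> snd T)"

definition convex_hull :: "'v sgraph \<Rightarrow> 'v set \<Rightarrow> 'v sgraph" where
  "convex_hull T S =
     (\<Union>{set p | p. \<exists>x\<in>S. \<exists>y\<in>S. spath T x p y},
      {{p ! i, p ! Suc i} | p i. Suc i < length p \<and> (\<exists>x\<in>S. \<exists>y\<in>S. spath T x p y)})"

definition valency :: "'v sgraph \<Rightarrow> 'v \<Rightarrow> nat" where
  "valency T v = card {e \<in> snd T. v \<in> e}"

definition finite_tree :: "'v sgraph \<Rightarrow> bool" where
  "finite_tree T \<longleftrightarrow> finite (fst T) \<and> fst T \<noteq> {} \<and> (\<forall>e\<in>snd T. e \<subseteq> fst T \<and> card e = 2) \<and>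
     (\<forall>x\<in>fst T. \<forall>y\<in>fst T. \<exists>!p. spath T x p y)"

text \<open>The elements of \<open>S\<close> are identified with vertices through an injective labelling.\<close>

definition S_tree :: "'s set \<Rightarrow> ('s \<Rightarrow> 'v) \<Rightarrow> 'v sgraph \<Rightarrow> bool" where
  "S_tree S lab T \<longleftrightarrow> finite_tree T \<and> inj_on lab S \<and> lab ` S \<subseteq> fst T \<and>
     (\<forall>v\<in>fst T. valency T v \<in> {1, 2} \<longrightarrow> v \<in> lab ` S)"

text \<open>\<open>r\<close> and \<open>r'\<close> are the roots.\<close>

definition rooted_S_tree_iso :: "'s set \<Rightarrow> ('s \<Rightarrow> 'v) \<Rightarrow> 'v sgraph \<Rightarrow> 'v \<Rightarrow>
    ('s \<Rightarrow> 'w) \<Rightarrow> 'w sgraph \<Rightarrow> 'w \<Rightarrow> bool" where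
  "rooted_S_tree_iso S lab T r lab' T' r' \<longleftrightarrow> S_tree S lab T \<and> S_tree S lab' T' \<and>
     (\<exists>f. bij_betw f (fst T) (fst T') \<and> snd T' = (`) f ` snd T \<and> f r = r' \<and>
        (\<forall>s\<in>S. f (lab s) = lab' s))"

text \<open>Forgetting the vertices of valency 2 outside \<open>K\<close>: the maximal paths whose interior vertices are
  forgotten become edges.\<close>

definition smoothing :: "'v set \<Rightarrow> 'v sgraph \<Rightarrow> 'v sgraph" where
  "smoothing K T =
     (let W = {v\<in>fst T. v \<in> K \<or> valency T v \<noteq> 2}
      in (W, {{x, y} | x y. x \<noteq> y \<and> x \<in> W \<and> y \<in> W \<and> (\<exists>p. spath T x p y \<and> set p \<inter> W = {x, y})}))"


section \<open>Ultrametrics and their rooted trees\<close>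

definition ultrametric_on :: "'s set \<Rightarrow> ('s \<Rightarrow> 's \<Rightarrow> real) \<Rightarrow> bool" where
  "ultrametric_on S d \<longleftrightarrow>
     (\<forall>x\<in>S. \<forall>y\<in>S. 0 \<le> d x y \<and> (d x y = 0 \<longleftrightarrow> x = y) \<and> d x y = d y x) \<and>
     (\<forall>x\<in>S. \<forall>y\<in>S. \<forall>z\<in>S. d x z \<le> max (d x y) (d y z))"

definition closed_balls :: "'s set \<Rightarrow> ('s \<Rightarrow> 's \<Rightarrow> real) \<Rightarrow> 's set set" where
  "closed_balls S d = {{y\<in>S. d x y \<le> r} | x r. x \<in> S \<and> 0 \<le> r}"

text \<open>The root is \<open>None\<close>. There is no ball when \<open>S\<close> is empty.\<close>

definition ball_tree :: "'s set \<Rightarrow> ('s \<Rightarrow> 's \<Rightarrow> real) \<Rightarrow> 's set option sgraph" where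
  "ball_tree S d =
     (insert None (Some ` closed_balls S d),
      {{Some b, Some b'} | b b'. b \<in> closed_balls S d \<and> b' \<in> closed_balls S d \<and> b \<subset> b' \<and>
          \<not> (\<exists>c\<in>closed_balls S d. b \<subset> c \<and> c \<subset> b')}
      \<union> (if S = {} then {} else {{None, Some S}}))"


section \<open>The dual graph and the convex hull of the branches\<close>

text \<open>The edges of the dual graph are indexed by the pairs of an intersection point and the set of
  the two components through it; the second projection gives the ends.\<close>

definition dual_graph :: "('m::t2_space) atlas \<Rightarrow> ('m \<Rightarrow> complex ^ 'n) \<Rightarrow> 'm set set \<Rightarrow>
    'n formal_branch set \<Rightarrow> (('m, 'n) comp, 'm \<times> ('m, 'n) comp set) graph" where
  "dual_graph \<A> \<pi> \<E> \<F> =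
     (comps \<E> \<F>,
      {(p, {C, D}) | p C D. C \<in> comps \<E> \<F> \<and> D \<in> comps \<E> \<F> \<and> C \<noteq> D \<and>
          p \<in> support \<A> \<pi> C \<inter> support \<A> \<pi> D})"

abbreviation branch_vertex :: "'n formal_branch \<Rightarrow>
    ('m, 'n) comp + (('m, 'n) comp, 'm \<times> ('m, 'n) comp set) graph" where
  "branch_vertex A \<equiv> Inl (Inr A)"

definition Conv :: "('m::t2_space) atlas \<Rightarrow> ('m \<Rightarrow> complex ^ 'n) \<Rightarrow> 'm set set \<Rightarrow>
    'n formal_branch set \<Rightarrow>
    (('m, 'n) comp + (('m, 'n) comp, 'm \<times> ('m, 'n) comp set) graph) sgraph" where
  "Conv \<A> \<pi> \<E> \<F> =
     convex_hull (brick_vertex_tree snd (dual_graph \<A> \<pi> \<E> \<F>)) (branch_vertex ` \<F>)"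

end

theory Submission
  imports Defs "HOL-Library.Sublist"
begin

text \<open>A coordinate function vanishing at \<open>x0\<close> has a positive order of vanishing \<open>m E\<close> along every
  exceptional component \<open>E\<close>. Its leading coefficient along \<open>E\<close> is a section of a power of the normal
  bundle, whose degree gives \<open>(\<Sum>E'. m E' (E \<cdot> E')) \<le> 0\<close>; equality for all \<open>E\<close> would confine the zeros
  of the function near the fibre to the fibre, against the maximum principle on its level curves.
  These weights replace negative definiteness: they yield a discrete maximum principle, hence
  positive Green functions \<open>G\<close> (the columns of minus the inverse of the intersection matrix), with
  \<open>A \<cdot> B = G a b\<close> for branches \<open>A\<close>, \<open>B\<close> crossing the components \<open>a\<close>, \<open>b\<close>, and
  \<open>G a v * G v b \<le> G a b * G v v\<close> with equality precisely when \<open>v\<close> separates \<open>a\<close> from \<open>b\<close>.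

  Removing a vertex of the dual graph separates the same vertices in the dual graph and in its
  brick-vertex tree. Rooting this tree at \<open>L\<close>, the inequality above shows that
  \<open>u\<^sub>L(A, B) \<le> u\<^sub>L(A, C)\<close> if and only if the meet of \<open>A\<close> and \<open>C\<close> lies above \<open>B\<close>; the valency hypothesis
  enters only when three branches part at a single vertex, which then has to be an exceptional
  component. So the closed balls are the sets of branches below the vertices of the convex hull.\<close>

section \<open>Functions of two complex variables\<close>

text \<open>For fixed \<open>b\<close> and \<open>v\<close> the difference
  \<open>G a b * G v v - G a v * G v b\<close>, as a function of \<open>a\<close>, vanishes at
  \<open>v\<close> and solves the equation of a Green function with pole \<open>b\<close> on the
  rest of the graph; hence it is positive exactly on the component of \<open>b\<close> that remains
  when \<open>v\<close> is removed. A comparison of two distances multiplies two such inequalities,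
  one of them strict, against equalities. Weights exist only at vertices of the dual graph, but no
  edge of the brick-vertex tree joins two brick-vertices, so a weighted vertex is found between any
  two distinct comparable meets, ends included. Since self-intersection is a degree, orders of
  vanishing have to be compared between arbitrary adapted charts. They are characterized by limits
  along and off the curve; the local analysis is Cauchy theory in each of two variables. Normality
  is used for the connectedness of the fibre, which makes the dual graph connected and provides a
  coordinate that vanishes identically near no point of the fibre. The case without exceptional
  components, with at most two branches, is treated apart.\<close>

lemma continuous_on_flip:
  assumes "continuous_on (A \<times> B) (\<lambda>(x, y). F x y)"
  shows "continuous_on (B \<times> A) (\<lambda>(y, x). F x y)"
proof -
  have "continuous_on (B \<times> A) (\<lambda>p. (case (snd p, fst p) of (x, y) \<Rightarrow> F x y))"
    by (rule continuous_on_compose2[OF assms]) (auto intro!: continuous_intros)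
  then show ?thesis by (simp add: case_prod_unfold)
qed

lemma continuous_on_Times_compose:
  assumes "continuous_on (A \<times> B) (\<lambda>(x, y). F x y)" "continuous_on S f" "continuous_on S g"
    "f ` S \<subseteq> A" "g ` S \<subseteq> B"
  shows "continuous_on S (\<lambda>s. F (f s) (g s))"
proof -
  have "continuous_on S (\<lambda>s. (case (f s, g s) of (x, y) \<Rightarrow> F x y))"
    by (rule continuous_on_compose2[OF assms(1)]) (use assms in \<open>auto intro!: continuous_intros\<close>)
  then show ?thesis by simp
qed

text \<open>The tube lemma, with the parameter in second place. It turns joint continuity into
  uniform closeness on compact sets such as discs and circles, to which Cauchy estimates and the
  maximum modulus principle apply.\<close>

lemma uniform_nhds_of_compact:
  fixes \<Phi> :: "'a::topological_space \<Rightarrow> 'b::topological_space \<Rightarrow> 'c::metric_space"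
  assumes "continuous_on (A \<times> T) (\<lambda>(x, t). \<Phi> x t)" "compact C" "C \<subseteq> A" "t0 \<in> T" "0 < e"
  obtains N where "open N" "t0 \<in> N" "\<And>t x. t \<in> N \<inter> T \<Longrightarrow> x \<in> C \<Longrightarrow> dist (\<Phi> x t) (\<Phi> x t0) \<le> e"
proof -
  have "continuous_on (T \<times> C) (\<lambda>(t, x). \<Phi> x t)"
    by (rule continuous_on_flip, rule continuous_on_subset[OF assms(1)]) (use assms in auto)
  from continuous_on_prod_compactE[OF this assms(2,4,5)]
  obtain X0 where "t0 \<in> X0" "open X0"
    "\<forall>t\<in>X0 \<inter> T. \<forall>x\<in>C. dist (case (t, x) of (t, x) \<Rightarrow> \<Phi> x t) (case (t0, x) of (t, x) \<Rightarrow> \<Phi> x t) \<le> e"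
    by blast
  then show thesis by (intro that[of X0]) auto
qed

lemma continuous_on_TimesI:
  fixes \<Phi> :: "'a::topological_space \<Rightarrow> 'b::topological_space \<Rightarrow> 'c::metric_space"
  assumes "\<And>x0 t0 e. x0 \<in> A \<Longrightarrow> t0 \<in> T \<Longrightarrow> 0 < e \<Longrightarrow>
    \<exists>M N. open M \<and> open N \<and> x0 \<in> M \<and> t0 \<in> N \<and>
      (\<forall>x\<in>M \<inter> A. \<forall>t\<in>N \<inter> T. dist (\<Phi> x t) (\<Phi> x0 t0) < e)"
  shows "continuous_on (A \<times> T) (\<lambda>(x, t). \<Phi> x t)"
  unfolding continuous_on_def
proof (intro ballI tendstoI)
  fix p e assume p: "p \<in> A \<times> T" "(0::real) < e"
  obtain x0 t0 where pp: "p = (x0, t0)" by force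
  with p have "x0 \<in> A" "t0 \<in> T" by auto
  from assms[OF this p(2)] obtain M N where MN: "open M" "open N" "x0 \<in> M" "t0 \<in> N"
    "\<forall>x\<in>M \<inter> A. \<forall>t\<in>N \<inter> T. dist (\<Phi> x t) (\<Phi> x0 t0) < e" by blast
  show "\<forall>\<^sub>F q in at p within A \<times> T. dist (case q of (x, t) \<Rightarrow> \<Phi> x t) (case p of (x, t) \<Rightarrow> \<Phi> x t) < e"
    unfolding eventually_at_topological
    by (rule exI[of _ "M \<times> N"]) (use MN in \<open>auto simp: pp open_Times\<close>)
qed

text \<open>Cauchy's inequality bounds the difference of two derivatives at \<open>x\<close> by the
  supremum of \<open>\<Phi> y t - \<Phi> y t0\<close> over a circle around \<open>x\<close>, which
  is small by compactness. The parameter space carries only a topology, so a real interval and a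
  second complex variable are both covered.\<close>

lemma continuous_on_deriv_param:
  fixes \<Phi> :: "complex \<Rightarrow> 'b::topological_space \<Rightarrow> complex"
  assumes cont: "continuous_on (A \<times> T) (\<lambda>(x, t). \<Phi> x t)" and A: "open A"
    and hol: "\<And>t. t \<in> T \<Longrightarrow> (\<lambda>x. \<Phi> x t) holomorphic_on A"
  shows "continuous_on (A \<times> T) (\<lambda>(x, t). deriv (\<lambda>x. \<Phi> x t) x)"
proof (rule continuous_on_TimesI)
  fix x0 t0 and e :: real assume x0: "x0 \<in> A" and t0: "t0 \<in> T" and e: "0 < e"
  obtain r where r: "r > 0" "cball x0 (2 * r) \<subseteq> A"
  proof -
    obtain s where "s > 0" "cball x0 s \<subseteq> A" using A x0 open_contains_cball by blast
    then show thesis by (intro that[of "s/2"]) auto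
  qed
  \<comment> \<open>Divided by the radius \<open>r\<close> in Cauchy's inequality, this tolerance
    becomes \<open>e / 3\<close>; the disc of radius \<open>2 * r\<close> contains the discs of
    radius \<open>r\<close> about all nearby centres.\<close>
  have "e * r / 3 > 0" using e r by simp
  from uniform_nhds_of_compact[OF cont compact_cball r(2) t0 this] obtain N where
    N: "open N" "t0 \<in> N" "\<And>t x. t \<in> N \<inter> T \<Longrightarrow> x \<in> cball x0 (2 * r) \<Longrightarrow> dist (\<Phi> x t) (\<Phi> x t0) \<le> e * r / 3"
    by blast
  have "continuous_on A (deriv (\<lambda>x. \<Phi> x t0))"
    using hol[OF t0] A by (intro holomorphic_on_imp_continuous_on holomorphic_deriv)
  then obtain d where d: "d > 0" "\<And>x. x \<in> A \<Longrightarrow> dist x x0 < d \<Longrightarrow>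
      dist (deriv (\<lambda>x. \<Phi> x t0) x) (deriv (\<lambda>x. \<Phi> x t0) x0) < e / 3"
    unfolding continuous_on_iff using x0 e by (metis divide_pos_pos zero_less_numeral)
  show "\<exists>M N. open M \<and> open N \<and> x0 \<in> M \<and> t0 \<in> N \<and>
      (\<forall>x\<in>M \<inter> A. \<forall>t\<in>N \<inter> T. dist (deriv (\<lambda>x. \<Phi> x t) x) (deriv (\<lambda>x. \<Phi> x t0) x0) < e)"
  proof (intro exI[of _ "ball x0 (min d r)"] exI[of _ N] conjI ballI)
    fix x t assume x: "x \<in> ball x0 (min d r) \<inter> A" and t: "t \<in> N \<inter> T"
    have sub: "cball x r \<subseteq> cball x0 (2 * r)"
      using x by (auto simp: cball_subset_cball_iff dist_commute)
    have hd: "(\<lambda>x. \<Phi> x t - \<Phi> x t0) holomorphic_on A"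
      using hol t t0 by (auto intro!: holomorphic_intros)
    have "norm ((deriv ^^ 1) (\<lambda>x. \<Phi> x t - \<Phi> x t0) x) \<le> fact 1 * (e * r / 3) / r ^ 1"
    proof (rule Cauchy_inequality)
      show "(\<lambda>x. \<Phi> x t - \<Phi> x t0) holomorphic_on ball x r"
        by (rule holomorphic_on_subset[OF hd]) (use sub r ball_subset_cball in blast)
      show "continuous_on (cball x r) (\<lambda>x. \<Phi> x t - \<Phi> x t0)"
        by (rule continuous_on_subset[OF holomorphic_on_imp_continuous_on[OF hd]]) (use sub r in blast)
      fix y assume "norm (x - y) = r"
      then have "y \<in> cball x0 (2 * r)" using sub by (auto simp: dist_norm)
      then show "norm (\<Phi> y t - \<Phi> y t0) \<le> e * r / 3" using N(3)[OF t] by (simp add: dist_norm)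
    qed fact
    moreover have "deriv (\<lambda>x. \<Phi> x t - \<Phi> x t0) x = deriv (\<lambda>x. \<Phi> x t) x - deriv (\<lambda>x. \<Phi> x t0) x"
      using hol[of t] hol[OF t0] t x A
      by (intro deriv_diff holomorphic_on_imp_differentiable_at[of _ A]) auto
    ultimately have "dist (deriv (\<lambda>x. \<Phi> x t) x) (deriv (\<lambda>x. \<Phi> x t0) x) \<le> e / 3"
      using r by (simp add: dist_norm)
    moreover have "dist (deriv (\<lambda>x. \<Phi> x t0) x) (deriv (\<lambda>x. \<Phi> x t0) x0) < e / 3"
      using d(2)[of x] x by (simp add: dist_commute)
    ultimately show "dist (deriv (\<lambda>x. \<Phi> x t) x) (deriv (\<lambda>x. \<Phi> x t0) x0) < e"
      using dist_triangle[of "deriv (\<lambda>x. \<Phi> x t) x" "deriv (\<lambda>x. \<Phi> x t0) x0" "deriv (\<lambda>x. \<Phi> x t0) x"] e by linarith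
  qed (use N d r in auto)
qed

lemma holomorphic_param_integral:
  fixes \<Phi> :: "complex \<Rightarrow> real \<Rightarrow> complex"
  assumes cont: "continuous_on (A \<times> {a..b}) (\<lambda>(x, t). \<Phi> x t)" and A: "open A" "convex A"
    and hol: "\<And>t. t \<in> {a..b} \<Longrightarrow> (\<lambda>x. \<Phi> x t) holomorphic_on A"
  shows "(\<lambda>x. integral {a..b} (\<Phi> x)) holomorphic_on A"
proof -
  have "(\<lambda>x. integral (cbox a b) (\<Phi> x)) holomorphic_on A"
  proof (rule leibniz_rule_holomorphic)
    fix x t assume "x \<in> A" "t \<in> cbox a b"
    then show "((\<lambda>x. \<Phi> x t) has_field_derivative deriv (\<lambda>x. \<Phi> x t) x) (at x within A)"
      using hol[of t] A by (intro has_field_derivative_at_within[OF holomorphic_derivI[of _ A]]) auto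
  next
    fix x assume x: "x \<in> A"
    have "continuous_on {a..b} (\<lambda>t. \<Phi> x t)"
      by (rule continuous_on_Times_compose[OF cont]) (use x in \<open>auto intro!: continuous_intros\<close>)
    then show "\<Phi> x integrable_on cbox a b"
      by (auto intro!: integrable_continuous_interval)
  next
    show "continuous_on (A \<times> cbox a b) (\<lambda>(x, t). deriv (\<lambda>x. \<Phi> x t) x)"
      using continuous_on_deriv_param[OF cont A(1) hol] by simp
  qed fact
  then show ?thesis by simp
qed

text \<open>Joint continuity is built in so that compactness arguments apply at once and each
  variable can be treated by one-variable theory, the other being a parameter.\<close>

definition hol2 :: "(complex \<Rightarrow> complex \<Rightarrow> complex) \<Rightarrow> complex set \<Rightarrow> complex set \<Rightarrow> bool" where
  "hol2 F A B \<longleftrightarrow> continuous_on (A \<times> B) (\<lambda>(x, y). F x y) \<and>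
     (\<forall>y\<in>B. (\<lambda>x. F x y) holomorphic_on A) \<and> (\<forall>x\<in>A. F x holomorphic_on B)"

lemma hol2_subset: "hol2 F A B \<Longrightarrow> A' \<subseteq> A \<Longrightarrow> B' \<subseteq> B \<Longrightarrow> hol2 F A' B'"
  unfolding hol2_def by (meson Sigma_mono continuous_on_subset holomorphic_on_subset subset_iff)

lemma hol2_swap: "hol2 F A B \<Longrightarrow> hol2 (\<lambda>y x. F x y) B A"
  by (auto simp: hol2_def intro: continuous_on_flip)

lemma hol2_diff: "hol2 F A B \<Longrightarrow> hol2 G A B \<Longrightarrow> hol2 (\<lambda>x y. F x y - G x y) A B"
  by (auto simp: hol2_def case_prod_unfold intro!: continuous_intros holomorphic_intros)

text \<open>The value at \<open>x = 0\<close> is the removable singularity of the quotient.\<close>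

definition quot_x :: "(complex \<Rightarrow> complex \<Rightarrow> complex) \<Rightarrow> complex \<Rightarrow> complex \<Rightarrow> complex" where
  "quot_x F x y = (if x = 0 then deriv (\<lambda>x. F x y) 0 else F x y / x)"

text \<open>In \<open>x\<close> the singularity at 0 is removable. On a circle around 0 division is
  harmless, and the maximum modulus principle carries the estimate into its interior, which gives
  joint continuity. At \<open>x = 0\<close>, holomorphy in \<open>y\<close> is inherited as a
  locally uniform limit.\<close>

lemma quot_x:
  assumes F: "hol2 F (ball 0 r) B" and B: "open B" and r: "0 < r" and F0: "\<And>y. y \<in> B \<Longrightarrow> F 0 y = 0"
  shows "hol2 (quot_x F) (ball 0 r) B" "\<And>x y. y \<in> B \<Longrightarrow> F x y = x * quot_x F x y"
proof -
  show "F x y = x * quot_x F x y" if "y \<in> B" for x y using F0[OF that] by (simp add: quot_x_def)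
  have hx: "(\<lambda>x. quot_x F x y) holomorphic_on ball 0 r" if "y \<in> B" for y
  proof -
    have "(\<lambda>x. F x y) holomorphic_on ball 0 r" using F that by (auto simp: hol2_def)
    from pole_lemma_open[OF this, of 0] show ?thesis
      unfolding quot_x_def using F0[OF that] by (auto intro: holomorphic_transform)
  qed
  have cont: "continuous_on (ball 0 r \<times> B) (\<lambda>(x, y). quot_x F x y)"
  proof (rule continuous_on_TimesI)
    fix x0 y0 :: complex and e :: real assume x0: "x0 \<in> ball 0 r" and y0: "y0 \<in> B" and e: "0 < e"
    \<comment> \<open>A circle that encloses \<open>x0\<close>, avoids 0 and stays inside the ball
      of radius \<open>r\<close>.\<close>
    define \<rho> where "\<rho> = (norm x0 + r) / 2"
    have \<rho>: "0 < \<rho>" "norm x0 < \<rho>" "\<rho> < r" using x0 r norm_ge_zero[of x0] by (simp_all add: \<rho>_def del: norm_ge_zero)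
    have "e * \<rho> / 3 > 0" using e \<rho> by simp
    have sub: "cball 0 \<rho> \<subseteq> ball 0 r" "continuous_on (ball 0 r \<times> B) (\<lambda>(x, y). F x y)"
      using F \<rho> by (auto simp: hol2_def)
    obtain N where N: "open N" "y0 \<in> N"
      "\<And>y x. y \<in> N \<inter> B \<Longrightarrow> x \<in> cball 0 \<rho> \<Longrightarrow> dist (F x y) (F x y0) \<le> e * \<rho> / 3"
      using uniform_nhds_of_compact[OF sub(2) compact_cball sub(1) y0 \<open>e * \<rho> / 3 > 0\<close>] by blast
    have "continuous_on (ball 0 r) (\<lambda>x. quot_x F x y0)"
      using hx[OF y0] holomorphic_on_imp_continuous_on by blast
    then obtain d where d: "d > 0" "\<And>x. x \<in> ball 0 r \<Longrightarrow> dist x x0 < d \<Longrightarrow>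
      dist (quot_x F x y0) (quot_x F x0 y0) < e / 3"
      unfolding continuous_on_iff using x0 e by (metis divide_pos_pos zero_less_numeral)
    show "\<exists>M N. open M \<and> open N \<and> x0 \<in> M \<and> y0 \<in> N \<and>
      (\<forall>x\<in>M \<inter> ball 0 r. \<forall>y\<in>N \<inter> B. dist (quot_x F x y) (quot_x F x0 y0) < e)"
    proof (rule exI[of _ "ball 0 \<rho> \<inter> ball x0 d"], rule exI[of _ N], intro conjI ballI)
      fix x y assume x: "x \<in> ball 0 \<rho> \<inter> ball x0 d \<inter> ball 0 r" and y: "y \<in> N \<inter> B"
      have hd: "(\<lambda>x. quot_x F x y - quot_x F x y0) holomorphic_on ball 0 r"
        using hx y y0 by (auto intro!: holomorphic_intros)
      have "norm (quot_x F x y - quot_x F x y0) \<le> e / 3"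
      proof (rule maximum_modulus_frontier[where S = "cball 0 \<rho>" and \<xi> = x
          and f = "\<lambda>x. quot_x F x y - quot_x F x y0"])
        show "(\<lambda>x. quot_x F x y - quot_x F x y0) holomorphic_on interior (cball 0 \<rho>)"
          by (rule holomorphic_on_subset[OF hd]) (use \<rho> in auto)
        show "continuous_on (closure (cball 0 \<rho>)) (\<lambda>x. quot_x F x y - quot_x F x y0)"
          by (rule continuous_on_subset[OF holomorphic_on_imp_continuous_on[OF hd]]) (use \<rho> in auto)
        fix z :: complex assume "z \<in> frontier (cball 0 \<rho>)"
        then have z: "norm z = \<rho>" using \<rho> by (simp add: frontier_cball)
        then have "norm (F z y - F z y0) \<le> e * \<rho> / 3" using N(3)[OF y, of z] by (simp add: dist_norm)
        moreover have "quot_x F z y - quot_x F z y0 = (F z y - F z y0) / z"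
          using z \<rho> by (auto simp: quot_x_def diff_divide_distrib)
        ultimately show "norm (quot_x F z y - quot_x F z y0) \<le> e / 3"
          using z \<rho> by (simp add: norm_divide field_simps)
      qed (use x in auto)
      moreover have "dist (quot_x F x y0) (quot_x F x0 y0) < e / 3"
        using d(2)[of x] x by (simp add: dist_commute)
      ultimately show "dist (quot_x F x y) (quot_x F x0 y0) < e"
        using dist_triangle[of "quot_x F x y" "quot_x F x0 y0" "quot_x F x y0"] e by (simp add: dist_norm)
    qed (use N d \<rho> in auto)
  qed
  have "quot_x F 0 holomorphic_on B"
  proof (rule holomorphic_uniform_sequence[OF B])
    \<comment> \<open>The points \<open>r / (n + 2)\<close> are non-zero, lie in the ball and tend
      to 0.\<close>
    fix n :: nat
    have "complex_of_real (r / (real n + 2)) \<in> ball 0 r" "complex_of_real (r / (real n + 2)) \<noteq> 0"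
      unfolding mem_ball_0 norm_of_real of_real_eq_0_iff using r by (auto simp: field_simps add_pos_nonneg)
    then show "quot_x F (complex_of_real (r / (real n + 2))) holomorphic_on B"
      unfolding quot_x_def using F r by (auto simp: hol2_def intro!: holomorphic_intros)
  next
    fix y assume "y \<in> B"
    then obtain d where d: "d > 0" "cball y d \<subseteq> B" using B open_contains_cball by blast
    have lim: "(\<lambda>n. complex_of_real (r / (real n + 2))) \<longlonglongrightarrow> 0"
    proof -
      have "(\<lambda>n. r / (real n + 2)) \<longlonglongrightarrow> 0" by real_asymp
      from tendsto_of_real[OF this, where 'a = complex] show ?thesis by simp
    qed
    have "uniform_limit (cball y d) (\<lambda>n. quot_x F (complex_of_real (r / (real n + 2)))) (quot_x F 0) sequentially"
      unfolding uniform_limit_iff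
    proof (intro allI impI)
      fix e :: real assume "e > 0"
      then have "e / 2 > 0" by simp
      from continuous_on_prod_compactE[OF continuous_on_subset[OF cont] compact_cball _ this, of "ball 0 r" y d 0] d r
      obtain X0 where X0: "0 \<in> X0" "open X0"
        "\<forall>x\<in>X0 \<inter> ball 0 r. \<forall>t\<in>cball y d. dist (quot_x F x t) (quot_x F 0 t) \<le> e / 2"
        by auto
      have "\<forall>\<^sub>F n in sequentially. complex_of_real (r / (real n + 2)) \<in> X0 \<inter> ball 0 r"
        using X0 r by (intro topological_tendstoD[OF lim]) auto
      then show "\<forall>\<^sub>F n in sequentially. \<forall>t\<in>cball y d. dist (quot_x F (complex_of_real (r / (real n + 2))) t) (quot_x F 0 t) < e"
      proof eventually_elim
        case (elim n)
        then have "\<forall>t\<in>cball y d. dist (quot_x F (complex_of_real (r / (real n + 2))) t) (quot_x F 0 t) \<le> e / 2"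
          using X0(3) by blast
        with \<open>e > 0\<close> show ?case by force
      qed
    qed
    then show "\<exists>d>0. cball y d \<subseteq> B \<and> uniform_limit (cball y d) (\<lambda>n. quot_x F (complex_of_real (r / (real n + 2)))) (quot_x F 0) sequentially"
      using d by auto
  qed
  moreover have "quot_x F x holomorphic_on B" if "x \<in> ball 0 r" "x \<noteq> 0" for x
    unfolding quot_x_def using F that by (auto simp: hol2_def intro!: holomorphic_intros)
  ultimately show "hol2 (quot_x F) (ball 0 r) B"
    using hx cont unfolding hol2_def by metis
qed

lemma hol2_mult: "hol2 F A B \<Longrightarrow> hol2 G A B \<Longrightarrow> hol2 (\<lambda>x y. F x y * G x y) A B"
  by (auto simp: hol2_def case_prod_unfold intro!: continuous_intros holomorphic_intros)

lemma hol2_const: "hol2 (\<lambda>x y. c) A B"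
  by (auto simp: hol2_def case_prod_unfold intro!: continuous_intros holomorphic_intros)

text \<open>The point is holomorphy in \<open>x\<close>: the derivative in \<open>y\<close> is the
  value at \<open>h = 0\<close> of the quotient of \<open>F x (y + h) - F x y\<close> by
  \<open>h\<close>, so \<open>quot_x\<close> applies with \<open>h\<close> as the variable that is
  divided out.\<close>

lemma hol2_deriv_y:
  assumes F: "hol2 F A B" and A: "open A" and B: "open B"
  shows "hol2 (\<lambda>x y. deriv (F x) y) A B"
proof -
  have c: "continuous_on (B \<times> A) (\<lambda>(y, x). deriv (F x) y)"
    using continuous_on_deriv_param[of B A "\<lambda>y x. F x y"] hol2_swap[OF F] B by (simp add: hol2_def)
  have c': "continuous_on (A \<times> B) (\<lambda>(x, y). deriv (F x) y)" by (rule continuous_on_flip[OF c])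
  have hx: "(\<lambda>x. deriv (F x) y) holomorphic_on A" if y: "y \<in> B" for y
  proof -
    obtain r where r: "r > 0" "ball y r \<subseteq> B" using y B open_contains_ball by blast
    define H where "H h x = F x (y + h) - F x y" for h x
    have tr: "(\<lambda>h. y + h) ` ball 0 r \<subseteq> B" using r by (auto simp: dist_norm)
    have hy: "(\<lambda>h. F x (y + h)) holomorphic_on ball 0 r" if "x \<in> A" for x
    proof -
      have "(\<lambda>h. y + h) holomorphic_on ball 0 r" by (intro holomorphic_intros)
      moreover have "F x holomorphic_on B" using F that by (simp add: hol2_def)
      ultimately have "(F x \<circ> (\<lambda>h. y + h)) holomorphic_on ball 0 r"
        using tr by (rule holomorphic_on_compose_gen)
      then show ?thesis by (simp add: o_def)
    qed
    have tr': "y + h \<in> B" if "norm h < r" for h using r that by (auto simp: dist_norm)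
    have ct: "continuous_on (ball 0 r \<times> A) (\<lambda>p. F (snd p) (y + fst p))"
      by (rule continuous_on_Times_compose[of A B F])
        (use F tr in \<open>auto intro!: continuous_intros simp: hol2_def tr'\<close>)
    have ct2: "continuous_on A (\<lambda>x. F x y)"
      using F y by (auto simp: hol2_def holomorphic_on_imp_continuous_on)
    have "hol2 H (ball 0 r) A"
      unfolding hol2_def
    proof (intro conjI ballI)
      show "continuous_on (ball 0 r \<times> A) (\<lambda>(x, y). H x y)"
        unfolding H_def case_prod_unfold using ct
        by (intro continuous_intros continuous_on_compose2[OF ct2]) (auto simp: o_def case_prod_unfold)
      show "(\<lambda>h. H h x) holomorphic_on ball 0 r" if "x \<in> A" for x
        unfolding H_def using hy that by (auto intro!: holomorphic_intros)
      show "H h holomorphic_on A" if "h \<in> ball 0 r" for h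
        unfolding H_def using F y that tr' by (auto simp: hol2_def intro!: holomorphic_on_diff)
    qed
    from quot_x(1)[OF this A r(1)] have "quot_x H 0 holomorphic_on A" using r by (simp add: hol2_def H_def)
    moreover have "quot_x H 0 x = deriv (F x) y" if x: "x \<in> A" for x
    proof -
      have "(F x has_field_derivative deriv (F x) y) (at y)"
        using F B x y by (intro holomorphic_derivI) (auto simp: hol2_def)
      then have "((\<lambda>h. H h x) has_field_derivative deriv (F x) y) (at 0)"
        unfolding H_def using DERIV_shift[of "F x" "deriv (F x) y" 0 y]
        by (auto intro!: derivative_eq_intros simp: add.commute[of y])
      then show ?thesis by (simp add: quot_x_def DERIV_imp_deriv)
    qed
    ultimately show ?thesis by (auto cong: holomorphic_cong)
  qed
  show ?thesis unfolding hol2_def using c' hx F B by (auto simp: hol2_def intro!: holomorphic_deriv)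
qed

section \<open>The exact power of a coordinate that divides a function\<close>

lemma eq_at_puncture:
  fixes f g :: "complex \<Rightarrow> complex"
  assumes "isCont f a" "isCont g a" "\<forall>\<^sub>F x in at a. f x = g x"
  shows "f a = g a"
proof -
  have "(f \<longlongrightarrow> g a) (at a)"
    using assms(2,3) by (simp add: isCont_def tendsto_cong)
  then show ?thesis using assms(1) tendsto_unique[of "at a" f] by (auto simp: isCont_def)
qed

lemma hol2_isCont_x: "hol2 F A B \<Longrightarrow> open A \<Longrightarrow> x \<in> A \<Longrightarrow> y \<in> B \<Longrightarrow> isCont (\<lambda>x. F x y) x"
  unfolding hol2_def using continuous_on_eq_continuous_at holomorphic_on_imp_continuous_on by blast

lemma hol2_isCont_y: "hol2 F A B \<Longrightarrow> open B \<Longrightarrow> x \<in> A \<Longrightarrow> y \<in> B \<Longrightarrow> isCont (F x) y"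
  unfolding hol2_def using continuous_on_eq_continuous_at holomorphic_on_imp_continuous_on by blast

text \<open>On the line \<open>y = y1\<close> the function has order \<open>n\<close> at 0, which
  bounds the number of divisions by \<open>x\<close>; they stop at the first quotient that is not
  identically zero on the axis \<open>x = 0\<close>.\<close>

lemma hol2_factor_aux:
  assumes "hol2 F (ball 0 r) B" "open B" "0 < r" "y1 \<in> B"
    "isCont h 0" "h 0 \<noteq> 0" "\<forall>\<^sub>F x in at 0. F x y1 = x ^ n * h x"
  shows "\<exists>m G. hol2 G (ball 0 r) B \<and> (\<forall>x. \<forall>y\<in>B. F x y = x ^ m * G x y) \<and> (\<exists>y\<in>B. G 0 y \<noteq> 0)"
  using assms
proof (induction n arbitrary: F)
  case 0
  have "F 0 y1 = h 0"
    by (rule eq_at_puncture[where f = "\<lambda>x. F x y1"]) (use 0 hol2_isCont_x[OF 0(1)] in auto)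
  then have "\<exists>y\<in>B. F 0 y \<noteq> 0" using 0 by metis
  then show ?case using 0 by (intro exI[of _ 0] exI[of _ F]) simp
next
  case (Suc n)
  show ?case
  proof (cases "\<exists>y\<in>B. F 0 y \<noteq> 0")
    case True
    then show ?thesis using Suc by (intro exI[of _ 0] exI[of _ F]) auto
  next
    case False
    then have F0: "\<And>y. y \<in> B \<Longrightarrow> F 0 y = 0" by blast
    have q: "hol2 (quot_x F) (ball 0 r) B" "\<And>x y. y \<in> B \<Longrightarrow> F x y = x * quot_x F x y"
      by (rule quot_x(1)[OF Suc.prems(1-3)], erule F0) (rule quot_x(2)[OF Suc.prems(1-3)], erule F0)
    have "\<forall>\<^sub>F x in at 0. quot_x F x y1 = x ^ n * h x"
      using Suc.prems(7) eventually_neq_at_within[of 0 0 UNIV]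
    proof eventually_elim
      case (elim x)
      then have "x * quot_x F x y1 = x * (x ^ n * h x)" using q(2)[OF Suc.prems(4), of x] by (simp add: mult.assoc)
      then show ?case using elim(2) by simp
    qed
    from Suc.IH[OF q(1) Suc.prems(2-6) this] obtain m G where
      "hol2 G (ball 0 r) B" "\<forall>x. \<forall>y\<in>B. quot_x F x y = x ^ m * G x y" "\<exists>y\<in>B. G 0 y \<noteq> 0" by blast
    then show ?thesis
      by (intro exI[of _ "Suc m"] exI[of _ G]) (auto simp: q(2) mult.assoc)
  qed
qed

lemma hol2_factor:
  assumes F: "hol2 F (ball 0 r) B" and B: "open B" and r: "0 < r"
    and nz: "x1 \<in> ball 0 r" "y1 \<in> B" "F x1 y1 \<noteq> 0"
  obtains m G where "hol2 G (ball 0 r) B" "\<And>x y. y \<in> B \<Longrightarrow> F x y = x ^ m * G x y" "\<exists>y\<in>B. G 0 y \<noteq> 0"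
proof -
  have hol: "(\<lambda>x. F x y1) holomorphic_on ball 0 r" using F nz by (auto simp: hol2_def)
  have "\<exists>w\<in>ball 0 r. F w y1 \<noteq> 0" using nz by blast
  from zorder_exist_zero[OF hol open_ball connected_ball _ this, of 0] r obtain \<rho> where \<rho>: "\<rho> > 0"
    and h: "zor_poly (\<lambda>x. F x y1) 0 holomorphic_on cball 0 \<rho>"
    and eq: "\<forall>w\<in>cball 0 \<rho>. F w y1 = zor_poly (\<lambda>x. F x y1) 0 w * (w - 0) ^ nat (zorder (\<lambda>x. F x y1) 0)
       \<and> zor_poly (\<lambda>x. F x y1) 0 w \<noteq> 0" unfolding centre_in_ball by blast
  have "isCont (zor_poly (\<lambda>x. F x y1) 0) 0"
    using h \<rho> holomorphic_on_imp_continuous_on[of _ "cball 0 \<rho>"]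
    by (metis centre_in_ball continuous_on_interior interior_cball)
  moreover have "zor_poly (\<lambda>x. F x y1) 0 0 \<noteq> 0" using eq \<rho> by auto
  moreover have "\<forall>\<^sub>F x in at 0. F x y1 = x ^ nat (zorder (\<lambda>x. F x y1) 0) * zor_poly (\<lambda>x. F x y1) 0 x"
    using eventually_at_ball[OF \<rho>, of 0 UNIV] by eventually_elim (use eq in auto)
  ultimately have "\<exists>m G. hol2 G (ball 0 r) B \<and> (\<forall>x. \<forall>y\<in>B. F x y = x ^ m * G x y) \<and> (\<exists>y\<in>B. G 0 y \<noteq> 0)"
    by (rule hol2_factor_aux[OF F B r nz(2)])
  then show thesis using that by blast
qed

text \<open>One-variable continuation twice: in \<open>x\<close> with \<open>y\<close> kept in
  \<open>V\<close>, then in \<open>y\<close>.\<close>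

lemma hol2_identity:
  assumes F: "hol2 F A B" and A: "open A" "connected A" and B: "open B" "connected B"
    and U: "open U" "U \<subseteq> A" "a \<in> U" and V: "open V" "V \<subseteq> B" "b \<in> V"
    and z: "\<And>x y. x \<in> U \<Longrightarrow> y \<in> V \<Longrightarrow> F x y = 0"
    and xy: "x \<in> A" "y \<in> B"
  shows "F x y = 0"
proof -
  have 1: "F x y = 0" if "x \<in> A" "y \<in> V" for x y
  proof -
    have "a islimpt U" using U by (simp add: interior_limit_point interior_open)
    moreover have "(\<lambda>x. F x y) holomorphic_on A" using F V that by (auto simp: hol2_def)
    ultimately show ?thesis
      by (intro analytic_continuation[where f = "\<lambda>x. F x y" and S = A and U = U and \<xi> = a and w = x])
        (use A U V z that in auto)
  qed
  have "b islimpt V" using V by (simp add: interior_limit_point interior_open)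
  moreover have "F x holomorphic_on B" using F xy by (auto simp: hol2_def)
  ultimately show ?thesis
    by (intro analytic_continuation[where f = "F x" and S = B and U = V and \<xi> = b and w = y])
      (use B V 1 xy in auto)
qed

text \<open>By the weighted argument principle the sum over the zeros is, up to a constant, the
  integral of \<open>h\<close> times the logarithmic derivative of \<open>F x\<close> over the
  circle \<open>norm y = \<rho>\<close>, which is free of zeros; the integrand depends
  holomorphically on \<open>x\<close>.\<close>

lemma zero_sum_holomorphic:
  fixes h :: "complex \<Rightarrow> complex \<Rightarrow> complex"
  assumes F: "hol2 F (ball 0 \<delta>) (ball 0 R)" and h: "hol2 h (ball 0 \<delta>) (ball 0 R)"
    and \<rho>: "0 < \<rho>" "\<rho> < R"
    and nz: "\<And>x y. norm x < \<delta> \<Longrightarrow> norm y = \<rho> \<Longrightarrow> F x y \<noteq> 0"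
  shows "(\<lambda>x. \<Sum>p | norm p < \<rho> \<and> F x p = 0. h x p * of_int (zorder (F x) p)) holomorphic_on ball 0 \<delta>"
    and "\<And>x. norm x < \<delta> \<Longrightarrow> finite {p. norm p < \<rho> \<and> F x p = 0}"
    and "\<And>x p. norm x < \<delta> \<Longrightarrow> norm p < \<rho> \<Longrightarrow> F x p = 0 \<Longrightarrow> zorder (F x) p > 0"
proof -
  \<comment> \<open>A slightly larger disc: by compactness \<open>F x\<close> has finitely many
    zeros there, and those beyond the circle of radius \<open>\<rho>\<close> have winding number
    0.\<close>
  define R' where "R' = (\<rho> + R) / 2"
  have R': "\<rho> < R'" "R' < R" "0 < R'" using \<rho> by (auto simp: R'_def)
  have hol: "F x holomorphic_on ball 0 R" if "norm x < \<delta>" for x using F that by (simp add: hol2_def)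
  have \<rho>R: "complex_of_real \<rho> \<in> ball 0 R" using \<rho> by simp
  have fin: "finite {p \<in> cball 0 R'. F x p = 0}" if "norm x < \<delta>" for x
  proof (cases "F x constant_on ball 0 R")
    case True
    then have "F x y \<noteq> 0" if "y \<in> ball 0 R" for y
      using nz[OF \<open>norm x < \<delta>\<close>, of "of_real \<rho>"] \<rho> \<rho>R that by (auto simp: constant_on_def)
    then have "{p \<in> cball 0 R'. F x p = 0} = {}" using R' by auto
    then show ?thesis by (simp only: finite.emptyI)
  next
    case False
    then show ?thesis
      by (intro holomorphic_compact_finite_zeros[of _ "ball 0 R"] hol[OF that]) (use R' in auto)
  qed
  show "finite {p. norm p < \<rho> \<and> F x p = 0}" if "norm x < \<delta>" for x
    by (rule finite_subset[OF _ fin[OF that]]) (use R' in auto)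
  show "zorder (F x) p > 0" if "norm x < \<delta>" "norm p < \<rho>" "F x p = 0" for x p
  proof -
    have "\<exists>w\<in>ball 0 R. F x w \<noteq> 0" using nz[OF that(1), of "of_real \<rho>"] \<rho> \<rho>R by (intro bexI[of _ "of_real \<rho>"]) auto
    then show ?thesis
      using zorder_exist_zero[OF hol[OF that(1)] open_ball connected_ball, of p] that \<rho> by auto
  qed
  define \<gamma> where "\<gamma> = circlepath 0 \<rho>"
  define \<Phi> where "\<Phi> x t = deriv (F x) (\<gamma> t) * h x (\<gamma> t) / F x (\<gamma> t) * vector_derivative \<gamma> (at t)" for x t
  have \<gamma>n: "norm (\<gamma> t) = \<rho>" for t using \<rho> by (simp add: \<gamma>_def circlepath norm_mult)
  have \<gamma>c: "continuous_on S \<gamma>" for S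
    unfolding \<gamma>_def circlepath by (auto intro!: continuous_intros)
  have "(\<lambda>x. integral {0..1} (\<Phi> x)) holomorphic_on ball 0 \<delta>"
  proof (rule holomorphic_param_integral)
    have dF: "hol2 (\<lambda>x y. deriv (F x) y) (ball 0 \<delta>) (ball 0 R)" using hol2_deriv_y[OF F] by simp
    have c: "continuous_on (ball 0 \<delta> \<times> {0..1}) (\<lambda>p. G (fst p) (\<gamma> (snd p)))"
      if "hol2 G (ball 0 \<delta>) (ball 0 R)" for G
      by (rule continuous_on_Times_compose[of "ball 0 \<delta>" "ball 0 R" G])
        (use that \<gamma>n \<rho> in \<open>auto intro!: continuous_intros continuous_on_compose2[OF \<gamma>c[of UNIV]] simp: hol2_def\<close>)
    show "continuous_on (ball 0 \<delta> \<times> {0..1}) (\<lambda>(x, t). \<Phi> x t)"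
      unfolding \<Phi>_def case_prod_unfold \<gamma>_def vector_derivative_circlepath unfolding \<gamma>_def[symmetric]
      using c[OF dF] c[OF h] c[OF F] nz \<gamma>n by (auto intro!: continuous_intros)
    show "(\<lambda>x. \<Phi> x t) holomorphic_on ball 0 \<delta>" if "t \<in> {0..1}" for t
      unfolding \<Phi>_def using dF h F nz \<gamma>n[of t] \<rho>
      by (intro holomorphic_intros) (auto simp: hol2_def)
  qed auto
  then have "(\<lambda>x. contour_integral \<gamma> (\<lambda>y. deriv (F x) y * h x y / F x y) / (2 * of_real pi * \<i>)) holomorphic_on ball 0 \<delta>"
    unfolding contour_integral_integral \<Phi>_def by (intro holomorphic_intros) auto
  moreover have "contour_integral \<gamma> (\<lambda>y. deriv (F x) y * h x y / F x y) / (2 * of_real pi * \<i>) =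
      (\<Sum>p | norm p < \<rho> \<and> F x p = 0. h x p * of_int (zorder (F x) p))" if x: "norm x < \<delta>" for x
  proof -
    let ?Z = "{w \<in> ball 0 R'. F x w = 0 \<or> w \<in> {}}"
    have finZ: "finite ?Z" by (rule finite_subset[OF _ fin[OF x]]) auto
    have sub: "ball 0 R' \<subseteq> ball (0::complex) R" using R' by auto
    have "contour_integral \<gamma> (\<lambda>y. deriv (F x) y * h x y / F x y) =
        of_real (2 * pi) * \<i> * (\<Sum>p\<in>?Z. winding_number \<gamma> p * h x p * of_int (zorder (F x) p))"
    proof (rule argument_principle)
      show "F x holomorphic_on ball 0 R' - {}" using hol[OF x] sub by (auto intro: holomorphic_on_subset)
      show "h x holomorphic_on ball 0 R'" using h x sub by (auto intro: holomorphic_on_subset simp: hol2_def)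
      show "path_image \<gamma> \<subseteq> ball 0 R' - ?Z"
        using \<gamma>n R' nz[OF x] by (auto simp: path_image_def)
      show "\<forall>z. z \<notin> ball 0 R' \<longrightarrow> winding_number \<gamma> z = 0"
        by (intro allI impI winding_number_zero_outside[of _ "ball 0 R'"])
          (use \<gamma>n R' in \<open>auto simp: path_image_def \<gamma>_def\<close>)
    qed (use finZ in \<open>auto simp: \<gamma>_def\<close>)
    also have "(\<Sum>p\<in>?Z. winding_number \<gamma> p * h x p * of_int (zorder (F x) p)) =
        (\<Sum>p | norm p < \<rho> \<and> F x p = 0. h x p * of_int (zorder (F x) p))"
    proof (rule sum.mono_neutral_cong_right[OF finZ])
      show "\<forall>i\<in>?Z - {p. norm p < \<rho> \<and> F x p = 0}. winding_number \<gamma> i * h x i * of_int (zorder (F x) i) = 0"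
      proof
        fix i assume i: "i \<in> ?Z - {p. norm p < \<rho> \<and> F x p = 0}"
        then have "norm i > \<rho>" using nz[OF x, of i] by force
        then have "winding_number \<gamma> i = 0"
          by (intro winding_number_zero_outside[of _ "cball 0 \<rho>"])
            (use \<gamma>n in \<open>auto simp: path_image_def \<gamma>_def\<close>)
        then show "winding_number \<gamma> i * h x i * of_int (zorder (F x) i) = 0" by simp
      qed
    qed (use R' in \<open>auto simp: \<gamma>_def winding_number_circlepath\<close>)
    finally show ?thesis by simp
  qed
  ultimately show "(\<lambda>x. \<Sum>p | norm p < \<rho> \<and> F x p = 0. h x p * of_int (zorder (F x) p)) holomorphic_on ball 0 \<delta>"
    by (rule holomorphic_transform) auto
qed


text \<open>Let \<open>b\<^sub>1, \<dots>, b\<^sub>k\<close> be the roots of \<open>F x\<close> near \<open>0\<close>. The holomorphic function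
  \<open>x \<mapsto> h x b\<^sub>1 + \<dots> + h x b\<^sub>k\<close> is bounded by \<open>k\<close> and takes the value \<open>k\<close> at \<open>0\<close>, hence is constant.\<close>

lemma curve_max_principle:
  assumes F: "hol2 F (ball 0 R) (ball 0 R)" and h: "hol2 h (ball 0 R) (ball 0 R)" and R: "0 < R"
    and F0: "F 0 0 = 0" and h0: "h 0 0 = 1"
    and le: "\<And>x y. norm x < R \<Longrightarrow> norm y < R \<Longrightarrow> F x y = 0 \<Longrightarrow> norm (h x y) \<le> 1"
  shows "\<exists>x y. norm x < R \<and> norm y < R \<and> (x, y) \<noteq> (0, 0) \<and> F x y = 0 \<and> h x y = 1"
proof (cases "\<forall>y\<in>ball 0 R. F 0 y = 0")
  \<comment> \<open>The whole axis \<open>x = 0\<close> belongs to the zero set, and the maximum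
    principle on this axis suffices.\<close>
  case True
  have "h 0 constant_on ball 0 R"
    by (rule maximum_modulus_principle[where U = "ball 0 R" and \<xi> = 0])
      (use h R le[of 0] True h0 in \<open>auto simp: hol2_def\<close>)
  then have "h 0 (of_real (R / 2)) = h 0 0" using R by (fastforce simp: constant_on_def)
  then show ?thesis using R True h0 by (intro exI[of _ 0] exI[of _ "of_real (R / 2)"]) auto
next
  case False
  have hF0: "F 0 holomorphic_on ball 0 R" using F R by (simp add: hol2_def)
  obtain \<beta> where \<beta>: "\<beta> \<in> ball 0 R" "F 0 \<beta> \<noteq> 0" using False by blast
  have "0 \<in> ball 0 R" using R by simp
  obtain r where r: "0 < r" "ball 0 r \<subseteq> ball (0::complex) R" "\<forall>z\<in>ball 0 r - {0}. F 0 z \<noteq> 0"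
    using isolated_zeros[OF hF0 open_ball connected_ball \<open>0 \<in> ball 0 R\<close> F0 \<beta>] by metis
  \<comment> \<open>The origin is the only zero of \<open>F 0\<close> inside this circle, and none
    lies on it; by compactness the circle stays free of zeros of \<open>F x\<close> for all small
    \<open>x\<close>.\<close>
  define \<rho> where "\<rho> = min r R / 2"
  have \<rho>: "0 < \<rho>" "\<rho> < r" "\<rho> < R" using r R by (auto simp: \<rho>_def)
  have comp: "compact (F 0 ` sphere 0 \<rho>)"
    by (intro compact_continuous_image continuous_on_subset[OF holomorphic_on_imp_continuous_on[OF hF0]])
      (use \<rho> in auto)
  have "0 \<notin> F 0 ` sphere 0 \<rho>" using r(3) \<rho> by (force simp: image_iff)
  then obtain \<epsilon> where \<epsilon>: "\<epsilon> > 0" "\<And>y. norm y = \<rho> \<Longrightarrow> norm (F 0 y) \<ge> \<epsilon>"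
    using separate_point_closed[OF compact_imp_closed[OF comp], of 0] by (auto simp: dist_norm)
  have "\<epsilon> / 2 > 0" using \<epsilon> by simp
  moreover have "continuous_on (ball 0 R \<times> sphere 0 \<rho>) (\<lambda>(x, y). F x y)"
    by (rule continuous_on_subset[of "ball 0 R \<times> ball 0 R"]) (use F \<rho> in \<open>auto simp: hol2_def\<close>)
  ultimately obtain X0 where X0: "0 \<in> X0" "open X0"
      "\<forall>x\<in>X0 \<inter> ball 0 R. \<forall>y\<in>sphere 0 \<rho>. dist (case (x, y) of (x, y) \<Rightarrow> F x y) (case (0, y) of (x, y) \<Rightarrow> F x y) \<le> \<epsilon> / 2"
    using continuous_on_prod_compactE[of "ball 0 R" "sphere 0 \<rho>" "\<lambda>(x, y). F x y" 0 "\<epsilon> / 2"] R by auto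
  obtain \<delta> where \<delta>: "\<delta> > 0" "ball 0 \<delta> \<subseteq> X0 \<inter> ball 0 R"
    using X0 R openE[of "X0 \<inter> ball 0 R" 0] by (metis IntI centre_in_ball open_Int open_ball)
  have nz: "F x y \<noteq> 0" if "norm x < \<delta>" "norm y = \<rho>" for x y
  proof -
    have "x \<in> X0 \<inter> ball 0 R" using \<delta>(2) that(1) by auto
    then have "dist (F x y) (F 0 y) \<le> \<epsilon> / 2" using X0(3) that(2) by auto
    then show ?thesis using \<epsilon>(1) \<epsilon>(2)[OF that(2)] by (auto simp: dist_norm)
  qed
  have \<delta>R: "ball 0 \<delta> \<subseteq> ball (0::complex) R" using \<delta> by auto
  then have \<delta>R': "norm x < R" if "norm x < \<delta>" for x :: complex using that by auto
  define Z where "Z x = {p. norm p < \<rho> \<and> F x p = 0}" for x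
  have F': "hol2 F (ball 0 \<delta>) (ball 0 R)" and h': "hol2 h (ball 0 \<delta>) (ball 0 R)"
    using hol2_subset[OF F \<delta>R] hol2_subset[OF h \<delta>R] by auto
  have zs: "(\<lambda>x. \<Sum>p\<in>Z x. g x p * of_int (zorder (F x) p)) holomorphic_on ball 0 \<delta>"
    if "hol2 g (ball 0 \<delta>) (ball 0 R)" for g
    unfolding Z_def by (rule zero_sum_holomorphic(1)[OF F' that \<rho>(1,3)], erule (1) nz)
  have finZ: "finite (Z x)" if "norm x < \<delta>" for x
    unfolding Z_def by (rule zero_sum_holomorphic(2)[OF F' h' \<rho>(1,3)], erule (1) nz, rule that)
  have pos: "zorder (F x) p > 0" if "norm x < \<delta>" "p \<in> Z x" for x p
    by (rule zero_sum_holomorphic(3)[OF F' h' \<rho>(1,3)], erule (1) nz) (use that in \<open>auto simp: Z_def\<close>)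
  define N S where "N x = (\<Sum>p\<in>Z x. zorder (F x) p)" and "S x = (\<Sum>p\<in>Z x. h x p * of_int (zorder (F x) p))" for x
  have S: "S holomorphic_on ball 0 \<delta>" using zs[OF h'] by (simp add: S_def[abs_def])
  have "(\<lambda>x. of_int (N x)) holomorphic_on ball (0::complex) \<delta>"
    using zs[OF hol2_const[of 1]] by (simp add: N_def)
  \<comment> \<open>The number of zeros, counted with multiplicity, is continuous and
    integer-valued.\<close>
  then have "(\<lambda>x. of_int (N x) :: complex) constant_on ball 0 \<delta>"
  proof (intro continuous_discrete_range_constant holomorphic_on_imp_continuous_on)
    fix x :: complex
    show "\<exists>e>0. \<forall>y. y \<in> ball 0 \<delta> \<and> of_int (N y) \<noteq> (of_int (N x) :: complex) \<longrightarrow>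
        e \<le> norm (of_int (N y) - of_int (N x) :: complex)"
    proof (intro exI[of _ 1] conjI allI impI)
      fix y assume "y \<in> ball 0 \<delta> \<and> of_int (N y) \<noteq> (of_int (N x) :: complex)"
      then have "1 \<le> \<bar>N y - N x\<bar>" by auto
      then have "1 \<le> norm (of_int (N y - N x) :: complex)" unfolding norm_of_int by linarith
      then show "1 \<le> norm (of_int (N y) - of_int (N x) :: complex)" by simp
    qed simp
  qed auto
  then have N: "N x = N 0" if "norm x < \<delta>" for x
    using that \<delta>(1) unfolding constant_on_def by (metis mem_ball_0 norm_zero of_int_eq_iff)
  have "Z 0 = {0}" using r(3) \<rho> F0 by (force simp: Z_def)
  then have S0: "S 0 = of_int (N 0)" and N0: "N 0 > 0"
    using pos[of 0 0] \<delta>(1) h0 by (auto simp: S_def N_def)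
  have hle: "norm (h x p) \<le> 1" if "norm x < \<delta>" "p \<in> Z x" for x p
    using le that \<delta>R' \<rho> by (auto simp: Z_def)
  have Sle: "norm (S x) \<le> of_int (N 0)" if "norm x < \<delta>" for x
  proof -
    have "norm (S x) \<le> (\<Sum>p\<in>Z x. norm (h x p * of_int (zorder (F x) p)))"
      unfolding S_def by (rule norm_sum)
    also have "\<dots> \<le> (\<Sum>p\<in>Z x. of_int (zorder (F x) p))"
      using hle pos that by (intro sum_mono) (force simp: norm_mult intro: mult_left_le_one_le)
    also have "\<dots> = of_int (N x)" by (simp add: N_def)
    finally show ?thesis using N[OF that] by simp
  qed
  have "S constant_on ball 0 \<delta>"
    by (rule maximum_modulus_principle[where U = "ball 0 \<delta>" and \<xi> = 0])
      (use S \<delta>(1) Sle S0 N0 in auto)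
  \<comment> \<open>A non-zero \<open>x\<close>, so that the point found on the curve differs from
    the origin.\<close>
  define x where "x = complex_of_real (\<delta> / 2)"
  have x: "norm x < \<delta>" "x \<noteq> 0" using \<delta>(1) by (auto simp: x_def)
  have "S x = of_int (N 0)"
    using \<open>S constant_on ball 0 \<delta>\<close> x(1) \<delta>(1) S0 by (fastforce simp: constant_on_def)
  then have "(\<Sum>p\<in>Z x. h x p * of_int (zorder (F x) p)) = (\<Sum>p\<in>Z x. of_int (zorder (F x) p))"
    unfolding N[OF x(1), symmetric] by (simp add: S_def N_def)
  \<comment> \<open>Equality in the triangle inequality: the real parts of \<open>1 - h x p\<close>
    are non-negative, their weights are positive, and the weighted sum vanishes.\<close>
  then have "(\<Sum>p\<in>Z x. Re (1 - h x p) * of_int (zorder (F x) p)) = 0"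
    by (simp add: algebra_simps sum_subtractf complex_eq_iff)
  then have "\<forall>p\<in>Z x. Re (1 - h x p) * of_int (zorder (F x) p) = 0"
  proof (subst (asm) sum_nonneg_eq_0_iff)
    fix p assume p: "p \<in> Z x"
    then have "Re (h x p) \<le> 1" using complex_Re_le_cmod hle[OF x(1) p] order_trans by blast
    then show "0 \<le> Re (1 - h x p) * of_int (zorder (F x) p)" using pos[OF x(1) p] by simp
  qed (use finZ[OF x(1)] in auto)
  moreover have "Z x \<noteq> {}" using N[OF x(1)] N0 by (auto simp: N_def)
  ultimately obtain p where p: "p \<in> Z x" "Re (h x p) = 1" using pos[OF x(1)] by fastforce
  then have "h x p = 1"
    using hle[OF x(1) p(1)] by (auto simp: complex_eq_iff cmod_def)
  then show ?thesis using p(1) x \<delta>R' \<rho> by (intro exI[of _ x] exI[of _ p]) (auto simp: Z_def)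
qed

section \<open>Charts of a complex surface\<close>

lemma vector_2_eta: "vector [z $ 1, z $ 2] = (z :: complex ^ 2)"
  by (simp add: vec_eq_iff forall_2)

lemma vector_2_decomp: "(vector [x, y] :: complex ^ 2) = x *s axis 1 1 + y *s axis 2 1"
  by (simp add: vec_eq_iff forall_2 axis_def)

lemma bounded_linear_smult_left: "bounded_linear (\<lambda>x :: complex. x *s (c :: complex ^ 'n))"
  by (intro linear_conv_bounded_linear[THEN iffD1] linearI) (auto simp: vec_eq_iff algebra_simps)

lemma continuous_on_vector_2 [continuous_intros]:
  fixes f g :: "'a::topological_space \<Rightarrow> complex"
  assumes "continuous_on S f" "continuous_on S g"
  shows "continuous_on S (\<lambda>s. vector [f s, g s] :: complex ^ 2)"
  unfolding vector_2_decomp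
  by (intro continuous_intros bounded_linear.continuous_on[OF bounded_linear_smult_left] assms)

lemma holo_fun_continuous_on: "holo_fun f U \<Longrightarrow> continuous_on U f"
  unfolding holo_fun_def
  by (meson continuous_at_imp_continuous_on has_derivative_continuous)

lemma holo_map_continuous_on: "holo_map f U \<Longrightarrow> continuous_on U f"
  unfolding holo_map_def
  using holo_fun_continuous_on by (fastforce simp: continuous_on_def intro!: vec_tendstoI)

text \<open>The differential is complex homogeneous, so its restrictions to the coordinate lines are
  complex derivatives.\<close>

lemma holo_fun_hol2:
  fixes f :: "complex ^ 2 \<Rightarrow> complex"
  assumes f: "holo_fun f U" and sub: "\<And>x y. x \<in> A \<Longrightarrow> y \<in> B \<Longrightarrow> vector [x, y] \<in> U"
  shows "hol2 (\<lambda>x y. f (vector [x, y])) A B"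
proof -
  have "(\<lambda>x. f (vector [x, y])) field_differentiable at x" "(\<lambda>y. f (vector [x, y])) field_differentiable at y"
    if xy: "x \<in> A" "y \<in> B" for x y
  proof -
    obtain f' where f': "(f has_derivative f') (at (vector [x, y]))" "\<And>c v. f' (c *s v) = c * f' v"
      using f sub[OF xy] unfolding holo_fun_def by blast
    have "((\<lambda>x. vector [x, y] :: complex ^ 2) has_derivative (\<lambda>t. t *s axis 1 1)) (at x)"
      unfolding vector_2_decomp
      by (auto intro!: derivative_eq_intros bounded_linear.has_derivative[OF bounded_linear_smult_left])
    from has_derivative_compose[OF this, of f f'] f'(1)
    show "(\<lambda>x. f (vector [x, y])) field_differentiable at x"
      unfolding field_differentiable_def has_field_derivative_def f'(2)
      by (intro exI[of _ "f' (axis 1 1)"]) (simp add: mult_commute_abs)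
    have "((\<lambda>y. vector [x, y] :: complex ^ 2) has_derivative (\<lambda>t. t *s axis 2 1)) (at y)"
      unfolding vector_2_decomp
      by (auto intro!: derivative_eq_intros bounded_linear.has_derivative[OF bounded_linear_smult_left])
    from has_derivative_compose[OF this, of f f'] f'(1)
    show "(\<lambda>y. f (vector [x, y])) field_differentiable at y"
      unfolding field_differentiable_def has_field_derivative_def f'(2)
      by (intro exI[of _ "f' (axis 2 1)"]) (simp add: mult_commute_abs)
  qed
  moreover have "continuous_on (A \<times> B) (\<lambda>p. f (vector [fst p, snd p]))"
    by (rule continuous_on_compose2[OF holo_fun_continuous_on[OF f]])
      (use sub in \<open>auto intro!: continuous_intros\<close>)
  ultimately show ?thesis
    unfolding hol2_def by (auto simp: holomorphic_on_def field_differentiable_at_within case_prod_unfold)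
qed

lemma has_derivative_vecI:
  fixes g :: "'a::real_normed_vector \<Rightarrow> complex ^ 'k"
  assumes "\<And>i. ((\<lambda>z. g z $ i) has_derivative (\<lambda>v. g' v $ i)) (at z)"
  shows "(g has_derivative g') (at z)"
proof (subst has_derivative_componentwise_within, rule ballI)
  fix b :: "complex ^ 'k" assume "b \<in> Basis"
  then obtain i u where b: "b = axis i u" by (auto simp: Basis_vec_def)
  show "((\<lambda>x. g x \<bullet> b) has_derivative (\<lambda>x. g' x \<bullet> b)) (at z)"
    unfolding b inner_axis by (intro has_derivative_inner_left assms)
qed

lemma holo_fun_compose:
  assumes f: "holo_fun f V" and g: "holo_map g U" and sub: "g ` U \<subseteq> V"
  shows "holo_fun (\<lambda>z. f (g z)) U"
  unfolding holo_fun_def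
proof
  fix z assume z: "z \<in> U"
  have "\<forall>i. \<exists>f'. ((\<lambda>z. g z $ i) has_derivative f') (at z) \<and> (\<forall>c v. f' (c *s v) = c * f' v)"
    using g z by (auto simp: holo_map_def holo_fun_def)
  then obtain g' where g': "\<And>i. ((\<lambda>z. g z $ i) has_derivative g' i) (at z)" "\<And>i c v. g' i (c *s v) = c * g' i v"
    by metis
  have dg: "(g has_derivative (\<lambda>v. \<chi> i. g' i v)) (at z)"
    by (rule has_derivative_vecI) (simp add: g'(1))
  obtain f' where f': "(f has_derivative f') (at (g z))" "\<And>c v. f' (c *s v) = c * f' v"
    using f sub z unfolding holo_fun_def by blast
  have "((\<lambda>z. f (g z)) has_derivative (\<lambda>v. f' (\<chi> i. g' i v))) (at z)"
    by (rule has_derivative_compose[OF dg f'(1)])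
  moreover have "f' (\<chi> i. g' i (c *s v)) = c * f' (\<chi> i. g' i v)" for c v
  proof -
    have "(\<chi> i. g' i (c *s v)) = c *s (\<chi> i. g' i v)" by (simp add: vec_eq_iff g'(2))
    then show ?thesis by (simp add: f'(2))
  qed
  ultimately show "\<exists>f'. ((\<lambda>z. f (g z)) has_derivative f') (at z) \<and> (\<forall>c v. f' (c *s v) = c * f' v)"
    by blast
qed

lemma holo_fun_local:
  assumes "\<And>z. z \<in> U \<Longrightarrow> \<exists>N g. open N \<and> z \<in> N \<and> holo_fun g N \<and> (\<forall>w\<in>N. f w = g w)"
  shows "holo_fun f U"
  unfolding holo_fun_def
proof
  fix z assume "z \<in> U"
  from assms[OF this] obtain N g where N: "open N" "z \<in> N" "holo_fun g N" "\<And>w. w \<in> N \<Longrightarrow> g w = f w" by metis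
  then obtain g' where "(g has_derivative g') (at z)" "\<forall>c v. g' (c *s v) = c * g' v"
    unfolding holo_fun_def by blast
  then show "\<exists>f'. (f has_derivative f') (at z) \<and> (\<forall>c v. f' (c *s v) = c * f' v)"
    by (auto intro!: exI[of _ g'] has_derivative_transform_within_open[OF _ N(1,2,4)])
qed

lemma holo_fun_subset: "holo_fun f U \<Longrightarrow> V \<subseteq> U \<Longrightarrow> holo_fun f V"
  unfolding holo_fun_def by blast

lemma chartD:
  assumes "chart \<A> U \<phi>"
  shows "open U" "open (\<phi> ` U)" "inj_on \<phi> U" "continuous_on U \<phi>" "continuous_on (\<phi> ` U) (inv_into U \<phi>)"
    "\<And>p. p \<in> U \<Longrightarrow> inv_into U \<phi> (\<phi> p) = p"
    "\<And>z. z \<in> \<phi> ` U \<Longrightarrow> \<phi> (inv_into U \<phi> z) = z" "\<And>z. z \<in> \<phi> ` U \<Longrightarrow> inv_into U \<phi> z \<in> U"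
proof -
  have h: "homeomorphism U (\<phi> ` U) \<phi> (inv_into U \<phi>)" using assms by (simp add: chart_def)
  show "open U" "open (\<phi> ` U)" using assms by (auto simp: chart_def)
  show "continuous_on U \<phi>" "continuous_on (\<phi> ` U) (inv_into U \<phi>)" using h by (auto simp: homeomorphism_def)
  show "\<And>p. p \<in> U \<Longrightarrow> inv_into U \<phi> (\<phi> p) = p" using h by (auto simp: homeomorphism_def)
  then show "inj_on \<phi> U" by (metis inj_onI)
  show "\<And>z. z \<in> \<phi> ` U \<Longrightarrow> \<phi> (inv_into U \<phi> z) = z" by (rule f_inv_into_f)
  show "\<And>z. z \<in> \<phi> ` U \<Longrightarrow> inv_into U \<phi> z \<in> U" by (rule inv_into_into)
qed

lemma chart_open_image:
  assumes "chart \<A> U \<phi>" "open S"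
  shows "open (\<phi> ` (U \<inter> S))"
proof -
  have "\<phi> ` (U \<inter> S) = inv_into U \<phi> -` S \<inter> \<phi> ` U"
    using chartD(6-8)[OF assms(1)] by (auto simp: image_iff)
  then show ?thesis
    using chartD(2,5)[OF assms(1)] assms(2) by (simp add: continuous_on_open_vimage)
qed

lemma chart_box:
  fixes \<phi> :: "'m::t2_space \<Rightarrow> complex ^ 2"
  assumes "chart \<A> U \<phi>" "open S" "p \<in> U" "p \<in> S"
  obtains r where "0 < r" "\<And>x y. x \<in> ball (\<phi> p $ 1) r \<Longrightarrow> y \<in> ball (\<phi> p $ 2) r \<Longrightarrow> vector [x, y] \<in> \<phi> ` (U \<inter> S)"
proof -
  obtain e where e: "e > 0" "ball (\<phi> p) e \<subseteq> \<phi> ` (U \<inter> S)"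
    using chart_open_image[OF assms(1,2)] assms(3,4) openE by (metis IntI imageI)
  show thesis
  proof (rule that[of "e / 2"])
    fix x y :: complex assume "x \<in> ball (\<phi> p $ 1) (e / 2)" "y \<in> ball (\<phi> p $ 2) (e / 2)"
    then have xy: "norm (\<phi> p $ 1 - x) < e / 2" "norm (\<phi> p $ 2 - y) < e / 2" by (auto simp: dist_norm)
    have "norm (\<phi> p - vector [x, y]) \<le> (\<Sum>i\<in>UNIV. norm ((\<phi> p - vector [x, y]) $ i))"
      unfolding norm_vec_def by (rule L2_set_le_sum) simp
    also have "\<dots> < e" using xy by (simp add: sum_2)
    finally have "vector [x, y] \<in> ball (\<phi> p) e" by (simp add: dist_norm)
    then show "vector [x, y] \<in> \<phi> ` (U \<inter> S)" using e(2) by blast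
  qed (use e in auto)
qed

lemma surface_cover: "complex_surface \<A> \<Longrightarrow> \<exists>V \<psi>. (V, \<psi>) \<in> \<A> \<and> p \<in> V \<and> chart \<A> V \<psi>"
  unfolding complex_surface_def by (fastforce simp: set_eq_iff)

text \<open>\<open>chart\<close> demands compatibility with the members of the atlas only, so two
  arbitrary charts are compared through an atlas chart around the point under consideration.\<close>

lemma chart_transition:
  fixes \<phi> \<psi> :: "'m::t2_space \<Rightarrow> complex ^ 2"
  assumes S: "complex_surface \<A>" and U: "chart \<A> U \<phi>" and V: "chart \<A> V \<psi>"
  shows "holo_fun (\<lambda>z. \<phi> (inv_into V \<psi> z) $ i) (\<psi> ` (U \<inter> V))"
proof (rule holo_fun_local)
  fix z assume z: "z \<in> \<psi> ` (U \<inter> V)"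
  define p where "p = inv_into V \<psi> z"
  have p: "p \<in> U" "p \<in> V" using z chartD(6)[OF V] by (auto simp: p_def)
  obtain W \<theta> where W: "(W, \<theta>) \<in> \<A>" "p \<in> W" "chart \<A> W \<theta>" using surface_cover[OF S] by blast
  let ?N = "\<psi> ` (V \<inter> (U \<inter> W))"
  have h1: "holo_map (\<phi> \<circ> inv_into W \<theta>) (\<theta> ` (U \<inter> W))" using U W(1) by (auto simp: chart_def)
  have "holo_map (\<theta> \<circ> inv_into V \<psi>) (\<psi> ` (V \<inter> W))" using V W(1) by (auto simp: chart_def)
  then have h2: "holo_map (\<theta> \<circ> inv_into V \<psi>) ?N"
    unfolding holo_map_def by (blast intro: holo_fun_subset)
  show "\<exists>N g. open N \<and> z \<in> N \<and> holo_fun g N \<and> (\<forall>w\<in>N. \<phi> (inv_into V \<psi> w) $ i = g w)"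
  proof (intro exI conjI)
    show "open ?N" by (rule chart_open_image[OF V]) (use chartD(1)[OF U] chartD(1)[OF W(3)] in auto)
    show "z \<in> ?N" using z W(2) p chartD(7)[OF V] by (auto simp: p_def intro!: rev_image_eqI[of p])
    show "holo_fun (\<lambda>w. (\<phi> \<circ> inv_into W \<theta>) ((\<theta> \<circ> inv_into V \<psi>) w) $ i) ?N"
      by (rule holo_fun_compose[OF _ h2, of "\<lambda>w. (\<phi> \<circ> inv_into W \<theta>) w $ i" "\<theta> ` (U \<inter> W)"])
        (use h1 chartD(6)[OF V] in \<open>auto simp: holo_map_def\<close>)
    show "\<forall>w\<in>?N. \<phi> (inv_into V \<psi> w) $ i = (\<phi> \<circ> inv_into W \<theta>) ((\<theta> \<circ> inv_into V \<psi>) w) $ i"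
      using chartD(6)[OF V] chartD(6)[OF W(3)] by auto
  qed
qed

definition holo_surf :: "('m::t2_space) atlas \<Rightarrow> ('m \<Rightarrow> complex) \<Rightarrow> bool" where
  "holo_surf \<A> f \<longleftrightarrow> (\<forall>U \<phi>. chart \<A> U \<phi> \<longrightarrow> holo_fun (\<lambda>z. f (inv_into U \<phi> z)) (\<phi> ` U))"

lemma holo_surfI:
  assumes S: "complex_surface \<A>" and f: "\<And>U \<phi>. (U, \<phi>) \<in> \<A> \<Longrightarrow> holo_fun (\<lambda>z. f (inv_into U \<phi> z)) (\<phi> ` U)"
  shows "holo_surf \<A> f"
  unfolding holo_surf_def
proof (intro allI impI, rule holo_fun_local)
  fix V \<psi> z assume V: "chart \<A> V \<psi>" and z: "z \<in> \<psi> ` V"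
  define p where "p = inv_into V \<psi> z"
  have p: "p \<in> V" using z chartD(6)[OF V] by (auto simp: p_def)
  obtain W \<theta> where W: "(W, \<theta>) \<in> \<A>" "p \<in> W" "chart \<A> W \<theta>" using surface_cover[OF S] by blast
  let ?N = "\<psi> ` (V \<inter> W)"
  have h2: "holo_map (\<theta> \<circ> inv_into V \<psi>) ?N" using V W(1) by (auto simp: chart_def)
  show "\<exists>N g. open N \<and> z \<in> N \<and> holo_fun g N \<and> (\<forall>w\<in>N. f (inv_into V \<psi> w) = g w)"
  proof (intro exI conjI)
    show "open ?N" by (rule chart_open_image[OF V]) (use chartD(1)[OF W(3)] in auto)
    show "z \<in> ?N" using z W(2) p chartD(7)[OF V] by (auto simp: p_def intro!: rev_image_eqI[of p])
    show "holo_fun (\<lambda>w. f (inv_into W \<theta> ((\<theta> \<circ> inv_into V \<psi>) w))) ?N"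
      by (rule holo_fun_compose[OF f[OF W(1)] h2]) (use chartD(6)[OF V] in auto)
    show "\<forall>w\<in>?N. f (inv_into V \<psi> w) = f (inv_into W \<theta> ((\<theta> \<circ> inv_into V \<psi>) w))"
      using chartD(6)[OF V] chartD(6)[OF W(3)] by auto
  qed
qed

lemma holo_surf_continuous:
  assumes "complex_surface \<A>" "holo_surf \<A> f"
  shows "continuous_on UNIV f"
proof (rule continuous_at_imp_continuous_on, rule ballI)
  fix p
  obtain U \<phi> where U: "p \<in> U" "chart \<A> U \<phi>" using surface_cover[OF assms(1)] by blast
  have "continuous_on U (\<lambda>q. f (inv_into U \<phi> (\<phi> q)))"
    by (rule continuous_on_compose2[OF holo_fun_continuous_on chartD(4)[OF U(2)]])
      (use assms(2) U(2) in \<open>auto simp: holo_surf_def\<close>)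
  then have "continuous_on U f" using chartD(6)[OF U(2)] by (auto cong: continuous_on_cong_simp)
  then show "isCont f p" using U chartD(1)[OF U(2)] by (simp add: continuous_on_eq_continuous_at)
qed

section \<open>Orders of vanishing along a curve\<close>

lemma axis_2_decomp: "z + axis 1 t = vector [z $ 1 + t, z $ (2::2)]" for z :: "complex ^ 2"
  by (simp add: vec_eq_iff forall_2 axis_def)

lemma adaptedD:
  fixes \<phi> :: "'m::t2_space \<Rightarrow> complex ^ 2"
  assumes "adapted \<A> E U \<phi>"
  shows "chart \<A> U \<phi>" "\<And>q. q \<in> U \<Longrightarrow> q \<in> E \<longleftrightarrow> \<phi> q $ 1 = 0"
  using assms by (auto simp: adapted_def)

lemma chart_tendsto:
  fixes \<phi> :: "'m::t2_space \<Rightarrow> complex ^ 2"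
  assumes "chart \<A> U \<phi>" "p \<in> U"
  shows "((\<lambda>q. \<phi> q $ i) \<longlongrightarrow> \<phi> p $ i) (nhds p)"
proof -
  have "isCont \<phi> p" using chartD(1,4)[OF assms(1)] assms(2) by (simp add: continuous_on_eq_continuous_at)
  then have "(\<phi> \<longlongrightarrow> \<phi> p) (nhds p)" by (simp add: continuous_at tendsto_at_iff_tendsto_nhds)
  then show ?thesis by (rule tendsto_vec_nth)
qed

lemma chart_eventually:
  assumes "chart \<A> U \<phi>" "p \<in> U"
  shows "\<forall>\<^sub>F q in nhds p. q \<in> U"
  using chartD(1)[OF assms(1)] assms(2) by (auto simp: eventually_nhds)

lemma eventually_at_nhds: "\<forall>\<^sub>F q in nhds p. P q \<Longrightarrow> \<forall>\<^sub>F q in at p within S. P q"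
  by (simp add: eventually_at_filter eventually_mono)

lemma tendsto_at_nhds: "(f \<longlongrightarrow> l) (nhds p) \<Longrightarrow> (f \<longlongrightarrow> l) (at p within S)"
  by (rule filterlim_mono[OF _ order_refl]) (auto simp: at_within_def)

text \<open>Makes limits at \<open>p\<close> along \<open>E\<close> and off \<open>E\<close> unique,
  which is how quantities computed in different charts get identified.\<close>

lemma adapted_nontrivial:
  fixes \<phi> :: "'m::t2_space \<Rightarrow> complex ^ 2"
  assumes a: "adapted \<A> E U \<phi>" and p: "p \<in> E" "p \<in> U"
  shows "at p within E \<noteq> bot" "at p within - E \<noteq> bot"
proof -
  note c = adaptedD(1)[OF a]
  have p0: "\<phi> p $ 1 = 0" using adaptedD(2)[OF a] p by blast
  have "\<exists>y\<in>E. y \<in> T \<and> y \<noteq> p" "\<exists>y\<in>-E. y \<in> T \<and> y \<noteq> p" if T: "open T" "p \<in> T" for T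
  proof -
    obtain r where r: "0 < r"
      "\<And>x y. x \<in> ball (\<phi> p $ 1) r \<Longrightarrow> y \<in> ball (\<phi> p $ 2) r \<Longrightarrow> vector [x, y] \<in> \<phi> ` (U \<inter> T)"
      using chart_box[OF c T(1) p(2) T(2)] by metis
    have "vector [0, \<phi> p $ 2 + of_real (r / 2)] \<in> \<phi> ` (U \<inter> T)"
      "vector [of_real (r / 2), \<phi> p $ 2] \<in> \<phi> ` (U \<inter> T)"
      using r(1) p0 by (auto intro!: r(2) simp: dist_norm)
    then obtain q q' where q: "q \<in> U" "q \<in> T" "\<phi> q = vector [0, \<phi> p $ 2 + of_real (r / 2)]"
      and q': "q' \<in> U" "q' \<in> T" "\<phi> q' = vector [of_real (r / 2), \<phi> p $ 2]" by (auto simp: image_iff)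
    have "\<phi> q $ 1 = 0" "\<phi> q $ 2 \<noteq> \<phi> p $ 2" "\<phi> q' $ 1 \<noteq> 0" using q(3) q'(3) r(1) by auto
    then have "q \<in> E" "q \<noteq> p" "q' \<in> - E" "q' \<noteq> p" using adaptedD(2)[OF a] q(1) q'(1) p0 by auto
    then show "\<exists>y\<in>E. y \<in> T \<and> y \<noteq> p" "\<exists>y\<in>-E. y \<in> T \<and> y \<noteq> p" using q q' by auto
  qed
  then have "p islimpt E" "p islimpt - E" by (auto simp: islimpt_def)
  then show "at p within E \<noteq> bot" "at p within - E \<noteq> bot" by (auto simp: trivial_limit_within)
qed

text \<open>The second coordinate is a local parameter of \<open>E\<close> at \<open>p\<close>: on
  \<open>E\<close> the first one is constant and the chart is injective, so the second does not
  return to its value at \<open>p\<close>.\<close>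

lemma adapted_tangent_filterlim:
  fixes \<phi> :: "'m::t2_space \<Rightarrow> complex ^ 2"
  assumes a: "adapted \<A> E U \<phi>" and p: "p \<in> E" "p \<in> U"
  shows "filterlim (\<lambda>q. \<phi> q $ 2) (at (\<phi> p $ 2)) (at p within E)"
  unfolding filterlim_at
proof
  note c = adaptedD(1)[OF a]
  show "((\<lambda>q. \<phi> q $ 2) \<longlongrightarrow> \<phi> p $ 2) (at p within E)"
    by (rule tendsto_at_nhds[OF chart_tendsto[OF c p(2)]])
  have "\<forall>\<^sub>F q in at p within E. q \<in> U" by (rule eventually_at_nhds[OF chart_eventually[OF c p(2)]])
  moreover have "\<forall>\<^sub>F q in at p within E. q \<in> E \<and> q \<noteq> p" by (auto simp: eventually_at_filter)
  ultimately show "\<forall>\<^sub>F q in at p within E. \<phi> q $ 2 \<in> UNIV \<and> \<phi> q $ 2 \<noteq> \<phi> p $ 2"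
  proof eventually_elim
    case (elim q)
    then have "\<phi> q $ 1 = \<phi> p $ 1" using adaptedD(2)[OF a] p by auto
    then show ?case using elim inj_onD[OF chartD(3)[OF c], of q p] p by (auto simp: vec_eq_iff forall_2)
  qed
qed

text \<open>\<open>F\<close> is \<open>f\<close> in the coordinates of the chart, on a bidisc around \<open>p\<close>.\<close>

lemma chart_hol2:
  fixes \<phi> :: "'m::t2_space \<Rightarrow> complex ^ 2"
  assumes "holo_fun (\<lambda>z. f (inv_into V \<phi> z)) (\<phi> ` (V \<inter> S))" "chart \<A> V \<phi>" "open S" "p \<in> V" "p \<in> S"
  obtains r where "0 < r" "hol2 (\<lambda>x y. f (inv_into V \<phi> (vector [x, y]))) (ball (\<phi> p $ 1) r) (ball (\<phi> p $ 2) r)"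
    "\<And>x y. x \<in> ball (\<phi> p $ 1) r \<Longrightarrow> y \<in> ball (\<phi> p $ 2) r \<Longrightarrow> vector [x, y] \<in> \<phi> ` (V \<inter> S)"
proof -
  obtain r where "0 < r"
      "\<And>x y. x \<in> ball (\<phi> p $ 1) r \<Longrightarrow> y \<in> ball (\<phi> p $ 2) r \<Longrightarrow> vector [x, y] \<in> \<phi> ` (V \<inter> S)"
    using chart_box[OF assms(2-5)] by metis
  then show thesis by (intro that[of r] holo_fun_hol2[OF assms(1)])
qed

section \<open>Two charts adapted to the same curve\<close>

lemma hol2_tendsto:
  assumes Q: "hol2 Q (ball a r) (ball b r)" "0 < r" and "(f \<longlongrightarrow> a) F" "(g \<longlongrightarrow> b) F"
  shows "((\<lambda>q. Q (f q) (g q)) \<longlongrightarrow> Q a b) F"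
proof -
  have "continuous_on (ball a r \<times> ball b r) (\<lambda>(x, y). Q x y)" using Q by (simp add: hol2_def)
  then have "isCont (\<lambda>(x, y). Q x y) (a, b)"
    using Q(2) by (subst (asm) continuous_on_eq_continuous_at) (auto simp: open_Times)
  from isCont_tendsto_compose[OF this tendsto_Pair[OF assms(3,4)]] show ?thesis by simp
qed

text \<open>The first coordinate of \<open>\<phi>\<close> vanishes on \<open>E\<close>, hence is
  divisible by the first coordinate of \<open>\<psi>\<close>. The quotient restricts on
  \<open>E\<close> to the transition function of the normal bundle, which gives the first two
  limits. The third is the derivative of the change of parameter on \<open>E\<close>.\<close>

lemma normal_transition_aux:
  fixes \<phi> \<psi> :: "'m::t2_space \<Rightarrow> complex ^ 2"
  assumes S: "complex_surface \<A>" and a: "adapted \<A> E U \<phi>" and b: "adapted \<A> E V \<psi>"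
    and p: "p \<in> E" "p \<in> U" "p \<in> V"
  shows "((\<lambda>q. \<phi> q $ 1 / \<psi> q $ 1) \<longlongrightarrow> normal_transition \<phi> V \<psi> p) (at p within - E)"
    "((\<lambda>q. normal_transition \<phi> V \<psi> q) \<longlongrightarrow> normal_transition \<phi> V \<psi> p) (at p within E)"
    "\<exists>\<kappa>. ((\<lambda>q. (\<phi> q $ 2 - \<phi> p $ 2) / (\<psi> q $ 2 - \<psi> p $ 2)) \<longlongrightarrow> \<kappa>) (at p within E)"
proof -
  note ca = adaptedD(1)[OF a] and cb = adaptedD(1)[OF b]
  have p0: "\<psi> p $ 1 = 0" using adaptedD(2)[OF b] p by blast
  define \<Phi> where "\<Phi> i x y = \<phi> (inv_into V \<psi> (vector [x, y])) $ i" for i :: 2 and x y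
  have \<Phi>q: "\<Phi> i (\<psi> q $ 1) (\<psi> q $ 2) = \<phi> q $ i" if "q \<in> V" for q i
    using chartD(6)[OF cb that] by (simp add: \<Phi>_def vector_2_eta)
  have hf: "holo_fun (\<lambda>z. \<phi> (inv_into V \<psi> z) $ i) (\<psi> ` (V \<inter> U))" for i
    using chart_transition[OF S ca cb, of i] by (simp add: Int_commute)
  obtain r where r: "0 < r" "hol2 (\<Phi> 1) (ball 0 r) (ball (\<psi> p $ 2) r)"
    and box: "\<And>x y. x \<in> ball 0 r \<Longrightarrow> y \<in> ball (\<psi> p $ 2) r \<Longrightarrow> vector [x, y] \<in> \<psi> ` (V \<inter> U)"
    using chart_hol2[OF hf[of 1] cb chartD(1)[OF ca] p(3,2)] unfolding \<Phi>_def p0 by metis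
  have z: "\<Phi> 1 0 y = 0" if "y \<in> ball (\<psi> p $ 2) r" for y
  proof -
    have "vector [0, y] \<in> \<psi> ` (V \<inter> U)" using box that r(1) by simp
    then obtain q where q: "q \<in> V" "q \<in> U" "\<psi> q = vector [0, y]" by (auto simp: image_iff)
    then have "q \<in> E" using adaptedD(2)[OF b] by auto
    then have "\<phi> q $ 1 = 0" using adaptedD(2)[OF a q(2)] by blast
    then show ?thesis using \<Phi>q[OF q(1), of 1] q(3) by simp
  qed
  define Q where "Q = quot_x (\<Phi> 1)"
  have Q: "hol2 Q (ball 0 r) (ball (\<psi> p $ 2) r)"
    unfolding Q_def by (rule quot_x(1)[OF r(2) open_ball r(1)], erule z)
  have QE: "normal_transition \<phi> V \<psi> q = Q 0 (\<psi> q $ 2)" if "q \<in> E" "q \<in> V" for q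
    using adaptedD(2)[OF b that(2)] that
    by (simp add: normal_transition_def Q_def quot_x_def \<Phi>_def axis_2_decomp)
  have t: "((\<lambda>q. \<psi> q $ i) \<longlongrightarrow> \<psi> p $ i) (at p within T)" for i T
    by (rule tendsto_at_nhds[OF chart_tendsto[OF cb p(3)]])
  have eV: "\<forall>\<^sub>F q in at p within T. q \<in> V" for T by (rule eventually_at_nhds[OF chart_eventually[OF cb p(3)]])
  have eT: "\<forall>\<^sub>F q in at p within T. q \<in> T" for T by (auto simp: eventually_at_filter)
  have "((\<lambda>q. Q (\<psi> q $ 1) (\<psi> q $ 2)) \<longlongrightarrow> Q 0 (\<psi> p $ 2)) (at p within - E)"
    by (rule hol2_tendsto[OF Q r(1)]) (use t[of 1] t[of 2] p0 in auto)
  moreover have "\<forall>\<^sub>F q in at p within - E. Q (\<psi> q $ 1) (\<psi> q $ 2) = \<phi> q $ 1 / \<psi> q $ 1"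
    using eV eT[of "- E"]
  proof eventually_elim
    case (elim q)
    then have "\<psi> q $ 1 \<noteq> 0" using adaptedD(2)[OF b] by auto
    then show ?case using \<Phi>q[OF elim(1), of 1] by (simp add: Q_def quot_x_def)
  qed
  ultimately show "((\<lambda>q. \<phi> q $ 1 / \<psi> q $ 1) \<longlongrightarrow> normal_transition \<phi> V \<psi> p) (at p within - E)"
    unfolding QE[OF p(1,3)] by (rule Lim_transform_eventually)
  have "((\<lambda>q. Q 0 (\<psi> q $ 2)) \<longlongrightarrow> Q 0 (\<psi> p $ 2)) (at p within E)"
    by (rule hol2_tendsto[OF Q r(1)]) (use t[of 2] in auto)
  moreover have "\<forall>\<^sub>F q in at p within E. Q 0 (\<psi> q $ 2) = normal_transition \<phi> V \<psi> q"
    using eV eT[of E] by eventually_elim (simp add: QE)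
  ultimately show "((\<lambda>q. normal_transition \<phi> V \<psi> q) \<longlongrightarrow> normal_transition \<phi> V \<psi> p) (at p within E)"
    unfolding QE[OF p(1,3)] by (rule Lim_transform_eventually)
  obtain r' where r': "0 < r'" "hol2 (\<Phi> 2) (ball 0 r') (ball (\<psi> p $ 2) r')"
    using chart_hol2[OF hf[of 2] cb chartD(1)[OF ca] p(3,2)] unfolding \<Phi>_def p0 by metis
  then have "\<Phi> 2 0 holomorphic_on ball (\<psi> p $ 2) r'" by (simp add: hol2_def)
  then have "\<Phi> 2 0 field_differentiable at (\<psi> p $ 2)"
    using r'(1) by (intro holomorphic_on_imp_differentiable_at) auto
  then obtain \<kappa> where "(\<Phi> 2 0 has_field_derivative \<kappa>) (at (\<psi> p $ 2))" by (auto simp: field_differentiable_def)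
  then have "((\<lambda>y. (\<Phi> 2 0 y - \<Phi> 2 0 (\<psi> p $ 2)) / (y - \<psi> p $ 2)) \<longlongrightarrow> \<kappa>) (at (\<psi> p $ 2))"
    by (simp add: has_field_derivative_iff)
  from filterlim_compose[OF this adapted_tangent_filterlim[OF b p(1,3)]]
  have "((\<lambda>q. (\<Phi> 2 0 (\<psi> q $ 2) - \<Phi> 2 0 (\<psi> p $ 2)) / (\<psi> q $ 2 - \<psi> p $ 2)) \<longlongrightarrow> \<kappa>) (at p within E)" .
  moreover have "\<forall>\<^sub>F q in at p within E. (\<Phi> 2 0 (\<psi> q $ 2) - \<Phi> 2 0 (\<psi> p $ 2)) / (\<psi> q $ 2 - \<psi> p $ 2) =
      (\<phi> q $ 2 - \<phi> p $ 2) / (\<psi> q $ 2 - \<psi> p $ 2)"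
    using eV eT[of E]
  proof eventually_elim
    case (elim q)
    then have "\<psi> q $ 1 = 0" using adaptedD(2)[OF b] by auto
    then show ?case using \<Phi>q[OF elim(1), of 2] \<Phi>q[OF p(3), of 2] p0 by simp
  qed
  ultimately have "((\<lambda>q. (\<phi> q $ 2 - \<phi> p $ 2) / (\<psi> q $ 2 - \<psi> p $ 2)) \<longlongrightarrow> \<kappa>) (at p within E)"
    by (rule Lim_transform_eventually)
  then show "\<exists>\<kappa>. ((\<lambda>q. (\<phi> q $ 2 - \<phi> p $ 2) / (\<psi> q $ 2 - \<psi> p $ 2)) \<longlongrightarrow> \<kappa>) (at p within E)" ..
qed

lemma limit_of_inverse_pair:
  fixes f g :: "'a \<Rightarrow> 'b::real_normed_field"
  assumes "(f \<longlongrightarrow> a) F" "(g \<longlongrightarrow> b) F" "F \<noteq> bot" "\<forall>\<^sub>F q in F. f q * g q = 1"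
  shows "a \<noteq> 0"
proof -
  have "((\<lambda>q. f q * g q) \<longlongrightarrow> a * b) F" using assms by (intro tendsto_mult)
  then have "((\<lambda>q. 1) \<longlongrightarrow> a * b) F" using assms(4) by (rule Lim_transform_eventually)
  then have "a * b = 1" using assms(3) tendsto_unique tendsto_const by metis
  then show ?thesis by auto
qed

text \<open>Exchanging the two charts inverts both quotients, and a product of limits equal to 1
  excludes the value 0.\<close>

lemma normal_transition:
  fixes \<phi> \<psi> :: "'m::t2_space \<Rightarrow> complex ^ 2"
  assumes S: "complex_surface \<A>" and a: "adapted \<A> E U \<phi>" and b: "adapted \<A> E V \<psi>"
    and p: "p \<in> E" "p \<in> U" "p \<in> V"
  shows "normal_transition \<phi> V \<psi> p \<noteq> 0"
    "\<exists>\<kappa>. \<kappa> \<noteq> 0 \<and> ((\<lambda>q. (\<phi> q $ 2 - \<phi> p $ 2) / (\<psi> q $ 2 - \<psi> p $ 2)) \<longlongrightarrow> \<kappa>) (at p within E)"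
proof -
  note A = normal_transition_aux[OF S a b p] and B = normal_transition_aux[OF S b a p(1,3,2)]
  note ca = adaptedD(1)[OF a] and cb = adaptedD(1)[OF b]
  have eV: "\<forall>\<^sub>F q in at p within T. q \<in> V" for T by (rule eventually_at_nhds[OF chart_eventually[OF cb p(3)]])
  have eU: "\<forall>\<^sub>F q in at p within T. q \<in> U" for T by (rule eventually_at_nhds[OF chart_eventually[OF ca p(2)]])
  have eT: "\<forall>\<^sub>F q in at p within T. q \<in> T" for T by (auto simp: eventually_at_filter)
  show "normal_transition \<phi> V \<psi> p \<noteq> 0"
  proof (rule limit_of_inverse_pair[OF A(1) B(1) adapted_nontrivial(2)[OF a p(1,2)]])
    show "\<forall>\<^sub>F q in at p within - E. \<phi> q $ 1 / \<psi> q $ 1 * (\<psi> q $ 1 / \<phi> q $ 1) = 1"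
      using eV eU eT[of "- E"] by eventually_elim (use adaptedD(2)[OF a] adaptedD(2)[OF b] in auto)
  qed
  obtain \<kappa> \<kappa>' where k: "((\<lambda>q. (\<phi> q $ 2 - \<phi> p $ 2) / (\<psi> q $ 2 - \<psi> p $ 2)) \<longlongrightarrow> \<kappa>) (at p within E)"
    "((\<lambda>q. (\<psi> q $ 2 - \<psi> p $ 2) / (\<phi> q $ 2 - \<phi> p $ 2)) \<longlongrightarrow> \<kappa>') (at p within E)" using A(3) B(3) by blast
  have "\<kappa> \<noteq> 0"
  proof (rule limit_of_inverse_pair[OF k adapted_nontrivial(1)[OF a p(1,2)]])
    have n: "\<forall>\<^sub>F q in at p within E. \<phi> q $ 2 \<noteq> \<phi> p $ 2" "\<forall>\<^sub>F q in at p within E. \<psi> q $ 2 \<noteq> \<psi> p $ 2"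
      using adapted_tangent_filterlim[OF a p(1,2)] adapted_tangent_filterlim[OF b p(1,3)]
      by (auto simp: filterlim_at)
    then show "\<forall>\<^sub>F q in at p within E. (\<phi> q $ 2 - \<phi> p $ 2) / (\<psi> q $ 2 - \<psi> p $ 2) *
        ((\<psi> q $ 2 - \<psi> p $ 2) / (\<phi> q $ 2 - \<phi> p $ 2)) = 1"
      by eventually_elim auto
  qed
  then show "\<exists>\<kappa>. \<kappa> \<noteq> 0 \<and> ((\<lambda>q. (\<phi> q $ 2 - \<phi> p $ 2) / (\<psi> q $ 2 - \<psi> p $ 2)) \<longlongrightarrow> \<kappa>) (at p within E)"
    using k by blast
qed

text \<open>The order along the curve near \<open>p\<close>: the cofactor \<open>G\<close> does not
  vanish identically on the curve, but it may vanish at \<open>p\<close> itself.\<close>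

definition vanishing_order ::
  "('m::t2_space \<Rightarrow> complex) \<Rightarrow> 'm set \<Rightarrow> ('m \<Rightarrow> complex ^ 2) \<Rightarrow> 'm \<Rightarrow> nat \<Rightarrow> bool" where
  "vanishing_order f U \<phi> p m \<longleftrightarrow> (\<exists>r G. 0 < r \<and> hol2 G (ball 0 r) (ball (\<phi> p $ 2) r) \<and>
     (\<forall>x\<in>ball 0 r. \<forall>y\<in>ball (\<phi> p $ 2) r. vector [x, y] \<in> \<phi> ` U \<and>
        f (inv_into U \<phi> (vector [x, y])) = x ^ m * G x y) \<and>
     (\<exists>y\<in>ball (\<phi> p $ 2) r. G 0 y \<noteq> 0))"

text \<open>The restriction of the cofactor \<open>G\<close> to the curve, written as a limit so
  that no choice of \<open>G\<close> enters.\<close>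

definition leading_coeff ::
  "('m::t2_space \<Rightarrow> complex) \<Rightarrow> nat \<Rightarrow> 'm set \<Rightarrow> ('m \<Rightarrow> complex ^ 2) \<Rightarrow> 'm \<Rightarrow> complex" where
  "leading_coeff f m U \<phi> p = Lim (at 0) (\<lambda>t. f (inv_into U \<phi> (\<phi> p + axis 1 t)) / t ^ m)"


lemma vanishing_order_exists:
  fixes \<phi> :: "'m::t2_space \<Rightarrow> complex ^ 2"
  assumes a: "adapted \<A> E U \<phi>" and p: "p \<in> E" "p \<in> U" and f: "holo_surf \<A> f"
    and nz: "\<not> (\<forall>\<^sub>F q in nhds p. f q = 0)"
  shows "\<exists>m. vanishing_order f U \<phi> p m"
proof -
  note c = adaptedD(1)[OF a]
  have p0: "\<phi> p $ 1 = 0" using adaptedD(2)[OF a] p by blast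
  have "holo_fun (\<lambda>z. f (inv_into U \<phi> z)) (\<phi> ` (U \<inter> UNIV))" using f c by (simp add: holo_surf_def)
  from chart_hol2[OF this c open_UNIV p(2) UNIV_I] p0 obtain r where r: "0 < r"
    "hol2 (\<lambda>x y. f (inv_into U \<phi> (vector [x, y]))) (ball 0 r) (ball (\<phi> p $ 2) r)"
    "\<And>x y. x \<in> ball 0 r \<Longrightarrow> y \<in> ball (\<phi> p $ 2) r \<Longrightarrow> vector [x, y] \<in> \<phi> ` U" by auto
  have "\<forall>\<^sub>F q in nhds p. \<phi> q $ 1 \<in> ball 0 r" "\<forall>\<^sub>F q in nhds p. \<phi> q $ 2 \<in> ball (\<phi> p $ 2) r"
    using topological_tendstoD[OF chart_tendsto[OF c p(2), of 1], of "ball 0 r"]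
      topological_tendstoD[OF chart_tendsto[OF c p(2), of 2], of "ball (\<phi> p $ 2) r"] r(1) p0 by auto
  then have "\<forall>\<^sub>F q in nhds p. q \<in> U \<and> \<phi> q $ 1 \<in> ball 0 r \<and> \<phi> q $ 2 \<in> ball (\<phi> p $ 2) r"
    using chart_eventually[OF c p(2)] by eventually_elim auto
  then have "\<exists>q. (q \<in> U \<and> \<phi> q $ 1 \<in> ball 0 r \<and> \<phi> q $ 2 \<in> ball (\<phi> p $ 2) r) \<and> f q \<noteq> 0"
    using nz eventually_mono[of _ "nhds p" "\<lambda>q. f q = 0"] by blast
  then obtain q where q: "q \<in> U" "\<phi> q $ 1 \<in> ball 0 r" "\<phi> q $ 2 \<in> ball (\<phi> p $ 2) r" "f q \<noteq> 0" by blast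
  have "f (inv_into U \<phi> (vector [\<phi> q $ 1, \<phi> q $ 2])) \<noteq> 0"
    using q chartD(6)[OF c q(1)] by (simp add: vector_2_eta)
  from hol2_factor[OF r(2) open_ball r(1) q(2,3) this] obtain m G where
    "hol2 G (ball 0 r) (ball (\<phi> p $ 2) r)"
    "\<forall>x y. y \<in> ball (\<phi> p $ 2) r \<longrightarrow> f (inv_into U \<phi> (vector [x, y])) = x ^ m * G x y"
    "\<exists>y\<in>ball (\<phi> p $ 2) r. G 0 y \<noteq> 0" by metis
  then show ?thesis unfolding vanishing_order_def using r(1,3)
    by (intro exI[of _ m] exI[of _ r] exI[of _ G]) auto
qed

lemma leading_coeff_eq:
  fixes \<phi> :: "'m::t2_space \<Rightarrow> complex ^ 2"
  assumes r: "0 < r" and G: "hol2 G (ball 0 r) (ball b r)"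
    and eq: "\<And>x y. x \<in> ball 0 r \<Longrightarrow> y \<in> ball b r \<Longrightarrow> f (inv_into U \<phi> (vector [x, y])) = x ^ m * G x y"
    and q: "\<phi> q $ 1 = 0" "\<phi> q $ 2 \<in> ball b r"
  shows "leading_coeff f m U \<phi> q = G 0 (\<phi> q $ 2)"
proof -
  have "isCont (\<lambda>x. G x (\<phi> q $ 2)) 0" using hol2_isCont_x[OF G open_ball _ q(2)] r by simp
  then have "((\<lambda>x. G x (\<phi> q $ 2)) \<longlongrightarrow> G 0 (\<phi> q $ 2)) (at 0)" by (simp add: isCont_def)
  moreover have "\<forall>\<^sub>F t in at 0. G t (\<phi> q $ 2) = f (inv_into U \<phi> (\<phi> q + axis 1 t)) / t ^ m"
  proof -
    have "\<forall>\<^sub>F t in at 0. t \<in> ball 0 r \<and> t \<noteq> 0"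
      using eventually_at_ball'[OF r, of 0 UNIV] by (rule eventually_mono) auto
    then show ?thesis
      by eventually_elim (use eq[OF _ q(2)] q(1) in \<open>auto simp: axis_2_decomp\<close>)
  qed
  ultimately have "((\<lambda>t. f (inv_into U \<phi> (\<phi> q + axis 1 t)) / t ^ m) \<longlongrightarrow> G 0 (\<phi> q $ 2)) (at 0)"
    by (rule Lim_transform_eventually)
  then show ?thesis unfolding leading_coeff_def by (intro tendsto_Lim) auto
qed

context
  fixes \<A> :: "('m::t2_space) atlas" and E U \<phi> and f :: "'m \<Rightarrow> complex" and p m
  assumes a: "adapted \<A> E U \<phi>" and p: "p \<in> E" "p \<in> U" and v: "vanishing_order f U \<phi> p m"
begin

lemma vanishing_order_data:
  obtains r G where "0 < r" "hol2 G (ball 0 r) (ball (\<phi> p $ 2) r)"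
    "\<And>x y. x \<in> ball 0 r \<Longrightarrow> y \<in> ball (\<phi> p $ 2) r \<Longrightarrow> vector [x, y] \<in> \<phi> ` U"
    "\<And>x y. x \<in> ball 0 r \<Longrightarrow> y \<in> ball (\<phi> p $ 2) r \<Longrightarrow> f (inv_into U \<phi> (vector [x, y])) = x ^ m * G x y"
    "\<exists>y\<in>ball (\<phi> p $ 2) r. G 0 y \<noteq> 0"
    "\<And>q. q \<in> E \<Longrightarrow> q \<in> U \<Longrightarrow> \<phi> q $ 2 \<in> ball (\<phi> p $ 2) r \<Longrightarrow> leading_coeff f m U \<phi> q = G 0 (\<phi> q $ 2)"
proof -
  obtain r G where r: "0 < r" "hol2 G (ball 0 r) (ball (\<phi> p $ 2) r)"
    "\<forall>x\<in>ball 0 r. \<forall>y\<in>ball (\<phi> p $ 2) r. vector [x, y] \<in> \<phi> ` U \<and>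
        f (inv_into U \<phi> (vector [x, y])) = x ^ m * G x y"
    "\<exists>y\<in>ball (\<phi> p $ 2) r. G 0 y \<noteq> 0" using v unfolding vanishing_order_def by blast
  show thesis
  proof (rule that[OF r(1,2) _ _ r(4)])
    fix q assume q: "q \<in> E" "q \<in> U" "\<phi> q $ 2 \<in> ball (\<phi> p $ 2) r"
    then have "\<phi> q $ 1 = 0" using adaptedD(2)[OF a] by blast
    then show "leading_coeff f m U \<phi> q = G 0 (\<phi> q $ 2)"
      using leading_coeff_eq[OF r(1,2)] r(3) q(3) by blast
  qed (use r(3) in auto)
qed

text \<open>The limit is taken over all points off \<open>E\<close>, not only along the coordinate
  line of one chart, so that it can be compared with another chart.\<close>

lemma leading_coeff_tendsto:
  "((\<lambda>q. f q / (\<phi> q $ 1) ^ m) \<longlongrightarrow> leading_coeff f m U \<phi> p) (at p within - E)"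
proof -
  note c = adaptedD(1)[OF a]
  have p0: "\<phi> p $ 1 = 0" using adaptedD(2)[OF a] p by blast
  obtain r G where r: "0 < r" "hol2 G (ball 0 r) (ball (\<phi> p $ 2) r)"
    "\<And>x y. x \<in> ball 0 r \<Longrightarrow> y \<in> ball (\<phi> p $ 2) r \<Longrightarrow> f (inv_into U \<phi> (vector [x, y])) = x ^ m * G x y"
    "leading_coeff f m U \<phi> p = G 0 (\<phi> p $ 2)"
    by (rule vanishing_order_data) (use p centre_in_ball in blast)
  have t: "((\<lambda>q. \<phi> q $ i) \<longlongrightarrow> \<phi> p $ i) (at p within T)" for i T
    by (rule tendsto_at_nhds[OF chart_tendsto[OF c p(2)]])
  have eV: "\<forall>\<^sub>F q in at p within T. q \<in> U" for T by (rule eventually_at_nhds[OF chart_eventually[OF c p(2)]])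
  have eT: "\<forall>\<^sub>F q in at p within T. q \<in> T" for T by (auto simp: eventually_at_filter)
  have b: "\<forall>\<^sub>F q in at p within - E. \<phi> q $ 1 \<in> ball 0 r" "\<forall>\<^sub>F q in at p within - E. \<phi> q $ 2 \<in> ball (\<phi> p $ 2) r"
    using topological_tendstoD[OF t[of 1 "- E"], of "ball 0 r"]
      topological_tendstoD[OF t[of 2 "- E"], of "ball (\<phi> p $ 2) r"] r(1) p0 by auto
  have "((\<lambda>q. G (\<phi> q $ 1) (\<phi> q $ 2)) \<longlongrightarrow> G 0 (\<phi> p $ 2)) (at p within - E)"
    by (rule hol2_tendsto[OF r(2,1)]) (use t[of 1] t[of 2] p0 in auto)
  moreover have "\<forall>\<^sub>F q in at p within - E. G (\<phi> q $ 1) (\<phi> q $ 2) = f q / (\<phi> q $ 1) ^ m"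
    using eV eT[of "- E"] b
  proof eventually_elim
    case (elim q)
    then have "\<phi> q $ 1 \<noteq> 0" using adaptedD(2)[OF a] by auto
    then show ?case using r(3)[OF elim(3,4)] chartD(6)[OF c elim(1)] by (simp add: vector_2_eta)
  qed
  ultimately show ?thesis unfolding r(4) by (rule Lim_transform_eventually)
qed

lemma leading_coeff_holomorphic:
  obtains r where "0 < r" "\<And>y. y \<in> ball (\<phi> p $ 2) r \<Longrightarrow> vector [0, y] \<in> \<phi> ` U"
    "(\<lambda>y. leading_coeff f m U \<phi> (inv_into U \<phi> (vector [0, y]))) holomorphic_on ball (\<phi> p $ 2) r"
    "\<exists>y\<in>ball (\<phi> p $ 2) r. leading_coeff f m U \<phi> (inv_into U \<phi> (vector [0, y])) \<noteq> 0"
proof -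
  note c = adaptedD(1)[OF a]
  obtain r G where r: "0 < r" "hol2 G (ball 0 r) (ball (\<phi> p $ 2) r)"
    "\<And>x y. x \<in> ball 0 r \<Longrightarrow> y \<in> ball (\<phi> p $ 2) r \<Longrightarrow> vector [x, y] \<in> \<phi> ` U"
    "\<And>x y. x \<in> ball 0 r \<Longrightarrow> y \<in> ball (\<phi> p $ 2) r \<Longrightarrow> f (inv_into U \<phi> (vector [x, y])) = x ^ m * G x y"
    "\<exists>y\<in>ball (\<phi> p $ 2) r. G 0 y \<noteq> 0"
    by (rule vanishing_order_data) blast
  have eq: "leading_coeff f m U \<phi> (inv_into U \<phi> (vector [0, y])) = G 0 y" if "y \<in> ball (\<phi> p $ 2) r" for y
    using leading_coeff_eq[where q = "inv_into U \<phi> (vector [0, y])", OF r(1,2,4)]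
      chartD(7)[OF c r(3)[OF _ that]] that r(1) by auto
  show thesis
  proof (rule that[OF r(1)])
    show "vector [0, y] \<in> \<phi> ` U" if "y \<in> ball (\<phi> p $ 2) r" for y using r(1,3) that by simp
    show "(\<lambda>y. leading_coeff f m U \<phi> (inv_into U \<phi> (vector [0, y]))) holomorphic_on ball (\<phi> p $ 2) r"
      by (rule holomorphic_transform[of "G 0"]) (use r(1,2) eq in \<open>auto simp: hol2_def\<close>)
    show "\<exists>y\<in>ball (\<phi> p $ 2) r. leading_coeff f m U \<phi> (inv_into U \<phi> (vector [0, y])) \<noteq> 0"
      using r(5) eq by metis
  qed
qed

lemma eventually_leading_coeff_nz:
  "\<forall>\<^sub>F y in at (\<phi> p $ 2). leading_coeff f m U \<phi> (inv_into U \<phi> (vector [0, y])) \<noteq> 0"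
  "\<forall>\<^sub>F q in at p within E. leading_coeff f m U \<phi> q \<noteq> 0"
proof -
  note c = adaptedD(1)[OF a]
  define g where "g y = leading_coeff f m U \<phi> (inv_into U \<phi> (vector [0, y]))" for y
  obtain r where r: "0 < r" "g holomorphic_on ball (\<phi> p $ 2) r" "\<exists>y\<in>ball (\<phi> p $ 2) r. g y \<noteq> 0"
    unfolding g_def[abs_def] by (rule leading_coeff_holomorphic) blast
  then obtain \<beta> where "\<beta> \<in> ball (\<phi> p $ 2) r" "g \<beta> \<noteq> 0" by blast
  from non_zero_neighbour_alt[OF r(2) open_ball connected_ball _ this, of "\<phi> p $ 2"] r(1)
  have *: "\<forall>\<^sub>F y in at (\<phi> p $ 2). g y \<noteq> 0" by (auto elim: eventually_mono)
  then show "\<forall>\<^sub>F y in at (\<phi> p $ 2). leading_coeff f m U \<phi> (inv_into U \<phi> (vector [0, y])) \<noteq> 0"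
    by (simp add: g_def)
  have "\<forall>\<^sub>F q in at p within E. g (\<phi> q $ 2) \<noteq> 0"
    using filterlim_iff[THEN iffD1, OF adapted_tangent_filterlim[OF a p], rule_format, OF *] .
  moreover have "\<forall>\<^sub>F q in at p within E. q \<in> U" by (rule eventually_at_nhds[OF chart_eventually[OF c p(2)]])
  moreover have "\<forall>\<^sub>F q in at p within E. q \<in> E" by (auto simp: eventually_at_filter)
  ultimately show "\<forall>\<^sub>F q in at p within E. leading_coeff f m U \<phi> q \<noteq> 0"
  proof eventually_elim
    case (elim q)
    then have "\<phi> q = vector [0, \<phi> q $ 2]" using adaptedD(2)[OF a, of q] by (metis vector_2_eta)
    then show ?case using elim chartD(6)[OF c elim(2)] unfolding g_def by metis
  qed
qed

text \<open>The same cofactor serves on a smaller bidisc about \<open>q\<close>; by the identity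
  theorem it does not vanish identically on that piece of \<open>E\<close>.\<close>

lemma vanishing_order_nearby: "\<forall>\<^sub>F q in nhds p. q \<in> E \<longrightarrow> vanishing_order f U \<phi> q m"
proof -
  note c = adaptedD(1)[OF a]
  obtain r G where r: "0 < r" "hol2 G (ball 0 r) (ball (\<phi> p $ 2) r)"
    "\<And>x y. x \<in> ball 0 r \<Longrightarrow> y \<in> ball (\<phi> p $ 2) r \<Longrightarrow> vector [x, y] \<in> \<phi> ` U"
    "\<And>x y. x \<in> ball 0 r \<Longrightarrow> y \<in> ball (\<phi> p $ 2) r \<Longrightarrow> f (inv_into U \<phi> (vector [x, y])) = x ^ m * G x y"
    "\<exists>y\<in>ball (\<phi> p $ 2) r. G 0 y \<noteq> 0"
    by (rule vanishing_order_data) blast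
  have "\<forall>\<^sub>F q in nhds p. \<phi> q $ 2 \<in> ball (\<phi> p $ 2) r"
    using topological_tendstoD[OF chart_tendsto[OF c p(2), of 2], of "ball (\<phi> p $ 2) r"] r(1) by auto
  then show ?thesis
  proof eventually_elim
    case (elim q)
    obtain s where s: "0 < s" "s \<le> r" "ball (\<phi> q $ 2) s \<subseteq> ball (\<phi> p $ 2) r"
    proof -
      obtain s where "0 < s" "ball (\<phi> q $ 2) s \<subseteq> ball (\<phi> p $ 2) r" using elim open_ball openE by metis
      then show thesis using r(1) by (intro that[of "min s r"]) auto
    qed
    have G0: "G 0 holomorphic_on ball (\<phi> p $ 2) r" using r(1,2) by (simp add: hol2_def)
    have "\<exists>y\<in>ball (\<phi> q $ 2) s. G 0 y \<noteq> 0"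
    proof (rule ccontr)
      assume "\<not> (\<exists>y\<in>ball (\<phi> q $ 2) s. G 0 y \<noteq> 0)"
      then have z: "\<And>y. y \<in> ball (\<phi> q $ 2) s \<Longrightarrow> G 0 y = 0" by blast
      have l: "\<phi> q $ 2 islimpt ball (\<phi> q $ 2) s" using s(1) by (simp add: islimpt_ball)
      have "G 0 w = 0" if "w \<in> ball (\<phi> p $ 2) r" for w
        by (rule analytic_continuation[OF G0 open_ball connected_ball s(3) elim l z that])
      then show False using r(5) by blast
    qed
    moreover have "hol2 G (ball 0 s) (ball (\<phi> q $ 2) s)" by (rule hol2_subset[OF r(2)]) (use s in auto)
    moreover have "\<forall>x\<in>ball 0 s. \<forall>y\<in>ball (\<phi> q $ 2) s. vector [x, y] \<in> \<phi> ` U \<and>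
        f (inv_into U \<phi> (vector [x, y])) = x ^ m * G x y"
      using r(3,4) s(2,3) by (auto simp: subset_iff)
    ultimately show ?case unfolding vanishing_order_def using s(1) by blast
  qed
qed

end

lemma eventually_in_at: "\<forall>\<^sub>F q in at p within S. q \<in> S"
  by (auto simp: eventually_at_filter)

lemma leading_coeff_transition:
  fixes \<phi> \<psi> :: "'m::t2_space \<Rightarrow> complex ^ 2"
  assumes S: "complex_surface \<A>" and a: "adapted \<A> E U \<phi>" and b: "adapted \<A> E V \<psi>"
    and p: "p \<in> E" "p \<in> U" "p \<in> V"
    and v: "vanishing_order f U \<phi> p m"
  shows "((\<lambda>q. f q / (\<psi> q $ 1) ^ m) \<longlongrightarrow> leading_coeff f m U \<phi> p * normal_transition \<phi> V \<psi> p ^ m) (at p within - E)"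
proof -
  have "((\<lambda>q. f q / (\<phi> q $ 1) ^ m * (\<phi> q $ 1 / \<psi> q $ 1) ^ m) \<longlongrightarrow>
      leading_coeff f m U \<phi> p * normal_transition \<phi> V \<psi> p ^ m) (at p within - E)"
    by (intro tendsto_intros leading_coeff_tendsto[OF a p(1,2) v] normal_transition_aux(1)[OF S a b p])
  moreover have "\<forall>\<^sub>F q in at p within - E. q \<in> U"
    by (rule eventually_at_nhds[OF chart_eventually[OF adaptedD(1)[OF a] p(2)]])
  then have "\<forall>\<^sub>F q in at p within - E. f q / (\<phi> q $ 1) ^ m * (\<phi> q $ 1 / \<psi> q $ 1) ^ m = f q / (\<psi> q $ 1) ^ m"
    using eventually_in_at[of "- E"]
  proof eventually_elim
    case (elim q)
    then have "\<phi> q $ 1 \<noteq> 0" using adaptedD(2)[OF a] by auto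
    then show ?case by (simp add: power_divide)
  qed
  ultimately show ?thesis by (rule Lim_transform_eventually)
qed

text \<open>If \<open>m < m'\<close>, the quotient of \<open>f\<close> by the \<open>m\<close>-th
  power of the equation of \<open>E\<close> would tend both to 0 and to a non-zero limit.\<close>

lemma vanishing_order_le:
  fixes \<phi> \<psi> :: "'m::t2_space \<Rightarrow> complex ^ 2"
  assumes S: "complex_surface \<A>" and a: "adapted \<A> E U \<phi>" and b: "adapted \<A> E V \<psi>"
    and p: "p \<in> E" "p \<in> U" "p \<in> V"
    and v: "vanishing_order f U \<phi> p m" and w: "vanishing_order f V \<psi> p m'"
  shows "m' \<le> m"
proof (rule ccontr)
  assume "\<not> m' \<le> m"
  then have less: "m < m'" by simp
  note ca = adaptedD(1)[OF a] and cb = adaptedD(1)[OF b]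
  have "\<forall>\<^sub>F q in at p within E. leading_coeff f m U \<phi> q \<noteq> 0 \<and> q \<in> U \<and> q \<in> V \<and> q \<in> E \<and>
      vanishing_order f U \<phi> q m \<and> vanishing_order f V \<psi> q m'"
    using eventually_leading_coeff_nz(2)[OF a p(1,2) v]
      eventually_at_nhds[OF chart_eventually[OF ca p(2)], of E]
      eventually_at_nhds[OF chart_eventually[OF cb p(3)], of E]
      eventually_in_at[of E]
      eventually_at_nhds[OF vanishing_order_nearby[OF a p(1,2) v], of E]
      eventually_at_nhds[OF vanishing_order_nearby[OF b p(1,3) w], of E]
    by eventually_elim auto
  \<comment> \<open>The leading coefficient may vanish at \<open>p\<close>, so the comparison takes
    place at a nearby point \<open>q\<close> of \<open>E\<close>.\<close>
  from eventually_happens'[OF adapted_nontrivial(1)[OF a p(1,2)] this]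
  obtain q where nz: "leading_coeff f m U \<phi> q \<noteq> 0" and q: "q \<in> E" "q \<in> U" "q \<in> V"
    and vq: "vanishing_order f U \<phi> q m" and wq: "vanishing_order f V \<psi> q m'" by blast
  have q0: "\<psi> q $ 1 = 0" using adaptedD(2)[OF b] q by blast
  have "((\<lambda>x. \<psi> x $ 1) \<longlongrightarrow> 0) (at q within - E)"
    using tendsto_at_nhds[OF chart_tendsto[OF cb q(3), of 1]] q0 by simp
  then have "((\<lambda>x. f x / (\<psi> x $ 1) ^ m' * (\<psi> x $ 1) ^ (m' - m)) \<longlongrightarrow>
      leading_coeff f m' V \<psi> q * 0 ^ (m' - m)) (at q within - E)"
    by (intro tendsto_intros leading_coeff_tendsto[OF b q(1,3) wq])
  moreover have "\<forall>\<^sub>F x in at q within - E. x \<in> V"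
    by (rule eventually_at_nhds[OF chart_eventually[OF cb q(3)]])
  then have "\<forall>\<^sub>F x in at q within - E. f x / (\<psi> x $ 1) ^ m' * (\<psi> x $ 1) ^ (m' - m) = f x / (\<psi> x $ 1) ^ m"
    using eventually_in_at[of "- E"]
  proof eventually_elim
    case (elim x)
    then have "\<psi> x $ 1 \<noteq> 0" using adaptedD(2)[OF b] by auto
    then show ?case using less by (simp add: power_diff)
  qed
  ultimately have "((\<lambda>x. f x / (\<psi> x $ 1) ^ m) \<longlongrightarrow> leading_coeff f m' V \<psi> q * 0 ^ (m' - m)) (at q within - E)"
    by (rule Lim_transform_eventually)
  then have "((\<lambda>x. f x / (\<psi> x $ 1) ^ m) \<longlongrightarrow> 0) (at q within - E)"
    using zero_power[of "m' - m", where 'a = complex] less by simp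
  from tendsto_unique[OF adapted_nontrivial(2)[OF a q(1,2)] this leading_coeff_transition[OF S a b q vq]]
  show False using nz normal_transition(1)[OF S a b q] by simp
qed

section \<open>The order along a whole curve and the degree of the leading coefficient\<close>

definition vanishes_along :: "('m::t2_space) atlas \<Rightarrow> 'm set \<Rightarrow> ('m \<Rightarrow> complex) \<Rightarrow> nat \<Rightarrow> bool" where
  "vanishes_along \<A> E f m \<longleftrightarrow>
     (\<forall>U \<phi> p. adapted \<A> E U \<phi> \<longrightarrow> p \<in> E \<longrightarrow> p \<in> U \<longrightarrow> vanishing_order f U \<phi> p m)"

lemma vanishes_alongD:
  "vanishes_along \<A> E f m \<Longrightarrow> adapted \<A> E U \<phi> \<Longrightarrow> p \<in> E \<Longrightarrow> p \<in> U \<Longrightarrow> vanishing_order f U \<phi> p m"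
  by (simp add: vanishes_along_def)

text \<open>Orders in different charts agree, and the order is locally constant on \<open>E\<close>,
  hence constant by connectedness.\<close>

lemma vanishing_order_on_curve:
  fixes f :: "'m::t2_space \<Rightarrow> complex"
  assumes S: "complex_surface \<A>" and E: "smooth_curve \<A> E" and f: "holo_surf \<A> f"
    and nz: "\<And>p. p \<in> E \<Longrightarrow> \<not> (\<forall>\<^sub>F q in nhds p. f q = 0)"
  obtains m where "vanishes_along \<A> E f m"
proof -
  define ord where "ord p = (SOME m. \<exists>U \<phi>. adapted \<A> E U \<phi> \<and> p \<in> U \<and> vanishing_order f U \<phi> p m)" for p
  have ord: "vanishing_order f U \<phi> p (ord p)" if a: "adapted \<A> E U \<phi>" and p: "p \<in> E" "p \<in> U" for U \<phi> p
  proof -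
    obtain m where m: "vanishing_order f U \<phi> p m"
      using vanishing_order_exists[OF a p f nz[OF p(1)]] by blast
    then have "\<exists>m U \<phi>. adapted \<A> E U \<phi> \<and> p \<in> U \<and> vanishing_order f U \<phi> p m" using a p by blast
    from someI_ex[OF this] obtain V \<psi> where b: "adapted \<A> E V \<psi>" "p \<in> V" "vanishing_order f V \<psi> p (ord p)"
      unfolding ord_def by blast
    have "m = ord p"
      using vanishing_order_le[OF S a b(1) p b(2) m b(3)] vanishing_order_le[OF S b(1) a p(1) b(2) p(2) b(3) m]
      by simp
    then show ?thesis using m by simp
  qed
  have uniq: "m = ord p" if "adapted \<A> E U \<phi>" "p \<in> E" "p \<in> U" "vanishing_order f U \<phi> p m" for U \<phi> p m
    using vanishing_order_le[OF S that(1,1,2,3,3) that(4) ord[OF that(1-3)]]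
      vanishing_order_le[OF S that(1,1,2,3,3) ord[OF that(1-3)] that(4)] by simp
  have const: "ord p = ord p'" if "p \<in> E" "p' \<in> E" for p p'
  proof (rule connected_local_const[of E])
    show "\<forall>a\<in>E. \<forall>\<^sub>F b in at a within E. ord a = ord b"
    proof
      fix p assume p: "p \<in> E"
      then obtain U \<phi> where a: "adapted \<A> E U \<phi>" "p \<in> U" using E unfolding smooth_curve_def by blast
      show "\<forall>\<^sub>F q in at p within E. ord p = ord q"
        using eventually_at_nhds[OF vanishing_order_nearby[OF a(1) p a(2) ord[OF a(1) p a(2)]], of E]
          eventually_at_nhds[OF chart_eventually[OF adaptedD(1)[OF a(1)] a(2)], of E]
          eventually_in_at[of E]
        by eventually_elim (use uniq[OF a(1)] in auto)
    qed
  qed (use E that in \<open>auto simp: smooth_curve_def\<close>)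
  obtain p0 where "p0 \<in> E" using E by (auto simp: smooth_curve_def)
  then have p0: "ord p = ord p0" if "p \<in> E" for p using const[OF that] by blast
  show thesis
  proof (rule that, unfold vanishes_along_def, intro allI impI)
    fix U \<phi> p assume "adapted \<A> E U \<phi>" "p \<in> E" "p \<in> U"
    then show "vanishing_order f U \<phi> p (ord p0)" using ord[of U \<phi> p] p0[of p] by simp
  qed
qed

text \<open>Characterizes the order by a limit, so that a change of chart can be handled by
  multiplying limits.\<close>

lemma zorder_limit:
  fixes g :: "complex \<Rightarrow> complex"
  assumes "g holomorphic_on ball b r" "0 < r" "\<exists>y\<in>ball b r. g y \<noteq> 0"
  obtains n c where "zorder g b = int n" "c \<noteq> 0" "((\<lambda>w. g w / (w - b) ^ n) \<longlongrightarrow> c) (at b)" "n = 0 \<longleftrightarrow> g b \<noteq> 0"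
proof -
  define h where "h = zor_poly g b"
  from zorder_exist_zero[OF assms(1) open_ball connected_ball _ assms(3), of b, folded h_def] assms(2)
  have z: "if g b = 0 then 0 < zorder g b else zorder g b = 0" and
    "\<exists>\<rho>. 0 < \<rho> \<and> cball b \<rho> \<subseteq> ball b r \<and> h holomorphic_on cball b \<rho> \<and>
      (\<forall>w\<in>cball b \<rho>. g w = h w * (w - b) ^ nat (zorder g b) \<and> h w \<noteq> 0)"
    unfolding centre_in_ball by blast+
  then obtain \<rho> where \<rho>: "0 < \<rho>" "h holomorphic_on cball b \<rho>"
    "\<forall>w\<in>cball b \<rho>. g w = h w * (w - b) ^ nat (zorder g b) \<and> h w \<noteq> 0" by blast
  have "continuous_on (ball b \<rho>) h"
    using \<rho>(2) ball_subset_cball by (meson continuous_on_subset holomorphic_on_imp_continuous_on)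
  then have "(h \<longlongrightarrow> h b) (at b)" using \<rho>(1) by (simp add: continuous_on_eq_continuous_at isCont_def)
  moreover have "\<forall>\<^sub>F w in at b. h w = g w / (w - b) ^ nat (zorder g b)"
    using eventually_at_ball'[OF \<rho>(1), of b UNIV] by eventually_elim (use \<rho>(3) in auto)
  ultimately have "((\<lambda>w. g w / (w - b) ^ nat (zorder g b)) \<longlongrightarrow> h b) (at b)"
    by (rule Lim_transform_eventually)
  moreover have "b \<in> cball b \<rho>" using \<rho>(1) by simp
  then have "h b \<noteq> 0" using \<rho>(3) by blast
  moreover have "zorder g b = int (nat (zorder g b))" "nat (zorder g b) = 0 \<longleftrightarrow> g b \<noteq> 0"
    using z by (cases "g b = 0"; simp)+
  ultimately show thesis by (intro that)
qed

lemma power_quotient_limit_unique: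
  fixes g e :: "'a \<Rightarrow> 'b::real_normed_field"
  assumes "((\<lambda>q. g q / e q ^ n) \<longlongrightarrow> c) F" "((\<lambda>q. g q / e q ^ n') \<longlongrightarrow> c') F"
    "c \<noteq> 0" "c' \<noteq> 0" "(e \<longlongrightarrow> 0) F" "\<forall>\<^sub>F q in F. e q \<noteq> 0" "F \<noteq> bot"
  shows "n = n'"
proof -
  have *: "\<not> n < n'" if lim: "((\<lambda>q. g q / e q ^ n) \<longlongrightarrow> c) F" "((\<lambda>q. g q / e q ^ n') \<longlongrightarrow> c') F" "c \<noteq> 0"
    for n n' and c c' :: 'b
  proof
    assume less: "n < n'"
    have "((\<lambda>q. g q / e q ^ n' * e q ^ (n' - n)) \<longlongrightarrow> c' * 0 ^ (n' - n)) F"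
      by (intro tendsto_intros lim assms)
    moreover have "\<forall>\<^sub>F q in F. g q / e q ^ n' * e q ^ (n' - n) = g q / e q ^ n"
      using assms(6) by eventually_elim (use less in \<open>simp add: power_diff\<close>)
    ultimately have "((\<lambda>q. g q / e q ^ n) \<longlongrightarrow> c' * 0 ^ (n' - n)) F" by (rule Lim_transform_eventually)
    from tendsto_unique[OF assms(7) this lim(1)] show False using zero_power[of "n' - n", where 'a = 'b] less lim(3) by simp
  qed
  show ?thesis using *[OF assms(1-3)] *[OF assms(2,1,4)] by simp
qed

context
  fixes \<A> :: "('m::t2_space) atlas" and E and f :: "'m \<Rightarrow> complex" and m
  assumes S: "complex_surface \<A>" and E: "smooth_curve \<A> E"
    and va: "vanishes_along \<A> E f m"
begin

lemmas order_m = vanishes_alongD[OF va]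

lemma leading_coeff_change:
  assumes a: "adapted \<A> E U \<phi>" and b: "adapted \<A> E V \<psi>" and p: "p \<in> E" "p \<in> U" "p \<in> V"
  shows "leading_coeff f m V \<psi> p = leading_coeff f m U \<phi> p * normal_transition \<phi> V \<psi> p ^ m"
  by (rule tendsto_unique[OF adapted_nontrivial(2)[OF a p(1,2)] leading_coeff_tendsto[OF b p(1,3) order_m[OF b p(1,3)]]
      leading_coeff_transition[OF S a b p order_m[OF a p(1,2)]]])

text \<open>The class of \<open>f\<close> modulo the next power of the ideal of \<open>E\<close> is
  a section of the \<open>m\<close>-th power of the conormal bundle; hence the exponent
  \<open>- int m\<close>.\<close>

lemma normal_section_leading_coeff: "normal_section \<A> E (- int m) (leading_coeff f m)"
  unfolding normal_section_def
proof (intro conjI allI impI)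
  fix U \<phi> assume a: "adapted \<A> E U \<phi>"
  note c = adaptedD(1)[OF a]
  have pt: "inv_into U \<phi> (vector [0, w]) \<in> E" "inv_into U \<phi> (vector [0, w]) \<in> U"
    "\<phi> (inv_into U \<phi> (vector [0, w])) = vector [0, w]" if "vector [0, w] \<in> \<phi> ` U" for w
    using adaptedD(2)[OF a] chartD(7,8)[OF c that] by auto
  have *: "\<exists>r>0. (\<forall>y\<in>ball w r. vector [0, y] \<in> \<phi> ` U) \<and> along (leading_coeff f m) U \<phi> holomorphic_on ball w r \<and>
      (\<forall>\<^sub>F z in at w. along (leading_coeff f m) U \<phi> z \<noteq> 0)" if w: "vector [0, w] \<in> \<phi> ` U" for w
  proof -
    have nz: "\<forall>\<^sub>F z in at w. along (leading_coeff f m) U \<phi> z \<noteq> 0"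
      using eventually_leading_coeff_nz(1)[OF a pt(1,2)[OF w] order_m[OF a pt(1,2)[OF w]]]
      unfolding along_def pt(3)[OF w] vector_2 .
    obtain r where "0 < r" "\<And>y. y \<in> ball w r \<Longrightarrow> vector [0, y] \<in> \<phi> ` U"
      "along (leading_coeff f m) U \<phi> holomorphic_on ball w r"
      using leading_coeff_holomorphic[OF a pt(1,2)[OF w] order_m[OF a pt(1,2)[OF w]]]
      unfolding along_def[abs_def] pt(3)[OF w] vector_2 by blast
    then show ?thesis using nz by blast
  qed
  then show "\<forall>\<^sub>F z in at w. along (leading_coeff f m) U \<phi> z \<noteq> 0" if "vector [0, w] \<in> \<phi> ` U" for w
    using that by blast
  have "along (leading_coeff f m) U \<phi> analytic_on {w. vector [0, w] \<in> \<phi> ` U}"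
    unfolding analytic_on_def using * by blast
  then show "along (leading_coeff f m) U \<phi> nicely_meromorphic_on {w. vector [0, w] \<in> \<phi> ` U}"
    by (rule analytic_on_imp_nicely_meromorphic_on)
next
  fix U V p and \<phi> \<psi> :: "'m \<Rightarrow> complex ^ 2"
  assume "adapted \<A> E U \<phi> \<and> adapted \<A> E V \<psi> \<and> p \<in> E \<inter> U \<inter> V"
  then have a: "adapted \<A> E U \<phi>" "adapted \<A> E V \<psi>" "p \<in> E" "p \<in> U" "p \<in> V" by auto
  show "leading_coeff f m U \<phi> p = normal_transition \<phi> V \<psi> p powi - int m * leading_coeff f m V \<psi> p"
    using leading_coeff_change[OF a] normal_transition(1)[OF S a] by (simp add: power_int_minus field_simps)
qed

text \<open>The order at \<open>p\<close> of the section formed by the leading coefficients; by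
  \<open>zorder_chart_independent\<close> it does not depend on the chart picked by
  \<open>SOME\<close>.\<close>

definition curve_order :: "'m \<Rightarrow> int" where
  "curve_order p = (let (U, \<phi>) = SOME (U, \<phi>). adapted \<A> E U \<phi> \<and> p \<in> U
     in zorder (along (leading_coeff f m) U \<phi>) (\<phi> p $ 2))"

lemma zorder_chart:
  assumes a: "adapted \<A> E U \<phi>" and p: "p \<in> E" "p \<in> U"
  obtains n c where "zorder (along (leading_coeff f m) U \<phi>) (\<phi> p $ 2) = int n" "c \<noteq> 0"
    "((\<lambda>q. leading_coeff f m U \<phi> q / (\<phi> q $ 2 - \<phi> p $ 2) ^ n) \<longlongrightarrow> c) (at p within E)"
    "n = 0 \<longleftrightarrow> leading_coeff f m U \<phi> p \<noteq> 0"
proof -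
  note c = adaptedD(1)[OF a]
  let ?g = "along (leading_coeff f m) U \<phi>"
  have g: "?g (\<phi> q $ 2) = leading_coeff f m U \<phi> q" if "q \<in> E" "q \<in> U" for q
  proof -
    have "\<phi> q = vector [0, \<phi> q $ 2]" using adaptedD(2)[OF a, of q] that by (metis vector_2_eta)
    then show ?thesis using chartD(6)[OF c that(2)] by (metis along_def)
  qed
  obtain r where r: "0 < r" "?g holomorphic_on ball (\<phi> p $ 2) r" "\<exists>y\<in>ball (\<phi> p $ 2) r. ?g y \<noteq> 0"
    unfolding along_def[abs_def] by (rule leading_coeff_holomorphic[OF a p order_m[OF a p]]) blast
  obtain n c where n: "zorder ?g (\<phi> p $ 2) = int n" "c \<noteq> 0"
    "((\<lambda>w. ?g w / (w - \<phi> p $ 2) ^ n) \<longlongrightarrow> c) (at (\<phi> p $ 2))" "n = 0 \<longleftrightarrow> ?g (\<phi> p $ 2) \<noteq> 0"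
    by (rule zorder_limit[OF r(2,1,3)])
  have "((\<lambda>q. ?g (\<phi> q $ 2) / (\<phi> q $ 2 - \<phi> p $ 2) ^ n) \<longlongrightarrow> c) (at p within E)"
    by (rule filterlim_compose[OF n(3) adapted_tangent_filterlim[OF a p]])
  moreover have "\<forall>\<^sub>F q in at p within E. ?g (\<phi> q $ 2) / (\<phi> q $ 2 - \<phi> p $ 2) ^ n =
      leading_coeff f m U \<phi> q / (\<phi> q $ 2 - \<phi> p $ 2) ^ n"
    using eventually_at_nhds[OF chart_eventually[OF c p(2)], of E]
      eventually_in_at[of E]
    by eventually_elim (auto simp: g)
  ultimately have "((\<lambda>q. leading_coeff f m U \<phi> q / (\<phi> q $ 2 - \<phi> p $ 2) ^ n) \<longlongrightarrow> c) (at p within E)"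
    by (rule Lim_transform_eventually)
  then show thesis using that[OF n(1,2)] n(4) g[OF p] by simp
qed

text \<open>Between the two charts the leading coefficient changes by a power of the normal
  transition, and the local parameter by a factor; both have non-zero limits, so the exponents
  agree.\<close>

lemma zorder_chart_independent:
  assumes a: "adapted \<A> E U \<phi>" and b: "adapted \<A> E V \<psi>" and p: "p \<in> E" "p \<in> U" "p \<in> V"
  shows "zorder (along (leading_coeff f m) U \<phi>) (\<phi> p $ 2) = zorder (along (leading_coeff f m) V \<psi>) (\<psi> p $ 2)"
proof -
  note ca = adaptedD(1)[OF a] and cb = adaptedD(1)[OF b]
  obtain n c where n: "zorder (along (leading_coeff f m) U \<phi>) (\<phi> p $ 2) = int n" "c \<noteq> 0"
    "((\<lambda>q. leading_coeff f m U \<phi> q / (\<phi> q $ 2 - \<phi> p $ 2) ^ n) \<longlongrightarrow> c) (at p within E)"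
    by (rule zorder_chart[OF a p(1,2)])
  obtain n' c' where n': "zorder (along (leading_coeff f m) V \<psi>) (\<psi> p $ 2) = int n'" "c' \<noteq> 0"
    "((\<lambda>q. leading_coeff f m V \<psi> q / (\<psi> q $ 2 - \<psi> p $ 2) ^ n') \<longlongrightarrow> c') (at p within E)"
    by (rule zorder_chart[OF b p(1,3)])
  obtain \<kappa> where \<kappa>: "\<kappa> \<noteq> 0" "((\<lambda>q. (\<phi> q $ 2 - \<phi> p $ 2) / (\<psi> q $ 2 - \<psi> p $ 2)) \<longlongrightarrow> \<kappa>) (at p within E)"
    using normal_transition(2)[OF S a b p] by blast
  note h = normal_transition(1)[OF S a b p] normal_transition_aux(2)[OF S a b p]
  have t: "filterlim (\<lambda>q. \<phi> q $ 2) (at (\<phi> p $ 2)) (at p within E)" "filterlim (\<lambda>q. \<psi> q $ 2) (at (\<psi> p $ 2)) (at p within E)"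
    using adapted_tangent_filterlim[OF a p(1,2)] adapted_tangent_filterlim[OF b p(1,3)] .
  have "((\<lambda>q. leading_coeff f m U \<phi> q / (\<phi> q $ 2 - \<phi> p $ 2) ^ n * normal_transition \<phi> V \<psi> q ^ m *
      ((\<phi> q $ 2 - \<phi> p $ 2) / (\<psi> q $ 2 - \<psi> p $ 2)) ^ n) \<longlongrightarrow> c * normal_transition \<phi> V \<psi> p ^ m * \<kappa> ^ n) (at p within E)"
    by (intro tendsto_intros n(3) h(2) \<kappa>(2))
  moreover have "\<forall>\<^sub>F q in at p within E. \<phi> q $ 2 \<in> UNIV \<and> \<phi> q $ 2 \<noteq> \<phi> p $ 2" using t(1) by (simp add: filterlim_at)
  then have "\<forall>\<^sub>F q in at p within E. leading_coeff f m U \<phi> q / (\<phi> q $ 2 - \<phi> p $ 2) ^ n * normal_transition \<phi> V \<psi> q ^ m *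
      ((\<phi> q $ 2 - \<phi> p $ 2) / (\<psi> q $ 2 - \<psi> p $ 2)) ^ n = leading_coeff f m V \<psi> q / (\<psi> q $ 2 - \<psi> p $ 2) ^ n"
    using eventually_at_nhds[OF chart_eventually[OF ca p(2)], of E]
      eventually_at_nhds[OF chart_eventually[OF cb p(3)], of E]
      eventually_in_at[of E]
    by eventually_elim (use leading_coeff_change[OF a b] in \<open>auto simp: power_divide\<close>)
  ultimately have lim: "((\<lambda>q. leading_coeff f m V \<psi> q / (\<psi> q $ 2 - \<psi> p $ 2) ^ n) \<longlongrightarrow>
      c * normal_transition \<phi> V \<psi> p ^ m * \<kappa> ^ n) (at p within E)"
    by (rule Lim_transform_eventually)
  have "n = n'"
  proof (rule power_quotient_limit_unique[OF lim n'(3)])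
    show "((\<lambda>q. \<psi> q $ 2 - \<psi> p $ 2) \<longlongrightarrow> 0) (at p within E)"
      using t(2) by (simp add: filterlim_at LIM_zero)
    show "\<forall>\<^sub>F q in at p within E. \<psi> q $ 2 - \<psi> p $ 2 \<noteq> 0" using t(2) by (simp add: filterlim_at)
  qed (use n n' \<kappa> h adapted_nontrivial(1)[OF a p(1,2)] in auto)
  then show ?thesis using n n' by simp
qed

lemma curve_order_eq:
  assumes "adapted \<A> E U \<phi>" "p \<in> E" "p \<in> U"
  shows "curve_order p = zorder (along (leading_coeff f m) U \<phi>) (\<phi> p $ 2)"
proof -
  have "case (SOME (U, \<phi>). adapted \<A> E U \<phi> \<and> p \<in> U) of (U, \<phi>) \<Rightarrow> adapted \<A> E U \<phi> \<and> p \<in> U"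
    by (rule someI[of _ "(U, \<phi>)"]) (use assms in auto)
  then obtain V \<psi> where b: "(SOME (U, \<phi>). adapted \<A> E U \<phi> \<and> p \<in> U) = (V, \<psi>)" "adapted \<A> E V \<psi>" "p \<in> V"
    by (auto split: prod.splits)
  have "curve_order p = zorder (along (leading_coeff f m) V \<psi>) (\<psi> p $ 2)"
    by (simp add: curve_order_def b(1))
  then show ?thesis using zorder_chart_independent[OF b(2) assms(1,2) b(3) assms(3)] by simp
qed

lemma curve_order_nonneg: "p \<in> E \<Longrightarrow> 0 \<le> curve_order p"
proof -
  assume p: "p \<in> E"
  then obtain U \<phi> where a: "adapted \<A> E U \<phi>" "p \<in> U" using E unfolding smooth_curve_def by blast
  obtain n where "zorder (along (leading_coeff f m) U \<phi>) (\<phi> p $ 2) = int n"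
    by (rule zorder_chart[OF a(1) p a(2)])
  then show ?thesis using curve_order_eq[OF a(1) p a(2)] by simp
qed

lemma curve_order_eq_0:
  assumes "adapted \<A> E U \<phi>" "p \<in> E" "p \<in> U"
  shows "curve_order p = 0 \<longleftrightarrow> leading_coeff f m U \<phi> p \<noteq> 0"
proof -
  obtain n where "zorder (along (leading_coeff f m) U \<phi>) (\<phi> p $ 2) = int n"
    "n = 0 \<longleftrightarrow> leading_coeff f m U \<phi> p \<noteq> 0"
    by (rule zorder_chart[OF assms])
  then show ?thesis using curve_order_eq[OF assms] by simp
qed

text \<open>Zeros of the leading coefficient are isolated in \<open>E\<close>, and \<open>E\<close>
  is compact.\<close>

lemma finite_curve_order:
  assumes "compact E"
  shows "finite {p \<in> E. curve_order p \<noteq> 0}"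
proof -
  have "\<exists>N. open N \<and> p \<in> N \<and> (\<forall>q\<in>N \<inter> E. q \<noteq> p \<longrightarrow> curve_order q = 0)" if p: "p \<in> E" for p
  proof -
    obtain U \<phi> where a: "adapted \<A> E U \<phi>" "p \<in> U" using E p unfolding smooth_curve_def by blast
    have "\<forall>\<^sub>F q in at p within E. curve_order q = 0"
      using eventually_leading_coeff_nz(2)[OF a(1) p a(2) order_m[OF a(1) p a(2)]]
        eventually_at_nhds[OF chart_eventually[OF adaptedD(1)[OF a(1)] a(2)], of E]
        eventually_in_at[of E]
      by eventually_elim (use curve_order_eq_0[OF a(1)] in auto)
    then show ?thesis unfolding eventually_at_topological by blast
  qed
  then obtain N where N: "\<And>p. p \<in> E \<Longrightarrow> open (N p)" "\<And>p. p \<in> E \<Longrightarrow> p \<in> N p"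
    "\<And>p q. p \<in> E \<Longrightarrow> q \<in> N p \<Longrightarrow> q \<in> E \<Longrightarrow> q \<noteq> p \<Longrightarrow> curve_order q = 0" by (metis IntI)
  obtain C where C: "C \<subseteq> E" "finite C" "E \<subseteq> (\<Union>c\<in>C. N c)"
    by (rule compactE_image[OF assms, of E N]) (use N(1,2) in auto)
  have "{p \<in> E. curve_order p \<noteq> 0} \<subseteq> C" using C N(3) by blast
  then show ?thesis using C(2) finite_subset by blast
qed

text \<open>The definition of the self-intersection, read for the power \<open>- int m\<close> of
  the normal bundle and the section of leading coefficients.\<close>

lemma degree_formula:
  assumes "self_intersection \<A> E k"
  shows "(\<Sum>p | p \<in> E \<and> curve_order p \<noteq> 0. curve_order p) = - int m * k"
  using assms[unfolded self_intersection_def, rule_format, of "- int m" "leading_coeff f m" curve_order]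
    normal_section_leading_coeff curve_order_eq by blast

end

section \<open>Orders at crossings\<close>

text \<open>Turns a chart adapted to \<open>E\<close> at a crossing into one adapted to the other
  component.\<close>

definition swap2 :: "complex ^ 2 \<Rightarrow> complex ^ 2" where
  "swap2 z = vector [z $ 2, z $ 1]"

lemma swap2_simps [simp]: "swap2 (swap2 z) = z" "swap2 z $ 1 = z $ 2" "swap2 z $ 2 = z $ 1"
  "swap2 (vector [x, y]) = vector [y, x]"
  by (auto simp: swap2_def vec_eq_iff forall_2)

lemma continuous_on_swap2: "continuous_on S swap2"
  unfolding swap2_def[abs_def] by (intro continuous_intros)

lemma holo_map_swap2: "holo_map swap2 U"
proof -
  have "((\<lambda>z. z $ j) has_derivative (\<lambda>v. v $ j)) (at (z :: complex ^ 2))" for j z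
    by (intro bounded_linear_imp_has_derivative bounded_linear_vec_nth)
  then have "holo_fun (\<lambda>z. z $ j) U" for j :: 2
    unfolding holo_fun_def by (intro ballI exI[of _ "\<lambda>v. v $ j"]) auto
  then show ?thesis unfolding holo_map_def forall_2 by simp
qed

lemma chart_swap2:
  assumes S: "complex_surface \<A>" and c: "chart \<A> U \<phi>"
  shows "chart \<A> U (swap2 \<circ> \<phi>)"
    "\<And>z. z \<in> (swap2 \<circ> \<phi>) ` U \<Longrightarrow> inv_into U (swap2 \<circ> \<phi>) z = inv_into U \<phi> (swap2 z)"
proof -
  have inj: "inj_on (swap2 \<circ> \<phi>) U"
    by (rule comp_inj_on[OF chartD(3)[OF c]]) (metis inj_onI swap2_simps(1))
  show i: "inv_into U (swap2 \<circ> \<phi>) z = inv_into U \<phi> (swap2 z)" if z: "z \<in> (swap2 \<circ> \<phi>) ` U" for z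
    using z inj chartD(6)[OF c] by (auto simp del: o_apply) (auto simp: o_def inv_into_f_eq)
  have im: "z \<in> (swap2 \<circ> \<phi>) ` T \<longleftrightarrow> swap2 z \<in> \<phi> ` T" for z T
    by (auto simp: image_iff) (metis swap2_simps(1))+
  have im2: "(swap2 \<circ> \<phi>) ` T = swap2 -` (\<phi> ` T)" for T using im by blast
  have op: "open ((swap2 \<circ> \<phi>) ` U)"
    unfolding im2 using chartD(2)[OF c] continuous_on_swap2[of UNIV] by (simp add: open_vimage)
  show "chart \<A> U (swap2 \<circ> \<phi>)"
    unfolding chart_def
  proof (intro conjI)
    show "open U" by (rule chartD(1)[OF c])
    show "open ((swap2 \<circ> \<phi>) ` U)" by (rule op)
    have "continuous_on ((swap2 \<circ> \<phi>) ` U) (\<lambda>z. inv_into U \<phi> (swap2 z))"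
      by (rule continuous_on_compose2[OF chartD(5)[OF c] continuous_on_swap2]) (use im in auto)
    then have "continuous_on ((swap2 \<circ> \<phi>) ` U) (inv_into U (swap2 \<circ> \<phi>))"
      using i by (simp cong: continuous_on_cong)
    moreover have "continuous_on U (swap2 \<circ> \<phi>)"
      by (rule continuous_on_compose[OF chartD(4)[OF c] continuous_on_swap2])
    moreover have "inv_into U (swap2 \<circ> \<phi>) ` (swap2 \<circ> \<phi>) ` U = U"
      by (rule inv_into_image_cancel[OF inj order_refl])
    ultimately show "homeomorphism U ((swap2 \<circ> \<phi>) ` U) (swap2 \<circ> \<phi>) (inv_into U (swap2 \<circ> \<phi>))"
      using inj unfolding homeomorphism_def by (auto simp: f_inv_into_f simp del: o_apply)
    show "\<forall>(V, \<psi>)\<in>\<A>. holo_map (swap2 \<circ> \<phi> \<circ> inv_into V \<psi>) (\<psi> ` (U \<inter> V)) \<and>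
        holo_map (\<psi> \<circ> inv_into U (swap2 \<circ> \<phi>)) ((swap2 \<circ> \<phi>) ` (U \<inter> V))"
    proof (clarify, intro conjI)
      fix V \<psi> assume V: "(V, \<psi>) \<in> \<A>"
      then have h: "holo_map (\<phi> \<circ> inv_into V \<psi>) (\<psi> ` (U \<inter> V))" "holo_map (\<psi> \<circ> inv_into U \<phi>) (\<phi> ` (U \<inter> V))"
        using c by (auto simp: chart_def)
      show "holo_map (swap2 \<circ> \<phi> \<circ> inv_into V \<psi>) (\<psi> ` (U \<inter> V))"
        using h(1) by (simp add: holo_map_def forall_2)
      show "holo_map (\<psi> \<circ> inv_into U (swap2 \<circ> \<phi>)) ((swap2 \<circ> \<phi>) ` (U \<inter> V))"
        unfolding holo_map_def
      proof
        fix j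
        have "holo_fun (\<lambda>z. (\<psi> \<circ> inv_into U \<phi>) (swap2 z) $ j) ((swap2 \<circ> \<phi>) ` (U \<inter> V))"
          by (rule holo_fun_compose[OF _ holo_map_swap2, of "\<lambda>z. (\<psi> \<circ> inv_into U \<phi>) z $ j" "\<phi> ` (U \<inter> V)"])
            (use h(2) im in \<open>auto simp: holo_map_def\<close>)
        moreover have "open ((swap2 \<circ> \<phi>) ` (U \<inter> V))"
        proof -
          have "open V" using S V chartD(1) by (fastforce simp: complex_surface_def)
          then show ?thesis
            unfolding im2 using chart_open_image[OF c] continuous_on_swap2[of UNIV] by (simp add: open_vimage)
        qed
        moreover have "\<forall>z\<in>(swap2 \<circ> \<phi>) ` (U \<inter> V). (\<psi> \<circ> inv_into U (swap2 \<circ> \<phi>)) z $ j = (\<psi> \<circ> inv_into U \<phi>) (swap2 z) $ j"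
          using i by auto
        ultimately show "holo_fun (\<lambda>z. (\<psi> \<circ> inv_into U (swap2 \<circ> \<phi>)) z $ j) ((swap2 \<circ> \<phi>) ` (U \<inter> V))"
          using holo_fun_local[of "(swap2 \<circ> \<phi>) ` (U \<inter> V)" "\<lambda>z. (\<psi> \<circ> inv_into U (swap2 \<circ> \<phi>)) z $ j"] by blast
      qed
    qed
  qed
qed

text \<open>The two coordinates are coprime. One factor \<open>y\<close> is divided out after the
  other: the cofactor vanishes on \<open>y = 0\<close> for \<open>x \<noteq> 0\<close> by comparison
  with the right-hand side, and at \<open>x = 0\<close> by continuity.\<close>

lemma hol2_divide_power_y:
  assumes G: "hol2 G (ball 0 r) (ball 0 r)" and G': "hol2 G' (ball 0 r) (ball 0 r)" and r: "0 < r"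
    and eq: "\<And>x y. norm x < r \<Longrightarrow> norm y < r \<Longrightarrow> x ^ m * G x y = y ^ m' * G' y x"
  shows "k \<le> m' \<Longrightarrow> \<exists>H. hol2 H (ball 0 r) (ball 0 r) \<and> (\<forall>x\<in>ball 0 r. \<forall>y\<in>ball 0 r. G x y = y ^ k * H x y)"
proof (induction k)
  case 0
  then show ?case using G by auto
next
  case (Suc k)
  then obtain H where H: "hol2 H (ball 0 r) (ball 0 r)" "\<And>x y. norm x < r \<Longrightarrow> norm y < r \<Longrightarrow> G x y = y ^ k * H x y"
    by auto
  have z: "H x 0 = 0" if x: "norm x < r" "x \<noteq> 0" for x
  proof -
    have "x ^ m * H x 0 = 0 ^ (m' - k) * G' 0 x"
    proof (rule eq_at_puncture[where f = "\<lambda>y. x ^ m * H x y" and g = "\<lambda>y. y ^ (m' - k) * G' y x"])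
      show "isCont (\<lambda>y. x ^ m * H x y) 0" "isCont (\<lambda>y. y ^ (m' - k) * G' y x) 0"
        using hol2_isCont_y[OF H(1), of x 0] hol2_isCont_x[OF G', of 0 x] x r by (auto intro!: continuous_intros)
      show "\<forall>\<^sub>F y in at 0. x ^ m * H x y = y ^ (m' - k) * G' y x"
        using eventually_at_ball'[OF r, of 0 UNIV]
      proof eventually_elim
        case (elim y)
        then have "y ^ k * (x ^ m * H x y) = y ^ k * (y ^ (m' - k) * G' y x)"
          using eq[of x y] H(2)[of x y] x Suc.prems by (simp add: power_add[symmetric] mult_ac)
        then show ?case using elim by simp
      qed
    qed
    then show ?thesis using x(2) Suc.prems by (simp add: zero_power)
  qed
  have z': "H x 0 = 0" if "norm x < r" for x
  proof (cases "x = 0")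
    case True
    have "H 0 0 = 0"
    proof (rule eq_at_puncture[where f = "\<lambda>x. H x 0" and g = "\<lambda>x. 0" and a = 0])
      show "isCont (\<lambda>x. H x 0) 0" using hol2_isCont_x[OF H(1), of 0 0] r by simp
      show "\<forall>\<^sub>F x in at 0. H x 0 = 0"
        using eventually_at_ball'[OF r, of 0 UNIV] by eventually_elim (use z in auto)
    qed auto
    then show ?thesis using True by simp
  qed (use z that in auto)
  have K: "hol2 (quot_x (\<lambda>y x. H x y)) (ball 0 r) (ball 0 r)"
    by (rule quot_x(1)[OF hol2_swap[OF H(1)] open_ball r]) (use z' in auto)
  have "H x y = y * quot_x (\<lambda>y x. H x y) y x" if "norm x < r" for x y
    by (rule quot_x(2)[OF hol2_swap[OF H(1)] open_ball r]) (use z' that in auto)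
  then show ?case using H(2) hol2_swap[OF K]
    by (intro exI[of _ "\<lambda>x y. quot_x (\<lambda>y x. H x y) y x"]) auto
qed

lemma vanishing_order_pos:
  fixes \<phi> :: "'m::t2_space \<Rightarrow> complex ^ 2"
  assumes a: "adapted \<A> E U \<phi>" and p: "p \<in> E" "p \<in> U" and v: "vanishing_order f U \<phi> p m"
    and f: "\<And>q. q \<in> E \<Longrightarrow> f q = 0"
  shows "0 < m"
proof (rule ccontr)
  assume "\<not> 0 < m"
  then have m: "m = 0" by simp
  note c = adaptedD(1)[OF a]
  obtain r G where r: "0 < r"
    "\<And>x y. x \<in> ball 0 r \<Longrightarrow> y \<in> ball (\<phi> p $ 2) r \<Longrightarrow> vector [x, y] \<in> \<phi> ` U"
    "\<And>x y. x \<in> ball 0 r \<Longrightarrow> y \<in> ball (\<phi> p $ 2) r \<Longrightarrow> f (inv_into U \<phi> (vector [x, y])) = x ^ m * G x y"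
    "\<exists>y\<in>ball (\<phi> p $ 2) r. G 0 y \<noteq> 0"
    by (rule vanishing_order_data[OF a p v]) blast
  obtain y where y: "y \<in> ball (\<phi> p $ 2) r" "G 0 y \<noteq> 0" using r(4) by blast
  have "vector [0, y] \<in> \<phi> ` U" using r(1,2) y(1) by simp
  then have "inv_into U \<phi> (vector [0, y]) \<in> E" using adaptedD(2)[OF a] chartD(7,8)[OF c] by simp
  then show False using f r(1) r(3)[of 0 y] y m by simp
qed

lemma eventually_nonzero_off_curve:
  fixes \<phi> :: "'m::t2_space \<Rightarrow> complex ^ 2"
  assumes a: "adapted \<A> E U \<phi>" and p: "p \<in> E" "p \<in> U" and v: "vanishing_order f U \<phi> p m"
    and nz: "leading_coeff f m U \<phi> p \<noteq> 0"
  shows "\<forall>\<^sub>F q in nhds p. q \<notin> E \<longrightarrow> f q \<noteq> 0"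
proof -
  have "\<forall>\<^sub>F q in at p within - E. f q / (\<phi> q $ 1) ^ m \<noteq> 0"
    by (rule tendsto_imp_eventually_ne[OF leading_coeff_tendsto[OF a p v] nz])
  then have "\<forall>\<^sub>F q in nhds p. q \<noteq> p \<longrightarrow> q \<in> - E \<longrightarrow> f q / (\<phi> q $ 1) ^ m \<noteq> 0" by (simp add: eventually_at_filter)
  then show ?thesis by eventually_elim (use p in auto)
qed

text \<open>Near the crossing \<open>f\<close> is \<open>x ^ m * y ^ m' * H x y\<close>, so its
  leading coefficient along \<open>E\<close> has order at least \<open>m'\<close>. Equality means
  \<open>H 0 0 \<noteq> 0\<close>, and then \<open>f\<close> has no zeros near \<open>p\<close>
  outside the two components.\<close>

lemma crossing_order:
  fixes f :: "'m::t2_space \<Rightarrow> complex" and \<phi> :: "'m \<Rightarrow> complex ^ 2"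
  assumes S: "complex_surface \<A>" and E: "smooth_curve \<A> E"
    and v: "vanishes_along \<A> E f m" and v': "vanishes_along \<A> E' f m'"
    and a: "adapted \<A> E U \<phi>" and E': "E' \<inter> U = {q \<in> U. \<phi> q $ 2 = 0}"
    and p: "p \<in> E" "p \<in> E'" "p \<in> U"
  shows "int m' \<le> curve_order \<A> E f m p"
    "curve_order \<A> E f m p = int m' \<Longrightarrow> \<forall>\<^sub>F q in nhds p. q \<notin> E \<longrightarrow> q \<notin> E' \<longrightarrow> f q \<noteq> 0"
proof -
  note c = adaptedD(1)[OF a]
  have p0: "\<phi> p $ 1 = 0" "\<phi> p $ 2 = 0" using adaptedD(2)[OF a] p E' by blast+
  have a': "adapted \<A> E' U (swap2 \<circ> \<phi>)"
    unfolding adapted_def using chart_swap2(1)[OF S c] E' by simp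
  obtain r1 G where r1: "0 < r1" "hol2 G (ball 0 r1) (ball 0 r1)"
    "\<And>x y. x \<in> ball 0 r1 \<Longrightarrow> y \<in> ball 0 r1 \<Longrightarrow> vector [x, y] \<in> \<phi> ` U"
    "\<And>x y. x \<in> ball 0 r1 \<Longrightarrow> y \<in> ball 0 r1 \<Longrightarrow> f (inv_into U \<phi> (vector [x, y])) = x ^ m * G x y"
    "\<And>q. q \<in> E \<Longrightarrow> q \<in> U \<Longrightarrow> \<phi> q $ 2 \<in> ball 0 r1 \<Longrightarrow> leading_coeff f m U \<phi> q = G 0 (\<phi> q $ 2)"
    by (rule vanishing_order_data[OF a p(1,3) vanishes_alongD[OF v a p(1,3)]], unfold p0) blast
  obtain r2 G' where r2: "0 < r2" "hol2 G' (ball 0 r2) (ball 0 r2)"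
    "\<And>x y. x \<in> ball 0 r2 \<Longrightarrow> y \<in> ball 0 r2 \<Longrightarrow> vector [x, y] \<in> (swap2 \<circ> \<phi>) ` U"
    "\<And>x y. x \<in> ball 0 r2 \<Longrightarrow> y \<in> ball 0 r2 \<Longrightarrow> f (inv_into U (swap2 \<circ> \<phi>) (vector [x, y])) = x ^ m' * G' x y"
    by (rule vanishing_order_data[OF a' p(2,3) vanishes_alongD[OF v' a' p(2,3)]], unfold o_apply swap2_simps p0) blast
  define r where "r = min r1 r2"
  have r: "0 < r" "ball 0 r \<subseteq> ball (0::complex) r1" "ball 0 r \<subseteq> ball (0::complex) r2" using r1(1) r2(1) by (auto simp: r_def)
  have G: "hol2 G (ball 0 r) (ball 0 r)" "hol2 G' (ball 0 r) (ball 0 r)"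
    using hol2_subset[OF r1(2)] hol2_subset[OF r2(2)] r by blast+
  have eq: "x ^ m * G x y = y ^ m' * G' y x" if "norm x < r" "norm y < r" for x y
  proof -
    have xy: "x \<in> ball 0 r1" "y \<in> ball 0 r1" "x \<in> ball 0 r2" "y \<in> ball 0 r2" using that by (auto simp: r_def)
    show ?thesis using r1(4)[OF xy(1,2)] r2(4)[OF xy(4,3)] chart_swap2(2)[OF S c r2(3)[OF xy(4,3)]] by simp
  qed
  obtain H where H: "hol2 H (ball 0 r) (ball 0 r)" "\<forall>x\<in>ball 0 r. \<forall>y\<in>ball 0 r. G x y = y ^ m' * H x y"
    using hol2_divide_power_y[OF G r(1) eq order_refl] by blast
  obtain n d where n: "zorder (along (leading_coeff f m) U \<phi>) (\<phi> p $ 2) = int n" "d \<noteq> 0"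
    "((\<lambda>q. leading_coeff f m U \<phi> q / (\<phi> q $ 2 - \<phi> p $ 2) ^ n) \<longlongrightarrow> d) (at p within E)"
    by (rule zorder_chart[OF S E v a p(1,3)])
  have ord: "curve_order \<A> E f m p = int n" using curve_order_eq[OF S E v a p(1,3)] n(1) by simp
  have t: "((\<lambda>q. \<phi> q $ i) \<longlongrightarrow> 0) (nhds p)" for i
    using chart_tendsto[OF c p(3), of i] p0 exhaust_2[of i] by auto
  have b: "\<forall>\<^sub>F q in nhds p. \<phi> q $ 1 \<in> ball 0 r \<and> \<phi> q $ 2 \<in> ball 0 r \<and> q \<in> U"
    using topological_tendstoD[OF t[of 1], of "ball 0 r"] topological_tendstoD[OF t[of 2], of "ball 0 r"] r(1)
    by (auto intro!: eventually_conj chart_eventually[OF c p(3)])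
  have lim0: "((\<lambda>q. H 0 (\<phi> q $ 2)) \<longlongrightarrow> H 0 0) (at p within E)"
    by (rule hol2_tendsto[OF H(1) r(1)]) (use tendsto_at_nhds[OF t[of 2]] in auto)
  have lc: "\<forall>\<^sub>F q in at p within E. leading_coeff f m U \<phi> q = (\<phi> q $ 2) ^ m' * H 0 (\<phi> q $ 2) \<and> \<phi> q $ 2 \<noteq> 0"
  proof -
    have "\<forall>\<^sub>F q in at p within E. \<phi> q $ 2 \<in> UNIV \<and> \<phi> q $ 2 \<noteq> \<phi> p $ 2"
      using adapted_tangent_filterlim[OF a p(1,3)] by (simp add: filterlim_at)
    then show ?thesis using eventually_at_nhds[OF b, of E] eventually_in_at[of E]
    proof eventually_elim
      case (elim q)
      then have "leading_coeff f m U \<phi> q = G 0 (\<phi> q $ 2)" using r1(5) r by blast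
      then show ?case using H(2) elim r(1) p0 by simp
    qed
  qed
  have le: "m' \<le> n"
  proof (rule ccontr)
    assume "\<not> m' \<le> n"
    then have less: "n < m'" by simp
    have "((\<lambda>q. (\<phi> q $ 2) ^ (m' - n) * H 0 (\<phi> q $ 2)) \<longlongrightarrow> 0 ^ (m' - n) * H 0 0) (at p within E)"
      by (intro tendsto_intros lim0 tendsto_at_nhds[OF t])
    moreover have "\<forall>\<^sub>F q in at p within E. (\<phi> q $ 2) ^ (m' - n) * H 0 (\<phi> q $ 2) =
        leading_coeff f m U \<phi> q / (\<phi> q $ 2 - \<phi> p $ 2) ^ n"
      using lc by eventually_elim (use less p0 in \<open>simp add: power_diff\<close>)
    ultimately have "((\<lambda>q. leading_coeff f m U \<phi> q / (\<phi> q $ 2 - \<phi> p $ 2) ^ n) \<longlongrightarrow> 0 ^ (m' - n) * H 0 0) (at p within E)"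
      by (rule Lim_transform_eventually)
    from tendsto_unique[OF adapted_nontrivial(1)[OF a p(1,3)] this n(3)]
    show False using zero_power[of "m' - n", where 'a = complex] less n(2) by simp
  qed
  then show "int m' \<le> curve_order \<A> E f m p" using ord by simp
  assume "curve_order \<A> E f m p = int m'"
  then have nm: "n = m'" using ord by simp
  have "\<forall>\<^sub>F q in at p within E. H 0 (\<phi> q $ 2) = leading_coeff f m U \<phi> q / (\<phi> q $ 2 - \<phi> p $ 2) ^ n"
    using lc by eventually_elim (simp add: nm p0)
  from Lim_transform_eventually[OF lim0 this]
  have "H 0 0 = d" using tendsto_unique[OF adapted_nontrivial(1)[OF a p(1,3)] _ n(3)] by blast
  then have "H 0 0 \<noteq> 0" using n(2) by simp
  moreover have "((\<lambda>q. H (\<phi> q $ 1) (\<phi> q $ 2)) \<longlongrightarrow> H 0 0) (nhds p)"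
    by (rule hol2_tendsto[OF H(1) r(1) t t])
  ultimately have "\<forall>\<^sub>F q in nhds p. H (\<phi> q $ 1) (\<phi> q $ 2) \<noteq> 0" by (metis tendsto_imp_eventually_ne)
  then show "\<forall>\<^sub>F q in nhds p. q \<notin> E \<longrightarrow> q \<notin> E' \<longrightarrow> f q \<noteq> 0"
    using b
  proof eventually_elim
    case (elim q)
    show ?case
    proof (intro impI)
      assume q: "q \<notin> E" "q \<notin> E'"
      have "f q = (\<phi> q $ 1) ^ m * G (\<phi> q $ 1) (\<phi> q $ 2)"
        using r1(4)[OF subsetD[OF r(2)] subsetD[OF r(2)], of "\<phi> q $ 1" "\<phi> q $ 2"] elim chartD(6)[OF c, of q]
        by (simp add: vector_2_eta)
      also have "G (\<phi> q $ 1) (\<phi> q $ 2) = (\<phi> q $ 2) ^ m' * H (\<phi> q $ 1) (\<phi> q $ 2)" using H(2) elim by blast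
      finally show "f q \<noteq> 0" using q elim adaptedD(2)[OF a, of q] E' by auto
    qed
  qed
qed


text \<open>For each \<open>E\<close> the degree of the leading coefficient is compared with the
  contribution of the crossings: orders are non-negative, and at least \<open>m E'\<close> at a
  point of \<open>E'\<close>. Equality on every component leaves no room for zeros of
  \<open>f\<close> near the curves but outside them.\<close>

theorem intersection_weights:
  fixes f :: "'m::t2_space \<Rightarrow> complex" and self :: "'m set \<Rightarrow> int"
  assumes S: "complex_surface \<A>" and fin: "finite \<E>" and sm: "\<And>E. E \<in> \<E> \<Longrightarrow> smooth_curve \<A> E"
    and cp: "\<And>E. E \<in> \<E> \<Longrightarrow> compact E" and si: "\<And>E. E \<in> \<E> \<Longrightarrow> self_intersection \<A> E (self E)"
    and cross: "\<And>E E' p. E \<in> \<E> \<Longrightarrow> E' \<in> \<E> \<Longrightarrow> E \<noteq> E' \<Longrightarrow> p \<in> E \<Longrightarrow> p \<in> E' \<Longrightarrow>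
      \<exists>U \<phi>. adapted \<A> E U \<phi> \<and> p \<in> U \<and> E' \<inter> U = {q \<in> U. \<phi> q $ 2 = 0}"
    and two: "\<And>p. card {E \<in> \<E>. p \<in> E} \<le> 2"
    and f: "holo_surf \<A> f" and f0: "\<And>E p. E \<in> \<E> \<Longrightarrow> p \<in> E \<Longrightarrow> f p = 0"
    and nz: "\<And>E p. E \<in> \<E> \<Longrightarrow> p \<in> E \<Longrightarrow> \<not> (\<forall>\<^sub>F q in nhds p. f q = 0)"
  obtains m :: "'m set \<Rightarrow> nat" where "\<And>E. E \<in> \<E> \<Longrightarrow> 0 < m E"
    "\<And>E. E \<in> \<E> \<Longrightarrow> int (m E) * self E + (\<Sum>E'\<in>\<E> - {E}. int (m E') * int (card (E \<inter> E'))) \<le> 0"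
    "(\<And>E. E \<in> \<E> \<Longrightarrow> int (m E) * self E + (\<Sum>E'\<in>\<E> - {E}. int (m E') * int (card (E \<inter> E'))) = 0) \<Longrightarrow>
      (\<And>E p. E \<in> \<E> \<Longrightarrow> p \<in> E \<Longrightarrow> \<forall>\<^sub>F q in nhds p. q \<notin> \<Union>\<E> \<longrightarrow> f q \<noteq> 0)"
    "\<And>E E'. E \<in> \<E> \<Longrightarrow> E' \<in> \<E> \<Longrightarrow> E \<noteq> E' \<Longrightarrow> finite (E \<inter> E')"
proof -
  have "\<exists>m. vanishes_along \<A> E f m" if "E \<in> \<E>" for E
    using vanishing_order_on_curve[OF S sm[OF that] f nz[OF that]] by blast
  then obtain m where m: "\<And>E. E \<in> \<E> \<Longrightarrow> vanishes_along \<A> E f (m E)" by metis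
  have pos: "0 < m E" if E: "E \<in> \<E>" for E
  proof -
    obtain p U \<phi> where a: "adapted \<A> E U \<phi>" "p \<in> E" "p \<in> U"
      using sm[OF E] unfolding smooth_curve_def by blast
    show ?thesis by (rule vanishing_order_pos[OF a vanishes_alongD[OF m[OF E] a] f0[OF E]])
  qed
  define ord where "ord E = curve_order \<A> E f (m E)" for E
  define P where "P E = {p \<in> E. ord E p \<noteq> 0}" for E
  \<comment> \<open>The order at \<open>p\<close> that is forced by the other components; at most
    one of them passes through \<open>p\<close>.\<close>
  define w where "w E p = (\<Sum>E' | E' \<in> \<E> - {E} \<and> p \<in> E'. int (m E'))" for E p
  have finP: "finite (P E)" if "E \<in> \<E>" for E
    unfolding P_def ord_def by (rule finite_curve_order[OF S sm[OF that] m[OF that] cp[OF that]])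
  have deg: "(\<Sum>p\<in>P E. ord E p) = - int (m E) * self E" if "E \<in> \<E>" for E
    unfolding P_def ord_def by (rule degree_formula[OF S sm[OF that] m[OF that] si[OF that]])
  have ord0: "0 \<le> ord E p" if "E \<in> \<E>" "p \<in> E" for E p
    unfolding ord_def by (rule curve_order_nonneg[OF S sm[OF that(1)] m[OF that(1)] that(2)])
  have others: "(\<forall>E'\<in>\<E> - {E}. p \<notin> E') \<or> (\<exists>E'\<in>\<E> - {E}. {E''. E'' \<in> \<E> - {E} \<and> p \<in> E''} = {E'})"
    if E: "E \<in> \<E>" "p \<in> E" for E p
  proof -
    have "card (insert E {E''. E'' \<in> \<E> - {E} \<and> p \<in> E''}) \<le> card {E \<in> \<E>. p \<in> E}"
      by (rule card_mono) (use fin E in auto)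
    then have "card {E''. E'' \<in> \<E> - {E} \<and> p \<in> E''} \<le> 1"
      using two[of p] fin by (simp add: card_insert_if)
    then have "{E''. E'' \<in> \<E> - {E} \<and> p \<in> E''} = {} \<or> (\<exists>E'. {E''. E'' \<in> \<E> - {E} \<and> p \<in> E''} = {E'})"
      using fin by (auto simp: le_Suc_eq card_1_singleton_iff)
    then show ?thesis by blast
  qed
  have cr: "int (m E') \<le> ord E p"
    "ord E p = int (m E') \<Longrightarrow> \<forall>\<^sub>F q in nhds p. q \<notin> E \<longrightarrow> q \<notin> E' \<longrightarrow> f q \<noteq> 0"
    if E: "E \<in> \<E>" "E' \<in> \<E>" "E \<noteq> E'" "p \<in> E" "p \<in> E'" for E E' p
  proof -
    obtain U and \<phi> :: "'m \<Rightarrow> complex ^ 2" where a: "adapted \<A> E U \<phi>" "p \<in> U" "E' \<inter> U = {q \<in> U. \<phi> q $ 2 = 0}"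
      using cross[OF E] by blast
    show "int (m E') \<le> ord E p"
      "ord E p = int (m E') \<Longrightarrow> \<forall>\<^sub>F q in nhds p. q \<notin> E \<longrightarrow> q \<notin> E' \<longrightarrow> f q \<noteq> 0"
      unfolding ord_def
      using crossing_order[OF S sm[OF E(1)] m[OF E(1)] m[OF E(2)] a(1,3) E(4,5) a(2)] by blast+
  qed
  have sub: "E \<inter> E' \<subseteq> P E" if E: "E \<in> \<E>" "E' \<in> \<E>" "E \<noteq> E'" for E E'
    using cr(1)[OF E] pos[OF E(2)] by (fastforce simp: P_def)
  have wle: "w E p \<le> ord E p" and wnz: "w E p = ord E p \<Longrightarrow> \<forall>\<^sub>F q in nhds p. q \<notin> \<Union>\<E> \<longrightarrow> f q \<noteq> 0"
    if E: "E \<in> \<E>" "p \<in> E" for E p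
    using others[OF E]
  proof (atomize (full), elim disjE bexE)
    assume "\<forall>E'\<in>\<E> - {E}. p \<notin> E'"
    then have "{E''. E'' \<in> \<E> - {E} \<and> p \<in> E''} = {}" by blast
    then have w0: "w E p = 0" unfolding w_def by (simp only: sum.empty)
    moreover have "\<forall>\<^sub>F q in nhds p. q \<notin> \<Union>\<E> \<longrightarrow> f q \<noteq> 0" if "0 = ord E p"
    proof -
      obtain U \<phi> where a: "adapted \<A> E U \<phi>" "p \<in> U" using sm[OF E(1)] E(2) unfolding smooth_curve_def by blast
      have "leading_coeff f (m E) U \<phi> p \<noteq> 0"
        using curve_order_eq_0[OF S sm[OF E(1)] m[OF E(1)] a(1) E(2) a(2)] that by (simp add: ord_def)
      from eventually_nonzero_off_curve[OF a(1) E(2) a(2) vanishes_alongD[OF m[OF E(1)] a(1) E(2) a(2)] this]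
      show ?thesis by eventually_elim (use E(1) in blast)
    qed
    ultimately show "w E p \<le> ord E p \<and> (w E p = ord E p \<longrightarrow> (\<forall>\<^sub>F q in nhds p. q \<notin> \<Union>\<E> \<longrightarrow> f q \<noteq> 0))"
      using ord0[OF E] by simp
  next
    fix E' assume E': "E' \<in> \<E> - {E}" and eq: "{E''. E'' \<in> \<E> - {E} \<and> p \<in> E''} = {E'}"
    then have w: "w E p = int (m E')" unfolding w_def by (simp only: sum.insert sum.empty finite.emptyI) simp
    have p: "p \<in> E'" using eq by blast
    have "E' \<in> \<E>" "E \<noteq> E'" using E' by auto
    note c = cr[OF E(1) this E(2) p]
    show "w E p \<le> ord E p \<and> (w E p = ord E p \<longrightarrow> (\<forall>\<^sub>F q in nhds p. q \<notin> \<Union>\<E> \<longrightarrow> f q \<noteq> 0))"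
    proof (intro conjI impI)
      show "w E p \<le> ord E p" using c(1) w by simp
      assume "w E p = ord E p"
      then have "\<forall>\<^sub>F q in nhds p. q \<notin> E \<longrightarrow> q \<notin> E' \<longrightarrow> f q \<noteq> 0" using c(2) w by simp
      then show "\<forall>\<^sub>F q in nhds p. q \<notin> \<Union>\<E> \<longrightarrow> f q \<noteq> 0"
        by eventually_elim (use E(1) E' in blast)
    qed
  qed
  have fi: "finite (E \<inter> E')" if "E \<in> \<E>" "E' \<in> \<E>" "E \<noteq> E'" for E E'
    using sub[OF that] finP[OF that(1)] finite_subset by blast
  \<comment> \<open>Double counting of pairs of a component and a crossing point; \<open>P E\<close>
    contains all crossings because \<open>m E'\<close> is positive.\<close>
  have sum: "(\<Sum>E'\<in>\<E> - {E}. int (m E') * int (card (E \<inter> E'))) = (\<Sum>p\<in>P E. w E p)" if E: "E \<in> \<E>" for E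
  proof -
    have "(\<Sum>p\<in>P E. w E p) = (\<Sum>p\<in>P E. \<Sum>E'\<in>\<E> - {E}. if p \<in> E' then int (m E') else 0)"
    proof (intro sum.cong refl)
      fix p
      show "w E p = (\<Sum>E'\<in>\<E> - {E}. if p \<in> E' then int (m E') else 0)"
        unfolding w_def using fin by (subst sum.inter_filter[symmetric]) auto
    qed
    also have "\<dots> = (\<Sum>E'\<in>\<E> - {E}. \<Sum>p\<in>P E. if p \<in> E' then int (m E') else 0)" by (rule sum.swap)
    also have "\<dots> = (\<Sum>E'\<in>\<E> - {E}. int (m E') * int (card (E \<inter> E')))"
    proof (intro sum.cong refl)
      fix E' assume E': "E' \<in> \<E> - {E}"
      have "(\<Sum>p\<in>P E. if p \<in> E' then int (m E') else 0) = (\<Sum>p | p \<in> P E \<and> p \<in> E'. int (m E'))"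
        using finP[OF E] by (subst sum.inter_filter) auto
      also have "{p. p \<in> P E \<and> p \<in> E'} = E \<inter> E'" using sub[OF E, of E'] E' by (auto simp: P_def)
      finally show "(\<Sum>p\<in>P E. if p \<in> E' then int (m E') else 0) = int (m E') * int (card (E \<inter> E'))" by simp
    qed
    finally show ?thesis by simp
  qed
  show thesis
  proof (rule that[of m])
    show "int (m E) * self E + (\<Sum>E'\<in>\<E> - {E}. int (m E') * int (card (E \<inter> E'))) \<le> 0" if E: "E \<in> \<E>" for E
    proof -
      have "(\<Sum>p\<in>P E. w E p) \<le> (\<Sum>p\<in>P E. ord E p)"
        by (rule sum_mono) (use wle[OF E] in \<open>auto simp: P_def\<close>)
      then show ?thesis using deg[OF E] sum[OF E] by simp
    qed
    fix E p assume E: "E \<in> \<E>" "p \<in> E"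
      and eq: "\<And>E. E \<in> \<E> \<Longrightarrow> int (m E) * self E + (\<Sum>E'\<in>\<E> - {E}. int (m E') * int (card (E \<inter> E'))) = 0"
    have "(\<Sum>p\<in>P E. ord E p - w E p) = 0"
      using eq[OF E(1)] deg[OF E(1)] sum[OF E(1)] by (simp add: sum_subtractf)
    then have *: "\<forall>p\<in>P E. ord E p - w E p = 0"
      by (subst (asm) sum_nonneg_eq_0_iff) (use finP[OF E(1)] wle[OF E(1)] in \<open>auto simp: P_def\<close>)
    have "0 \<le> w E p" unfolding w_def by (intro sum_nonneg) simp
    then have "w E p = ord E p" using * wle[OF E] E(2) by (cases "p \<in> P E") (auto simp: P_def)
    then show "\<forall>\<^sub>F q in nhds p. q \<notin> \<Union>\<E> \<longrightarrow> f q \<noteq> 0" by (rule wnz[OF E])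
  qed (use pos fi in auto)
qed

section \<open>The exceptional fibre\<close>

lemma t2_separate_compact:
  fixes S T :: "'a::t2_space set"
  assumes "compact S" "compact T" "S \<inter> T = {}"
  obtains U V where "open U" "open V" "S \<subseteq> U" "T \<subseteq> V" "U \<inter> V = {}"
proof -
  have "Hausdorff_space (euclidean :: 'a topology)"
    using hausdorff by (fastforce simp: Hausdorff_space_def disjnt_def)
  moreover have "compactin euclidean S" "compactin euclidean T" "disjnt S T" using assms by (auto simp: disjnt_def)
  ultimately obtain U V where UV: "openin euclidean U" "openin euclidean V" "S \<subseteq> U" "T \<subseteq> V" "disjnt U V"
    by (rule Hausdorff_space_compact_separation)
  show thesis by (rule that[of U V]) (use UV in \<open>auto simp: disjnt_def\<close>)
qed

lemma analytic_set_compact_ball: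
  assumes X: "analytic_set X" and x0: "x0 \<in> X"
  obtains R where "0 < R" "\<And>r. r \<le> R \<Longrightarrow> compact (X \<inter> cball x0 r)"
proof -
  obtain U F where U: "open U" "x0 \<in> U" "finite F" "\<forall>f\<in>F. holo_fun f U"
    "X \<inter> U = {z\<in>U. \<forall>f\<in>F. f z = 0}" using bspec[OF X[unfolded analytic_set_def] x0] by (elim exE conjE)
  obtain R where R: "0 < R" "cball x0 R \<subseteq> U" using U(1,2) open_contains_cball by blast
  show thesis
  proof (rule that[OF R(1)])
    fix r assume r: "r \<le> R"
    then have sub: "cball x0 r \<subseteq> U" using R(2) by (meson order_trans subset_cball)
    have "X \<inter> cball x0 r = cball x0 r \<inter> (\<Inter>f\<in>F. {z \<in> cball x0 r. f z = 0})"
      using sub U(5) by blast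
    moreover have "closed {z \<in> cball x0 r. f z = 0}" if "f \<in> F" for f
      by (rule continuous_closed_preimage_constant)
        (use holo_fun_continuous_on[OF bspec[OF U(4) that]] sub in \<open>auto intro: continuous_on_subset\<close>)
    ultimately show "compact (X \<inter> cball x0 r)"
      by (auto intro!: compact_Int_closed closed_INT)
  qed
qed

locale surface_resolution =
  fixes X :: "(complex ^ 'n) set" and x0 :: "complex ^ 'n"
    and \<A> :: "('m::t2_space) atlas" and \<pi> :: "'m \<Rightarrow> complex ^ 'n"
  assumes X: "normal_surface X" and x0: "x0 \<in> X" and res: "resolution X x0 \<A> \<pi>"
begin

lemma surf: "complex_surface \<A>"
  and pi_X: "\<pi> q \<in> X"
  and proper: "compact K \<Longrightarrow> K \<subseteq> X \<Longrightarrow> compact (\<pi> -` K)"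
  and dense: "closure (\<pi> -` (X - {x0})) = UNIV"
  using res unfolding resolution_def by blast+

lemma pi_inj: "\<pi> p = \<pi> q \<Longrightarrow> \<pi> p \<noteq> x0 \<Longrightarrow> p = q"
proof -
  assume pq: "\<pi> p = \<pi> q" "\<pi> p \<noteq> x0"
  have "inj_on \<pi> (\<pi> -` (X - {x0}))" using res unfolding resolution_def bij_betw_def by (elim conjE)
  from inj_onD[OF this pq(1)] show "p = q" using pi_X[of p] pi_X[of q] pq by auto
qed

lemma pi_surj: "y \<in> X \<Longrightarrow> y \<noteq> x0 \<Longrightarrow> \<exists>p. \<pi> p = y"
proof -
  assume y: "y \<in> X" "y \<noteq> x0"
  have "\<pi> ` (\<pi> -` (X - {x0})) = X - {x0}" using res unfolding resolution_def bij_betw_def by (elim conjE)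
  then have "y \<in> \<pi> ` (\<pi> -` (X - {x0}))" using y by (simp only: Diff_iff singleton_iff) simp
  then show "\<exists>p. \<pi> p = y" by (elim imageE) (rule exI, erule sym)
qed

lemma pi_inverse:
  assumes "\<pi> p \<noteq> x0"
  obtains U \<phi> V g where "chart \<A> U \<phi>" "p \<in> U" "open V" "\<pi> p \<in> V" "holo_map g V"
    "\<forall>q. \<pi> q \<in> V \<longrightarrow> q \<in> U \<and> g (\<pi> q) = \<phi> q"
proof -
  have "\<forall>p. \<pi> p \<noteq> x0 \<longrightarrow> (\<exists>U \<phi> V g. chart \<A> U \<phi> \<and> p \<in> U \<and> open V \<and> \<pi> p \<in> V \<and> holo_map g V \<and>
        (\<forall>q. \<pi> q \<in> V \<longrightarrow> q \<in> U \<and> g (\<pi> q) = \<phi> q))"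
    using res unfolding resolution_def by (elim conjE)
  then show thesis using assms that by blast
qed

lemma holo_pi: "holo_surf \<A> (\<lambda>q. \<pi> q $ i)"
  by (rule holo_surfI[OF surf]) (use res in \<open>fastforce simp: resolution_def holo_map_def o_def\<close>)

lemma continuous_pi: "continuous_on UNIV \<pi>"
  using holo_surf_continuous[OF surf holo_pi]
  by (auto simp: continuous_on_def intro!: vec_tendstoI)

lemma dense_meets: "open T \<Longrightarrow> p \<in> T \<Longrightarrow> \<exists>q\<in>T. \<pi> q \<noteq> x0"
proof -
  assume T: "open T" "p \<in> T"
  have "p \<in> closure (\<pi> -` (X - {x0}))" by (simp add: dense)
  then have "\<pi> -` (X - {x0}) \<inter> T \<noteq> {}" using T closure_iff_nhds_not_empty by blast
  then show ?thesis by blast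
qed

lemma compact_fibre: "compact (\<pi> -` {x0})"
  by (rule proper) (use x0 in auto)

text \<open>By properness, the part outside \<open>T\<close> of the preimage of a compact
  neighbourhood of \<open>x0\<close> is compact; its image misses \<open>x0\<close>, hence stays at
  a positive distance.\<close>

lemma fibre_nbhd:
  assumes T: "open T" "\<pi> -` {x0} \<subseteq> T"
  obtains r where "0 < r" "\<And>q. dist x0 (\<pi> q) < r \<Longrightarrow> q \<in> T"
proof -
  obtain R where R: "0 < R" "compact (X \<inter> cball x0 R)"
  proof -
    have "analytic_set X" using X by (simp add: normal_surface_def)
    then show thesis by (rule analytic_set_compact_ball[OF _ x0]) (use that in blast)
  qed
  have "compact (\<pi> -` (X \<inter> cball x0 R) - T)"
    by (rule compact_diff[OF proper[OF R(2)] T(1)]) auto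
  then have "compact (\<pi> ` (\<pi> -` (X \<inter> cball x0 R) - T))"
    by (intro compact_continuous_image continuous_on_subset[OF continuous_pi]) auto
  moreover have "x0 \<notin> \<pi> ` (\<pi> -` (X \<inter> cball x0 R) - T)" using T(2) by auto
  ultimately obtain d where d: "0 < d" "\<forall>y\<in>\<pi> ` (\<pi> -` (X \<inter> cball x0 R) - T). d \<le> dist x0 y"
    using separate_point_closed compact_imp_closed by metis
  show thesis
  proof (rule that[of "min d R"])
    fix q assume q: "dist x0 (\<pi> q) < min d R"
    show "q \<in> T"
    proof (rule ccontr)
      assume "q \<notin> T"
      then have "\<pi> q \<in> \<pi> ` (\<pi> -` (X \<inter> cball x0 R) - T)" using q pi_X[of q] by simp
      from bspec[OF d(2) this] show False using q by simp
    qed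
  qed (use d R in auto)
qed

text \<open>If the fibre were disconnected, the function equal to 1 near one piece and to 0 near the other
  would extend continuously to \<open>x0\<close> by normality. When \<open>x0\<close> is a regular point of \<open>X\<close> it is
  constant because a punctured ball is connected.\<close>

lemma connected_fibre: "connected (\<pi> -` {x0})"
proof (rule ccontr)
  assume "\<not> connected (\<pi> -` {x0})"
  then obtain A B where AB: "closed A" "closed B" "\<pi> -` {x0} \<subseteq> A \<union> B" "A \<inter> B \<inter> \<pi> -` {x0} = {}"
    "A \<inter> \<pi> -` {x0} \<noteq> {}" "B \<inter> \<pi> -` {x0} \<noteq> {}" unfolding connected_closed by blast
  have "compact (A \<inter> \<pi> -` {x0})" "compact (B \<inter> \<pi> -` {x0})"
    using AB(1,2) compact_fibre by (auto simp: closed_Int_compact)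
  moreover have "(A \<inter> \<pi> -` {x0}) \<inter> (B \<inter> \<pi> -` {x0}) = {}" using AB(4) by blast
  ultimately obtain S T where ST: "open S" "open T" "A \<inter> \<pi> -` {x0} \<subseteq> S" "B \<inter> \<pi> -` {x0} \<subseteq> T" "S \<inter> T = {}"
    by (rule t2_separate_compact)
  have "open (S \<union> T)" "\<pi> -` {x0} \<subseteq> S \<union> T" using ST AB(3) by blast+
  then obtain r where r: "0 < r" "\<And>q. dist x0 (\<pi> q) < r \<Longrightarrow> q \<in> S \<union> T" using fibre_nbhd by blast
  define W where "W = ball x0 r"
  \<comment> \<open>The indicator function of \<open>S\<close>, pushed down to \<open>X\<close>.
    Away from \<open>x0\<close> the map \<open>\<pi>\<close> is injective, so there it separates the
    images of \<open>S\<close> and \<open>T\<close>.\<close>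
  define f :: "complex ^ 'n \<Rightarrow> complex" where "f y = (if \<exists>p\<in>S. \<pi> p = y then 1 else 0)" for y
  have f_S: "f (\<pi> p) = 1" if "p \<in> S" for p using that by (auto simp: f_def)
  have f_T: "f (\<pi> p) = 0" if "p \<in> T" "\<pi> p \<noteq> x0" for p using that ST(5) pi_inj by (fastforce simp: f_def)
  \<comment> \<open>Off \<open>x0\<close> the map \<open>\<pi>\<close> has a local inverse, so
    \<open>f\<close> is locally constant there.\<close>
  have loc: "\<exists>V. open V \<and> y \<in> V \<and> V \<subseteq> W - {x0} \<and> (\<forall>y'\<in>X \<inter> V. f y' = f y)"
    if y: "y \<in> X" "y \<in> W" "y \<noteq> x0" for y
  proof -
    obtain p where p: "\<pi> p = y" using pi_surj y by blast
    obtain U \<phi> V g where g: "chart \<A> U \<phi>" "p \<in> U" "open V" "\<pi> p \<in> V" "holo_map g V"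
      "\<forall>q. \<pi> q \<in> V \<longrightarrow> q \<in> U \<and> g (\<pi> q) = \<phi> q"
      by (rule pi_inverse[of p]) (use p y(3) in simp)
    have "\<exists>N. open N \<and> p \<in> N \<and> (N = S \<or> N = T)" using r(2)[of p] p y(2) ST(1,2) by (auto simp: W_def)
    then obtain N where N: "open N" "p \<in> N" "N = S \<or> N = T" by blast
    define V' where "V' = (V \<inter> g -` (\<phi> ` (U \<inter> N))) \<inter> (W - {x0})"
    have "open (V \<inter> g -` (\<phi> ` (U \<inter> N)))"
      using continuous_open_preimage[OF holo_map_continuous_on[OF g(5)] g(3) chart_open_image[OF g(1) N(1)]] .
    moreover have "open (W - {x0})" by (simp add: W_def open_Diff)
    ultimately have "open V'" unfolding V'_def by (rule open_Int)
    moreover have "y \<in> V'" using g(2,4,6) p y N(2) by (auto simp: V'_def)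
    moreover have fN: "f (\<pi> q) = f y" if "q \<in> N" "\<pi> q \<noteq> x0" for q
      using N(3)
    proof
      assume "N = S"
      then show ?thesis using f_S[of q] f_S[of p] N(2) that(1) p by simp
    next
      assume "N = T"
      then show ?thesis using f_T[of q] f_T[of p] N(2) that p y(3) by simp
    qed
    have "f y' = f y" if y': "y' \<in> X \<inter> V'" for y'
    proof -
      obtain q where q: "\<pi> q = y'" using pi_surj[of y'] y' by (auto simp: V'_def)
      then have "q \<in> U" "\<phi> q \<in> \<phi> ` (U \<inter> N)" using g(6)[rule_format, of q] y' by (auto simp: V'_def)
      then have "q \<in> N" using inj_onD[OF chartD(3)[OF g(1)], of q] by blast
      then show ?thesis using fN q y' by (auto simp: V'_def)
    qed
    ultimately show ?thesis by (intro exI[of _ V']) (auto simp: V'_def)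
  qed
  \<comment> \<open>Both values occur arbitrarily near \<open>x0\<close>, since the preimage of
    \<open>X - {x0}\<close> is dense.\<close>
  have near: "\<exists>y\<in>X \<inter> V. y \<noteq> x0 \<and> y \<in> W \<and> f y = 1" "\<exists>y\<in>X \<inter> V. y \<noteq> x0 \<and> y \<in> W \<and> f y = 0"
    if V: "open V" "x0 \<in> V" for V
  proof -
    have o: "open (\<pi> -` (V \<inter> W))"
      by (rule open_vimage[OF _ continuous_pi]) (use V in \<open>auto simp: W_def\<close>)
    have w0: "x0 \<in> V \<inter> W" using V r(1) by (simp add: W_def)
    obtain p where "p \<in> S" "\<pi> p = x0" using AB(5) ST(3) by blast
    then obtain q where "q \<in> S \<inter> \<pi> -` (V \<inter> W)" "\<pi> q \<noteq> x0"
      using dense_meets[of "S \<inter> \<pi> -` (V \<inter> W)" p] ST(1) o w0 by auto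
    then show "\<exists>y\<in>X \<inter> V. y \<noteq> x0 \<and> y \<in> W \<and> f y = 1" using f_S pi_X by (intro bexI[of _ "\<pi> q"]) auto
    obtain p where "p \<in> T" "\<pi> p = x0" using AB(6) ST(4) by blast
    then obtain q where "q \<in> T \<inter> \<pi> -` (V \<inter> W)" "\<pi> q \<noteq> x0"
      using dense_meets[of "T \<inter> \<pi> -` (V \<inter> W)" p] ST(2) o w0 by auto
    then show "\<exists>y\<in>X \<inter> V. y \<noteq> x0 \<and> y \<in> W \<and> f y = 0" using f_T pi_X by (intro bexI[of _ "\<pi> q"]) auto
  qed
  show False
  proof (cases "x0 \<in> reg X")
    case True
    then obtain U D h g where h: "open U" "x0 \<in> U" "open D" "holo_map h D" "holo_map g U"
      "h ` D = X \<inter> U" "\<forall>w\<in>(D :: (complex ^ 2) set). g (h w) = w" unfolding reg_def by blast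
    obtain w0 where w0: "w0 \<in> D" "h w0 = x0" 
    proof -
      have "x0 \<in> h ` D" using h(2,6) x0 by simp
      then show thesis using that by (elim imageE) simp
    qed
    have "open (D \<inter> h -` W)"
      using continuous_open_preimage[OF holo_map_continuous_on[OF h(4)] h(3)] by (simp add: W_def)
    moreover have "w0 \<in> D \<inter> h -` W" using w0 r(1) by (simp add: W_def)
    ultimately obtain e where e: "0 < e" "ball w0 e \<subseteq> D \<inter> h -` W" using openE by blast
    have hX: "h w \<in> X" if "w \<in> D" for w using imageI[OF that, of h] h(6) by simp
    have conn: "connected (ball w0 e - {w0})"
      by (rule connected_open_delete) (simp_all add: DIM_complex)
    have in0: "h w \<noteq> x0" if "w \<in> ball w0 e - {w0}" for w
      using h(7) bspec[OF h(7) w0(1)] w0 e(2) that by auto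
    have cst: "f (h a) = f (h b)" if ab: "a \<in> ball w0 e - {w0}" "b \<in> ball w0 e - {w0}" for a b
    proof (rule connected_local_const[OF conn ab])
      show "\<forall>a\<in>ball w0 e - {w0}. \<forall>\<^sub>F b in at a within ball w0 e - {w0}. f (h a) = f (h b)"
      proof
        fix a assume a: "a \<in> ball w0 e - {w0}"
        then have "h a \<in> X" "h a \<in> W" using e(2) hX by auto
        then obtain V where V: "open V" "h a \<in> V" "\<forall>y'\<in>X \<inter> V. f y' = f (h a)" using loc in0[OF a] by blast
        have "open (D \<inter> h -` V)" by (rule continuous_open_preimage[OF holo_map_continuous_on[OF h(4)] h(3) V(1)])
        then have "\<forall>\<^sub>F b in nhds a. b \<in> D \<inter> h -` V" using a e(2) V(2) by (intro eventually_nhds_in_open) auto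
        then have "\<forall>\<^sub>F b in at a within ball w0 e - {w0}. b \<in> D \<inter> h -` V" by (rule eventually_at_nhds)
        then show "\<forall>\<^sub>F b in at a within ball w0 e - {w0}. f (h a) = f (h b)"
          by eventually_elim (use V(3) hX in auto)
      qed
    qed
    define V where "V = U \<inter> g -` ball w0 e"
    have "open V" unfolding V_def by (rule continuous_open_preimage[OF holo_map_continuous_on[OF h(5)] h(1)]) simp
    moreover have "x0 \<in> V" using h(2) bspec[OF h(7) w0(1)] w0(2) e(1) by (simp add: V_def)
    ultimately obtain y z where yz: "y \<in> X \<inter> V" "y \<noteq> x0" "f y = 1" "z \<in> X \<inter> V" "z \<noteq> x0" "f z = 0" using near by blast
    have "\<exists>w\<in>ball w0 e - {w0}. h w = y" if "y \<in> X \<inter> V" "y \<noteq> x0" for y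
    proof -
      have "y \<in> h ` D" using h(6) that(1) by (auto simp: V_def)
      then obtain w where w: "w \<in> D" "h w = y" by blast
      then have "w \<in> ball w0 e" using that(1) h(7) by (auto simp: V_def)
      then show ?thesis using w that(2) w0(2) by blast
    qed
    then obtain a b where "a \<in> ball w0 e - {w0}" "h a = y" "b \<in> ball w0 e - {w0}" "h b = z" using yz by blast
    then show False using cst[of a b] yz by simp
  next
    case False
    have rX: "reg X \<subseteq> X" unfolding reg_def by (rule Collect_restrict)
    \<comment> \<open>Here \<open>x0\<close> is not in \<open>reg X\<close>, so \<open>f\<close> is
      locally constant on the regular points, and normality extends it.\<close>
    have "holo_on_set f (reg X \<inter> W)"
      unfolding holo_on_set_def
    proof
      fix y assume y: "y \<in> reg X \<inter> W"
      then have "y \<in> X" "y \<noteq> x0" using False rX by blast+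
      then obtain V where V: "open V" "y \<in> V" "\<forall>y'\<in>X \<inter> V. f y' = f y" using loc y by blast
      have "holo_fun (\<lambda>z. f y) V" unfolding holo_fun_def by (auto intro!: exI[of _ "\<lambda>v. 0"])
      then show "\<exists>V h. open V \<and> y \<in> V \<and> holo_fun h V \<and> (\<forall>z\<in>reg X \<inter> W \<inter> V. f z = h z)"
        using V by (intro exI[of _ V] exI[of _ "\<lambda>z. f y"]) (use rX in auto)
    qed
    moreover have "bounded (f ` (reg X \<inter> W))"
      by (rule bounded_subset[of "{0, 1}"]) (auto simp: f_def)
    moreover have "open W" by (simp add: W_def)
    ultimately obtain Q where Q: "holo_on_set Q (X \<inter> W)" "\<forall>y\<in>reg X \<inter> W. Q y = f y"
      using X unfolding normal_surface_def by blast
    have "x0 \<in> X \<inter> W" using x0 r(1) by (simp add: W_def)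
    then obtain V h where V: "open V" "x0 \<in> V" "holo_fun h V" "\<forall>y\<in>X \<inter> W \<inter> V. Q y = h y"
      using Q(1) unfolding holo_on_set_def by blast
    define V0 where "V0 = V \<inter> h -` ball (h x0) (1/2)"
    have V0: "open V0" "x0 \<in> V0"
      unfolding V0_def using V(2) by (auto intro!: continuous_open_preimage[OF holo_fun_continuous_on[OF V(3)] V(1)])
    have "dist (h x0) (f y) < 1/2" if y: "y \<in> X \<inter> V0" "y \<noteq> x0" "y \<in> W" for y
    proof -
      obtain N where N: "open N" "y \<in> N" "N \<subseteq> W - {x0}" "\<forall>y'\<in>X \<inter> N. f y' = f y" using loc y by blast
      have "y \<in> closure (reg X)" using X y unfolding normal_surface_def by blast
      then obtain y' where y': "y' \<in> reg X" "y' \<in> N \<inter> V0"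
      proof -
        have "open (N \<inter> V0)" "y \<in> N \<inter> V0" using N(1,2) V0(1) y(1) by auto
        then have "reg X \<inter> (N \<inter> V0) \<noteq> {}" using \<open>y \<in> closure (reg X)\<close> closure_iff_nhds_not_empty by blast
        then show thesis using that by blast
      qed
      then have "y' \<in> X" "y' \<in> W" using N(3) rX by auto
      then have "f y' = f y" "Q y' = f y'" "Q y' = h y'"
        using y' bspec[OF N(4), of y'] bspec[OF Q(2), of y'] bspec[OF V(4), of y'] unfolding V0_def by blast+
      then have "f y = h y'" by simp
      then show ?thesis using y' by (simp add: V0_def)
    qed
    then have "dist (h x0) 1 < 1/2" "dist (h x0) 0 < 1/2" using near[OF V0] by fastforce+
    \<comment> \<open>The extension would have at \<open>x0\<close> a value at distance less than
      \<open>1/2\<close> from both 0 and 1.\<close>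
    then show False using dist_triangle[of 1 "0::complex" "h x0"] by (simp add: dist_commute)
  qed
qed

text \<open>The identity theorem on a bidisc about \<open>a\<close>. It makes the set of points with
  vanishing germ closed; openness is immediate from the notion of germ.\<close>

lemma zero_germ_local:
  assumes f: "holo_surf \<A> f"
  shows "\<forall>\<^sub>F b in nhds a. (\<forall>\<^sub>F q in nhds b. f q = 0) \<longrightarrow> (\<forall>\<^sub>F q in nhds a. f q = 0)"
proof -
  obtain U and \<phi> :: "'m \<Rightarrow> complex ^ 2" where U: "a \<in> U" "chart \<A> U \<phi>" using surface_cover[OF surf] by blast
  note c = U(2)
  have "holo_fun (\<lambda>z. f (inv_into U \<phi> z)) (\<phi> ` (U \<inter> UNIV))" using f c by (simp add: holo_surf_def)
  then obtain r where r: "0 < r"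
    "hol2 (\<lambda>x y. f (inv_into U \<phi> (vector [x, y]))) (ball (\<phi> a $ 1) r) (ball (\<phi> a $ 2) r)"
    by (rule chart_hol2[OF _ c open_UNIV U(1) UNIV_I])
  have box: "\<forall>\<^sub>F q in nhds a. q \<in> U \<and> \<phi> q $ 1 \<in> ball (\<phi> a $ 1) r \<and> \<phi> q $ 2 \<in> ball (\<phi> a $ 2) r"
    using topological_tendstoD[OF chart_tendsto[OF c U(1), of 1], of "ball (\<phi> a $ 1) r"]
      topological_tendstoD[OF chart_tendsto[OF c U(1), of 2], of "ball (\<phi> a $ 2) r"] r(1)
    by (auto intro!: eventually_conj chart_eventually[OF c U(1)])
  then show ?thesis
  proof eventually_elim
    case (elim b)
    show ?case
    proof
      assume "\<forall>\<^sub>F q in nhds b. f q = 0"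
      then obtain N where N: "open N" "b \<in> N" "\<And>q. q \<in> N \<Longrightarrow> f q = 0" unfolding eventually_nhds by blast
      obtain s where s: "0 < s" "\<And>x y. x \<in> ball (\<phi> b $ 1) s \<Longrightarrow> y \<in> ball (\<phi> b $ 2) s \<Longrightarrow> vector [x, y] \<in> \<phi> ` (U \<inter> N)"
        by (rule chart_box[OF c N(1) _ N(2)]) (use elim in blast)+
      have "\<exists>P. open P \<and> \<phi> b $ i \<in> P \<and> P \<subseteq> ball (\<phi> a $ i) r \<and> P \<subseteq> ball (\<phi> b $ i) s" for i
        using elim s(1) exhaust_2[of i] by (intro exI[of _ "ball (\<phi> a $ i) r \<inter> ball (\<phi> b $ i) s"]) auto
      then obtain P where P: "\<And>i. open (P i)" "\<And>i. \<phi> b $ i \<in> P i" "\<And>i. P i \<subseteq> ball (\<phi> a $ i) r" "\<And>i. P i \<subseteq> ball (\<phi> b $ i) s"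
        by metis
      have z: "f (inv_into U \<phi> (vector [x, y])) = 0" if "x \<in> P 1" "y \<in> P 2" for x y
      proof -
        have "vector [x, y] \<in> \<phi> ` (U \<inter> N)" using s(2) P(4) that by blast
        then show ?thesis using chartD(6)[OF c] N(3) by auto
      qed
      have "f (inv_into U \<phi> (vector [x, y])) = 0" if "x \<in> ball (\<phi> a $ 1) r" "y \<in> ball (\<phi> a $ 2) r" for x y
        by (rule hol2_identity[OF r(2) open_ball connected_ball open_ball connected_ball P(1,3,2) P(1,3,2) z that])
      then show "\<forall>\<^sub>F q in nhds a. f q = 0"
        using box by (auto elim!: eventually_mono) (metis chartD(6)[OF c] vector_2_eta)
    qed
  qed
qed

lemma holo_coordinate: "holo_surf \<A> (\<lambda>q. \<pi> q $ i - x0 $ i)"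
proof -
  have "holo_fun (\<lambda>z. \<pi> (inv_into U \<phi> z) $ i - x0 $ i) (\<phi> ` U)" if "chart \<A> U \<phi>" for U \<phi>
  proof -
    have "holo_fun (\<lambda>z. \<pi> (inv_into U \<phi> z) $ i) (\<phi> ` U)" using holo_pi that by (simp add: holo_surf_def)
    then show ?thesis unfolding holo_fun_def by (fastforce intro: derivative_eq_intros)
  qed
  then show ?thesis by (simp add: holo_surf_def)
qed

text \<open>Vanishing of the germ is locally constant along the connected fibre, so a coordinate
  whose germ is non-zero at a single point serves at all of them. If all germs vanished at a point,
  a non-empty open set would be mapped to \<open>x0\<close>.\<close>

lemma coordinate_nonzero:
  assumes "\<pi> -` {x0} \<noteq> {}"
  obtains i where "\<And>p. \<pi> p = x0 \<Longrightarrow> \<not> (\<forall>\<^sub>F q in nhds p. \<pi> q $ i - x0 $ i = 0)"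
proof -
  define Z where "Z i p \<longleftrightarrow> (\<forall>\<^sub>F q in nhds p. \<pi> q $ i - x0 $ i = 0)" for i p
  have cst: "Z i p = Z i p'" if "\<pi> p = x0" "\<pi> p' = x0" for i p p'
  proof (rule connected_local_const[OF connected_fibre])
    show "\<forall>a\<in>\<pi> -` {x0}. \<forall>\<^sub>F b in at a within \<pi> -` {x0}. Z i a = Z i b"
    proof
      fix a
      have "\<forall>\<^sub>F b in nhds a. Z i b \<longrightarrow> Z i a" using zero_germ_local[OF holo_coordinate] by (simp add: Z_def)
      moreover have "\<forall>\<^sub>F b in nhds a. Z i a \<longrightarrow> Z i b"
      proof (cases "Z i a")
        case True
        then have "\<forall>\<^sub>F b in nhds a. \<forall>\<^sub>F q in nhds b. \<pi> q $ i - x0 $ i = 0" by (simp add: Z_def eventually_eventually)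
        then show ?thesis by eventually_elim (simp add: Z_def)
      qed simp
      ultimately have "\<forall>\<^sub>F b in nhds a. Z i a = Z i b" by eventually_elim blast
      then show "\<forall>\<^sub>F b in at a within \<pi> -` {x0}. Z i a = Z i b" by (rule eventually_at_nhds)
    qed
  qed (use that in auto)
  obtain p where p: "\<pi> p = x0" using assms by blast
  have "\<exists>i. \<not> Z i p"
  proof (rule ccontr)
    assume "\<not> (\<exists>i. \<not> Z i p)"
    then have "\<forall>\<^sub>F q in nhds p. \<forall>i. \<pi> q $ i - x0 $ i = 0"
      by (intro eventually_all_finite) (simp add: Z_def)
    then obtain N where "open N" "p \<in> N" "\<And>q. q \<in> N \<Longrightarrow> \<pi> q = x0"
      unfolding eventually_nhds by (auto simp: vec_eq_iff)
    then show False using dense_meets by blast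
  qed
  then obtain i where i: "\<not> Z i p" ..
  show thesis
  proof (rule that[of i])
    fix p' assume "\<pi> p' = x0"
    then have "\<not> Z i p'" using cst[OF p] i by blast
    then show "\<not> (\<forall>\<^sub>F q in nhds p'. \<pi> q $ i - x0 $ i = 0)" by (simp add: Z_def)
  qed
qed

end

section \<open>Level curves of a coordinate function near the fibre\<close>

lemma hol2_sum: "(\<And>j. j \<in> J \<Longrightarrow> hol2 (F j) A B) \<Longrightarrow> hol2 (\<lambda>x y. \<Sum>j\<in>J. F j x y) A B"
  by (auto simp: hol2_def case_prod_unfold intro!: continuous_intros holomorphic_intros)

lemma hol2_exp: "hol2 F A B \<Longrightarrow> hol2 (\<lambda>x y. exp (F x y)) A B"
  by (auto simp: hol2_def case_prod_unfold intro!: continuous_intros holomorphic_on_exp')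

lemma hol2_shift:
  assumes F: "hol2 F (ball a r) (ball b r)"
  shows "hol2 (\<lambda>x y. F (a + x) (b + y)) (ball 0 r) (ball 0 r)"
proof -
  have t: "(+) c ` ball 0 r \<subseteq> ball c r" for c :: complex by (auto simp: dist_norm)
  have h: "(\<lambda>x. g (c + x)) holomorphic_on ball 0 r" if "g holomorphic_on ball c r" for g and c :: complex
  proof -
    have "(+) c holomorphic_on ball 0 r" by (intro holomorphic_intros)
    from holomorphic_on_compose_gen[OF this that t] show ?thesis by (simp add: o_def)
  qed
  have "continuous_on (ball 0 r \<times> ball 0 r) (\<lambda>p. F (a + fst p) (b + snd p))"
    by (rule continuous_on_Times_compose[of "ball a r" "ball b r" F])
      (use F t in \<open>auto intro!: continuous_intros simp: hol2_def dist_norm\<close>)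
  moreover have "(\<lambda>x. F (a + x) (b + y)) holomorphic_on ball 0 r" if "y \<in> ball 0 r" for y
    using F that by (intro h[of "\<lambda>x. F x (b + y)"]) (simp add: hol2_def dist_norm)
  moreover have "(\<lambda>y. F (a + x) (b + y)) holomorphic_on ball 0 r" if "x \<in> ball 0 r" for x
    using F that by (intro h) (simp add: hol2_def dist_norm)
  ultimately show ?thesis unfolding hol2_def by (simp add: case_prod_unfold)
qed

context surface_resolution
begin

lemma hol2_chart:
  fixes \<phi> :: "'m \<Rightarrow> complex ^ 2"
  assumes f: "holo_surf \<A> f" and c: "chart \<A> U \<phi>"
    and sub: "\<And>x y. x \<in> ball a r \<Longrightarrow> y \<in> ball b r \<Longrightarrow> vector [x, y] \<in> \<phi> ` U"
  shows "hol2 (\<lambda>x y. f (inv_into U \<phi> (vector [a + x, b + y]))) (ball 0 r) (ball 0 r)"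
proof -
  have h: "holo_fun (\<lambda>z. f (inv_into U \<phi> z)) (\<phi> ` U)" using f c by (simp add: holo_surf_def)
  show ?thesis by (rule hol2_shift) (rule holo_fun_hol2[OF h sub])
qed

text \<open>If a coordinate function vanished only on the fibre near the fibre, then its level set through
  a nearby point would contain a compact part \<open>Z\<close>. At the point of \<open>Z\<close> which is farthest
  from \<open>x0\<close> the maximum principle fails.\<close>

lemma coordinate_zeros_leave_fibre:
  assumes ne: "\<pi> -` {x0} \<noteq> {}"
  shows "\<exists>p. \<pi> p = x0 \<and> \<not> (\<forall>\<^sub>F q in nhds p. \<pi> q \<noteq> x0 \<longrightarrow> \<pi> q $ i - x0 $ i \<noteq> 0)"
proof (rule ccontr)
  assume "\<not> ?thesis"
  then have nz: "\<And>p. \<pi> p = x0 \<Longrightarrow> \<forall>\<^sub>F q in nhds p. \<pi> q \<noteq> x0 \<longrightarrow> \<pi> q $ i - x0 $ i \<noteq> 0" by blast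
  define f where "f q = \<pi> q $ i - x0 $ i" for q
  have hf: "holo_surf \<A> f" unfolding f_def[abs_def] by (rule holo_coordinate)
  have cf: "continuous_on UNIV f" by (rule holo_surf_continuous[OF surf hf])
  define T where "T = interior {q. \<pi> q \<noteq> x0 \<longrightarrow> f q \<noteq> 0}"
  have "\<pi> -` {x0} \<subseteq> T"
  proof
    fix p assume "p \<in> \<pi> -` {x0}"
    then obtain N where "open N" "p \<in> N" "\<forall>q\<in>N. \<pi> q \<noteq> x0 \<longrightarrow> \<pi> q $ i - x0 $ i \<noteq> 0"
      using nz[of p] unfolding eventually_nhds by auto
    then show "p \<in> T" unfolding T_def f_def by (intro interiorI[of N]) auto
  qed
  then obtain r' where r': "0 < r'" "\<And>q. dist x0 (\<pi> q) < r' \<Longrightarrow> q \<in> T"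
    using fibre_nbhd[of T] unfolding T_def by blast
  obtain R where R: "0 < R" "\<And>r. r \<le> R \<Longrightarrow> compact (X \<inter> cball x0 r)"
  proof -
    have "analytic_set X" using X by (simp add: normal_surface_def)
    then show thesis by (rule analytic_set_compact_ball[OF _ x0]) (use that in blast)
  qed
  define r where "r = min R r' / 2"
  have r: "0 < r" "r < r'" "r \<le> R" using r'(1) R(1) by (auto simp: r_def)
  define K where "K = \<pi> -` (X \<inter> cball x0 r)"
  have K: "compact K" unfolding K_def by (rule proper[OF R(2)[OF r(3)]]) simp
  have inK: "q \<in> K \<longleftrightarrow> dist x0 (\<pi> q) \<le> r" for q using pi_X by (simp add: K_def)
  have cd: "continuous_on UNIV (\<lambda>q. dist x0 (\<pi> q))" by (intro continuous_intros continuous_pi)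
  have nzK: "f q \<noteq> 0" if "dist x0 (\<pi> q) \<le> r" "\<pi> q \<noteq> x0" for q
    using r'(2)[of q] that r(2) interior_subset unfolding T_def by fastforce
  have "compact (K \<inter> (\<lambda>q. dist x0 (\<pi> q)) -` {r})"
    by (intro compact_Int_closed K closed_vimage cd) simp
  then have "compact (f ` (K \<inter> (\<lambda>q. dist x0 (\<pi> q)) -` {r}))"
    by (intro compact_continuous_image continuous_on_subset[OF cf]) auto
  moreover have "0 \<notin> f ` (K \<inter> (\<lambda>q. dist x0 (\<pi> q)) -` {r})" using nzK r(1) by fastforce
  \<comment> \<open>Over the sphere of radius \<open>r\<close> the modulus of \<open>f\<close> is at
    least \<open>\<delta>\<close>, so a level set of \<open>f\<close> in \<open>K\<close> for a
    smaller value does not reach the boundary.\<close>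
  ultimately obtain \<delta> where \<delta>: "0 < \<delta>" "\<forall>w\<in>f ` (K \<inter> (\<lambda>q. dist x0 (\<pi> q)) -` {r}). \<delta> \<le> dist 0 w"
    using separate_point_closed[OF compact_imp_closed] by metis
  obtain p where p: "\<pi> p = x0" using ne by blast
  have "open (f -` ball 0 \<delta> \<inter> (\<lambda>q. dist x0 (\<pi> q)) -` {..<r})"
    by (intro open_Int open_vimage cf cd) auto
  moreover have "p \<in> f -` ball 0 \<delta> \<inter> (\<lambda>q. dist x0 (\<pi> q)) -` {..<r}"
    using p r(1) \<delta>(1) by (simp add: f_def)
  ultimately obtain q0 where q0: "norm (f q0) < \<delta>" "dist x0 (\<pi> q0) < r" "\<pi> q0 \<noteq> x0"
    using dense_meets by fastforce
  define c where "c = f q0"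
  define Z where "Z = K \<inter> f -` {c}"
  have "compact Z" unfolding Z_def by (intro compact_Int_closed K closed_vimage cf) simp
  moreover have "q0 \<in> Z" using q0(2) by (simp add: Z_def c_def inK)
  ultimately obtain q where q: "q \<in> Z" "\<And>z. z \<in> Z \<Longrightarrow> dist x0 (\<pi> z) \<le> dist x0 (\<pi> q)"
    using continuous_attains_sup[of Z "\<lambda>q. dist x0 (\<pi> q)"] continuous_on_subset[OF cd] by blast
  have fq: "f q = c" and c0: "c \<noteq> 0" using q(1) nzK[of q0] q0 by (auto simp: Z_def c_def)
  then have q_ne: "\<pi> q \<noteq> x0" by (auto simp: f_def)
  have q_lt: "dist x0 (\<pi> q) < r"
  proof (rule ccontr)
    assume "\<not> dist x0 (\<pi> q) < r"
    then have "q \<in> K \<inter> (\<lambda>q. dist x0 (\<pi> q)) -` {r}" using q(1) by (auto simp: Z_def inK)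
    then have "f q \<in> f ` (K \<inter> (\<lambda>q. dist x0 (\<pi> q)) -` {r})" by (rule imageI)
    from bspec[OF \<delta>(2) this] show False using fq q0(1) by (simp add: c_def)
  qed
  define v where "v = \<pi> q - x0"
  have v0: "v \<noteq> 0" using q_ne by (simp add: v_def)
  \<comment> \<open>The pullback of a complex affine function on the ambient space, normalized by
    \<open>l q = 1\<close>. By Cauchy-Schwarz its real part is at most 1 on \<open>Z\<close>, and
    equality forces the image \<open>\<pi> q\<close>.\<close>
  define l where "l z = (\<Sum>j\<in>UNIV. (\<pi> z $ j - x0 $ j) * (cnj (v $ j) / of_real (norm v ^ 2)))" for z
  have Re_l: "Re (l z) = inner (\<pi> z - x0) v / norm v ^ 2" for z
  proof -
    have "Re (l z) = (\<Sum>j\<in>UNIV. inner ((\<pi> z - x0) $ j) (v $ j) / norm v ^ 2)"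
      unfolding l_def by (simp add: inner_complex_def add_divide_distrib)
    then show ?thesis by (simp add: inner_vec_def sum_divide_distrib)
  qed
  have le: "norm (\<pi> z - x0) \<le> norm v" if "z \<in> Z" for z
    using q(2)[OF that] by (simp add: v_def dist_norm norm_minus_commute)
  have Re_le: "Re (l z) \<le> 1" if "z \<in> Z" for z
  proof -
    have "inner (\<pi> z - x0) v \<le> norm (\<pi> z - x0) * norm v" by (rule norm_cauchy_schwarz)
    also have "\<dots> \<le> norm v ^ 2" using le[OF that] by (simp add: power2_eq_square mult_right_mono)
    finally show ?thesis using v0 by (simp add: Re_l)
  qed
  have peak: "\<pi> z = \<pi> q" if z: "z \<in> Z" "Re (l z) = 1" for z
  proof -
    have "inner (\<pi> z - x0) v = norm v ^ 2" using z(2) v0 by (simp add: Re_l)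
    then have "norm (\<pi> z - x0 - v) ^ 2 = norm (\<pi> z - x0) ^ 2 - norm v ^ 2"
      by (simp add: power2_norm_eq_inner inner_diff_left inner_diff_right inner_commute)
    also have "\<dots> \<le> 0" using le[OF z(1)] by (simp add: power_mono)
    finally show ?thesis by (simp add: v_def)
  qed
  obtain U and \<phi> :: "'m \<Rightarrow> complex ^ 2" where U: "q \<in> U" "chart \<A> U \<phi>" using surface_cover[OF surf] by blast
  have oB: "open ((\<lambda>q. dist x0 (\<pi> q)) -` {..<r})" by (rule open_vimage[OF _ cd]) simp
  obtain s where s: "0 < s" "\<And>x y. x \<in> ball (\<phi> q $ 1) s \<Longrightarrow> y \<in> ball (\<phi> q $ 2) s \<Longrightarrow>
      vector [x, y] \<in> \<phi> ` (U \<inter> (\<lambda>q. dist x0 (\<pi> q)) -` {..<r})"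
    by (rule chart_box[OF U(2) oB U(1)]) (use q_lt in auto)
  define P where "P x y = inv_into U \<phi> (vector [\<phi> q $ 1 + x, \<phi> q $ 2 + y])" for x y
  have P: "dist x0 (\<pi> (P x y)) < r" "\<phi> (P x y) = vector [\<phi> q $ 1 + x, \<phi> q $ 2 + y]" if "norm x < s" "norm y < s" for x y
  proof -
    have "vector [\<phi> q $ 1 + x, \<phi> q $ 2 + y] \<in> \<phi> ` (U \<inter> (\<lambda>q. dist x0 (\<pi> q)) -` {..<r})"
      using that by (intro s(2)) (auto simp: dist_norm)
    then obtain z where z: "z \<in> U" "dist x0 (\<pi> z) < r" "vector [\<phi> q $ 1 + x, \<phi> q $ 2 + y] = \<phi> z" by auto
    then have "P x y = z" using chartD(6)[OF U(2)] by (simp add: P_def)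
    then show "dist x0 (\<pi> (P x y)) < r" "\<phi> (P x y) = vector [\<phi> q $ 1 + x, \<phi> q $ 2 + y]" using z by simp_all
  qed
  have P0: "P 0 0 = q" using chartD(6)[OF U(2,1)] by (simp add: P_def vector_2_eta)
  have sub: "vector [x, y] \<in> \<phi> ` U" if "x \<in> ball (\<phi> q $ 1) s" "y \<in> ball (\<phi> q $ 2) s" for x y
    using s(2)[OF that] by blast
  have h2: "hol2 (\<lambda>x y. g (P x y)) (ball 0 s) (ball 0 s)" if "holo_surf \<A> g" for g
    unfolding P_def by (rule hol2_chart[OF that U(2)], erule (1) sub)
  have inZ: "P x y \<in> Z" if "norm x < s" "norm y < s" "f (P x y) - c = 0" for x y
    using P(1)[OF that(1,2)] that(3) by (simp add: Z_def inK)
  have lq: "l q = 1"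
  proof -
    have "l q = (\<Sum>j\<in>UNIV. of_real (inner (v $ j) (v $ j)) / of_real (norm v ^ 2))"
      unfolding l_def v_def[symmetric] by (intro sum.cong refl)
        (auto simp: v_def[symmetric] vector_minus_component[symmetric] complex_eq_iff inner_complex_def
          simp del: vector_minus_component)
    also have "\<dots> = of_real (inner v v) / of_real (norm v ^ 2)"
      by (simp add: inner_vec_def sum_divide_distrib)
    finally show ?thesis using v0 by (simp add: power2_norm_eq_inner)
  qed
  \<comment> \<open>The exponential turns the bound on the real part into the bound 1 on a modulus.
    On the level curve of \<open>f\<close> through \<open>q\<close> the maximum principle then
    yields a second point with the same image under \<open>\<pi>\<close>.\<close>
  have "\<exists>x y. norm x < s \<and> norm y < s \<and> (x, y) \<noteq> (0, 0) \<and> f (P x y) - c = 0 \<and> exp (l (P x y) - 1) = 1"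
  proof (rule curve_max_principle)
    show "hol2 (\<lambda>x y. f (P x y) - c) (ball 0 s) (ball 0 s)" by (intro hol2_diff h2 hf hol2_const)
    show "hol2 (\<lambda>x y. exp (l (P x y) - 1)) (ball 0 s) (ball 0 s)"
      unfolding l_def by (intro hol2_exp hol2_diff hol2_sum hol2_mult hol2_const h2 holo_pi)
    show "f (P 0 0) - c = 0" by (simp add: P0 fq)
    show "exp (l (P 0 0) - 1) = 1" by (simp add: P0 lq)
    fix x y assume "norm x < s" "norm y < s" "f (P x y) - c = 0"
    then show "norm (exp (l (P x y) - 1)) \<le> 1" using Re_le[OF inZ] by simp
  qed (rule s(1))
  then obtain x y where xy: "norm x < s" "norm y < s" "(x, y) \<noteq> (0, 0)" "f (P x y) - c = 0" "exp (l (P x y) - 1) = 1"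
    by blast
  have "norm (exp (l (P x y) - 1)) = 1" using xy(5) by simp
  then have "Re (l (P x y)) = 1" by simp
  then have "P x y = q" using peak[OF inZ[OF xy(1,2,4)]] pi_inj q_ne by metis
  then have "vector [\<phi> q $ 1 + x, \<phi> q $ 2 + y] = \<phi> q" using P(2)[OF xy(1,2)] by simp
  then have "\<phi> q $ 1 + x = \<phi> q $ 1" "\<phi> q $ 2 + y = \<phi> q $ 2" by (metis vector_2(1), metis vector_2(2))
  then show False using xy(3) by simp
qed

text \<open>The coordinate comes from \<open>coordinate_nonzero\<close>; equality on every component
  would contradict \<open>coordinate_zeros_leave_fibre\<close>.\<close>

theorem exceptional_weights:
  fixes self :: "'m set \<Rightarrow> int"
  assumes ex: "exceptional_components \<A> \<pi> x0 \<E>" and ne: "\<E> \<noteq> {}"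
    and si: "\<And>E. E \<in> \<E> \<Longrightarrow> self_intersection \<A> E (self E)"
    and emb: "embedded_resolution \<A> \<pi> \<E> \<F>" and fin: "finite \<F>"
  obtains m :: "'m set \<Rightarrow> nat" where "\<And>E. E \<in> \<E> \<Longrightarrow> 0 < m E"
    "\<And>E. E \<in> \<E> \<Longrightarrow> int (m E) * self E + (\<Sum>E'\<in>\<E> - {E}. int (m E') * int (card (E \<inter> E'))) \<le> 0"
    "\<exists>E\<in>\<E>. int (m E) * self E + (\<Sum>E'\<in>\<E> - {E}. int (m E') * int (card (E \<inter> E'))) \<noteq> 0"
    "\<And>E E'. E \<in> \<E> \<Longrightarrow> E' \<in> \<E> \<Longrightarrow> E \<noteq> E' \<Longrightarrow> finite (E \<inter> E')"
proof -
  have E: "finite \<E>" "\<And>E. E \<in> \<E> \<Longrightarrow> smooth_curve \<A> E" "\<Union>\<E> = \<pi> -` {x0}"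
    using ex ne unfolding exceptional_components_def by auto
  have sub: "E \<subseteq> \<pi> -` {x0}" if "E \<in> \<E>" for E using E(3) that by blast
  have ne': "\<pi> -` {x0} \<noteq> {}" using E(2,3) ne unfolding smooth_curve_def by blast
  obtain i where i: "\<And>p. \<pi> p = x0 \<Longrightarrow> \<not> (\<forall>\<^sub>F q in nhds p. \<pi> q $ i - x0 $ i = 0)"
    using coordinate_nonzero[OF ne'] by blast
  have cp: "compact E" if "E \<in> \<E>" for E
  proof -
    have "closed E" using E(2)[OF that] by (simp add: smooth_curve_def)
    then have "compact (E \<inter> \<pi> -` {x0})" by (rule closed_Int_compact[OF _ compact_fibre])
    then show ?thesis using sub[OF that] by (simp add: Int_absorb2)
  qed
  have two: "card {E \<in> \<E>. p \<in> E} \<le> 2" for p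
  proof -
    have "card ((Inl :: 'm set \<Rightarrow> ('m, 'n) comp) ` {E \<in> \<E>. p \<in> E}) \<le> card {C \<in> comps \<E> \<F>. p \<in> support \<A> \<pi> C}"
      by (rule card_mono) (use E(1) fin in \<open>auto simp: comps_def support_def\<close>)
    also have "\<dots> \<le> 2" using emb by (simp add: embedded_resolution_def)
    finally show ?thesis by (simp add: card_image)
  qed
  have cross: "\<exists>U \<phi>. adapted \<A> E U \<phi> \<and> p \<in> U \<and> E' \<inter> U = {q \<in> U. \<phi> q $ 2 = 0}"
    if "E \<in> \<E>" "E' \<in> \<E>" "E \<noteq> E'" "p \<in> E" "p \<in> E'" for E E' p
  proof -
    have "\<forall>E\<in>\<E>. \<forall>E'\<in>\<E>. E \<noteq> E' \<longrightarrow> (\<forall>p\<in>E \<inter> E'. \<exists>U \<phi>. adapted \<A> E U \<phi> \<and> p \<in> U \<and>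
        E' \<inter> U = {q\<in>U. \<phi> q $ 2 = 0})"
      using emb unfolding embedded_resolution_def by (elim conjE)
    from this[rule_format, OF that(1-3), of p] show ?thesis using that(4,5) by simp
  qed
  have "\<exists>m :: 'm set \<Rightarrow> nat. (\<forall>E\<in>\<E>. 0 < m E) \<and>
      (\<forall>E\<in>\<E>. int (m E) * self E + (\<Sum>E'\<in>\<E> - {E}. int (m E') * int (card (E \<inter> E'))) \<le> 0) \<and>
      ((\<forall>E\<in>\<E>. int (m E) * self E + (\<Sum>E'\<in>\<E> - {E}. int (m E') * int (card (E \<inter> E'))) = 0) \<longrightarrow>
        (\<forall>E\<in>\<E>. \<forall>p\<in>E. \<forall>\<^sub>F q in nhds p. q \<notin> \<Union>\<E> \<longrightarrow> \<pi> q $ i - x0 $ i \<noteq> 0)) \<and>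
      (\<forall>E\<in>\<E>. \<forall>E'\<in>\<E>. E \<noteq> E' \<longrightarrow> finite (E \<inter> E'))"
  proof (rule intersection_weights[OF surf E(1) E(2) cp si cross two holo_coordinate[of i]])
    fix E p assume "E \<in> \<E>" "p \<in> E"
    then have p: "\<pi> p = x0" using sub by blast
    then show "\<pi> p $ i - x0 $ i = 0" by simp
    show "\<not> (\<forall>\<^sub>F q in nhds p. \<pi> q $ i - x0 $ i = 0)" by (rule i[OF p])
  next
    fix m :: "'m set \<Rightarrow> nat"
    assume m: "\<And>E. E \<in> \<E> \<Longrightarrow> 0 < m E"
      "\<And>E. E \<in> \<E> \<Longrightarrow> int (m E) * self E + (\<Sum>E'\<in>\<E> - {E}. int (m E') * int (card (E \<inter> E'))) \<le> 0"
      "\<And>E p. (\<And>E. E \<in> \<E> \<Longrightarrow> int (m E) * self E + (\<Sum>E'\<in>\<E> - {E}. int (m E') * int (card (E \<inter> E'))) = 0) \<Longrightarrow>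
        E \<in> \<E> \<Longrightarrow> p \<in> E \<Longrightarrow> \<forall>\<^sub>F q in nhds p. q \<notin> \<Union>\<E> \<longrightarrow> \<pi> q $ i - x0 $ i \<noteq> 0"
      "\<And>E E'. E \<in> \<E> \<Longrightarrow> E' \<in> \<E> \<Longrightarrow> E \<noteq> E' \<Longrightarrow> finite (E \<inter> E')"
    show ?thesis
    proof (intro exI[of _ m] conjI ballI impI)
      fix E p assume all: "\<forall>E\<in>\<E>. int (m E) * self E + (\<Sum>E'\<in>\<E> - {E}. int (m E') * int (card (E \<inter> E'))) = 0"
        and Ep: "E \<in> \<E>" "p \<in> E"
      from m(3)[OF bspec[OF all] Ep] show "\<forall>\<^sub>F q in nhds p. q \<notin> \<Union>\<E> \<longrightarrow> \<pi> q $ i - x0 $ i \<noteq> 0" .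
    next
      fix E E' assume E: "E \<in> \<E>" "E' \<in> \<E>" "E \<noteq> E'"
      show "finite (E \<inter> E')" by (rule m(4)[OF E])
    qed (erule m(1), erule m(2))
  qed
  then obtain m :: "'m set \<Rightarrow> nat" where m: "\<forall>E\<in>\<E>. 0 < m E"
    "\<forall>E\<in>\<E>. int (m E) * self E + (\<Sum>E'\<in>\<E> - {E}. int (m E') * int (card (E \<inter> E'))) \<le> 0"
    "(\<forall>E\<in>\<E>. int (m E) * self E + (\<Sum>E'\<in>\<E> - {E}. int (m E') * int (card (E \<inter> E'))) = 0) \<longrightarrow>
        (\<forall>E\<in>\<E>. \<forall>p\<in>E. \<forall>\<^sub>F q in nhds p. q \<notin> \<Union>\<E> \<longrightarrow> \<pi> q $ i - x0 $ i \<noteq> 0)"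
    "\<forall>E\<in>\<E>. \<forall>E'\<in>\<E>. E \<noteq> E' \<longrightarrow> finite (E \<inter> E')" by (elim exE conjE)
  have "\<exists>E\<in>\<E>. int (m E) * self E + (\<Sum>E'\<in>\<E> - {E}. int (m E') * int (card (E \<inter> E'))) \<noteq> 0"
  proof (rule ccontr)
    assume "\<not> ?thesis"
    then have nz: "\<forall>E\<in>\<E>. \<forall>p\<in>E. \<forall>\<^sub>F q in nhds p. q \<notin> \<Union>\<E> \<longrightarrow> \<pi> q $ i - x0 $ i \<noteq> 0" using m(3) by blast
    obtain p where p: "\<pi> p = x0" "\<not> (\<forall>\<^sub>F q in nhds p. \<pi> q \<noteq> x0 \<longrightarrow> \<pi> q $ i - x0 $ i \<noteq> 0)"
      using coordinate_zeros_leave_fibre[OF ne'] by blast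
    then obtain E where "E \<in> \<E>" "p \<in> E" using E(3) by blast
    then show False using nz p(2) unfolding E(3) by simp
  qed
  moreover have "\<And>E. E \<in> \<E> \<Longrightarrow> 0 < m E" by (rule bspec[OF m(1)])
  moreover have "\<And>E. E \<in> \<E> \<Longrightarrow> int (m E) * self E + (\<Sum>E'\<in>\<E> - {E}. int (m E') * int (card (E \<inter> E'))) \<le> 0"
    by (rule bspec[OF m(2)])
  moreover have "\<And>E E'. E \<in> \<E> \<Longrightarrow> E' \<in> \<E> \<Longrightarrow> E \<noteq> E' \<Longrightarrow> finite (E \<inter> E')" using m(4) by blast
  ultimately show thesis by (intro that[of m])
qed

end

section \<open>Intersection forms and Green functions\<close>

text \<open>Gaussian elimination: the unknown \<open>c\<close> is removed with a pivot row
  \<open>r\<close>, and the smaller system still has trivial kernel.\<close>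

lemma injective_system_solvable:
  fixes a :: "'r \<Rightarrow> 'c \<Rightarrow> 'k::field"
  assumes "finite W" "finite V" "card W = card V"
    and "\<And>y. (\<And>x. x \<in> W \<Longrightarrow> (\<Sum>z\<in>V. a x z * y z) = 0) \<Longrightarrow> (\<And>z. z \<in> V \<Longrightarrow> y z = 0)"
  shows "\<exists>y. \<forall>x\<in>W. (\<Sum>z\<in>V. a x z * y z) = b x"
  using assms
proof (induction "card V" arbitrary: V W a b)
  case 0
  then have "W = {}" by simp
  then show ?case by simp
next
  case (Suc n)
  obtain c where c: "c \<in> V" using Suc(2) by (metis all_not_in_conv card.empty nat.distinct(1))
  have "\<exists>r\<in>W. a r c \<noteq> 0"
  proof (rule ccontr)
    assume "\<not> (\<exists>r\<in>W. a r c \<noteq> 0)"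
    then have "(\<Sum>z\<in>V. a x z * (if z = c then 1 else 0)) = 0" if "x \<in> W" for x
      using that Suc(4) c by (simp add: if_distrib cong: if_cong)
    from Suc.prems(4)[OF this c] show False by simp
  qed
  then obtain r where r: "r \<in> W" "a r c \<noteq> 0" by blast
  \<comment> \<open>Row \<open>x\<close> minus the multiple of row \<open>r\<close> that cancels
    column \<open>c\<close>.\<close>
  define a' where "a' x z = a x z - a x c * a r z / a r c" for x z
  have split: "(\<Sum>z\<in>V. a x z * y z) = a x c * y c + (\<Sum>z\<in>V - {c}. a x z * y z)" for x y
    using Suc(4) c by (simp add: sum.remove)
  have a': "(\<Sum>z\<in>V - {c}. a' x z * y z) = (\<Sum>z\<in>V - {c}. a x z * y z) - a x c / a r c * (\<Sum>z\<in>V - {c}. a r z * y z)" for x y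
  proof -
    have "a' x z * y z = a x z * y z - a x c / a r c * (a r z * y z)" for z
      by (simp add: a'_def left_diff_distrib)
    then show ?thesis by (simp add: sum_subtractf sum_distrib_left)
  qed
  have "\<exists>y. \<forall>x\<in>W - {r}. (\<Sum>z\<in>V - {c}. a' x z * y z) = b x - a x c / a r c * b r"
  proof (rule Suc.hyps(1))
    show "n = card (V - {c})" "finite (W - {r})" "finite (V - {c})" "card (W - {r}) = card (V - {c})"
      using Suc(2-5) c r by auto
    fix y z assume y: "\<And>x. x \<in> W - {r} \<Longrightarrow> (\<Sum>z\<in>V - {c}. a' x z * y z) = 0" and z: "z \<in> V - {c}"
    define y' where "y' = y(c := - (\<Sum>z\<in>V - {c}. a r z * y z) / a r c)"
    have s: "(\<Sum>z\<in>V - {c}. a x z * y' z) = (\<Sum>z\<in>V - {c}. a x z * y z)" for x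
      by (intro sum.cong) (auto simp: y'_def)
    have "(\<Sum>z\<in>V. a x z * y' z) = 0" if x: "x \<in> W" for x
    proof (cases "x = r")
      case True
      then show ?thesis unfolding split s using r by (simp add: y'_def)
    next
      case False
      then have "(\<Sum>z\<in>V - {c}. a x z * y z) = a x c / a r c * (\<Sum>z\<in>V - {c}. a r z * y z)"
        using y[of x] a'[of x y] x by simp
      then show ?thesis unfolding split s by (simp add: y'_def)
    qed
    from Suc.prems(4)[OF this, of z] z show "y z = 0" by (simp add: y'_def)
  qed
  then obtain y where y: "\<And>x. x \<in> W - {r} \<Longrightarrow> (\<Sum>z\<in>V - {c}. a' x z * y z) = b x - a x c / a r c * b r" by blast
  define y' where "y' = y(c := (b r - (\<Sum>z\<in>V - {c}. a r z * y z)) / a r c)"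
  have s: "(\<Sum>z\<in>V - {c}. a x z * y' z) = (\<Sum>z\<in>V - {c}. a x z * y z)" for x
    by (intro sum.cong) (auto simp: y'_def)
  have "(\<Sum>z\<in>V. a x z * y' z) = b x" if x: "x \<in> W" for x
  proof (cases "x = r")
    case True
    then show ?thesis unfolding split s using r by (simp add: y'_def)
  next
    case False
    then have "(\<Sum>z\<in>V - {c}. a x z * y z) =
        b x - a x c / a r c * b r + a x c / a r c * (\<Sum>z\<in>V - {c}. a r z * y z)"
      using y[of x] a'[of x y] x by (simp add: diff_eq_eq)
    then show ?thesis unfolding split s by (simp add: y'_def diff_divide_distrib right_diff_distrib)
  qed
  then show ?case by blast
qed

text \<open>Up to sign, an irreducible symmetric matrix with a positive supersolution
  \<open>m\<close> that is not a solution, in other words a non-singular M-matrix.\<close>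

locale intersection_form =
  fixes V :: "'v set" and a :: "'v \<Rightarrow> 'v \<Rightarrow> 'k::linordered_field" and m :: "'v \<Rightarrow> 'k"
  assumes fin: "finite V"
    and sym: "\<And>x y. x \<in> V \<Longrightarrow> y \<in> V \<Longrightarrow> a x y = a y x"
    and off: "\<And>x y. x \<in> V \<Longrightarrow> y \<in> V \<Longrightarrow> x \<noteq> y \<Longrightarrow> 0 \<le> a x y"
    and pos: "\<And>x. x \<in> V \<Longrightarrow> 0 < m x"
    and super: "\<And>x. x \<in> V \<Longrightarrow> (\<Sum>z\<in>V. a x z * m z) \<le> 0"
    and strict: "\<exists>x\<in>V. (\<Sum>z\<in>V. a x z * m z) \<noteq> 0"
    and conn: "\<And>S. S \<subseteq> V \<Longrightarrow> S \<noteq> {} \<Longrightarrow> S \<noteq> V \<Longrightarrow> \<exists>x\<in>S. \<exists>y\<in>V - S. a x y \<noteq> 0"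
begin

text \<open>At a zero of a non-negative \<open>y\<close> the diagonal term disappears, so all terms
  are non-negative and have to vanish one by one.\<close>

lemma zero_set_closed:
  assumes y: "\<forall>z\<in>V. 0 \<le> y z" and x: "x \<in> V" "y x = 0" and le: "(\<Sum>z\<in>V. a x z * y z) \<le> 0"
  shows "(\<Sum>z\<in>V. a x z * y z) = 0" "z \<in> V \<Longrightarrow> a x z \<noteq> 0 \<Longrightarrow> y z = 0"
proof -
  have nn: "0 \<le> a x z * y z" if "z \<in> V" for z
    using off[OF x(1) that] bspec[OF y that] x(2) by (cases "z = x") auto
  then have "0 \<le> (\<Sum>z\<in>V. a x z * y z)" by (rule sum_nonneg)
  then show eq: "(\<Sum>z\<in>V. a x z * y z) = 0" using le by simp
  show "z \<in> V \<Longrightarrow> a x z \<noteq> 0 \<Longrightarrow> y z = 0"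
    using eq sum_nonneg_eq_0_iff[OF fin nn] by auto
qed

text \<open>The minimum of \<open>y / m\<close> propagates along the edges, and it cannot be negative because \<open>m\<close> is
  a strict supersolution somewhere.\<close>

lemma max_principle:
  assumes out: "\<And>x. x \<in> V - S \<Longrightarrow> 0 \<le> y x"
    and le: "\<And>x. x \<in> V \<inter> S \<Longrightarrow> (\<Sum>z\<in>V. a x z * y z) \<le> 0" and x: "x \<in> V"
  shows "0 \<le> y x"
proof (rule ccontr)
  assume neg: "\<not> 0 \<le> y x"
  define t where "t = Min ((\<lambda>z. y z / m z) ` V)"
  have t_le: "t \<le> y z / m z" if "z \<in> V" for z unfolding t_def using fin that by simp
  have "t \<le> y x / m x" by (rule t_le[OF x])
  also have "\<dots> < 0" using neg pos[OF x] by (simp add: divide_neg_pos)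
  finally have t: "t < 0" .
  \<comment> \<open>Subtracting the extremal multiple of \<open>m\<close> leaves a non-negative
    function with a zero.\<close>
  define w where "w z = y z - t * m z" for z
  have w: "\<forall>z\<in>V. 0 \<le> w z"
  proof
    fix z assume "z \<in> V"
    then show "0 \<le> w z" using t_le[of z] pos[of z] by (simp add: w_def field_simps)
  qed
  define Z where "Z = {z\<in>V. w z = 0}"
  have "t \<in> (\<lambda>z. y z / m z) ` V" unfolding t_def using fin x by (intro Min_in) auto
  then obtain z where z: "z \<in> V" "t = y z / m z" by blast
  then have "z \<in> Z" using pos[OF z(1)] by (simp add: Z_def w_def)
  have wle: "(\<Sum>z\<in>V. a x z * w z) \<le> 0" if xZ: "x \<in> Z" for x
  proof -
    have x: "x \<in> V" "y x = t * m x" using xZ by (auto simp: Z_def w_def)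
    then have "y x < 0" using t pos[OF x(1)] by (simp add: mult_neg_pos)
    then have "x \<in> V \<inter> S" using out[of x] x(1) by force
    then have "(\<Sum>z\<in>V. a x z * y z) - t * (\<Sum>z\<in>V. a x z * m z) \<le> 0"
      using le[of x] mult_nonpos_nonpos[OF less_imp_le[OF t] super[OF x(1)]] by simp
    then show ?thesis by (simp add: w_def right_diff_distrib sum_subtractf sum_distrib_left mult_ac)
  qed
  have "Z = V"
  proof (rule ccontr)
    assume "Z \<noteq> V"
    then obtain x' y' where "x' \<in> Z" "y' \<in> V - Z" "a x' y' \<noteq> 0"
      using conn[of Z] \<open>z \<in> Z\<close> by (auto simp: Z_def)
    then show False using zero_set_closed(2)[OF w, of x' y'] wle[of x'] by (auto simp: Z_def)
  qed
  \<comment> \<open>Now \<open>y = t * m\<close> with \<open>t < 0\<close>, so \<open>y\<close> is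
    negative everywhere, all of \<open>V\<close> lies in \<open>S\<close>, and \<open>m\<close> is a
    subsolution as well as a supersolution.\<close>
  have "(\<Sum>z\<in>V. a x z * m z) = 0" if x: "x \<in> V" for x
  proof -
    have xZ: "x \<in> Z" using \<open>Z = V\<close> x by simp
    have yx: "y z = t * m z" if "z \<in> V" for z using \<open>Z = V\<close> that by (auto simp: Z_def w_def)
    have "y x < 0" using yx[OF x] t pos[OF x] by (simp add: mult_neg_pos)
    then have "x \<in> V \<inter> S" using out[of x] x by force
    then have "(\<Sum>z\<in>V. a x z * (t * m z)) \<le> 0" using le[of x] yx by (simp cong: sum.cong)
    then have "t * (\<Sum>z\<in>V. a x z * m z) \<le> 0" by (simp add: sum_distrib_left mult_ac)
    then show ?thesis using super[OF x] t by (simp add: mult_le_0_iff)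
  qed
  then show False using strict by blast
qed

text \<open>Uniqueness in the Dirichlet problem on \<open>S\<close>, from the maximum principle for
  \<open>y\<close> and \<open>- y\<close>.\<close>

lemma trivial_kernel:
  assumes "\<And>x. x \<in> V - S \<Longrightarrow> y x = 0" "\<And>x. x \<in> V \<inter> S \<Longrightarrow> (\<Sum>z\<in>V. a x z * y z) = 0" "x \<in> V"
  shows "y x = 0"
proof -
  have "0 \<le> y x"
    by (rule max_principle[of S]) (simp_all add: assms(1) assms(2) assms(3))
  moreover have "0 \<le> - y x"
    by (rule max_principle[of S "\<lambda>x. - y x"]) (simp_all add: sum_negf assms(1) assms(2) assms(3))
  ultimately show ?thesis by simp
qed

definition green :: "'v \<Rightarrow> 'v \<Rightarrow> 'k" where
  "green v = (SOME y. \<forall>x\<in>V. (\<Sum>z\<in>V. a x z * y z) = (if x = v then - 1 else 0))"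

lemma green: "x \<in> V \<Longrightarrow> (\<Sum>z\<in>V. a x z * green v z) = (if x = v then - 1 else 0)"
proof -
  have "\<exists>y. \<forall>x\<in>V. (\<Sum>z\<in>V. a x z * y z) = (if x = v then - 1 else 0)"
  proof (rule injective_system_solvable[OF fin fin refl])
    fix y z assume y: "\<And>x. x \<in> V \<Longrightarrow> (\<Sum>z\<in>V. a x z * y z) = 0" and z: "z \<in> V"
    show "y z = 0" by (rule trivial_kernel[of V, OF _ _ z]) (simp, rule y, simp)
  qed
  from someI_ex[OF this] show "x \<in> V \<Longrightarrow> (\<Sum>z\<in>V. a x z * green v z) = (if x = v then - 1 else 0)"
    unfolding green_def by blast
qed

lemma green_unique:
  assumes "\<And>x. x \<in> V \<Longrightarrow> (\<Sum>z\<in>V. a x z * y z) = (if x = v then - 1 else 0)" "x \<in> V"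
  shows "y x = green v x"
proof -
  have "y x - green v x = 0"
    by (rule trivial_kernel[of V "\<lambda>x. y x - green v x", OF _ _ assms(2)])
      (simp_all add: right_diff_distrib sum_subtractf assms(1) green)
  then show ?thesis by simp
qed

text \<open>A zero would spread along the edges to all of \<open>V\<close>, and then the equation at
  the pole \<open>v\<close> could not hold.\<close>

lemma green_pos:
  assumes v: "v \<in> V" and x: "x \<in> V"
  shows "0 < green v x"
proof -
  have nn: "\<forall>z\<in>V. 0 \<le> green v z"
  proof
    fix z assume "z \<in> V"
    then show "0 \<le> green v z" by (rule max_principle[of V, rotated 2]) (simp_all add: green)
  qed
  have le: "(\<Sum>z\<in>V. a x z * green v z) \<le> 0" if "x \<in> V" for x using green[OF that] by simp
  define Z where "Z = {z\<in>V. green v z = 0}"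
  have "Z \<noteq> V"
  proof
    assume "Z = V"
    then have "(\<Sum>z\<in>V. a v z * green v z) = 0" by (intro sum.neutral) (auto simp: Z_def)
    then show False using green[OF v, of v] by simp
  qed
  have "Z = {}"
  proof (rule ccontr)
    assume "Z \<noteq> {}"
    then obtain x' y' where "x' \<in> Z" "y' \<in> V - Z" "a x' y' \<noteq> 0"
      using conn[of Z] \<open>Z \<noteq> V\<close> by (auto simp: Z_def)
    then show False using zero_set_closed(2)[OF nn, of x' y'] le[of x'] by (auto simp: Z_def)
  qed
  then have "green v x \<noteq> 0" using x by (auto simp: Z_def)
  then show ?thesis using bspec[OF nn x] by simp
qed

text \<open>Both values arise, up to sign, by evaluating the symmetric form on the two Green
  functions.\<close>

lemma green_sym:
  assumes v: "v \<in> V" and w: "w \<in> V"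
  shows "green v w = green w v"
proof -
  have *: "(\<Sum>x\<in>V. \<Sum>z\<in>V. y x * (a x z * green u z)) = - y u" if u: "u \<in> V" for y u
  proof -
    have "(\<Sum>x\<in>V. \<Sum>z\<in>V. y x * (a x z * green u z)) = (\<Sum>x\<in>V. y x * (if x = u then - 1 else 0))"
      by (intro sum.cong refl) (simp add: sum_distrib_left[symmetric] green)
    also have "\<dots> = - y u" using fin u by (simp add: if_distrib cong: if_cong)
    finally show ?thesis .
  qed
  have "(\<Sum>x\<in>V. \<Sum>z\<in>V. green w x * (a x z * green v z)) = (\<Sum>z\<in>V. \<Sum>x\<in>V. green v z * (a z x * green w x))"
    by (subst sum.swap, intro sum.cong refl) (simp add: sym mult_ac)
  then show ?thesis using *[OF v, of "green w"] *[OF w, of "green v"] by simp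
qed

section \<open>Green functions and separation by a vertex\<close>

definition avoiding :: "'v \<Rightarrow> ('v \<times> 'v) set" where
  "avoiding v = {(x, y). x \<in> V - {v} \<and> y \<in> V - {v} \<and> x \<noteq> y \<and> a x y \<noteq> 0}"

context
  fixes v b :: 'v
  assumes v: "v \<in> V" and b: "b \<in> V" "b \<noteq> v"
begin

text \<open>Divided by \<open>green v v\<close>, this is the Green function with pole
  \<open>b\<close> and boundary value 0 at \<open>v\<close>.\<close>

definition defect :: "'v \<Rightarrow> 'k" where
  "defect x = green b x * green v v - green b v * green v x"

lemma defect_eq:
  "x \<in> V \<Longrightarrow> (\<Sum>z\<in>V. a x z * defect z) = (if x = b then - green v v else if x = v then green b v else 0)"
proof -
  assume x: "x \<in> V"
  have "(\<Sum>z\<in>V. a x z * defect z) = (\<Sum>z\<in>V. a x z * green b z) * green v v - green b v * (\<Sum>z\<in>V. a x z * green v z)"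
    unfolding defect_def by (simp add: right_diff_distrib sum_subtractf sum_distrib_left sum_distrib_right mult_ac)
  then show ?thesis using green[OF x] b by simp
qed

lemma defect_v: "defect v = 0"
  by (simp add: defect_def mult.commute)

lemma defect_nonneg: "x \<in> V \<Longrightarrow> 0 \<le> defect x"
proof (rule max_principle[of "V - {v}"])
  fix x assume "x \<in> V \<inter> (V - {v})"
  then show "(\<Sum>z\<in>V. a x z * defect z) \<le> 0"
    using defect_eq[of x] green_pos[OF v v] by simp
qed (use defect_v in auto)

text \<open>If it vanishes at \<open>x\<close>, zeros spread along the edges that avoid
  \<open>v\<close> and would reach \<open>b\<close>, where the equation excludes them. If
  \<open>b\<close> cannot be reached, the restriction to the component of \<open>x\<close> solves a
  Dirichlet problem with zero data.\<close>

lemma defect_zero_iff: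
  assumes x: "x \<in> V" "x \<noteq> v"
  shows "defect x = 0 \<longleftrightarrow> (x, b) \<notin> (avoiding v)\<^sup>*"
proof
  assume "defect x = 0"
  have nn: "\<forall>z\<in>V. 0 \<le> defect z" using defect_nonneg by blast
  have "(x, z) \<in> (avoiding v)\<^sup>* \<Longrightarrow> z \<in> V - {v} \<and> defect z = 0" for z
  proof (induction rule: rtrancl_induct)
    case base
    then show ?case using \<open>defect x = 0\<close> x by simp
  next
    case (step y z)
    then have "y \<in> V" "y \<noteq> v" "z \<in> V" "z \<noteq> v" "a y z \<noteq> 0" by (auto simp: avoiding_def)
    moreover have "(\<Sum>z\<in>V. a y z * defect z) \<le> 0"
      using defect_eq[of y] calculation green_pos[OF v v] by simp
    ultimately show ?case using zero_set_closed(2)[OF nn, of y z] step.IH by simp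
  qed
  moreover have "defect b \<noteq> 0"
  proof
    assume "defect b = 0"
    then have "(\<Sum>z\<in>V. a b z * defect z) = 0"
      using zero_set_closed(1)[OF nn b(1)] defect_eq[OF b(1)] green_pos[OF v v] by simp
    then show False using defect_eq[OF b(1)] green_pos[OF v v] by simp
  qed
  ultimately show "(x, b) \<notin> (avoiding v)\<^sup>*" by blast
next
  assume nb: "(x, b) \<notin> (avoiding v)\<^sup>*"
  define K where "K = {z\<in>V. (x, z) \<in> (avoiding v)\<^sup>*}"
  have KV: "z \<in> V - {v}" if "z \<in> K" for z
  proof -
    have "(x, z) \<in> (avoiding v)\<^sup>*" using that by (simp add: K_def)
    then show ?thesis by (induction rule: rtrancl_induct) (use x in \<open>auto simp: avoiding_def\<close>)
  qed
  \<comment> \<open>Extension by zero from the component \<open>K\<close>. The only neighbour of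
    \<open>K\<close> outside it is \<open>v\<close>, where \<open>defect\<close> vanishes, so the
    equations on \<open>K\<close> persist.\<close>
  define y where "y z = (if z \<in> K then defect z else 0)" for z
  have "y x = 0"
  proof (rule trivial_kernel[of K])
    fix z assume z: "z \<in> V \<inter> K"
    have "a z w * y w = a z w * defect w" if w: "w \<in> V" for w
    proof (cases "w \<in> K \<or> w = v \<or> a z w = 0")
      case True
      then show ?thesis using defect_v by (auto simp: y_def)
    next
      case False
      then have "z \<noteq> w" using z by auto
      then have "(z, w) \<in> avoiding v" using False z w KV[of z] by (auto simp: avoiding_def)
      then have "w \<in> K" using z w by (auto simp: K_def)
      then show ?thesis using False by simp
    qed
    then have "(\<Sum>w\<in>V. a z w * y w) = (\<Sum>w\<in>V. a z w * defect w)" by (rule sum.cong[OF refl])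
    also have "\<dots> = 0" using defect_eq[of z] z KV[of z] nb by (auto simp: K_def)
    finally show "(\<Sum>w\<in>V. a z w * y w) = 0" .
  qed (use x in \<open>auto simp: y_def\<close>)
  then show "defect x = 0" using x by (simp add: y_def K_def)
qed

end

lemma green_separation:
  assumes "v \<in> V" "b \<in> V" "x \<in> V"
  shows "green b v * green v x \<le> green b x * green v v"
    "green b v * green v x = green b x * green v v \<longleftrightarrow> x = v \<or> b = v \<or> (x, b) \<notin> (avoiding v)\<^sup>*"
proof -
  consider "b = v" | "x = v" | "b \<noteq> v" "x \<noteq> v" by blast
  then have "green b v * green v x \<le> green b x * green v v \<and>
    (green b v * green v x = green b x * green v v \<longleftrightarrow> x = v \<or> b = v \<or> (x, b) \<notin> (avoiding v)\<^sup>*)"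
  proof cases
    case 1
    then show ?thesis by (simp add: mult.commute)
  next
    case 2
    then show ?thesis by simp
  next
    case 3
    have "0 \<le> green b x * green v v - green b v * green v x"
      using defect_nonneg[OF assms(1,2) 3(1) assms(3)] by (simp add: defect_def[OF assms(1,2) 3(1)])
    moreover have "green b x * green v v - green b v * green v x = 0 \<longleftrightarrow> (x, b) \<notin> (avoiding v)\<^sup>*"
      using defect_zero_iff[OF assms(1,2) 3(1) assms(3) 3(2)] by (simp add: defect_def[OF assms(1,2) 3(1)])
    ultimately show ?thesis using 3 by (simp add: eq_commute[of "green b v * green v x"])
  qed
  then show "green b v * green v x \<le> green b x * green v v"
    "green b v * green v x = green b x * green v v \<longleftrightarrow> x = v \<or> b = v \<or> (x, b) \<notin> (avoiding v)\<^sup>*" by blast+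
qed

end

section \<open>Rooted trees\<close>

definition edge_rel :: "'v sgraph \<Rightarrow> 'v set \<Rightarrow> ('v \<times> 'v) set" where
  "edge_rel T B = {(x, y). x \<in> B \<and> y \<in> B \<and> {x, y} \<in> snd T}"

lemma edge_rel_sym: "(x, y) \<in> edge_rel T B \<Longrightarrow> (y, x) \<in> edge_rel T B"
  by (auto simp: edge_rel_def insert_commute)

lemma edge_rel_rtrancl_sym: "(x, y) \<in> (edge_rel T B)\<^sup>* \<Longrightarrow> (y, x) \<in> (edge_rel T B)\<^sup>*"
  by (metis edge_rel_sym symI sym_rtrancl symD)

lemma not_spath_Nil [simp]: "\<not> spath T x [] y"
  by (simp add: spath_def)

lemma spath_Cons:
  "spath T x (a # p) y \<longleftrightarrow> a = x \<and> x \<in> fst T \<and> x \<notin> set p \<and>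
     (if p = [] then y = x else {x, hd p} \<in> snd T \<and> spath T (hd p) p y)"
proof (cases p)
  case (Cons b q)
  have all: "(\<forall>i. P i) \<longleftrightarrow> P 0 \<and> (\<forall>i. P (Suc i))" for P :: "nat \<Rightarrow> bool" by (metis not0_implies_Suc)
  have "(\<forall>i. Suc i < length (a # p) \<longrightarrow> {(a # p) ! i, (a # p) ! Suc i} \<in> snd T) \<longleftrightarrow>
      {a, b} \<in> snd T \<and> (\<forall>i. Suc i < length p \<longrightarrow> {p ! i, p ! Suc i} \<in> snd T)"
    by (subst all) (auto simp: Cons)
  then show ?thesis unfolding spath_def Cons by auto
qed (auto simp: spath_def)

lemma spath_ends: "spath T x p y \<Longrightarrow> x \<in> set p \<and> y \<in> set p \<and> set p \<subseteq> fst T"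
  by (auto simp: spath_def)

lemma spath_append:
  "spath T x (p @ z # q) y \<Longrightarrow> spath T x (p @ [z]) z \<and> spath T z (z # q) y"
proof (induction p arbitrary: x)
  case (Cons a p)
  then show ?case by (cases p) (auto simp: spath_Cons)
qed (auto simp: spath_Cons)

lemma spath_snoc:
  assumes "spath T x p y" "{y, z} \<in> snd T" "z \<in> fst T" "z \<notin> set p"
  shows "spath T x (p @ [z]) z"
  using assms
proof (induction p arbitrary: x)
  case (Cons a p)
  then show ?case by (cases p) (auto simp: spath_Cons)
qed simp

lemma spath_rev:
  assumes "spath T x p y" shows "spath T y (rev p) x"
  using assms
proof (induction p arbitrary: x)
  case (Cons a p)
  show ?case
  proof (cases p)
    case Nil
    then show ?thesis using Cons.prems by (auto simp: spath_Cons)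
  next
    case (Cons b q)
    then have "spath T b p y" "a = x" "{b, x} \<in> snd T" "x \<in> fst T" "x \<notin> set p"
      using Cons.prems by (auto simp: spath_Cons insert_commute)
    then show ?thesis using spath_snoc[OF Cons.IH, of b x] by simp
  qed
qed simp

lemma spath_rtrancl:
  assumes "spath T x p y" "set p \<subseteq> B"
  shows "(x, y) \<in> (edge_rel T B)\<^sup>*"
  using assms
proof (induction p arbitrary: x)
  case (Cons a p)
  show ?case
  proof (cases p)
    case Nil
    then show ?thesis using Cons.prems by (auto simp: spath_Cons)
  next
    case (Cons b q)
    then have "spath T b p y" "(x, b) \<in> edge_rel T B" "set p \<subseteq> B"
      using Cons.prems by (auto simp: spath_Cons edge_rel_def)
    then show ?thesis using Cons.IH converse_rtrancl_into_rtrancl by metis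
  qed
qed simp

text \<open>A walk is shortened to a path: when the new first vertex occurs already, the initial
  loop is cut off.\<close>

lemma rtrancl_spath:
  assumes "(x, y) \<in> (edge_rel T B)\<^sup>*" "x \<in> B" "B \<subseteq> fst T"
  obtains p where "spath T x p y" "set p \<subseteq> B"
proof -
  have "\<exists>p. spath T x p y \<and> set p \<subseteq> B"
    using assms(1,2)
  proof (induction rule: converse_rtrancl_induct)
    case base
    then show ?case using assms(3) by (intro exI[of _ "[y]"]) (auto simp: spath_Cons)
  next
    case (step x z)
    then obtain p where p: "spath T z p y" "set p \<subseteq> B" by (auto simp: edge_rel_def)
    show ?case
    proof (cases "x \<in> set p")
      case True
      then obtain q q' where q: "p = q @ x # q'" by (meson split_list)
      then have "spath T x (x # q') y" using p(1) spath_append[of T z q x q' y] by simp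
      then show ?thesis using p(2) q by (intro exI[of _ "x # q'"]) auto
    next
      case False
      obtain q where "p = z # q" using p(1) by (cases p) (auto simp: spath_Cons)
      then show ?thesis using p False step assms(3)
        by (intro exI[of _ "x # p"]) (auto simp: spath_Cons edge_rel_def)
    qed
  qed
  then show thesis using that by blast
qed

text \<open>A graph all of whose edges are bridges has at most one path between two vertices: when two
  paths part, they close up to a detour around the first edge of one of them.\<close>

lemma spath_unique:
  assumes br: "\<And>x y. {x, y} \<in> snd T \<Longrightarrow> x \<noteq> y \<Longrightarrow> (x, y) \<notin> (edge_rel (fst T, snd T - {{x, y}}) (fst T))\<^sup>*"
  shows "spath T x p y \<Longrightarrow> spath T x q y \<Longrightarrow> p = q"
proof (induction p arbitrary: x q)
  case (Cons a p)
  obtain q' where q: "q = a # q'" using Cons.prems by (cases q) (auto simp: spath_Cons)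
  show ?case
  proof (cases p)
    case Nil
    then have "x = y" using Cons.prems(1) by (simp add: spath_Cons)
    have "q' = []"
    proof (rule ccontr)
      assume "q' \<noteq> []"
      then have "spath T (hd q') q' y" "x \<notin> set q'" using Cons.prems(2) q by (auto simp: spath_Cons)
      then show False using spath_ends \<open>x = y\<close> by metis
    qed
    then show ?thesis using Nil q by simp
  next
    case p: (Cons b p')
    then have pp: "spath T b p y" "a = x" "{x, b} \<in> snd T" "x \<notin> set p" "x \<in> fst T" "b \<in> fst T"
      using Cons.prems(1) by (auto simp: spath_Cons dest: spath_ends)
    have "y \<in> set p" using spath_ends[OF pp(1)] by simp
    then have "x \<noteq> y" using pp(4) by auto
    then obtain c q'' where q'': "q' = c # q''" using Cons.prems(2) q by (cases q') (auto simp: spath_Cons)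
    then have qq: "spath T c q' y" "{x, c} \<in> snd T" "x \<notin> set q'" "c \<in> fst T"
      using Cons.prems(2) q by (auto simp: spath_Cons dest: spath_ends)
    have "b = c"
    proof (rule ccontr)
      assume bc: "b \<noteq> c"
      let ?T = "(fst T, snd T - {{x, b}})"
      have off: "(edge_rel T (fst T - {x}))\<^sup>* \<subseteq> (edge_rel ?T (fst T))\<^sup>*"
        by (intro rtrancl_mono) (auto simp: edge_rel_def doubleton_eq_iff)
      have "(c, y) \<in> (edge_rel T (fst T - {x}))\<^sup>*" "(b, y) \<in> (edge_rel T (fst T - {x}))\<^sup>*"
        by (intro spath_rtrancl[OF qq(1)] spath_rtrancl[OF pp(1)];
            use spath_ends[OF qq(1)] spath_ends[OF pp(1)] pp(4) qq(3) in blast)+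
      then have "(c, b) \<in> (edge_rel T (fst T - {x}))\<^sup>*" by (meson edge_rel_rtrancl_sym rtrancl_trans)
      then have "(c, b) \<in> (edge_rel ?T (fst T))\<^sup>*" using off by blast
      moreover have "(x, c) \<in> edge_rel ?T (fst T)"
        using qq(2,4) pp(5) bc by (auto simp: edge_rel_def doubleton_eq_iff)
      ultimately have "(x, b) \<in> (edge_rel ?T (fst T))\<^sup>*" by (rule converse_rtrancl_into_rtrancl[rotated])
      moreover have "x \<noteq> b" using pp(4) p by auto
      ultimately show False using br[OF pp(3)] by blast
    qed
    then show ?thesis using Cons.IH[OF pp(1)] qq(1) q by simp
  qed
qed simp

text \<open>Existence and uniqueness are stated for paths from the root: these determine the
  ancestor order, by which all other paths are controlled.\<close>

locale rooted_tree =
  fixes T :: "'v sgraph" and r :: 'v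
  assumes root: "r \<in> fst T"
    and edges: "\<And>x y. {x, y} \<in> snd T \<Longrightarrow> x \<in> fst T \<and> y \<in> fst T \<and> x \<noteq> y"
    and edge_card: "\<And>e. e \<in> snd T \<Longrightarrow> \<exists>x y. e = {x, y}"
    and uniq: "\<And>x p q. spath T r p x \<Longrightarrow> spath T r q x \<Longrightarrow> p = q"
    and ex: "\<And>x. x \<in> fst T \<Longrightarrow> \<exists>p. spath T r p x"
begin

definition path_to :: "'v \<Rightarrow> 'v list" where "path_to x = (THE p. spath T r p x)"

definition anc :: "'v \<Rightarrow> 'v \<Rightarrow> bool" where "anc y x \<longleftrightarrow> x \<in> fst T \<and> y \<in> set (path_to x)"

definition child :: "'v \<Rightarrow> 'v \<Rightarrow> bool" where
  "child c v \<longleftrightarrow> {v, c} \<in> snd T \<and> path_to c = path_to v @ [c]"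

lemma path_to: "x \<in> fst T \<Longrightarrow> spath T r (path_to x) x"
proof -
  assume "x \<in> fst T"
  then obtain p where p: "spath T r p x" using ex by blast
  then have "path_to x = p" unfolding path_to_def using uniq by (intro the_equality) blast+
  then show ?thesis using p by simp
qed

lemma path_to_eq: "spath T r p x \<Longrightarrow> path_to x = p"
proof -
  assume p: "spath T r p x"
  then have "x \<in> fst T" using spath_ends[OF p] by blast
  from uniq[OF path_to[OF this] p] show ?thesis .
qed

lemma path_to_set: "x \<in> fst T \<Longrightarrow> x \<in> set (path_to x) \<and> r \<in> set (path_to x) \<and> set (path_to x) \<subseteq> fst T"
  using spath_ends[OF path_to] by blast

lemma last_path_to: "x \<in> fst T \<Longrightarrow> last (path_to x) = x"
  by (drule path_to) (simp add: spath_def)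

lemma path_to_inj: "x \<in> fst T \<Longrightarrow> y \<in> fst T \<Longrightarrow> path_to x = path_to y \<Longrightarrow> x = y"
  by (metis last_path_to)

lemma anc_fst: "anc y x \<Longrightarrow> x \<in> fst T \<and> y \<in> fst T"
  using path_to_set[of x] by (auto simp: anc_def)

text \<open>The ancestor order is the prefix order of the root paths; transitivity, antisymmetry and
  the comparability of two ancestors of a vertex are inherited from lists.\<close>

lemma anc_prefix: "anc y x \<longleftrightarrow> x \<in> fst T \<and> y \<in> fst T \<and> prefix (path_to y) (path_to x)"
proof
  assume a: "anc y x"
  then have x: "x \<in> fst T" "y \<in> set (path_to x)" by (auto simp: anc_def)
  then obtain p q where pq: "path_to x = p @ y # q" by (meson split_list)
  then have "path_to y = p @ [y]"
    using spath_append[of T r p y q x] path_to[OF x(1)] by (intro path_to_eq) auto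
  then show "x \<in> fst T \<and> y \<in> fst T \<and> prefix (path_to y) (path_to x)" using pq anc_fst[OF a] by (simp add: prefix_def)
next
  assume a: "x \<in> fst T \<and> y \<in> fst T \<and> prefix (path_to y) (path_to x)"
  then have "y \<in> set (path_to y)" using path_to_set by blast
  then show "anc y x" using a set_mono_prefix by (auto simp: anc_def)
qed

lemma anc_refl: "x \<in> fst T \<Longrightarrow> anc x x"
  by (simp add: anc_prefix)

lemma anc_trans: "anc z y \<Longrightarrow> anc y x \<Longrightarrow> anc z x"
  by (auto simp: anc_prefix intro: prefix_order.trans)

lemma anc_antisym: "anc y x \<Longrightarrow> anc x y \<Longrightarrow> x = y"
  by (auto simp: anc_prefix intro: path_to_inj prefix_order.antisym)

lemma anc_root: "x \<in> fst T \<Longrightarrow> anc r x"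
  using path_to_set by (simp add: anc_def)

lemma path_to_root: "path_to r = [r]"
  by (rule path_to_eq) (simp add: spath_Cons root)

lemma anc_of_root: "anc x r \<Longrightarrow> x = r"
  by (simp add: anc_def path_to_root)

lemma anc_chain: "anc y x \<Longrightarrow> anc z x \<Longrightarrow> anc y z \<or> anc z y"
  by (auto simp: anc_prefix dest: prefix_same_cases)

lemma edge_child: "{x, y} \<in> snd T \<Longrightarrow> child x y \<or> child y x"
proof -
  assume e: "{x, y} \<in> snd T"
  then have xy: "x \<in> fst T" "y \<in> fst T" "x \<noteq> y" using edges by blast+
  show ?thesis
  proof (cases "y \<in> set (path_to x)")
    case True
    then have a: "anc y x" using xy by (simp add: anc_def)
    have "x \<notin> set (path_to y)" using anc_antisym[OF a] xy by (auto simp: anc_def)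
    then have "path_to x = path_to y @ [x]"
      using spath_snoc[OF path_to[OF xy(2)], of x] e xy by (intro path_to_eq) (simp add: insert_commute)
    then show ?thesis using e by (simp add: child_def insert_commute)
  next
    case False
    then have "path_to y = path_to x @ [y]"
      using spath_snoc[OF path_to[OF xy(1)] e] xy by (intro path_to_eq) simp
    then show ?thesis using e by (simp add: child_def)
  qed
qed

lemma childD: "child c v \<Longrightarrow> c \<in> fst T \<and> v \<in> fst T \<and> c \<noteq> v \<and> anc v c"
  using edges[of v c] by (auto simp: child_def anc_prefix)

lemma anc_child: "child c v \<Longrightarrow> anc x c \<longleftrightarrow> x = c \<or> anc x v"
  using childD[of c v] by (auto simp: anc_def child_def)

lemma child_parent_unique: "child c v \<Longrightarrow> child c w \<Longrightarrow> v = w"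
  using childD path_to_inj by (metis append_same_eq child_def)

lemma parent_ex: "x \<in> fst T \<Longrightarrow> x \<noteq> r \<Longrightarrow> \<exists>v. child x v"
proof -
  assume x: "x \<in> fst T" "x \<noteq> r"
  obtain p where p: "path_to x = p @ [x]"
    using path_to[OF x(1)] last_path_to[OF x(1)] by (metis append_butlast_last_id not_spath_Nil)
  have "p \<noteq> []" using path_to[OF x(1)] x(2) unfolding p by (auto simp: spath_Cons)
  then obtain p' v where v: "p = p' @ [v]" by (metis rev_exhaust)
  then have "spath T r (p' @ v # [x]) x" using path_to[OF x(1)] p by simp
  then have "spath T r p v" "spath T v [v, x] x" using spath_append v by metis+
  then show ?thesis using path_to_eq p by (auto simp: child_def spath_Cons)
qed

lemma child_towards:
  assumes "anc v x" "v \<noteq> x"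
  obtains c where "child c v" "anc c x"
proof -
  have vx: "x \<in> fst T" "v \<in> fst T" "prefix (path_to v) (path_to x)" using assms by (auto simp: anc_prefix)
  then obtain q where q: "path_to x = path_to v @ q" by (auto simp: prefix_def)
  have "q \<noteq> []" using path_to_inj[OF vx(1,2)] q assms(2) by auto
  then obtain c q' where c: "q = c # q'" by (cases q) auto
  have "spath T r (path_to v @ [c]) c" using spath_append[of T r "path_to v" c q' x] path_to[OF vx(1)] q c by simp
  then have pc: "path_to c = path_to v @ [c]" by (rule path_to_eq)
  obtain p where p: "path_to v = p @ [v]"
    using path_to[OF vx(2)] last_path_to[OF vx(2)] by (metis append_butlast_last_id not_spath_Nil)
  have "spath T v [v, c] c"
    using spath_append[of T r p v "[c]" c] \<open>spath T r (path_to v @ [c]) c\<close> p by simp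
  then have "child c v" using pc by (auto simp: child_def spath_Cons)
  moreover have "anc c x" using q c vx(1) by (auto simp: anc_def)
  ultimately show thesis by (rule that)
qed

lemma child_towards_unique: "child c v \<Longrightarrow> child c' v \<Longrightarrow> anc c x \<Longrightarrow> anc c' x \<Longrightarrow> c = c'"
  using anc_chain[of c x c'] anc_child anc_antisym childD by metis

text \<open>The ancestors of \<open>x\<close> form a finite chain, so the common ancestor with the
  longest root path is below all others.\<close>

lemma meet_ex:
  assumes "x \<in> fst T" "y \<in> fst T"
  shows "\<exists>z. anc z x \<and> anc z y \<and> (\<forall>w. anc w x \<longrightarrow> anc w y \<longrightarrow> anc w z)"
proof -
  let ?C = "{z. anc z x \<and> anc z y}"
  have fin: "finite ?C" by (rule finite_subset[of _ "set (path_to x)"]) (auto simp: anc_def)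
  have "r \<in> ?C" using anc_root assms by blast
  define n where "n = Max ((\<lambda>z. length (path_to z)) ` ?C)"
  have "n \<in> (\<lambda>z. length (path_to z)) ` ?C" unfolding n_def using fin \<open>r \<in> ?C\<close> by (intro Max_in) auto
  then obtain z where z: "anc z x" "anc z y" "length (path_to z) = n" by auto
  have "anc w z" if w: "anc w x" "anc w y" for w
  proof -
    have "length (path_to w) \<le> n" unfolding n_def using fin w by (intro Max_ge) auto
    moreover have "anc w z \<or> anc z w" using anc_chain w z by blast
    moreover have "w = z" if zw: "anc z w"
    proof -
      obtain zs where "path_to w = path_to z @ zs" using zw by (auto simp: anc_prefix prefix_def)
      then have "path_to w = path_to z" using \<open>length (path_to w) \<le> n\<close> z(3) by simp
      then show ?thesis using path_to_inj anc_fst[OF zw] by blast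
    qed
    ultimately show ?thesis by blast
  qed
  then show ?thesis using z by blast
qed

definition meet :: "'v \<Rightarrow> 'v \<Rightarrow> 'v" where
  "meet x y = (SOME z. anc z x \<and> anc z y \<and> (\<forall>w. anc w x \<longrightarrow> anc w y \<longrightarrow> anc w z))"

lemma meet:
  assumes "x \<in> fst T" "y \<in> fst T"
  shows "anc (meet x y) x" "anc (meet x y) y" "anc w x \<Longrightarrow> anc w y \<Longrightarrow> anc w (meet x y)"
  using someI_ex[OF meet_ex[OF assms]] unfolding meet_def by blast+

lemma meet_commute: "x \<in> fst T \<Longrightarrow> y \<in> fst T \<Longrightarrow> meet x y = meet y x"
  by (rule anc_antisym) (simp_all add: meet)

section \<open>Paths of the tree that avoid a vertex\<close>

abbreviation conn_avoiding :: "'v \<Rightarrow> 'v \<Rightarrow> 'v \<Rightarrow> bool" where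
  "conn_avoiding v x y \<equiv> (x, y) \<in> (edge_rel T (fst T - {v}))\<^sup>*"

text \<open>Every edge joins a child to its parent, so the only way out of the part below
  \<open>v\<close> leads through \<open>v\<close>.\<close>

lemma below_separated:
  assumes "conn_avoiding v x y" "anc v x" "x \<noteq> v" shows "anc v y"
  using assms(1)
proof (induction rule: rtrancl_induct)
  case (step y z)
  then have "{y, z} \<in> snd T" "y \<noteq> v" "z \<noteq> v" by (auto simp: edge_rel_def)
  then show ?case using edge_child[of y z] anc_child step.IH by metis
qed (rule assms(2))

lemma branches_separated:
  assumes "conn_avoiding v x y" "child c v" "anc c x" shows "anc c y"
  using assms(1)
proof (induction rule: rtrancl_induct)
  case (step y z)
  then have yz: "{y, z} \<in> snd T" "y \<noteq> v" "z \<noteq> v" by (auto simp: edge_rel_def)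
  from edge_child[OF yz(1)] show ?case
  proof
    assume "child y z"
    then have "y = c \<or> anc c z" using anc_child step.IH by metis
    moreover have "y \<noteq> c" using child_parent_unique[OF assms(2)] \<open>child y z\<close> yz(3) by metis
    ultimately show ?thesis by simp
  next
    assume "child z y"
    then show ?thesis using anc_child step.IH by metis
  qed
qed (rule assms(3))

text \<open>The climb from \<open>x\<close> to its ancestor \<open>z\<close> passes only through
  vertices between them.\<close>

lemma conn_upwards:
  assumes "anc z x" "\<not> (anc z v \<and> anc v x)"
  shows "conn_avoiding v x z"
  using assms
proof (induction "length (path_to x)" arbitrary: x rule: less_induct)
  case less
  show ?case
  proof (cases "x = z")
    case False
    have x: "x \<in> fst T" using less.prems anc_fst by blast
    have "x \<noteq> r" using less.prems(1) False anc_of_root by metis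
    then obtain y where y: "child x y" using parent_ex[OF x] by blast
    then have a: "anc z y" using less.prems(1) False anc_child by metis
    have ay: "anc y x" using childD[OF y] by blast
    have len: "length (path_to y) < length (path_to x)" using y by (simp add: child_def)
    have "conn_avoiding v y z" by (rule less.hyps[OF len a]) (use less.prems(2) ay anc_trans in blast)
    moreover have "(x, y) \<in> edge_rel T (fst T - {v})"
      using y childD[OF y] less.prems a anc_refl[OF x] ay by (auto simp: edge_rel_def child_def insert_commute)
    ultimately show ?thesis by (rule converse_rtrancl_into_rtrancl[rotated])
  qed simp
qed

lemma spath_through_separator:
  assumes "spath T x p y" "\<not> conn_avoiding v x y" shows "v \<in> set p"
proof (rule ccontr)
  assume "v \<notin> set p"
  then have "set p \<subseteq> fst T - {v}" using spath_ends[OF assms(1)] by blast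
  from spath_rtrancl[OF assms(1) this] show False using assms(2) by blast
qed

text \<open>A vertex of the path above neither end would be left on both sides towards its parent,
  so its two neighbours on the path would coincide.\<close>

lemma spath_above_ends:
  assumes p: "spath T x p y" and z: "z \<in> set p"
  shows "anc z x \<or> anc z y"
proof (rule ccontr)
  assume nz: "\<not> (anc z x \<or> anc z y)"
  have fst: "x \<in> fst T" "y \<in> fst T" "z \<in> fst T" using spath_ends[OF p] z by auto
  obtain q q' where q: "p = q @ z # q'" using z by (meson split_list)
  have s: "spath T x (q @ [z]) z" "spath T z (z # q') y" using spath_append[of T x q z q' y] p q by simp_all
  have "q \<noteq> []" using s(1) nz anc_refl fst by (auto simp: spath_Cons)
  then obtain q1 a where a: "q = q1 @ [a]" by (metis rev_exhaust)
  have "q' \<noteq> []" using s(2) nz anc_refl fst by (auto simp: spath_Cons)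
  then obtain b q2 where b: "q' = b # q2" by (cases q') auto
  have d: "distinct p" using p by (simp add: spath_def)
  have "spath T x (q1 @ a # [z]) z" using s(1) a by simp
  then have sa: "spath T x (q1 @ [a]) a" "{a, z} \<in> snd T"
    using spath_append[of T x q1 a "[z]" z] by (simp_all add: spath_Cons)
  have sb: "spath T b q' y" "{z, b} \<in> snd T" using s(2) b by (auto simp: spath_Cons)
  have xa: "conn_avoiding z x a"
    by (rule spath_rtrancl[OF sa(1)]) (use spath_ends[OF sa(1)] d q a in auto)
  have na: "\<not> anc z a"
    using below_separated[OF edge_rel_rtrancl_sym[OF xa]] nz d q a by auto
  have yb: "conn_avoiding z b y"
    by (rule spath_rtrancl[OF sb(1)]) (use spath_ends[OF sb(1)] d q b in auto)
  have nb: "\<not> anc z b" using below_separated[OF yb] nz d q b by auto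
  have "child z a" using edge_child[OF sa(2)] na childD by blast
  moreover have "child z b" using edge_child[OF sb(2)] nb childD by blast
  ultimately have "a = b" by (rule child_parent_unique)
  then show False using d q a b by auto
qed

end

section \<open>Trees of balls\<close>

text \<open>Requiring the edges of \<open>T\<close> to consist of vertices of \<open>T\<close> makes
  the inverse map an isomorphism as well.\<close>

definition giso :: "('v \<Rightarrow> 'w) \<Rightarrow> 'v sgraph \<Rightarrow> 'w sgraph \<Rightarrow> bool" where
  "giso f T T' \<longleftrightarrow> bij_betw f (fst T) (fst T') \<and> snd T' = (`) f ` snd T \<and> (\<forall>e\<in>snd T. e \<subseteq> fst T)"

lemma giso_inv:
  assumes "giso f T T'" shows "giso (inv_into (fst T) f) T' T"
proof -
  have b: "bij_betw f (fst T) (fst T')" and e: "snd T' = (`) f ` snd T" and s: "\<forall>e\<in>snd T. e \<subseteq> fst T"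
    using assms by (auto simp: giso_def)
  have inj: "inj_on f (fst T)" using b by (simp add: bij_betw_def)
  have im: "f ` fst T = fst T'" using b by (simp add: bij_betw_def)
  have "inv_into (fst T) f ` f ` e = e" if "e \<in> snd T" for e
    by (rule inv_into_image_cancel[OF inj]) (use s that in blast)
  then have "snd T = (`) (inv_into (fst T) f) ` snd T'" unfolding e image_image by simp
  moreover have "\<forall>e\<in>snd T'. e \<subseteq> fst T'" unfolding e im[symmetric] using s by blast
  ultimately show ?thesis using bij_betw_inv_into[OF b] by (simp add: giso_def)
qed

lemma giso_comp: "giso f T T' \<Longrightarrow> giso g T' T'' \<Longrightarrow> giso (g \<circ> f) T T''"
  by (auto simp: giso_def bij_betw_trans image_comp[symmetric] image_image)

lemma giso_spath:
  assumes "giso f T T'" "spath T x p y"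
  shows "spath T' (f x) (map f p) (f y)"
proof -
  have f: "bij_betw f (fst T) (fst T')" "snd T' = (`) f ` snd T" using assms(1) by (auto simp: giso_def)
  have "inj_on f (set p)" using f(1) assms(2) by (auto simp: bij_betw_def spath_def intro: inj_on_subset)
  moreover have "f ` set p \<subseteq> fst T'" using f(1) assms(2) by (auto simp: bij_betw_def spath_def)
  moreover have "{map f p ! i, map f p ! Suc i} \<in> snd T'" if "Suc i < length p" for i
  proof -
    have "{p ! i, p ! Suc i} \<in> snd T" using assms(2) that by (simp add: spath_def)
    then have "f ` {p ! i, p ! Suc i} \<in> snd T'" unfolding f(2) by blast
    then show ?thesis using that by simp
  qed
  ultimately show ?thesis using assms(2)
    by (auto simp: spath_def distinct_map hd_map last_map)
qed

lemma giso_finite_tree: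
  assumes g: "giso f T T'" and t: "finite_tree T"
  shows "finite_tree T'"
proof -
  have f: "bij_betw f (fst T) (fst T')" "snd T' = (`) f ` snd T" using g by (auto simp: giso_def)
  have e: "e \<subseteq> fst T \<and> card e = 2" if "e \<in> snd T" for e using t that by (simp add: finite_tree_def)
  let ?g = "inv_into (fst T) f"
  have "\<exists>!p. spath T' x p y" if xy: "x \<in> fst T'" "y \<in> fst T'" for x y
  proof -
    have x: "?g x \<in> fst T" "f (?g x) = x" "?g y \<in> fst T" "f (?g y) = y"
      using f(1) xy by (auto simp: bij_betw_def inv_into_into f_inv_into_f)
    have "\<exists>!p. spath T (?g x) p (?g y)" using t x(1,3) by (simp add: finite_tree_def)
    then obtain p where p: "spath T (?g x) p (?g y)" "\<forall>q. spath T (?g x) q (?g y) \<longrightarrow> q = p" by (elim ex1E)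
    have "q = map f p" if q: "spath T' x q y" for q
    proof -
      have "map ?g q = p" using p(2) giso_spath[OF giso_inv[OF g] q] by blast
      moreover have "map (\<lambda>z. f (?g z)) q = map (\<lambda>z. z) q"
      proof (rule map_cong[OF refl])
        fix z assume "z \<in> set q"
        then have "z \<in> f ` fst T" using q f(1) by (auto simp: spath_def bij_betw_def)
        then show "f (?g z) = z" by (rule f_inv_into_f)
      qed
      then have "map f (map ?g q) = q" by (simp add: o_def)
      ultimately show ?thesis by simp
    qed
    moreover have "spath T' x (map f p) y" using giso_spath[OF g p(1)] x by simp
    ultimately show ?thesis by blast
  qed
  moreover have "card e' = 2 \<and> e' \<subseteq> fst T'" if "e' \<in> snd T'" for e'
  proof -
    have "e' \<in> (`) f ` snd T" using that f(2) by simp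
    then obtain e0 where "e' = f ` e0" "e0 \<in> snd T" by (elim imageE)
    moreover have "inj_on f e0" "f ` e0 \<subseteq> fst T'"
      using e[OF calculation(2)] f(1) by (auto simp: bij_betw_def intro: inj_on_subset)
    ultimately show ?thesis using e[of e0] by (simp add: card_image)
  qed
  moreover have "finite (fst T')" "fst T' \<noteq> {}"
    using t f(1) bij_betw_finite by (auto simp: finite_tree_def bij_betw_def)
  ultimately show ?thesis by (simp add: finite_tree_def)
qed

lemma giso_valency:
  assumes g: "giso f T T'" and v: "v \<in> fst T"
  shows "valency T' (f v) = valency T v"
proof -
  have f: "inj_on f (fst T)" "snd T' = (`) f ` snd T" "\<And>e. e \<in> snd T \<Longrightarrow> e \<subseteq> fst T"
    using g by (auto simp: giso_def bij_betw_def)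
  have "{e \<in> snd T'. f v \<in> e} = (`) f ` {e \<in> snd T. v \<in> e}"
  proof -
    have *: "f v \<in> f ` e \<longleftrightarrow> v \<in> e" if "e \<in> snd T" for e
      by (rule inj_on_image_mem_iff[OF f(1) v f(3)[OF that]])
    show ?thesis
    proof (intro equalityI subsetI)
      fix e' assume "e' \<in> {e \<in> snd T'. f v \<in> e}"
      then obtain e where "e' = f ` e" "e \<in> snd T" "f v \<in> f ` e" unfolding f(2) by auto
      then show "e' \<in> (`) f ` {e \<in> snd T. v \<in> e}" using *[of e] by simp
    next
      fix e' assume "e' \<in> (`) f ` {e \<in> snd T. v \<in> e}"
      then obtain e where "e' = f ` e" "e \<in> snd T" "v \<in> e" by auto
      then show "e' \<in> {e \<in> snd T'. f v \<in> e}" unfolding f(2) by simp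
    qed
  qed
  moreover have "inj_on ((`) f) {e \<in> snd T. v \<in> e}"
    using inj_on_image_Pow[OF f(1)] by (rule inj_on_subset) (use f(3) in auto)
  ultimately show ?thesis by (simp add: valency_def card_image)
qed

lemma giso_S_tree:
  assumes g: "giso f T T'" and t: "S_tree S lab T"
  shows "S_tree S (\<lambda>s. f (lab s)) T'"
proof -
  have f: "bij_betw f (fst T) (fst T')" using g by (simp add: giso_def)
  have l: "lab ` S \<subseteq> fst T" "inj_on lab S" using t by (auto simp: S_tree_def)
  have "inj_on (\<lambda>s. f (lab s)) S"
    using comp_inj_on[OF l(2), of f] f l(1) by (auto simp: bij_betw_def o_def intro: inj_on_subset)
  moreover have "(\<lambda>s. f (lab s)) ` S \<subseteq> fst T'" using l f by (auto simp: bij_betw_def)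
  moreover have "v' \<in> (\<lambda>s. f (lab s)) ` S" if v': "v' \<in> fst T'" "valency T' v' \<in> {1, 2}" for v'
  proof -
    obtain v where v: "v \<in> fst T" "v' = f v" using v'(1) f by (auto simp: bij_betw_def)
    then have "v \<in> lab ` S" using v'(2) giso_valency[OF g v(1)] t by (auto simp: S_tree_def)
    then show ?thesis using v(2) by auto
  qed
  ultimately show ?thesis using giso_finite_tree[OF g] t by (simp add: S_tree_def)
qed

text \<open>The rank decreases along \<open>par\<close>, so every vertex reaches the root. The edge
  \<open>{z, par z}\<close> is the only one that leaves the set of descendants of \<open>z\<close>,
  hence a bridge, and paths are unique by \<open>spath_unique\<close>.\<close>

lemma parent_tree:
  fixes par :: "'v \<Rightarrow> 'v" and rk :: "'v \<Rightarrow> nat"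
  assumes fin: "finite V" and r: "r \<in> V"
    and par: "\<And>x. x \<in> V \<Longrightarrow> x \<noteq> r \<Longrightarrow> par x \<in> V \<and> rk (par x) < rk x"
  shows "finite_tree (V, {{x, par x} | x. x \<in> V \<and> x \<noteq> r})"
proof -
  let ?T = "(V, {{x, par x} | x. x \<in> V \<and> x \<noteq> r})"
  have conn: "(x, r) \<in> (edge_rel ?T V)\<^sup>*" if "x \<in> V" for x
    using that
  proof (induction "rk x" arbitrary: x rule: less_induct)
    case less
    show ?case
    proof (cases "x = r")
      case False
      have "(x, par x) \<in> edge_rel ?T V" using par[OF less.prems False] less.prems False by (auto simp: edge_rel_def)
      moreover have "(par x, r) \<in> (edge_rel ?T V)\<^sup>*" using par[OF less.prems False] by (intro less.hyps) auto
      ultimately show ?thesis by (rule converse_rtrancl_into_rtrancl)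
    qed simp
  qed
  define below where "below x = {y. (y, x) \<in> {(y, par y) | y. y \<in> V \<and> y \<noteq> r}\<^sup>*}" for x
  have below_step: "z \<in> below x \<longleftrightarrow> par z \<in> below x" if z: "z \<in> V" "z \<noteq> r" "z \<noteq> x" for z x
  proof -
    have "z \<in> below x \<Longrightarrow> par z \<in> below x"
      unfolding below_def mem_Collect_eq by (erule converse_rtranclE) (use z in auto)
    moreover have "par z \<in> below x \<Longrightarrow> z \<in> below x"
      unfolding below_def mem_Collect_eq by (rule converse_rtrancl_into_rtrancl) (use z in auto)
    ultimately show ?thesis by blast
  qed
  have rk_below: "rk x \<le> rk y" if "y \<in> below x" for x y
    using that unfolding below_def mem_Collect_eq
    by (induction rule: converse_rtrancl_induct) (use par in force)+
  have bridge: "(x, y) \<notin> (edge_rel (V, snd ?T - {{x, y}}) V)\<^sup>*" if e: "{x, y} \<in> snd ?T" "x \<noteq> y" for x y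
  proof -
    obtain z where z: "{x, y} = {z, par z}" "z \<in> V" "z \<noteq> r"
      using e(1) unfolding snd_conv mem_Collect_eq by (elim exE conjE)
    have inv: "a \<in> below z \<longleftrightarrow> b \<in> below z" if "(a, b) \<in> (edge_rel (V, snd ?T - {{x, y}}) V)\<^sup>*" for a b
      using that
    proof (induction rule: rtrancl_induct)
      case (step b c)
      then have bc: "{b, c} \<in> snd ?T" "{b, c} \<noteq> {z, par z}" unfolding edge_rel_def z(1)[symmetric] by simp_all
      then obtain w where w: "{b, c} = {w, par w}" "w \<in> V" "w \<noteq> r"
        unfolding snd_conv mem_Collect_eq by (elim exE conjE)
      then have "w \<noteq> z" using bc(2) by auto
      then have "b \<in> below z \<longleftrightarrow> c \<in> below z" using below_step[OF w(2,3)] w(1) by (auto simp: doubleton_eq_iff)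
      then show ?case using step.IH by simp
    qed simp
    have "z \<in> below z" by (simp add: below_def)
    moreover have "par z \<notin> below z" using rk_below[of "par z" z] par[OF z(2,3)] by auto
    ultimately have "\<not> (x \<in> below z \<longleftrightarrow> y \<in> below z)" using z(1) by (auto simp: doubleton_eq_iff)
    then show ?thesis using inv by blast
  qed
  have "\<exists>!p. spath ?T x p y" if xy: "x \<in> V" "y \<in> V" for x y
  proof -
    have "(x, y) \<in> (edge_rel ?T V)\<^sup>*"
      using conn[OF xy(1)] edge_rel_rtrancl_sym[OF conn[OF xy(2)]] by (rule rtrancl_trans)
    then obtain p where "spath ?T x p y" by (rule rtrancl_spath) (use xy in auto)
    moreover have "p = q" if "spath ?T x p y" "spath ?T x q y" for p q
      by (rule spath_unique[OF _ that]) (use bridge in simp)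
    ultimately show ?thesis by blast
  qed
  moreover have "e \<subseteq> V \<and> card e = 2" if "e \<in> snd ?T" for e
    using that par by (auto simp: card_2_iff) (metis less_irrefl)
  ultimately show ?thesis using fin r by (auto simp: finite_tree_def)
qed

text \<open>The Hasse diagram of \<open>\<B>\<close> under inclusion, as undirected edges.\<close>

definition covers :: "'s set set \<Rightarrow> 's set set set" where
  "covers \<B> = {{b, b'} | b b'. b \<in> \<B> \<and> b' \<in> \<B> \<and> b \<subset> b' \<and> \<not> (\<exists>c\<in>\<B>. b \<subset> c \<and> c \<subset> b')}"

lemma coversI:
  assumes "b \<in> \<B>" "b' \<in> \<B>" "b \<subset> b'" "\<And>c. c \<in> \<B> \<Longrightarrow> b \<subset> c \<Longrightarrow> c \<subset> b' \<Longrightarrow> False"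
  shows "{b, b'} \<in> covers \<B>"
  unfolding covers_def mem_Collect_eq
  by (rule exI[of _ b], rule exI[of _ b']) (use assms in blast)

text \<open>In a laminar family each member other than \<open>F\<close> has a least proper superset,
  its parent. A member without label has at least two children besides its parent, so its valency is
  at least 3. The set \<open>F\<close> stands for the root \<open>L\<close>.\<close>

lemma laminar_S_tree:
  assumes fin: "finite F" and L: "L \<in> F" and sub: "\<And>b. b \<in> \<B> \<Longrightarrow> b \<subseteq> F \<and> b \<noteq> {}"
    and top: "F \<in> \<B>" and topL: "\<And>b. b \<in> \<B> \<Longrightarrow> L \<in> b \<Longrightarrow> b = F"
    and sing: "\<And>A. A \<in> F \<Longrightarrow> A \<noteq> L \<Longrightarrow> {A} \<in> \<B>"
    and lam: "\<And>b b'. b \<in> \<B> \<Longrightarrow> b' \<in> \<B> \<Longrightarrow> b \<inter> b' \<noteq> {} \<Longrightarrow> b \<subseteq> b' \<or> b' \<subseteq> b"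
  shows "S_tree F (\<lambda>A. if A = L then F else {A}) (\<B>, covers \<B>)"
proof -
  have finB: "finite \<B>" by (rule finite_subset[of _ "Pow F"]) (use sub fin in auto)
  have fb: "finite b" if "b \<in> \<B>" for b using sub[OF that] fin finite_subset by blast
  define par where "par b = \<Inter>{c\<in>\<B>. b \<subset> c}" for b
  have par_min: "par b \<in> \<B> \<and> b \<subset> par b" if b: "b \<in> \<B>" "b \<noteq> F" for b
  proof -
    have "F \<in> {c\<in>\<B>. b \<subset> c}" using top b sub by blast
    then have "{c\<in>\<B>. b \<subset> c} \<noteq> {}" by blast
    from finite_has_minimal[OF _ this] finB
    obtain c where c: "c \<in> {c\<in>\<B>. b \<subset> c}" "\<forall>d\<in>{c\<in>\<B>. b \<subset> c}. d \<subseteq> c \<longrightarrow> c = d" by auto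
    have "c \<subseteq> d" if d: "d \<in> {c\<in>\<B>. b \<subset> c}" for d
    proof -
      have "c \<inter> d \<noteq> {}" using c(1) d sub[OF b(1)] by blast
      then show ?thesis using lam[of c d] c d by blast
    qed
    then have "par b = c" using c(1) by (auto simp: par_def)
    then show ?thesis using c(1) by simp
  qed
  have par_le: "par b \<subseteq> c" if "c \<in> \<B>" "b \<subset> c" for b c using that by (auto simp: par_def)
  have cov: "covers \<B> = {{b, par b} | b. b \<in> \<B> \<and> b \<noteq> F}"
  proof (intro equalityI subsetI)
    fix e assume "e \<in> covers \<B>"
    then obtain b b' where e: "e = {b, b'}" "b \<in> \<B>" "b' \<in> \<B>" "b \<subset> b'" "\<not> (\<exists>c\<in>\<B>. b \<subset> c \<and> c \<subset> b')"
      by (auto simp: covers_def)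
    have "b \<noteq> F" using e(3,4) sub by blast
    moreover have "par b = b'" using par_min[OF e(2) \<open>b \<noteq> F\<close>] par_le[OF e(3,4)] e(5) by blast
    ultimately show "e \<in> {{b, par b} | b. b \<in> \<B> \<and> b \<noteq> F}" using e(1,2) by blast
  next
    fix e assume "e \<in> {{b, par b} | b. b \<in> \<B> \<and> b \<noteq> F}"
    then obtain b where b: "e = {b, par b}" "b \<in> \<B>" "b \<noteq> F" by blast
    have "\<not> (\<exists>c\<in>\<B>. b \<subset> c \<and> c \<subset> par b)" using par_le by blast
    then show "e \<in> covers \<B>" using b par_min[OF b(2,3)] unfolding covers_def by blast
  qed
  have "finite_tree (\<B>, covers \<B>)"
    unfolding cov
  proof (rule parent_tree[where rk = "\<lambda>b. card F - card b"])
    fix b assume b: "b \<in> \<B>" "b \<noteq> F"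
    have "card b < card (par b)" using par_min[OF b] fb by (intro psubset_card_mono) auto
    moreover have "card (par b) \<le> card F" using par_min[OF b] sub fin by (intro card_mono) auto
    ultimately show "par b \<in> \<B> \<and> card F - card (par b) < card F - card b" using par_min[OF b] by simp
  qed (use finB top in auto)
  moreover have "b \<in> (\<lambda>A. if A = L then F else {A}) ` F"
    if b: "b \<in> \<B>" and val: "valency (\<B>, covers \<B>) b \<in> {1, 2}" for b
  proof (rule ccontr)
    assume nl: "b \<notin> (\<lambda>A. if A = L then F else {A}) ` F"
    have bF: "b \<noteq> F" using nl L by auto
    then have Lb: "L \<notin> b" using topL b by blast
    \<comment> \<open>A maximal member among those that contain \<open>x\<close> and are strictly
      smaller than \<open>b\<close> is a child of \<open>b\<close>; the singleton of
      \<open>x\<close> is a candidate.\<close>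
    have sub_child: "\<exists>c\<in>\<B>. x \<in> c \<and> c \<noteq> F \<and> par c = b" if x: "x \<in> b" for x
    proof -
      have xF: "x \<in> F" "x \<noteq> L" using x sub[OF b] Lb by auto
      have "{x} \<noteq> b" using nl xF by (auto simp: image_iff)
      then have "{x} \<in> {c\<in>\<B>. x \<in> c \<and> c \<subset> b}" using sing[OF xF] x by auto
      then have "{c\<in>\<B>. x \<in> c \<and> c \<subset> b} \<noteq> {}" by blast
      from finite_has_maximal[OF _ this] finB
      obtain c where c: "c \<in> {c\<in>\<B>. x \<in> c \<and> c \<subset> b}" "\<forall>d\<in>{c\<in>\<B>. x \<in> c \<and> c \<subset> b}. c \<subseteq> d \<longrightarrow> c = d" by auto
      have cF: "c \<noteq> F" using c(1) sub[OF b] by auto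
      have "par c = b"
      proof (rule ccontr)
        assume "par c \<noteq> b"
        then have "par c \<in> {c\<in>\<B>. x \<in> c \<and> c \<subset> b}"
          using par_min[of c] par_le[of b c] c(1) b cF by blast
        then show False using c(2) par_min[of c] c(1) cF by blast
      qed
      then show ?thesis using c(1) cF by blast
    qed
    obtain x where x: "x \<in> b" using sub[OF b] by blast
    obtain c where c: "c \<in> \<B>" "x \<in> c" "c \<noteq> F" "par c = b" using sub_child[OF x] by blast
    have "c \<subset> b" using par_min[OF c(1,3)] c(4) by simp
    then obtain y where y: "y \<in> b" "y \<notin> c" by blast
    obtain d where d: "d \<in> \<B>" "y \<in> d" "d \<noteq> F" "par d = b" using sub_child[OF y(1)] by blast
    have "d \<subset> b" using par_min[OF d(1,3)] d(4) by simp
    have pb: "b \<subset> par b" using par_min[OF b bF] by simp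
    have cd: "c \<noteq> d" using y(2) d(2) by blast
    have "{{c, b}, {d, b}, {b, par b}} \<subseteq> {e \<in> covers \<B>. b \<in> e}"
      unfolding cov using b bF c d by blast
    moreover have "finite (covers \<B>)" unfolding cov using finB by simp
    ultimately have "card {{c, b}, {d, b}, {b, par b}} \<le> valency (\<B>, covers \<B>) b"
      unfolding valency_def by (intro card_mono) auto
    moreover have "c \<noteq> par b" "d \<noteq> par b" "c \<noteq> b" "d \<noteq> b"
      using \<open>c \<subset> b\<close> \<open>d \<subset> b\<close> pb by auto
    then have "card {{c, b}, {d, b}, {b, par b}} = 3"
      using cd by (simp add: doubleton_eq_iff)
    ultimately show False using val by auto
  qed
  moreover have "inj_on (\<lambda>A. if A = L then F else {A}) F"
    using L by (auto simp: inj_on_def)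
  ultimately show ?thesis using top sing by (auto simp: S_tree_def)
qed

text \<open>No ball contains \<open>L\<close>, so adjoining the set \<open>F\<close> as top element
  models the extra root, and the edge at the root becomes the covering of \<open>F - {L}\<close> by
  \<open>F\<close>.\<close>

lemma ball_tree_giso:
  assumes L: "L \<in> F" and fin: "finite F" and d: "ultrametric_on (F - {L}) d"
  shows "giso (\<lambda>b. if b = F then None else Some b)
    (insert F (closed_balls (F - {L}) d), covers (insert F (closed_balls (F - {L}) d))) (ball_tree (F - {L}) d)"
proof -
  let ?S = "F - {L}" and ?B = "closed_balls (F - {L}) d" and ?f = "\<lambda>b. if b = F then None else Some b"
  have sub: "b \<subseteq> ?S" if "b \<in> ?B" for b using that by (auto simp: closed_balls_def)
  then have nF: "F \<notin> ?B" using L by blast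
  have S: "?S \<in> ?B" if "?S \<noteq> {}"
  proof -
    obtain x where x: "x \<in> ?S" using \<open>?S \<noteq> {}\<close> by blast
    \<comment> \<open>With this radius the ball about \<open>x\<close> is all of
      \<open>F - {L}\<close>.\<close>
    define R where "R = Max (d x ` ?S)"
    have "d x y \<le> R" if "y \<in> ?S" for y unfolding R_def using fin that by (intro Max_ge) auto
    moreover have "0 \<le> d x x" using d x unfolding ultrametric_on_def by blast
    then have "0 \<le> R" using calculation[OF x] by simp
    moreover have "?S = {y\<in>?S. d x y \<le> R}" using calculation by blast
    ultimately show ?thesis unfolding closed_balls_def using x \<open>0 \<le> R\<close> by blast
  qed
  have ne: "?S \<noteq> {}" if "b \<in> ?B" for b using that by (auto simp: closed_balls_def)
  have "bij_betw ?f (insert F ?B) (insert None (Some ` ?B))"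
    using nF by (auto simp: bij_betw_def inj_on_def)
  moreover have "snd (ball_tree ?S d) = (`) ?f ` covers (insert F ?B)"
  proof (intro equalityI subsetI)
    fix e assume "e \<in> snd (ball_tree ?S d)"
    then have "(\<exists>b b'. e = {Some b, Some b'} \<and> b \<in> ?B \<and> b' \<in> ?B \<and> b \<subset> b' \<and> \<not> (\<exists>c\<in>?B. b \<subset> c \<and> c \<subset> b')) \<or>
        ?S \<noteq> {} \<and> e = {None, Some ?S}"
      unfolding ball_tree_def snd_conv Un_iff mem_Collect_eq
      by (elim disjE) (rule disjI1, assumption, rule disjI2, simp split: if_splits)
    then show "e \<in> (`) ?f ` covers (insert F ?B)"
    proof (elim disjE exE conjE)
      fix b b' assume b: "e = {Some b, Some b'}" "b \<in> ?B" "b' \<in> ?B" "b \<subset> b'" "\<not> (\<exists>c\<in>?B. b \<subset> c \<and> c \<subset> b')"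
      have "{b, b'} \<in> covers (insert F ?B)"
      proof (rule coversI)
        fix c assume c: "c \<in> insert F ?B" "b \<subset> c" "c \<subset> b'"
        have "c \<noteq> F" using c(3) sub[OF b(3)] by blast
        then show False using c b(5) by blast
      qed (use b in auto)
      moreover have "e = ?f ` {b, b'}" using b(1-3) nF by auto
      ultimately show ?thesis by (rule rev_image_eqI)
    next
      assume e: "?S \<noteq> {}" "e = {None, Some ?S}"
      have "{?S, F} \<in> covers (insert F ?B)"
      proof (rule coversI)
        fix c assume c: "c \<in> insert F ?B" "?S \<subset> c" "c \<subset> F"
        then show False using sub[of c] by blast
      qed (use S[OF e(1)] L in auto)
      moreover have "e = ?f ` {?S, F}" using e(2) L by auto
      ultimately show ?thesis by (rule rev_image_eqI)
    qed
  next
    fix e assume "e \<in> (`) ?f ` covers (insert F ?B)"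
    then obtain e0 where e0: "e = ?f ` e0" "e0 \<in> covers (insert F ?B)" by (elim imageE)
    then obtain b b' where b: "e0 = {b, b'}" "b \<in> insert F ?B" "b' \<in> insert F ?B" "b \<subset> b'"
      "\<not> (\<exists>c\<in>insert F ?B. b \<subset> c \<and> c \<subset> b')" unfolding covers_def mem_Collect_eq by (elim exE conjE)
    have "b \<noteq> F" using b(3,4) sub[of b'] by blast
    then have bB: "b \<in> ?B" "b \<noteq> F" using b(2) by auto
    show "e \<in> snd (ball_tree ?S d)"
    proof (cases "b' = F")
      case True
      have "b = ?S"
      proof (rule ccontr)
        assume "b \<noteq> ?S"
        then have "b \<subset> ?S" "?S \<subset> b'" using sub[OF bB(1)] True L by auto
        then show False using b(5) S[OF ne[OF bB(1)]] by blast
      qed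
      then show ?thesis using e0(1) b(1) True bB ne[OF bB(1)] by (simp add: ball_tree_def insert_commute)
    next
      case False
      then have "b' \<in> ?B" using b(3) by blast
      moreover have "e = {Some b, Some b'}" using e0(1) b(1) bB False by simp
      moreover have "\<not> (\<exists>c\<in>?B. b \<subset> c \<and> c \<subset> b')" using b(5) by blast
      ultimately show ?thesis using bB(1) b(4) unfolding ball_tree_def snd_conv by blast
    qed
  qed
  moreover have "\<forall>e\<in>covers (insert F ?B). e \<subseteq> insert F ?B" by (auto simp: covers_def)
  ultimately show ?thesis by (simp add: giso_def ball_tree_def)
qed

section \<open>Convex hulls of leaves\<close>

locale branch_tree = rooted_tree T "\<beta> L" for T :: "'v sgraph" and \<beta> :: "'f \<Rightarrow> 'v" and L :: 'f +
  fixes F :: "'f set"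
  assumes finF: "finite F" and LF: "L \<in> F" and inj: "inj_on \<beta> F" and \<beta>T: "A \<in> F \<Longrightarrow> \<beta> A \<in> fst T"
    and leaf: "A \<in> F \<Longrightarrow> {\<beta> A, x} \<in> snd T \<Longrightarrow> {\<beta> A, y} \<in> snd T \<Longrightarrow> x = y"
begin

abbreviation C :: "'v sgraph" where "C \<equiv> convex_hull T (\<beta> ` F)"

definition below :: "'v \<Rightarrow> 'f set" where "below x = {A\<in>F. anc x (\<beta> A)}"

text \<open>A vertex strictly below \<open>\<beta> A\<close> would give it a child besides its
  parent, hence two neighbours.\<close>

lemma leaf_below:
  assumes A: "A \<in> F" "A \<noteq> L" and a: "anc (\<beta> A) x" shows "x = \<beta> A"
proof (rule ccontr)
  assume "x \<noteq> \<beta> A"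
  then obtain c where c: "child c (\<beta> A)" using child_towards[OF a] by metis
  have "\<beta> A \<noteq> \<beta> L" using A LF inj by (meson inj_onD)
  then obtain v where v: "child (\<beta> A) v" using parent_ex[OF \<beta>T[OF A(1)]] by blast
  have "{\<beta> A, c} \<in> snd T" "{\<beta> A, v} \<in> snd T" using c v by (auto simp: child_def insert_commute)
  then have "c = v" by (rule leaf[OF A(1)])
  then show False using childD[OF c] childD[OF v] anc_antisym by blast
qed

lemma root_child_unique: "child c (\<beta> L) \<Longrightarrow> child c' (\<beta> L) \<Longrightarrow> c = c'"
  using leaf[OF LF] by (auto simp: child_def)

lemma anc_antisym_ne: "anc x y \<Longrightarrow> x \<noteq> y \<Longrightarrow> \<not> anc y x"
  using anc_antisym by blast

text \<open>Every vertex of a path lies above one of its ends; conversely the root is itself a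
  branch, so the root paths of the branches belong to the hull.\<close>

lemma conv_vertices: "fst C = {x. \<exists>A\<in>F. anc x (\<beta> A)}"
proof (intro equalityI subsetI)
  fix x assume "x \<in> fst C"
  then obtain p a b where p: "a \<in> \<beta> ` F" "b \<in> \<beta> ` F" "spath T a p b" "x \<in> set p"
    unfolding convex_hull_def by auto
  then show "x \<in> {x. \<exists>A\<in>F. anc x (\<beta> A)}" using spath_above_ends[OF p(3,4)] by auto
next
  fix x assume "x \<in> {x. \<exists>A\<in>F. anc x (\<beta> A)}"
  then obtain A where A: "A \<in> F" "x \<in> set (path_to (\<beta> A))" by (auto simp: anc_def)
  have "spath T (\<beta> L) (path_to (\<beta> A)) (\<beta> A)" by (rule path_to[OF \<beta>T[OF A(1)]])
  then have "set (path_to (\<beta> A)) \<in> {set p | p. \<exists>x\<in>\<beta> ` F. \<exists>y\<in>\<beta> ` F. spath T x p y}" using A(1) LF by blast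
  then show "x \<in> fst C" unfolding convex_hull_def fst_conv using A(2) by (rule UnionI)
qed

lemma conv_fst: "fst C \<subseteq> fst T"
  unfolding conv_vertices using anc_fst by blast

lemma conv_up: "x \<in> fst C \<Longrightarrow> anc y x \<Longrightarrow> y \<in> fst C"
  unfolding conv_vertices using anc_trans by blast

lemma conv_leaf: "A \<in> F \<Longrightarrow> \<beta> A \<in> fst C"
  unfolding conv_vertices using anc_refl[OF \<beta>T] by blast

lemma finite_conv: "finite (fst C)"
proof -
  have "fst C \<subseteq> (\<Union>A\<in>F. set (path_to (\<beta> A)))" unfolding conv_vertices by (auto simp: anc_def)
  then show ?thesis by (rule finite_subset) (use finF in auto)
qed

lemma conv_edges: "snd C = {{v, x} | v x. child x v \<and> x \<in> fst C}"
proof (intro equalityI subsetI)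
  fix e assume "e \<in> snd C"
  then obtain p i a b where p: "e = {p ! i, p ! Suc i}" "Suc i < length p" "a \<in> \<beta> ` F" "b \<in> \<beta> ` F" "spath T a p b"
    unfolding convex_hull_def snd_conv mem_Collect_eq by (elim exE conjE bexE)
  have "set p \<subseteq> fst C" using p(3-5) unfolding convex_hull_def fst_conv by blast
  then have "p ! i \<in> fst C" "p ! Suc i \<in> fst C" using p(2) by auto
  moreover have "{p ! i, p ! Suc i} \<in> snd T" using p(2,5) by (simp add: spath_def)
  ultimately show "e \<in> {{v, x} | v x. child x v \<and> x \<in> fst C}"
    using edge_child[of "p ! i" "p ! Suc i"] p(1) by (auto simp: insert_commute)
next
  fix e assume "e \<in> {{v, x} | v x. child x v \<and> x \<in> fst C}"
  then obtain v x where e: "e = {v, x}" "child x v" "x \<in> fst C" by blast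
  obtain A where A: "A \<in> F" "anc x (\<beta> A)" using e(3) unfolding conv_vertices by blast
  obtain zs where zs: "path_to (\<beta> A) = path_to x @ zs" using A(2) by (auto simp: anc_prefix prefix_def)
  have v: "v \<in> fst T" using childD[OF e(2)] by blast
  obtain q where q: "path_to v = q @ [v]"
    using path_to[OF v] last_path_to[OF v] by (metis append_butlast_last_id not_spath_Nil)
  have pA: "path_to (\<beta> A) = q @ v # x # zs" using zs q e(2) by (simp add: child_def)
  have "e = {path_to (\<beta> A) ! length q, path_to (\<beta> A) ! Suc (length q)}"
    unfolding pA e(1) by (simp add: nth_append)
  moreover have "Suc (length q) < length (path_to (\<beta> A))" by (simp add: pA)
  moreover have "\<exists>x\<in>\<beta> ` F. \<exists>y\<in>\<beta> ` F. spath T x (path_to (\<beta> A)) y"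
    using path_to[OF \<beta>T[OF A(1)]] A(1) LF by blast
  ultimately show "e \<in> snd C" unfolding convex_hull_def snd_conv by blast
qed

lemma conv_edgeI: "{a, b} \<in> snd T \<Longrightarrow> a \<in> fst C \<Longrightarrow> b \<in> fst C \<Longrightarrow> {a, b} \<in> snd C"
proof -
  assume e: "{a, b} \<in> snd T" "a \<in> fst C" "b \<in> fst C"
  from edge_child[OF e(1)] show "{a, b} \<in> snd C"
    unfolding conv_edges using e(2,3) insert_commute[of a b "{}"] by blast
qed

section \<open>Valencies in the hull and the vertices kept by smoothing\<close>

definition children :: "'v \<Rightarrow> 'v set" where "children v = {c\<in>fst C. child c v}"

lemma finite_children: "finite (children v)"
  unfolding children_def using finite_conv by simp

lemma conv_valency:
  assumes v: "v \<in> fst C"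
  shows "valency C v = card (children v) + (if v = \<beta> L then 0 else 1)"
proof -
  have vT: "v \<in> fst T" using v conv_fst by blast
  have inj1: "inj_on (\<lambda>c. {v, c}) (children v)" by (auto simp: inj_on_def doubleton_eq_iff)
  have down: "{e \<in> snd C. v \<in> e} = (\<lambda>c. {v, c}) ` children v \<union> {{w, v} | w. child v w}"
    using v unfolding conv_edges children_def by (auto simp: doubleton_eq_iff)
  show ?thesis
  proof (cases "v = \<beta> L")
    case True
    then have "\<not> child v w" for w using childD anc_of_root by metis
    then have "{e \<in> snd C. v \<in> e} = (\<lambda>c. {v, c}) ` children v" using down by blast
    then show ?thesis unfolding valency_def using card_image[OF inj1] True by simp
  next
    case False
    then obtain w where w: "child v w" using parent_ex[OF vT] by blast
    then have "{{w, v} | w. child v w} = {{w, v}}" using child_parent_unique by blast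
    moreover have "{w, v} \<notin> (\<lambda>c. {v, c}) ` children v"
      using childD[OF w] anc_antisym childD by (auto simp: children_def doubleton_eq_iff)
    ultimately show ?thesis using down False
      by (simp add: valency_def card_image[OF inj1] finite_children)
  qed
qed

definition W :: "'v set" where "W = {v\<in>fst C. v \<in> \<beta> ` F \<or> valency C v \<noteq> 2}"

text \<open>A vertex of the hull that is not a branch has one parent and at least one child; valency
  different from 2 thus means two children.\<close>

lemma W_iff: "v \<in> W \<longleftrightarrow> v \<in> fst C \<and> (v \<in> \<beta> ` F \<or> (\<exists>c\<in>children v. \<exists>c'\<in>children v. c \<noteq> c'))"
proof (cases "v \<in> fst C \<and> v \<notin> \<beta> ` F")
  case True
  then have v: "v \<in> fst C" "v \<noteq> \<beta> L" using LF by auto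
  obtain A where A: "A \<in> F" "anc v (\<beta> A)" using v(1) unfolding conv_vertices by blast
  have "v \<noteq> \<beta> A" using True A(1) by auto
  then obtain c where "child c v" "anc c (\<beta> A)" using child_towards[OF A(2)] by blast
  then have c: "c \<in> children v" using A(1) unfolding children_def conv_vertices by blast
  have "card (children v) = 1 \<longleftrightarrow> \<not> (\<exists>c\<in>children v. \<exists>c'\<in>children v. c \<noteq> c')"
    using c by (auto simp: card_1_singleton_iff)
  then show ?thesis using True conv_valency[OF v(1)] v(2) by (simp add: W_def)
qed (auto simp: W_def)

lemma W_conv: "x \<in> W \<Longrightarrow> x \<in> fst C"
  by (simp add: W_def)

lemma W_leaf: "A \<in> F \<Longrightarrow> \<beta> A \<in> W"
  using conv_leaf by (simp add: W_def)

lemma branching: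
  assumes x: "x \<in> fst C" and y: "y \<in> fst C" and m: "meet x y \<noteq> x" "meet x y \<noteq> y"
  obtains c c' where "c \<in> children (meet x y)" "c' \<in> children (meet x y)" "c \<noteq> c'" "anc c x" "anc c' y"
    "\<not> anc c y" "\<not> anc c' x"
proof -
  have xy: "x \<in> fst T" "y \<in> fst T" using x y conv_fst by auto
  note mm = meet[OF xy]
  obtain c where c: "child c (meet x y)" "anc c x" using child_towards[OF mm(1) m(1)] by blast
  obtain c' where c': "child c' (meet x y)" "anc c' y" using child_towards[OF mm(2) m(2)] by blast
  have n: "\<not> anc d (meet x y)" if "child d (meet x y)" for d using childD[OF that] anc_antisym by blast
  have "\<not> anc c y" "\<not> anc c' x" using mm(3) n c c' by blast+
  then show thesis using that[of c c'] c c' x y conv_up unfolding children_def by blast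
qed

lemma meet_in_W:
  assumes "x \<in> W" "y \<in> W" shows "meet x y \<in> W"
proof (cases "meet x y = x \<or> meet x y = y")
  case False
  have xy: "x \<in> fst C" "y \<in> fst C" using assms W_conv by auto
  have "meet x y \<in> fst C" using xy conv_up meet(1) conv_fst by blast
  moreover obtain c c' where "c \<in> children (meet x y)" "c' \<in> children (meet x y)" "c \<noteq> c'"
    by (rule branching[OF xy]) (use False in auto)
  ultimately show ?thesis unfolding W_iff by blast
qed (use assms in auto)

text \<open>Two different children of \<open>x\<close> lead to branches whose lowest common ancestor
  is \<open>x\<close>; a branch is its own meet.\<close>

lemma W_is_meet:
  assumes x: "x \<in> W" "x \<noteq> \<beta> L"
  shows "\<exists>A\<in>F - {L}. \<exists>B\<in>F - {L}. x = meet (\<beta> A) (\<beta> B)"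
proof (cases "x \<in> \<beta> ` F")
  case True
  then obtain A where A: "A \<in> F" "x = \<beta> A" by blast
  then have "meet (\<beta> A) (\<beta> A) = x" using meet[OF \<beta>T \<beta>T] anc_refl[OF \<beta>T] anc_antisym by blast
  then show ?thesis using A x(2) by blast
next
  case False
  then obtain c c' where c: "c \<in> children x" "c' \<in> children x" "c \<noteq> c'" using x(1) unfolding W_iff by blast
  have ex: "\<exists>A\<in>F - {L}. anc d (\<beta> A)" if d: "d \<in> children x" for d
  proof -
    obtain A where A: "A \<in> F" "anc d (\<beta> A)" using d unfolding children_def conv_vertices by blast
    have "A \<noteq> L" using A(2) d childD[of d x] anc_of_root x(2) unfolding children_def by blast
    then show ?thesis using A by blast
  qed
  obtain A B where AB: "A \<in> F - {L}" "anc c (\<beta> A)" "B \<in> F - {L}" "anc c' (\<beta> B)" using ex c by blast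
  have ch: "child c x" "child c' x" using c by (auto simp: children_def)
  have T: "\<beta> A \<in> fst T" "\<beta> B \<in> fst T" using AB \<beta>T by auto
  note mm = meet[OF T]
  have xm: "anc x (meet (\<beta> A) (\<beta> B))" using mm(3) AB(2,4) ch childD anc_trans by blast
  have "x = meet (\<beta> A) (\<beta> B)"
  proof (rule ccontr)
    assume "x \<noteq> meet (\<beta> A) (\<beta> B)"
    then obtain d where d: "child d x" "anc d (meet (\<beta> A) (\<beta> B))" using child_towards[OF xm] by blast
    have "anc d (\<beta> A)" "anc d (\<beta> B)" using d(2) mm(1,2) anc_trans by blast+
    then have "d = c" "d = c'" using child_towards_unique[OF d(1)] ch AB(2,4) by blast+
    then show False using c(3) by simp
  qed
  then show ?thesis using AB by blast
qed

lemma below_mono: "anc y x \<Longrightarrow> below x \<subseteq> below y"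
  unfolding below_def using anc_trans by blast

text \<open>If \<open>y\<close> is a branch, it is itself the additional one. Otherwise
  \<open>y\<close> has a second child, and the branches below that child are not below
  \<open>x\<close>.\<close>

lemma below_strict:
  assumes a: "anc y x" "y \<noteq> x" and y: "y \<in> W"
  shows "below x \<subset> below y"
proof -
  have "\<exists>A\<in>F. anc y (\<beta> A) \<and> \<not> anc x (\<beta> A)"
  proof (cases "y \<in> \<beta> ` F")
    case True
    then show ?thesis using anc_antisym_ne[OF a] anc_refl anc_fst[OF a(1)] by auto
  next
    case False
    then obtain c c' where c: "c \<in> children y" "c' \<in> children y" "c \<noteq> c'" using y unfolding W_iff by blast
    obtain d where d: "child d y" "anc d x" using child_towards[OF a] by blast
    have "\<exists>c\<in>children y. c \<noteq> d" using c by (cases "c = d") auto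
    then obtain c where c: "c \<in> children y" "c \<noteq> d" by blast
    obtain A where A: "A \<in> F" "anc c (\<beta> A)" using c(1) unfolding children_def conv_vertices by blast
    have ch: "child c y" using c(1) by (simp add: children_def)
    have "\<not> anc x (\<beta> A)" using child_towards_unique[OF ch d(1) A(2)] d(2) anc_trans c(2) by blast
    then show ?thesis using A ch childD anc_trans by blast
  qed
  then show ?thesis using below_mono[OF a(1)] unfolding below_def by blast
qed

lemma below_nonempty: "x \<in> fst C \<Longrightarrow> below x \<noteq> {}"
  unfolding below_def conv_vertices by blast

lemma below_subset_iff:
  assumes "x \<in> W" "y \<in> W"
  shows "below x \<subseteq> below y \<longleftrightarrow> anc y x"
proof
  assume s: "below x \<subseteq> below y"
  obtain A where "A \<in> below x" using below_nonempty W_conv assms(1) by blast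
  then have "anc x (\<beta> A)" "anc y (\<beta> A)" using s unfolding below_def by blast+
  then have "anc y x \<or> anc x y" using anc_chain by blast
  moreover have "x = y" if "anc x y" using below_strict[OF that _ assms(1)] s by blast
  ultimately show "anc y x" using anc_refl anc_fst by blast
qed (rule below_mono)

lemma below_psubset_iff:
  assumes "x \<in> W" "y \<in> W"
  shows "below x \<subset> below y \<longleftrightarrow> anc y x \<and> x \<noteq> y"
  using below_subset_iff[OF assms] below_strict[of y x] assms(2) by blast

lemma below_inj: "inj_on below W"
  by (rule inj_onI) (metis anc_antisym below_subset_iff order_refl)

text \<open>The path from \<open>x\<close> up to its ancestor \<open>y\<close> consists exactly of
  the vertices between them.\<close>

lemma smoothing_edge_iff:
  assumes xy: "x \<in> W" "y \<in> W" and a: "anc y x" "x \<noteq> y"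
  shows "(\<exists>p. spath C x p y \<and> set p \<inter> W = {x, y}) \<longleftrightarrow> \<not> (\<exists>z\<in>W. anc y z \<and> anc z x \<and> z \<noteq> x \<and> z \<noteq> y)"
proof
  assume "\<exists>p. spath C x p y \<and> set p \<inter> W = {x, y}"
  then obtain p where p: "spath C x p y" "set p \<inter> W = {x, y}" by blast
  have pT: "spath T x p y" using p(1) conv_fst edge_child unfolding spath_def conv_edges child_def by (auto simp: insert_commute)
  show "\<not> (\<exists>z\<in>W. anc y z \<and> anc z x \<and> z \<noteq> x \<and> z \<noteq> y)"
  proof
    assume "\<exists>z\<in>W. anc y z \<and> anc z x \<and> z \<noteq> x \<and> z \<noteq> y"
    then obtain z where z: "z \<in> W" "anc y z" "anc z x" "z \<noteq> x" "z \<noteq> y" by blast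
    have "\<not> conn_avoiding z x y" using below_separated[where v = z and x = x and y = y] z anc_antisym by blast
    then have "z \<in> set p" by (rule spath_through_separator[OF pT])
    then show False using p(2) z by blast
  qed
next
  assume nz: "\<not> (\<exists>z\<in>W. anc y z \<and> anc z x \<and> z \<noteq> x \<and> z \<noteq> y)"
  have T: "x \<in> fst T" "y \<in> fst T" using anc_fst[OF a(1)] by auto
  obtain q q' where q: "path_to x = q @ y # q'" using a(1) unfolding anc_def by (meson split_list)
  have s: "spath T y (y # q') x" "spath T (\<beta> L) (q @ [y]) y" using spath_append[of T "\<beta> L" q y q' x] path_to[OF T(1)] q by simp_all
  have between: "anc y z \<and> anc z x" if z: "z \<in> set (y # q')" for z
  proof -
    have zx: "anc z x" using z q T(1) by (auto simp: anc_def)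
    moreover have "z = y" if "anc z y"
    proof -
      have "z \<in> set (q @ [y])" using that path_to_eq[OF s(2)] by (simp add: anc_def)
      moreover have "distinct (q @ y # q')" using path_to[OF T(1)] q by (simp add: spath_def)
      ultimately show ?thesis using z by auto
    qed
    ultimately show ?thesis using anc_chain[OF a(1) zx] anc_refl[OF T(2)] by blast
  qed
  have "set (y # q') \<subseteq> fst C" using between conv_up W_conv[OF xy(1)] by blast
  moreover have "{(y # q') ! i, (y # q') ! Suc i} \<in> snd C" if i: "Suc i < length (y # q')" for i
  proof -
    have "{(y # q') ! i, (y # q') ! Suc i} \<in> snd T" using s(1) i unfolding spath_def by blast
    moreover have "(y # q') ! i \<in> set (y # q')" "(y # q') ! Suc i \<in> set (y # q')" by (rule nth_mem, use i in simp)+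
    ultimately show ?thesis using conv_edgeI \<open>set (y # q') \<subseteq> fst C\<close> by blast
  qed
  ultimately have "spath C y (y # q') x" using s(1) unfolding spath_def by blast
  then have "spath C x (rev (y # q')) y" by (rule spath_rev)
  moreover have "set (rev (y # q')) \<inter> W = {x, y}"
    using between nz xy spath_ends[OF s(1)] by auto
  ultimately show "\<exists>p. spath C x p y \<and> set p \<inter> W = {x, y}" by blast
qed

text \<open>The path between incomparable vertices passes through their meet, which has two children
  and so is kept.\<close>

lemma smoothing_comparable:
  assumes xy: "x \<in> W" "y \<in> W" and p: "spath C x p y" "set p \<inter> W = {x, y}"
  shows "anc y x \<or> anc x y"
proof (rule ccontr)
  assume n: "\<not> (anc y x \<or> anc x y)"
  have T: "x \<in> fst T" "y \<in> fst T" "x \<in> fst C" "y \<in> fst C" using xy W_conv conv_fst by blast+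
  have m: "meet x y \<noteq> x" "meet x y \<noteq> y" using meet[OF T(1,2)] n by metis+
  obtain c where c: "c \<in> children (meet x y)" "anc c x" "\<not> anc c y" by (rule branching[OF T(3,4) m])
  have pT: "spath T x p y" using p(1) conv_fst edge_child unfolding spath_def conv_edges child_def by (auto simp: insert_commute)
  have "\<not> conn_avoiding (meet x y) x y" using branches_separated[where v = "meet x y" and x = x and y = y and c = c] c by (auto simp: children_def)
  then have "meet x y \<in> set p" by (rule spath_through_separator[OF pT])
  then show False using p(2) m meet_in_W[OF xy] by blast
qed

text \<open>Edges of the smoothed hull join consecutive kept vertices of the ancestor order, and
  \<open>below\<close> reverses this order into inclusion.\<close>

lemma smoothing_giso: "giso below (smoothing (\<beta> ` F) C) (below ` W, covers (below ` W))"
proof -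
  have sm: "smoothing (\<beta> ` F) C = (W, {{x, y} | x y. x \<noteq> y \<and> x \<in> W \<and> y \<in> W \<and> (\<exists>p. spath C x p y \<and> set p \<inter> W = {x, y})})"
    by (simp add: smoothing_def W_def Let_def)
  have edge: "below ` {x, y} \<in> covers (below ` W)"
    if xy: "x \<in> W" "y \<in> W" "x \<noteq> y" "anc y x" and p: "\<exists>p. spath C x p y \<and> set p \<inter> W = {x, y}" for x y
  proof -
    have "{below x, below y} \<in> covers (below ` W)"
    proof (rule coversI)
      show "below x \<subset> below y" using below_psubset_iff[OF xy(1,2)] xy by simp
      fix b assume b: "b \<in> below ` W" "below x \<subset> b" "b \<subset> below y"
      obtain z where z: "b = below z" "z \<in> W" using b(1) by (rule imageE)
      have "anc z x \<and> x \<noteq> z" "anc y z \<and> z \<noteq> y"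
        using b(2,3) below_psubset_iff[OF xy(1) z(2)] below_psubset_iff[OF z(2) xy(2)] unfolding z(1) by simp_all
      moreover have "\<not> (\<exists>z\<in>W. anc y z \<and> anc z x \<and> z \<noteq> x \<and> z \<noteq> y)"
        using smoothing_edge_iff[OF xy(1,2,4,3)] p by (rule iffD1)
      ultimately show False using z(2) by metis
    qed (use xy in auto)
    then show ?thesis by simp
  qed
  have "covers (below ` W) = (`) below ` snd (smoothing (\<beta> ` F) C)"
  proof (intro equalityI subsetI)
    fix e assume "e \<in> covers (below ` W)"
    then obtain b b' where b: "e = {b, b'}" "b \<in> below ` W" "b' \<in> below ` W" "b \<subset> b'" "\<not> (\<exists>c\<in>below ` W. b \<subset> c \<and> c \<subset> b')"
      unfolding covers_def mem_Collect_eq by (elim exE conjE)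
    obtain x where x: "b = below x" "x \<in> W" using b(2) by (rule imageE)
    obtain y where y: "b' = below y" "y \<in> W" using b(3) by (rule imageE)
    note xy = x(2) y(2) x(1) y(1)
    have a: "anc y x" "x \<noteq> y" using b(4) below_psubset_iff[OF xy(1,2)] by (simp_all add: xy(3,4))
    have "\<not> (\<exists>z\<in>W. anc y z \<and> anc z x \<and> z \<noteq> x \<and> z \<noteq> y)"
    proof
      assume "\<exists>z\<in>W. anc y z \<and> anc z x \<and> z \<noteq> x \<and> z \<noteq> y"
      then obtain z where z: "z \<in> W" "anc y z" "anc z x" "z \<noteq> x" "z \<noteq> y" by (elim bexE conjE)
      have "below x \<subset> below z" "below z \<subset> below y"
        using below_psubset_iff[OF xy(1) z(1)] below_psubset_iff[OF z(1) xy(2)] z by simp_all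
      moreover have "below z \<in> below ` W" using z(1) by (rule imageI)
      ultimately show False using b(5) unfolding xy(3,4) by (meson bexI)
    qed
    then have "\<exists>p. spath C x p y \<and> set p \<inter> W = {x, y}" using smoothing_edge_iff[OF xy(1,2) a] by (rule iffD2[rotated])
    with xy(1,2) a(2) have "{x, y} \<in> snd (smoothing (\<beta> ` F) C)" unfolding sm snd_conv mem_Collect_eq
      by (intro exI[of _ x] exI[of _ y] conjI refl)
    moreover have "e = below ` {x, y}" using b(1) xy(3,4) by simp
    ultimately show "e \<in> (`) below ` snd (smoothing (\<beta> ` F) C)" by (rule rev_image_eqI)
  next
    fix e assume "e \<in> (`) below ` snd (smoothing (\<beta> ` F) C)"
    then obtain e0 where e0: "e = below ` e0" "e0 \<in> snd (smoothing (\<beta> ` F) C)" by (elim imageE)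
    then obtain x y p where xy: "e0 = {x, y}" "x \<noteq> y" "x \<in> W" "y \<in> W"
      and p: "spath C x p y" "set p \<inter> W = {x, y}"
      unfolding sm snd_conv mem_Collect_eq by (elim exE conjE)
    from p have ex: "\<exists>p. spath C x p y \<and> set p \<inter> W = {x, y}" by (intro exI[of _ p] conjI)
    from smoothing_comparable[OF xy(3,4) p] show "e \<in> covers (below ` W)"
    proof
      assume "anc y x"
      then show ?thesis using edge[OF xy(3,4,2) _ ex] e0(1) xy(1) by simp
    next
      assume a: "anc x y"
      have "spath C y (rev p) x" "set (rev p) \<inter> W = {y, x}" using spath_rev[OF p(1)] p(2) by auto
      then have "\<exists>p. spath C y p x \<and> set p \<inter> W = {y, x}" by (intro exI[of _ "rev p"] conjI)
      from edge[OF xy(4,3) xy(2)[symmetric] a this] show ?thesis unfolding e0(1) xy(1) by (simp add: insert_commute)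
    qed
  qed
  moreover have "bij_betw below W (below ` W)" using below_inj by (simp add: bij_betw_def)
  ultimately show ?thesis unfolding giso_def by (auto simp: sm)
qed

lemma below_root: "below (\<beta> L) = F"
  unfolding below_def using anc_root \<beta>T by blast

lemma below_leaf: "A \<in> F \<Longrightarrow> A \<noteq> L \<Longrightarrow> below (\<beta> A) = {A}"
  unfolding below_def using leaf_below anc_refl[OF \<beta>T] inj by (auto dest: inj_onD)

lemma below_S_tree: "S_tree F (\<lambda>A. if A = L then F else {A}) (below ` W, covers (below ` W))"
proof (rule laminar_S_tree[OF finF LF])
  show "F \<in> below ` W" using below_root W_leaf[OF LF] by (metis imageI)
  show "\<And>b. b \<in> below ` W \<Longrightarrow> b \<subseteq> F \<and> b \<noteq> {}" using below_nonempty W_conv by (auto simp: below_def)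
  show "\<And>A. A \<in> F \<Longrightarrow> A \<noteq> L \<Longrightarrow> {A} \<in> below ` W" using below_leaf W_leaf by (metis imageI)
  fix b assume "b \<in> below ` W"
  then obtain x where x: "b = below x" "x \<in> W" by blast
  show "b = F" if "L \<in> b" using that x(1) anc_of_root below_root unfolding below_def by auto
  fix b' assume "b' \<in> below ` W" "b \<inter> b' \<noteq> {}"
  then obtain y A where y: "b' = below y" "A \<in> below x" "A \<in> below y" using x(1) by blast
  then have "anc x y \<or> anc y x" using anc_chain unfolding below_def by blast
  then show "b \<subseteq> b' \<or> b' \<subseteq> b" using below_mono x(1) y(1) by blast
qed

end

section \<open>The ultrametric of a weighted tree\<close>

text \<open>In the main application \<open>p A B\<close> is the intersection number of two branches,
  \<open>h v A\<close> and \<open>c v\<close> are the Green values \<open>green v (on A)\<close> and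
  \<open>green v v\<close>, and \<open>orig\<close> holds for the vertices of the dual graph.
  Brick-vertices carry no weight; their valency is bounded instead.\<close>

locale weighted_branch_tree = branch_tree T \<beta> L F for T :: "'v sgraph" and \<beta> :: "'f \<Rightarrow> 'v" and L and F +
  fixes orig :: "'v \<Rightarrow> bool" and p :: "'f \<Rightarrow> 'f \<Rightarrow> real" and h :: "'v \<Rightarrow> 'f \<Rightarrow> real" and c :: "'v \<Rightarrow> real"
  assumes edge_orig: "{x, y} \<in> snd T \<Longrightarrow> orig x \<or> orig y"
    and few: "v \<in> fst (convex_hull T (\<beta> ` F)) \<Longrightarrow> \<not> orig v \<Longrightarrow> valency (convex_hull T (\<beta> ` F)) v < 4"
    and p_sym: "A \<in> F \<Longrightarrow> B \<in> F \<Longrightarrow> A \<noteq> B \<Longrightarrow> p A B = p B A"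
    and p_pos: "A \<in> F \<Longrightarrow> B \<in> F \<Longrightarrow> A \<noteq> B \<Longrightarrow> 0 < p A B"
    and c_pos: "v \<in> fst T \<Longrightarrow> orig v \<Longrightarrow> v \<notin> \<beta> ` F \<Longrightarrow> 0 < c v"
    and h_pos: "v \<in> fst T \<Longrightarrow> orig v \<Longrightarrow> v \<notin> \<beta> ` F \<Longrightarrow> A \<in> F \<Longrightarrow> 0 < h v A"
    and h_le: "v \<in> fst T \<Longrightarrow> orig v \<Longrightarrow> v \<notin> \<beta> ` F \<Longrightarrow> A \<in> F \<Longrightarrow> B \<in> F \<Longrightarrow> A \<noteq> B \<Longrightarrow>
      h v A * h v B \<le> c v * p A B"
    and h_eq: "v \<in> fst T \<Longrightarrow> orig v \<Longrightarrow> v \<notin> \<beta> ` F \<Longrightarrow> A \<in> F \<Longrightarrow> B \<in> F \<Longrightarrow> A \<noteq> B \<Longrightarrow>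
      h v A * h v B = c v * p A B \<longleftrightarrow> (\<beta> A, \<beta> B) \<notin> (edge_rel T (fst T - {v}))\<^sup>*"
begin

definition u :: "'f \<Rightarrow> 'f \<Rightarrow> real" where
  "u A B = (if A = B then 0 else p L A * p L B / p A B)"

lemma u_sym: "A \<in> F \<Longrightarrow> B \<in> F \<Longrightarrow> u A B = u B A"
  by (simp add: u_def p_sym[of A B])

lemma u_pos: "A \<in> F - {L} \<Longrightarrow> B \<in> F - {L} \<Longrightarrow> A \<noteq> B \<Longrightarrow> 0 < u A B"
  using p_pos[OF LF] p_pos[of A B] by (auto simp: u_def intro!: divide_pos_pos mult_pos_pos)

lemma anc_leaf_eq: "A \<in> F - {L} \<Longrightarrow> B \<in> F \<Longrightarrow> anc (\<beta> A) (\<beta> B) \<Longrightarrow> A = B"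
  using leaf_below[of A "\<beta> B"] inj by (auto dest: inj_onD)

text \<open>If the meet were the root, both branches would lie below the only child of the root;
  below any other branch there is no second vertex.\<close>

lemma meet_not_leaf:
  assumes A: "A \<in> F - {L}" and B: "B \<in> F - {L}" and ne: "A \<noteq> B"
  shows "meet (\<beta> A) (\<beta> B) \<notin> \<beta> ` F"
proof
  have T: "\<beta> A \<in> fst T" "\<beta> B \<in> fst T" using A B \<beta>T by auto
  note m = meet[OF T]
  assume "meet (\<beta> A) (\<beta> B) \<in> \<beta> ` F"
  then obtain D where D: "D \<in> F" "meet (\<beta> A) (\<beta> B) = \<beta> D" by auto
  show False
  proof (cases "D = L")
    case True
    have AL: "\<beta> L \<noteq> \<beta> A" "\<beta> L \<noteq> \<beta> B" using A B LF inj by (auto dest: inj_onD)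
    obtain d where d: "child d (\<beta> L)" "anc d (\<beta> A)" using child_towards[OF anc_root[OF T(1)] AL(1)] by blast
    obtain e where e: "child e (\<beta> L)" "anc e (\<beta> B)" using child_towards[OF anc_root[OF T(2)] AL(2)] by blast
    have "d = e" by (rule root_child_unique[OF d(1) e(1)])
    then have "anc d (\<beta> L)" using m(3)[OF d(2)] e(2) D(2) True by simp
    then show False using anc_of_root childD[OF d(1)] by metis
  next
    case False
    then show False using anc_leaf_eq[of D A] anc_leaf_eq[of D B] A B D m(1,2) ne by simp
  qed
qed

lemma separated_by_v:
  assumes v: "v \<in> fst T" "orig v" "v \<notin> \<beta> ` F" and AB: "A \<in> F" "B \<in> F" "A \<noteq> B"
    and s: "\<not> conn_avoiding v (\<beta> A) (\<beta> B)"
  shows "p A B = h v A * h v B / c v"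
  using h_eq[OF v AB] s c_pos[OF v] by (simp add: field_simps)

text \<open>An original vertex \<open>v\<close>, chosen from the meet of \<open>A\<close> and
  \<open>D\<close> down to that of \<open>A\<close> and \<open>B\<close>, separates \<open>A\<close>
  and \<open>B\<close> from both \<open>L\<close> and \<open>D\<close>, so four intersection numbers
  factor through \<open>v\<close>. The remaining pairs, \<open>L\<close> with \<open>D\<close> and
  \<open>A\<close> with \<open>B\<close>, are not both separated by \<open>v\<close>, which makes
  the comparison strict.\<close>

lemma isosceles:
  assumes A: "A \<in> F - {L}" and B: "B \<in> F - {L}" and D: "D \<in> F - {L}" and ne: "A \<noteq> B"
    and a: "anc (meet (\<beta> A) (\<beta> D)) (meet (\<beta> A) (\<beta> B))" "meet (\<beta> A) (\<beta> D) \<noteq> meet (\<beta> A) (\<beta> B)"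
  shows "u A B < u A D \<and> u A D = u B D"
proof -
  define x where "x = meet (\<beta> A) (\<beta> D)"
  define y where "y = meet (\<beta> A) (\<beta> B)"
  have T: "\<beta> A \<in> fst T" "\<beta> B \<in> fst T" "\<beta> D \<in> fst T" using A B D \<beta>T by auto
  have xy: "anc x y" "x \<noteq> y" using a by (simp_all add: x_def y_def)
  have yx: "\<not> anc y x" using anc_antisym_ne[OF xy] .
  have y: "anc y (\<beta> A)" "anc y (\<beta> B)" unfolding y_def by (rule meet[OF T(1,2)])+
  have x: "anc x (\<beta> A)" "anc x (\<beta> D)" unfolding x_def by (rule meet[OF T(1,3)])+
  have AD: "A \<noteq> D"
  proof
    assume "A = D"
    then have "x = \<beta> A" using x meet(3)[OF T(1,3)] anc_refl[OF T(1)] anc_antisym unfolding x_def by blast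
    then show False using xy y(1) anc_antisym by blast
  qed
  have BD: "B \<noteq> D" using xy(2) by (auto simp: x_def y_def)
  have yl: "y \<notin> \<beta> ` F" unfolding y_def by (rule meet_not_leaf[OF A B ne])
  have xl: "x \<notin> \<beta> ` F" unfolding x_def by (rule meet_not_leaf[OF A D AD])
  \<comment> \<open>One end of the first edge from \<open>x\<close> towards \<open>y\<close> is
    original.\<close>
  have "\<exists>v. orig v \<and> anc x v \<and> anc v y"
  proof -
    obtain d where d: "child d x" "anc d y" by (rule child_towards[OF xy])
    have "orig x \<or> orig d" using d(1) by (intro edge_orig) (simp add: child_def)
    then show ?thesis using d(2) childD[OF d(1)] xy(1) anc_refl by blast
  qed
  then obtain v where v: "orig v" "anc x v" "anc v y" by (elim exE conjE)
  have vT: "v \<in> fst T" using anc_fst[OF v(2)] by blast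
  have vl: "v \<notin> \<beta> ` F"
  proof
    assume "v \<in> \<beta> ` F"
    then obtain E where E: "E \<in> F" "v = \<beta> E" by auto
    show False
    proof (cases "E = L")
      case True
      then have "x = v" using v(2) E(2) anc_of_root by metis
      then show False using xl E by auto
    next
      case False
      then have "y = v" using leaf_below[OF E(1) False] v(3) E(2) by blast
      then show False using yl E by auto
    qed
  qed
  note V = vT v(1) vl
  have vA: "anc v (\<beta> A)" "anc v (\<beta> B)" using v(3) y anc_trans by blast+
  have leafne: "\<beta> E \<noteq> v" if "E \<in> F" for E using vl that by auto
  have vL: "\<not> anc v (\<beta> L)" using anc_of_root leafne[OF LF] by metis
  have sL: "\<not> conn_avoiding v (\<beta> A) (\<beta> L)" "\<not> conn_avoiding v (\<beta> B) (\<beta> L)"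
    using below_separated[where v = v and y = "\<beta> L"] vA vL leafne A B by blast+
  have "(\<not> conn_avoiding v (\<beta> A) (\<beta> D) \<and> \<not> conn_avoiding v (\<beta> B) (\<beta> D)) \<and>
      (conn_avoiding v (\<beta> D) (\<beta> L) \<or> conn_avoiding v (\<beta> A) (\<beta> B))"
  \<comment> \<open>If \<open>v\<close> lies strictly below \<open>x\<close>, then \<open>D\<close>
    and \<open>L\<close> are joined without passing \<open>v\<close>; if \<open>v = x\<close>, then
    \<open>A\<close> and \<open>B\<close> are joined through \<open>y\<close>.\<close>
  proof (cases "v = x")
    case False
    have nD: "\<not> anc v (\<beta> D)"
    proof
      assume "anc v (\<beta> D)"
      then have "anc v x" using meet(3)[OF T(1,3)] vA(1) unfolding x_def by blast
      then show False using v(2) False anc_antisym by blast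
    qed
    then have "conn_avoiding v (\<beta> D) (\<beta> L)" using conn_upwards[OF anc_root[OF T(3)]] by blast
    moreover have "\<not> conn_avoiding v (\<beta> A) (\<beta> D)" "\<not> conn_avoiding v (\<beta> B) (\<beta> D)"
      using below_separated[where v = v and y = "\<beta> D"] vA nD leafne A B by blast+
    ultimately show ?thesis by simp
  next
    case True
    obtain d where d: "child d v" "anc d y" using child_towards[OF xy] True by blast
    have dA: "anc d (\<beta> A)" "anc d (\<beta> B)" using d(2) y anc_trans by blast+
    have nD: "\<not> anc d (\<beta> D)"
    proof
      assume "anc d (\<beta> D)"
      then have "anc d v" using meet(3)[OF T(1,3)] dA(1) True unfolding x_def by blast
      then show False using childD[OF d(1)] anc_antisym by blast
    qed
    have "\<not> conn_avoiding v (\<beta> A) (\<beta> D)" "\<not> conn_avoiding v (\<beta> B) (\<beta> D)"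
      using branches_separated[where v = v and y = "\<beta> D" and c = d] d(1) dA nD by blast+
    moreover have "conn_avoiding v (\<beta> A) y" "conn_avoiding v (\<beta> B) y"
      by (rule conn_upwards[OF y(1)], use yx True in blast, rule conn_upwards[OF y(2)], use yx True in blast)
    then have "conn_avoiding v (\<beta> A) (\<beta> B)" using edge_rel_rtrancl_sym rtrancl_trans by metis
    ultimately show ?thesis by simp
  qed
  then have s: "\<not> conn_avoiding v (\<beta> A) (\<beta> D)" "\<not> conn_avoiding v (\<beta> B) (\<beta> D)"
    and st: "conn_avoiding v (\<beta> D) (\<beta> L) \<or> conn_avoiding v (\<beta> A) (\<beta> B)" by simp_all
  have F: "A \<in> F" "B \<in> F" "D \<in> F" "A \<noteq> L" "B \<noteq> L" "D \<noteq> L" using A B D by auto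
  have pAL: "p L A = h v L * h v A / c v" and pBL: "p L B = h v L * h v B / c v"
    using separated_by_v[OF V F(1) LF F(4) sL(1)] separated_by_v[OF V F(2) LF F(5) sL(2)] p_sym F LF by (simp_all add: mult.commute)
  have pAD: "p A D = h v A * h v D / c v" and pBD: "p B D = h v B * h v D / c v"
    using separated_by_v[OF V F(1,3) AD s(1)] separated_by_v[OF V F(2,3) BD s(2)] by auto
  have le: "h v L * h v D \<le> c v * p L D" "h v A * h v B \<le> c v * p A B"
    using h_le[OF V LF F(3)] h_le[OF V F(1,2) ne] F(6) by auto
  have pos: "0 < c v" "0 < h v L" "0 < h v A" "0 < h v B" "0 < h v D" using c_pos[OF V] h_pos[OF V] F LF by auto
  have "h v L * h v D < c v * p L D \<or> h v A * h v B < c v * p A B"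
    using st le h_eq[OF V F(3) LF F(6)] h_eq[OF V F(1,2) ne] p_sym[OF F(3) LF F(6)] by (auto simp: mult.commute)
  then have "(h v L * h v D) * (h v A * h v B) < (c v * p L D) * (c v * p A B)"
  proof
    assume "h v L * h v D < c v * p L D"
    from mult_less_le_imp_less[OF this le(2)] show ?thesis using pos by simp
  next
    assume "h v A * h v B < c v * p A B"
    from mult_le_less_imp_less[OF le(1) this] show ?thesis using pos by simp
  qed
  then have main: "p L B * p A D < p L D * p A B"
    unfolding pBL pAD using pos(1) by (simp add: field_simps)
  have "u A B < u A D"
    using main ne AD p_pos F LF unfolding u_def by (simp add: field_simps)
  moreover have "u A D = u B D"
    using AD BD pos unfolding u_def pAL pBL pAD pBD by (simp add: field_simps)
  ultimately show ?thesis ..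
qed

text \<open>Three branches parting at one vertex give it valency at least 4, counting its parent.\<close>

lemma equilateral:
  assumes A: "A \<in> F - {L}" and B: "B \<in> F - {L}" and D: "D \<in> F - {L}" and ne: "A \<noteq> B" "A \<noteq> D" "B \<noteq> D"
    and m: "meet (\<beta> A) (\<beta> B) = v" "meet (\<beta> A) (\<beta> D) = v" "meet (\<beta> B) (\<beta> D) = v"
  shows "u A B = u A D"
proof -
  have T: "\<beta> A \<in> fst T" "\<beta> B \<in> fst T" "\<beta> D \<in> fst T" using A B D \<beta>T by auto
  have vl: "v \<notin> \<beta> ` F" using meet_not_leaf[OF A B ne(1)] m(1) by simp
  have v: "anc v (\<beta> A)" "anc v (\<beta> B)" "anc v (\<beta> D)" using meet(1,2)[OF T(1,2)] meet(2)[OF T(1,3)] m by auto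
  have leafne: "v \<noteq> \<beta> E" if "E \<in> F" for E using vl that by auto
  obtain a where a: "child a v" "anc a (\<beta> A)" using child_towards[OF v(1)] leafne A by blast
  obtain b where b: "child b v" "anc b (\<beta> B)" using child_towards[OF v(2)] leafne B by blast
  obtain d where d: "child d v" "anc d (\<beta> D)" using child_towards[OF v(3)] leafne D by blast
  have nv: "\<not> anc e v" if "child e v" for e using childD[OF that] anc_antisym by blast
  have sep: "\<not> anc a (\<beta> B)" "\<not> anc a (\<beta> D)" "\<not> anc b (\<beta> D)"
    using meet(3)[OF T(1,2)] meet(3)[OF T(1,3)] meet(3)[OF T(2,3)] m nv a b by metis+
  have vC: "v \<in> fst C" using A v(1) unfolding conv_vertices by blast
  have ch: "{a, b, d} \<subseteq> children v" using A B D a b d unfolding children_def conv_vertices by blast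
  have "a \<noteq> b" "a \<noteq> d" "b \<noteq> d" using sep b d by auto
  then have "card {a, b, d} = 3" by simp
  then have "3 \<le> card (children v)" using card_mono[OF finite_children ch] by simp
  then have "\<not> valency C v < 4" using conv_valency[OF vC] leafne[OF LF] by simp
  then have orig: "orig v" using few[OF vC] by blast
  note V = anc_fst[OF v(1), THEN conjunct2] orig vl
  have F: "A \<in> F" "B \<in> F" "D \<in> F" "A \<noteq> L" "B \<noteq> L" "D \<noteq> L" using A B D by auto
  have vL: "\<not> anc v (\<beta> L)" using anc_of_root leafne[OF LF] by metis
  have "\<not> conn_avoiding v (\<beta> A) (\<beta> L)" "\<not> conn_avoiding v (\<beta> B) (\<beta> L)" "\<not> conn_avoiding v (\<beta> D) (\<beta> L)"
    using below_separated[where v = v and y = "\<beta> L"] v vL leafne F by metis+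
  moreover have "\<not> conn_avoiding v (\<beta> A) (\<beta> B)" "\<not> conn_avoiding v (\<beta> A) (\<beta> D)"
    using branches_separated[where v = v and c = a] a sep by blast+
  ultimately have "p A B = h v A * h v B / c v" "p A D = h v A * h v D / c v"
    "p L A = h v L * h v A / c v" "p L B = h v L * h v B / c v" "p L D = h v L * h v D / c v"
    using separated_by_v[OF V] F LF ne p_sym by (simp_all add: mult.commute)
  moreover have "h v A \<noteq> 0" "h v B \<noteq> 0" "h v D \<noteq> 0" using h_pos[OF V] F by force+
  ultimately show ?thesis using ne unfolding u_def by (simp add: field_simps)
qed

text \<open>The meets of \<open>A\<close> with \<open>D\<close> and of \<open>A\<close> with
  \<open>B\<close> are ancestors of \<open>A\<close>, hence comparable. A strict order between them
  is the situation of \<open>isosceles\<close>; if they coincide, the two distances are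
  equal.\<close>

lemma u_le_iff:
  assumes A: "A \<in> F - {L}" and B: "B \<in> F - {L}" and D: "D \<in> F - {L}"
  shows "u A B \<le> u A D \<longleftrightarrow> anc (meet (\<beta> A) (\<beta> D)) (\<beta> B)"
proof -
  have T: "\<beta> A \<in> fst T" "\<beta> B \<in> fst T" "\<beta> D \<in> fst T" using A B D \<beta>T by auto
  have self: "meet (\<beta> A) (\<beta> A) = \<beta> A" using meet[OF T(1,1)] anc_refl[OF T(1)] anc_antisym by blast
  consider "B = A" | "D = A" "B \<noteq> A" | "B = D" "B \<noteq> A" | "A \<noteq> B" "A \<noteq> D" "B \<noteq> D" by blast
  then show ?thesis
  proof cases
    case 1
    have "0 \<le> u A D" using u_pos[OF A D] by (cases "A = D") (auto simp: u_def)
    then show ?thesis using 1 meet(1)[OF T(1,3)] by (simp add: u_def)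
  next
    case 2
    have "\<not> u A B \<le> u A D" using u_pos[OF A B] 2 by (simp add: u_def)
    moreover have "\<not> anc (\<beta> A) (\<beta> B)" using anc_leaf_eq[OF A] B 2(2) by blast
    ultimately show ?thesis using 2 self by simp
  next
    case 3
    then show ?thesis using meet(2)[OF T(1,2)] by simp
  next
    case 4
    let ?x = "meet (\<beta> A) (\<beta> D)" and ?y = "meet (\<beta> A) (\<beta> B)"
    have y: "anc ?y (\<beta> A)" "anc ?y (\<beta> B)" by (rule meet[OF T(1,2)])+
    have x: "anc ?x (\<beta> A)" "anc ?x (\<beta> D)" by (rule meet[OF T(1,3)])+
    consider "?x = ?y" | "anc ?x ?y" "?x \<noteq> ?y" | "anc ?y ?x" "?y \<noteq> ?x" using anc_chain[OF x(1) y(1)] by metis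
    then show ?thesis
    proof cases
      case 1
      \<comment> \<open>Although their meets with \<open>A\<close> coincide, \<open>B\<close> and
        \<open>D\<close> may part further down; then they are the close pair of
        \<open>isosceles\<close>.\<close>
      have xz: "anc ?x (meet (\<beta> B) (\<beta> D))" using meet(3)[OF T(2,3)] y(2) x(2) 1 by simp
      have "u A B = u A D"
      proof (cases "meet (\<beta> B) (\<beta> D) = ?x")
        case True
        then show ?thesis using equilateral[OF A B D 4] 1 by simp
      next
        case False
        have BA: "meet (\<beta> B) (\<beta> A) = ?x" using 1 meet_commute[OF T(1,2)] by simp
        have "u B A = u D A" using isosceles[OF B D A 4(3)] xz False BA by auto
        then show ?thesis using u_sym A B D by simp
      qed
      then show ?thesis using y(2) 1 by simp
    next
      case 2
      then show ?thesis using isosceles[OF A B D 4(1)] y(2) anc_trans by (metis less_imp_le)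
    next
      case 3
      have "\<not> anc ?x (\<beta> B)" using meet(3)[OF T(1,2)] x(1) 3 anc_antisym by blast
      then show ?thesis using isosceles[OF A D B 4(2)] 3 by auto
    qed
  qed
qed

text \<open>The meets of \<open>B\<close> with \<open>A\<close> and with \<open>D\<close> are
  comparable, and the upper one lies above all three branches.\<close>

lemma ultrametric: "ultrametric_on (F - {L}) u"
  unfolding ultrametric_on_def
proof (intro conjI ballI)
  fix A B assume A: "A \<in> F - {L}" and B: "B \<in> F - {L}"
  show "0 \<le> u A B" "u A B = 0 \<longleftrightarrow> A = B" using u_pos[OF A B] by (cases "A = B"; force simp: u_def)+
  show "u A B = u B A" using u_sym A B by simp
  fix D assume D: "D \<in> F - {L}"
  have T: "\<beta> A \<in> fst T" "\<beta> B \<in> fst T" "\<beta> D \<in> fst T" using A B D \<beta>T by auto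
  note 1 = meet[OF T(1,2)] note 2 = meet[OF T(3,2)]
  have "anc (meet (\<beta> A) (\<beta> B)) (\<beta> D) \<or> anc (meet (\<beta> D) (\<beta> B)) (\<beta> A)"
    using anc_chain[OF 1(2) 2(2)] anc_trans 1(1) 2(1) by blast
  then have "u A D \<le> u A B \<or> u D A \<le> u D B" using u_le_iff[OF A D B] u_le_iff[OF D A B] by blast
  then show "u A D \<le> max (u A B) (u B D)" using u_sym A B D by auto
qed

lemma closed_ball_below:
  assumes A: "A \<in> F - {L}" and D: "D \<in> F - {L}"
  shows "{B\<in>F - {L}. u A B \<le> u A D} = below (meet (\<beta> A) (\<beta> D))"
proof -
  have T: "\<beta> A \<in> fst T" "\<beta> D \<in> fst T" using A D \<beta>T by auto
  have "meet (\<beta> A) (\<beta> D) \<noteq> \<beta> L"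
  proof (cases "A = D")
    case True
    then have "meet (\<beta> A) (\<beta> D) = \<beta> A" using meet[OF T] anc_refl[OF T(1)] anc_antisym by blast
    then show ?thesis using A LF inj by (auto dest: inj_onD)
  next
    case False
    then show ?thesis using meet_not_leaf[OF A D] LF by auto
  qed
  then have "\<not> anc (meet (\<beta> A) (\<beta> D)) (\<beta> L)" using anc_of_root by metis
  then show ?thesis unfolding below_def using u_le_iff[OF A _ D] by auto
qed

lemma closed_balls: "insert F (closed_balls (F - {L}) u) = below ` W"
proof (intro equalityI subsetI)
  fix b assume "b \<in> insert F (closed_balls (F - {L}) u)"
  then consider "b = F" | A r where "A \<in> F - {L}" "0 \<le> r" "b = {B\<in>F - {L}. u A B \<le> r}"
    unfolding closed_balls_def by auto
  then show "b \<in> below ` W"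
  proof cases
    case 1
    then show ?thesis using below_root W_leaf[OF LF] by (metis imageI)
  next
    case 2
    \<comment> \<open>The radius is lowered to the largest distance that occurs in the ball; the
      ball stays the same and its radius becomes a value of \<open>u A\<close>.\<close>
    let ?R = "{u A B | B. B \<in> F - {L} \<and> u A B \<le> r}"
    have "finite ?R" using finF by simp
    moreover have "u A A \<in> ?R" using 2(1,2) by (force simp: u_def)
    ultimately have "Max ?R \<in> ?R" "\<forall>s\<in>?R. s \<le> Max ?R" using Max_in Max_ge by blast+
    then obtain D where D: "D \<in> F - {L}" "u A D \<le> r" "Max ?R = u A D" by auto
    have "b = {B\<in>F - {L}. u A B \<le> u A D}"
      unfolding 2(3) using D(2) \<open>\<forall>s\<in>?R. s \<le> Max ?R\<close> unfolding D(3) by auto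
    then have "b = below (meet (\<beta> A) (\<beta> D))" using closed_ball_below[OF 2(1) D(1)] by simp
    moreover have "meet (\<beta> A) (\<beta> D) \<in> W" using 2(1) D(1) by (intro meet_in_W W_leaf) auto
    ultimately show ?thesis by (rule image_eqI)
  qed
next
  fix b assume "b \<in> below ` W"
  then obtain x where x: "b = below x" "x \<in> W" by (rule imageE)
  show "b \<in> insert F (closed_balls (F - {L}) u)"
  proof (cases "x = \<beta> L")
    case True
    then show ?thesis using x(1) below_root by simp
  next
    case False
    obtain A D where AD: "A \<in> F - {L}" "D \<in> F - {L}" "x = meet (\<beta> A) (\<beta> D)"
      using W_is_meet[OF x(2) False] by blast
    have "b = {B\<in>F - {L}. u A B \<le> u A D}" using closed_ball_below[OF AD(1,2)] AD(3) x(1) by simp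
    moreover have "0 \<le> u A D" using ultrametric AD(1,2) unfolding ultrametric_on_def by blast
    ultimately show ?thesis unfolding closed_balls_def using AD(1) by blast
  qed
qed

text \<open>Both trees are identified with the Hasse diagram of the sets \<open>below x\<close> for
  \<open>x \<in> W\<close>.\<close>

theorem ball_tree_conv:
  "rooted_S_tree_iso F (\<lambda>A. if A = L then None else Some {A}) (ball_tree (F - {L}) u) None
     \<beta> (smoothing (\<beta> ` F) C) (\<beta> L)"
proof -
  let ?B = "(below ` W, covers (below ` W))" and ?M = "smoothing (\<beta> ` F) C"
  define f where "f = (\<lambda>b. if b = F then None else Some b)"
  have sm: "fst ?M = W" by (simp add: smoothing_def W_def Let_def)
  have g1: "giso f ?B (ball_tree (F - {L}) u)"
    using ball_tree_giso[OF LF finF ultrametric] unfolding closed_balls f_def .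
  have g2: "giso (inv_into W below) ?B ?M" using giso_inv[OF smoothing_giso] unfolding sm .
  have inv: "inv_into W below (if A = L then F else {A}) = \<beta> A" if "A \<in> F" for A
    using that below_leaf below_root inv_into_f_f[OF below_inj W_leaf[OF that]] by (cases "A = L") auto
  have lab1: "f (if A = L then F else {A}) = (if A = L then None else Some {A})" if "A \<in> F" for A
    using that LF by (auto simp: f_def)
  have st1: "S_tree F (\<lambda>A. if A = L then None else Some {A}) (ball_tree (F - {L}) u)"
    using giso_S_tree[OF g1 below_S_tree] lab1 by (simp add: S_tree_def cong: inj_on_cong image_cong)
  have st2: "S_tree F \<beta> ?M"
    using giso_S_tree[OF g2 below_S_tree] inv by (simp add: S_tree_def cong: inj_on_cong image_cong)
  let ?g = "inv_into W below \<circ> inv_into (below ` W) f"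
  have "giso ?g (ball_tree (F - {L}) u) ?M" using giso_comp[OF giso_inv[OF g1] g2] by simp
  moreover have lab: "?g (if A = L then None else Some {A}) = \<beta> A" if "A \<in> F" for A
  proof -
    have "inj_on f (below ` W)" using g1 by (simp add: giso_def bij_betw_def)
    moreover have "(if A = L then F else {A}) \<in> below ` W" using below_S_tree that by (auto simp: S_tree_def)
    ultimately have "inv_into (below ` W) f (f (if A = L then F else {A})) = (if A = L then F else {A})" by (rule inv_into_f_f)
    then show ?thesis using lab1[OF that] inv[OF that] by simp
  qed
  moreover have "?g None = \<beta> L" using lab[OF LF] by (simp only: if_True simp_thms)
  ultimately show ?thesis unfolding rooted_S_tree_iso_def giso_def
    by (intro conjI st1 st2 exI[of _ ?g] ballI) (simp_all only:)
qed

end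

section \<open>Blocks and the brick-vertex tree\<close>

abbreviation joined :: "('e \<Rightarrow> 'v set) \<Rightarrow> 'e set \<Rightarrow> 'v set \<Rightarrow> 'v \<Rightarrow> 'v \<Rightarrow> bool" where
  "joined ends D A x y \<equiv> (x, y) \<in> (edge_rel (UNIV, ends ` D) A)\<^sup>*"

lemma joined_mono: "joined ends D A x y \<Longrightarrow> D \<subseteq> D' \<Longrightarrow> A \<subseteq> A' \<Longrightarrow> joined ends D' A' x y"
  by (erule rtrancl_mono[THEN subsetD, rotated]) (auto simp: edge_rel_def)

lemma joined_sym: "joined ends D A x y \<Longrightarrow> joined ends D A y x"
  by (rule edge_rel_rtrancl_sym)

lemma joined_edge: "e \<in> D \<Longrightarrow> ends e = {x, y} \<Longrightarrow> x \<in> A \<Longrightarrow> y \<in> A \<Longrightarrow> joined ends D A x y"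
  by (rule r_into_rtrancl) (simp add: edge_rel_def, metis imageI)

text \<open>Edges are cells too, and the removal of a vertex leaves half-open edges. As every edge
  keeps an end in \<open>A\<close>, it is attached to a vertex, and only vertices have to be
  compared.\<close>

lemma cells_connected_iff:
  fixes ends :: "'e \<Rightarrow> 'v set"
  assumes D: "\<And>e. e \<in> D \<Longrightarrow> \<exists>x y. ends e = {x, y} \<and> x \<in> A"
  shows "cells_connected ends A D \<longleftrightarrow> (\<forall>x\<in>A. \<forall>y\<in>A. joined ends D A x y)"
proof -
  define R :: "('v + 'e) rel" where "R = {(Inl v, Inr e) | v e. v \<in> A \<and> e \<in> D \<and> v \<in> ends e}"
  have cc: "cells_connected ends A D \<longleftrightarrow> (\<forall>a \<in> A <+> D. \<forall>b \<in> A <+> D. (a, b) \<in> (R \<union> R\<inverse>)\<^sup>*)"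
    by (simp add: cells_connected_def R_def Let_def)
  have RI: "(Inl v, Inr e) \<in> R \<union> R\<inverse>" "(Inr e, Inl v) \<in> R \<union> R\<inverse>" if "v \<in> A" "e \<in> D" "v \<in> ends e" for v e
    using that by (auto simp: R_def)
  have fwd: "case b of Inl y \<Rightarrow> joined ends D A x y | Inr e \<Rightarrow> e \<in> D \<and> (\<forall>y\<in>ends e \<inter> A. joined ends D A x y)"
    if "(Inl x, b) \<in> (R \<union> R\<inverse>)\<^sup>*" for x b
    using that
  proof (induction rule: rtrancl_induct)
    case (step b d)
    from step.hyps(2) consider v e where "b = Inl v" "d = Inr e" "v \<in> A" "e \<in> D" "v \<in> ends e"
      | v e where "b = Inr e" "d = Inl v" "v \<in> A" "e \<in> D" "v \<in> ends e" by (auto simp: R_def)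
    then show ?case
    proof cases
      case 1
      have xv: "joined ends D A x v" using step.IH 1(1) by simp
      have "joined ends D A v y" if y: "y \<in> ends e \<inter> A" for y
      proof (cases "y = v")
        case False
        obtain z z' where "ends e = {z, z'}" using D[OF 1(4)] by blast
        moreover have "y \<in> ends e" "y \<in> A" using y by simp_all
        ultimately have "ends e = {v, y}" using False 1(5) by (auto simp: insert_commute)
        from joined_edge[where ends = ends, OF 1(4) this 1(3) \<open>y \<in> A\<close>] show ?thesis .
      qed simp
      then have "\<forall>y\<in>ends e \<inter> A. joined ends D A x y" using rtrancl_trans[OF xv] by simp
      then show ?thesis using 1(2,4) by simp
    next
      case 2
      then show ?thesis using step.IH by simp
    qed
  qed simp
  show ?thesis
  proof
    assume c: "cells_connected ends A D"
    show "\<forall>x\<in>A. \<forall>y\<in>A. joined ends D A x y"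
    proof (intro ballI)
      fix x y assume "x \<in> A" "y \<in> A"
      then have "(Inl x, Inl y) \<in> (R \<union> R\<inverse>)\<^sup>*" using c unfolding cc by blast
      from fwd[OF this] show "joined ends D A x y" by simp
    qed
  next
    assume j: "\<forall>x\<in>A. \<forall>y\<in>A. joined ends D A x y"
    have step: "(Inl x, Inl y) \<in> (R \<union> R\<inverse>)\<^sup>*" if xy: "(x, y) \<in> edge_rel (UNIV, ends ` D) A" for x y
    proof -
      obtain e where e: "e \<in> D" "{x, y} = ends e" "x \<in> A" "y \<in> A" using xy by (auto simp: edge_rel_def)
      then have "(Inl x, Inr e) \<in> R \<union> R\<inverse>" "(Inr e, Inl y) \<in> R \<union> R\<inverse>" by (intro RI; blast)+
      then show ?thesis by (meson r_into_rtrancl rtrancl_into_rtrancl)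
    qed
    have vert: "(Inl x, Inl y) \<in> (R \<union> R\<inverse>)\<^sup>*" if "joined ends D A x y" for x y
      using that by (induction rule: rtrancl_induct) (simp, metis step rtrancl_trans)
    have rep: "\<exists>x\<in>A. (a, Inl x) \<in> (R \<union> R\<inverse>)\<^sup>* \<and> (Inl x, a) \<in> (R \<union> R\<inverse>)\<^sup>*" if "a \<in> A <+> D" for a
    proof (cases a)
      case (Inr e)
      then have e: "e \<in> D" using that by auto
      then obtain x where "x \<in> A" "x \<in> ends e" using D by blast
      then show ?thesis using RI[OF _ e] Inr by (meson r_into_rtrancl)
    qed (use that in auto)
    show "cells_connected ends A D"
      unfolding cc
    proof (intro ballI)
      fix a b assume "a \<in> A <+> D" "b \<in> A <+> D"
      then obtain x y where "x \<in> A" "(a, Inl x) \<in> (R \<union> R\<inverse>)\<^sup>*" "y \<in> A" "(Inl y, b) \<in> (R \<union> R\<inverse>)\<^sup>*" using rep by metis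
      then show "(a, b) \<in> (R \<union> R\<inverse>)\<^sup>*" using vert j rtrancl_trans by metis
    qed
  qed
qed

locale multigraph =
  fixes ends :: "'e \<Rightarrow> 'v set" and V :: "'v set" and D :: "'e set"
  assumes finV: "finite V" and finD: "finite D"
    and two_ends: "e \<in> D \<Longrightarrow> \<exists>x y. x \<in> V \<and> y \<in> V \<and> x \<noteq> y \<and> ends e = {x, y}"
    and conn: "cells_connected ends V D"
begin

abbreviation "sub H \<equiv> subgraph ends H (V, D)"
abbreviation "nonsep \<equiv> nonseparable ends"
abbreviation "blk \<equiv> block ends (V, D)"
abbreviation "brdg \<equiv> bridge ends (V, D)"
abbreviation "brk \<equiv> brick ends (V, D)"
abbreviation "J \<equiv> joined ends"

lemma subD: "sub H \<Longrightarrow> e \<in> snd H \<Longrightarrow> e \<in> D \<and> ends e \<subseteq> fst H"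
  by (auto simp: subgraph_def)

lemma nonsep_iff:
  assumes "sub H"
  shows "nonsep H \<longleftrightarrow> fst H \<noteq> {} \<and> (\<forall>x\<in>fst H. \<forall>y\<in>fst H. J (snd H) (fst H) x y) \<and>
    (\<forall>v\<in>fst H. \<forall>x\<in>fst H - {v}. \<forall>y\<in>fst H - {v}. J (snd H) (fst H - {v}) x y)"
proof -
  have e: "\<exists>x y. x \<noteq> y \<and> ends e = {x, y} \<and> x \<in> fst H \<and> y \<in> fst H" if "e \<in> snd H" for e
    using two_ends subD[OF assms that] by fastforce
  have "cells_connected ends (fst H) (snd H) \<longleftrightarrow> (\<forall>x\<in>fst H. \<forall>y\<in>fst H. J (snd H) (fst H) x y)"
    by (rule cells_connected_iff) (use e in blast)
  moreover have "cells_connected ends (fst H - {v}) (snd H) \<longleftrightarrow>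
      (\<forall>x\<in>fst H - {v}. \<forall>y\<in>fst H - {v}. J (snd H) (fst H - {v}) x y)" for v
  proof (rule cells_connected_iff)
    fix e assume "e \<in> snd H"
    from e[OF this] obtain x y where "x \<noteq> y" "ends e = {x, y}" "x \<in> fst H" "y \<in> fst H" by blast
    then show "\<exists>x y. ends e = {x, y} \<and> x \<in> fst H - {v}" by (cases "x = v") (auto simp: insert_commute)
  qed
  ultimately show ?thesis by (simp add: nonseparable_def)
qed

lemma nonsep_joined:
  assumes "sub H" "nonsep H" "x \<in> fst H - {v}" "y \<in> fst H - {v}"
  shows "J (snd H) (fst H - {v}) x y"
  using assms nonsep_iff[OF assms(1)] by (cases "v \<in> fst H") auto

lemma joined_all: "x \<in> V \<Longrightarrow> y \<in> V \<Longrightarrow> J D V x y"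
proof -
  have "cells_connected ends V D \<longleftrightarrow> (\<forall>x\<in>V. \<forall>y\<in>V. J D V x y)"
    by (rule cells_connected_iff) (use two_ends in blast)
  then show "x \<in> V \<Longrightarrow> y \<in> V \<Longrightarrow> J D V x y" using conn by blast
qed

lemma blockD: "blk H \<Longrightarrow> sub H \<and> nonsep H \<and> fst H \<noteq> {}"
  by (auto simp: block_def nonseparable_def)

lemma block_max: "blk H \<Longrightarrow> sub K \<Longrightarrow> nonsep K \<Longrightarrow> fst H \<subseteq> fst K \<Longrightarrow> snd H \<subseteq> snd K \<Longrightarrow> K = H"
proof -
  assume H: "blk H" and K: "sub K" "nonsep K" "fst H \<subseteq> fst K" "snd H \<subseteq> snd K"
  have "subgraph ends H K" using blockD[OF H] K(3,4) by (simp add: subgraph_def)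
  then show "K = H" using H K(1,2) unfolding block_def by blast
qed

lemma block_exists:
  assumes "sub H" "nonsep H"
  obtains K where "blk K" "fst H \<subseteq> fst K" "snd H \<subseteq> snd K"
proof -
  let ?S = "{K. sub K \<and> nonsep K \<and> fst H \<subseteq> fst K \<and> snd H \<subseteq> snd K}"
  have "?S \<subseteq> Pow V \<times> Pow D" by (auto simp: subgraph_def)
  then have fin: "finite ?S" using finV finD by (meson finite_Pow_iff finite_SigmaI finite_subset)
  have "H \<in> ?S" using assms by simp
  define f where "f K = card (fst K) + card (snd K)" for K :: "('v, 'e) graph"
  have "Max (f ` ?S) \<in> f ` ?S" by (rule Max_in) (use fin \<open>H \<in> ?S\<close> in blast)+
  then obtain K where K: "K \<in> ?S" "f K = Max (f ` ?S)" by (metis (no_types, lifting) imageE)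
  have "K' = K" if K': "sub K'" "nonsep K'" "subgraph ends K K'" for K'
  proof -
    have s: "fst K \<subseteq> fst K'" "snd K \<subseteq> snd K'" using K'(3) by (auto simp: subgraph_def)
    have f': "finite (fst K')" "finite (snd K')" using K'(1) finV finD by (auto simp: subgraph_def intro: finite_subset)
    have "K' \<in> ?S" using K' K(1) s by auto
    then have "f K' \<le> f K" unfolding K(2) using fin by (intro Max_ge) auto
    moreover have "card (fst K) \<le> card (fst K')" "card (snd K) \<le> card (snd K')" using card_mono s f' by blast+
    ultimately have "card (fst K') \<le> card (fst K)" "card (snd K') \<le> card (snd K)" unfolding f_def by linarith+
    then have "fst K = fst K'" "snd K = snd K'" using s f' by (meson card_seteq)+
    then show ?thesis by (simp add: prod_eq_iff)
  qed
  then have "blk K" using K(1) by (auto simp: block_def)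
  then show thesis using K(1) by (intro that[of K]) auto
qed

text \<open>The subgraphs share \<open>v\<close> and are linked by a path that avoids
  \<open>v\<close>. After deletion of \<open>v\<close> the path keeps them together; after deletion
  of another vertex they still meet in \<open>v\<close>, and each remaining vertex of the path
  reaches one of them along the path.\<close>

lemma union_nonsep:
  assumes H: "sub H" "nonsep H" and K: "sub K" "nonsep K" and v: "v \<in> fst H" "v \<in> fst K"
    and x: "x \<in> fst H - {v}" and y: "y \<in> fst K - {v}"
    and p: "spath (UNIV, ends ` D) x p y" "set p \<subseteq> V - {v}"
    and A: "A = fst H \<union> fst K \<union> set p"
  shows "sub (A, {e\<in>D. ends e \<subseteq> A}) \<and> nonsep (A, {e\<in>D. ends e \<subseteq> A})"
proof -
  let ?D = "{e\<in>D. ends e \<subseteq> A}"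
  have sub: "sub (A, ?D)" using H(1) K(1) p(2) by (auto simp: subgraph_def A)
  have emb: "snd H \<subseteq> ?D" "snd K \<subseteq> ?D" using subD H(1) K(1) A by blast+
  have jH: "J ?D (A - {w}) a b" if "a \<in> fst H - {w}" "b \<in> fst H - {w}" for a b w
    by (rule joined_mono[OF nonsep_joined[OF H that]]) (use emb A in auto)
  have jK: "J ?D (A - {w}) a b" if "a \<in> fst K - {w}" "b \<in> fst K - {w}" for a b w
    by (rule joined_mono[OF nonsep_joined[OF K that]]) (use emb A in auto)
  have jp: "J ?D B a b" if q: "spath (UNIV, ends ` D) a q b" "set q \<subseteq> B" "B \<subseteq> A" for a b q B
  proof -
    have s: "edge_rel (UNIV, ends ` D) B \<subseteq> edge_rel (UNIV, ends ` ?D) B"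
    proof (rule subsetI, clarify)
      fix a b assume "(a, b) \<in> edge_rel (UNIV, ends ` D) B"
      then obtain e where e: "e \<in> D" "ends e = {a, b}" "a \<in> B" "b \<in> B" by (auto simp: edge_rel_def)
      then have "e \<in> ?D" using q(3) by auto
      then have "{a, b} \<in> ends ` ?D" using e(2) by (metis imageI)
      then show "(a, b) \<in> edge_rel (UNIV, ends ` ?D) B" using e(3,4) by (simp add: edge_rel_def)
    qed
    show ?thesis by (rule rtrancl_mono[OF s, THEN subsetD]) (rule spath_rtrancl[OF q(1,2)])
  qed
  \<comment> \<open>The set \<open>B\<close> has at most one element and \<open>p\<close> is a
    simple path, so one of the two halves of \<open>p\<close> at \<open>z\<close> misses
    \<open>B\<close>.\<close>
  have split: "(J ?D (A - B) z x \<and> x \<notin> B) \<or> (J ?D (A - B) z y \<and> y \<notin> B)"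
    if z: "z \<in> set p" "z \<notin> B" "\<And>a b. a \<in> B \<Longrightarrow> b \<in> B \<Longrightarrow> a = b" for z B
  proof -
    obtain q q' where q: "p = q @ z # q'" using z(1) by (meson split_list)
    have s: "spath (UNIV, ends ` D) x (q @ [z]) z" "spath (UNIV, ends ` D) z (z # q') y"
      using spath_append[of "(UNIV, ends ` D)" x q z q' y] p(1) q by simp_all
    have d: "distinct p" using p(1) by (simp add: spath_def)
    have m: "set (q @ [z]) \<subseteq> A" "set (z # q') \<subseteq> A" using q A by auto
    consider "set (q @ [z]) \<inter> B = {}" | "set (z # q') \<inter> B = {}" using d q z(2,3) by fastforce
    then show ?thesis
    proof cases
      case 1
      then have "set (q @ [z]) \<subseteq> A - B" using m by blast
      from jp[OF s(1) this] have "J ?D (A - B) x z" by simp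
      then have "J ?D (A - B) z x" by (rule joined_sym)
      moreover have "x \<notin> B" using 1 conjunct1[OF spath_ends[OF s(1)]] by blast
      ultimately show ?thesis by simp
    next
      case 2
      then have "set (z # q') \<subseteq> A - B" using m by blast
      from jp[OF s(2) this] have "J ?D (A - B) z y" by simp
      moreover have "y \<in> set (z # q')" using spath_ends[OF s(2)] by simp
      then have "y \<notin> B" using 2 by blast
      ultimately show ?thesis by simp
    qed
  qed
  have off: "J ?D (A - {w}) z v" if z: "z \<in> A - {w}" "w \<noteq> v" for z w
  proof -
    consider "z \<in> fst H" | "z \<in> fst K" | "z \<in> set p" using z A by auto
    then show ?thesis
    proof cases
      case 3
      from split[of z "{w}"] z 3 have "(J ?D (A - {w}) z x \<and> x \<noteq> w) \<or> (J ?D (A - {w}) z y \<and> y \<noteq> w)" by simp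
      then show ?thesis
      proof (elim disjE conjE)
        assume zx: "J ?D (A - {w}) z x" and "x \<noteq> w"
        have "J ?D (A - {w}) x v" by (rule jH) (use x v z \<open>x \<noteq> w\<close> in auto)
        with zx show ?thesis by (rule rtrancl_trans)
      next
        assume zx: "J ?D (A - {w}) z y" and "y \<noteq> w"
        have "J ?D (A - {w}) y v" by (rule jK) (use y v z \<open>y \<noteq> w\<close> in auto)
        with zx show ?thesis by (rule rtrancl_trans)
      qed
    qed (use jH jK z v in auto)
  qed
  have at: "J ?D (A - {v}) z x" if z: "z \<in> A - {v}" for z
  proof -
    have pA: "set p \<subseteq> A - {v}" using p(2) A by auto
    have "J ?D (A - {v}) x y" by (rule jp[OF p(1) pA]) auto
    then have xy: "J ?D (A - {v}) y x" by (rule joined_sym)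
    consider "z \<in> fst H" | "z \<in> fst K" | "z \<in> set p" using z A by auto
    then show ?thesis
    proof cases
      case 2
      have "J ?D (A - {v}) z y" by (rule jK) (use 2 z y in auto)
      then show ?thesis using xy by (rule rtrancl_trans)
    next
      case 3
      from split[of z "{v}"] z 3 have "J ?D (A - {v}) z x \<or> J ?D (A - {v}) z y" by auto
      then show ?thesis by (elim disjE) (assumption, erule rtrancl_trans[OF _ xy])
    qed (use jH z x in auto)
  qed
  have vx: "J ?D A x v"
  proof -
    have "J (snd H) (fst H) x v" using nonsep_iff[OF H(1)] H(2) x v(1) by blast
    then show ?thesis by (rule joined_mono) (use emb A in auto)
  qed
  have all: "J ?D A z v" if z: "z \<in> A" for z
  proof (cases "z = v")
    case False
    then have "J ?D (A - {v}) z x" using at z by blast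
    then have "J ?D A z x" by (rule joined_mono) auto
    then show ?thesis using vx by (rule rtrancl_trans)
  qed simp
  have "J ?D (A - {w}) a b" if ab: "a \<in> A - {w}" "b \<in> A - {w}" for a b w
  proof (cases "w = v")
    case True
    then show ?thesis using rtrancl_trans[OF at[of a] joined_sym[OF at[of b]]] ab by simp
  next
    case False
    from rtrancl_trans[OF off[OF ab(1) this] joined_sym[OF off[OF ab(2) this]]] show ?thesis .
  qed
  moreover have "J ?D A a b" if "a \<in> A" "b \<in> A" for a b
    by (rule rtrancl_trans[OF all[OF that(1)] joined_sym[OF all[OF that(2)]]])
  ultimately have "nonsep (A, ?D)" unfolding nonsep_iff[OF sub] using v(1) A by auto
  then show ?thesis using sub by simp
qed

text \<open>The union with the joining path is nonseparable, so by maximality both blocks are equal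
  to it. Hence \<open>v\<close> separates different blocks through it.\<close>

lemma blocks_eq:
  assumes H: "blk H" and K: "blk K" and v: "v \<in> fst H" "v \<in> fst K"
    and x: "x \<in> fst H - {v}" and y: "y \<in> fst K - {v}" and j: "J D (V - {v}) x y"
  shows "H = K"
proof -
  note h = blockD[OF H] and k = blockD[OF K]
  have "x \<in> V - {v}" using h x by (auto simp: subgraph_def)
  then obtain p where p: "spath (UNIV, ends ` D) x p y" "set p \<subseteq> V - {v}"
    using rtrancl_spath[OF j] by auto
  define A where "A = fst H \<union> fst K \<union> set p"
  let ?U = "(A, {e\<in>D. ends e \<subseteq> A})"
  have U: "sub ?U" "nonsep ?U" using union_nonsep[OF _ _ _ _ v x y p A_def] h k by auto
  have "fst H \<subseteq> fst ?U" "snd H \<subseteq> snd ?U" "fst K \<subseteq> fst ?U" "snd K \<subseteq> snd ?U"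
    using subD[of H] subD[of K] h k unfolding A_def by fastforce+
  then show ?thesis using block_max[OF H U] block_max[OF K U] by metis
qed

lemma edge_nonsep:
  assumes "e \<in> D" shows "sub (ends e, {e}) \<and> nonsep (ends e, {e})"
proof -
  obtain x y where e: "x \<in> V" "y \<in> V" "x \<noteq> y" "ends e = {x, y}" using two_ends[OF assms] by blast
  have sub: "sub (ends e, {e})" using e assms by (auto simp: subgraph_def)
  have "J {e} {x, y} x y" by (rule joined_edge) (use e in auto)
  then have "J {e} {x, y} x y" "J {e} {x, y} y x" using joined_sym by metis+
  then have "nonsep (ends e, {e})" unfolding nonsep_iff[OF sub] using e(3,4) by (auto simp: e(4))
  then show ?thesis using sub by simp
qed

lemma bridge_separates:
  assumes "brdg e" "ends e = {x, y}" shows "\<not> J (D - {e}) V x y"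
proof
  assume j: "J (D - {e}) V x y"
  have step: "J (D - {e}) V a b" if ab: "(a, b) \<in> edge_rel (UNIV, ends ` D) V" for a b
  proof -
    obtain e' where e': "e' \<in> D" "ends e' = {a, b}" "a \<in> V" "b \<in> V" using ab by (auto simp: edge_rel_def)
    show ?thesis
    proof (cases "e' = e")
      case True
      then have "{a, b} = {x, y}" using e'(2) assms(2) by simp
      then show ?thesis using j joined_sym by (auto simp: doubleton_eq_iff)
    next
      case False
      then show ?thesis by (intro joined_edge[of e']) (use e' in auto)
    qed
  qed
  have all: "J (D - {e}) V a b" if "J D V a b" for a b
    using that by (induction rule: rtrancl_induct) (simp, metis step rtrancl_trans)
  have "cells_connected ends V (D - {e}) \<longleftrightarrow> (\<forall>x\<in>V. \<forall>y\<in>V. J (D - {e}) V x y)"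
    by (rule cells_connected_iff) (use two_ends in blast)
  then have "cells_connected ends V (D - {e})" using all joined_all by blast
  then show False using assms(1) by (simp add: bridge_def)
qed

text \<open>In a block with a third vertex \<open>z\<close>, deleting either end of \<open>e\<close>
  leaves the other end joined to \<open>z\<close>, and these connections bypass \<open>e\<close>. A
  bridge admits no such detour, and no parallel edge either.\<close>

lemma bridge_block:
  assumes b: "brdg e" shows "blk (ends e, {e})"
proof -
  have e: "e \<in> D" using b by (simp add: bridge_def)
  obtain K where K: "blk K" "ends e \<subseteq> fst K" "{e} \<subseteq> snd K" using block_exists edge_nonsep[OF e] by (metis fst_conv snd_conv)
  note k = blockD[OF K(1)]
  have KV: "fst K \<subseteq> V" "snd K \<subseteq> D" using k by (auto simp: subgraph_def)
  obtain x y where xy: "x \<noteq> y" "ends e = {x, y}" using two_ends[OF e] by blast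
  have "fst K \<subseteq> ends e"
  proof
    fix z assume z: "z \<in> fst K"
    show "z \<in> ends e"
    proof (rule ccontr)
      assume nz: "z \<notin> ends e"
      have avoid: "J (D - {e}) V a z" if ab: "ends e = {a, b}" "a \<noteq> b" for a b
      proof -
        have "J (snd K) (fst K - {b}) a z" using nonsep_joined[of K a b z] k K(2) ab nz z by auto
        moreover have "edge_rel (UNIV, ends ` snd K) (fst K - {b}) \<subseteq> edge_rel (UNIV, ends ` (D - {e})) V"
        proof (rule subsetI, clarify)
          fix c d assume "(c, d) \<in> edge_rel (UNIV, ends ` snd K) (fst K - {b})"
          then obtain e' where e': "e' \<in> snd K" "ends e' = {c, d}" "c \<in> fst K" "d \<in> fst K" "c \<noteq> b" "d \<noteq> b"
            by (auto simp: edge_rel_def)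
          then have "e' \<in> D - {e}" using KV ab(1) by auto
          then have "{c, d} \<in> ends ` (D - {e})" using e'(2) by (metis imageI)
          then show "(c, d) \<in> edge_rel (UNIV, ends ` (D - {e})) V" using e' KV by (auto simp: edge_rel_def)
        qed
        ultimately show ?thesis using rtrancl_mono by blast
      qed
      have "J (D - {e}) V x z" "J (D - {e}) V y z" using avoid[of x y] avoid[of y x] xy by auto
      then have "J (D - {e}) V x y" using joined_sym rtrancl_trans by metis
      then show False using bridge_separates[OF b xy(2)] by simp
    qed
  qed
  then have fK: "fst K = ends e" using K(2) by blast
  have "snd K \<subseteq> {e}"
  proof
    fix e' assume e': "e' \<in> snd K"
    show "e' \<in> {e}"
    proof (rule ccontr)
      assume "e' \<notin> {e}"
      have "ends e' \<subseteq> {x, y}" "e' \<in> D" using subD[of K e'] k e' fK xy(2) by auto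
      then have "ends e' = {x, y}" using two_ends[of e'] by auto
      then have "J (D - {e}) V x y" using \<open>e' \<notin> {e}\<close> \<open>e' \<in> D\<close> two_ends[OF e] xy(2)
        by (intro joined_edge[of e']) (auto simp: doubleton_eq_iff)
      then show False using bridge_separates[OF b xy(2)] by simp
    qed
  qed
  then have "K = (ends e, {e})" using fK K(3) by (auto simp: prod_eq_iff)
  then show ?thesis using K(1) by simp
qed

lemma bridge_or_brick:
  assumes e: "e \<in> D" shows "brdg e \<or> (\<exists>H. brk H \<and> ends e \<subseteq> fst H)"
proof -
  obtain K where K: "blk K" "ends e \<subseteq> fst K" "{e} \<subseteq> snd K" using block_exists edge_nonsep[OF e] by (metis fst_conv snd_conv)
  show ?thesis
  proof (cases "brk K")
    case False
    then obtain e' where "brdg e'" "K = (ends e', {e'})" using K(1) by (auto simp: brick_def)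
    then show ?thesis using K(3) by simp
  qed (use K in blast)
qed

section \<open>Uniqueness of paths and separations in the brick-vertex tree\<close>

abbreviation BT :: "('v + ('v, 'e) graph) sgraph" where "BT \<equiv> brick_vertex_tree ends (V, D)"

lemma BT_vertices: "fst BT = Inl ` V \<union> Inr ` {H. brk H}"
  by (simp add: brick_vertex_tree_def)

lemma BT_edges: "snd BT = {Inl ` ends e | e. brdg e} \<union> {{Inr H, Inl v} | H v. brk H \<and> v \<in> fst H}"
  by (simp add: brick_vertex_tree_def)

lemma BT_bridge: "brdg e \<Longrightarrow> ends e = {x, y} \<Longrightarrow> {Inl x, Inl y} \<in> snd BT"
proof -
  assume e: "brdg e" "ends e = {x, y}"
  have "Inl ` ends e \<in> snd BT" unfolding BT_edges using e(1) by blast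
  then show ?thesis using e(2) by simp
qed

lemma BT_brick: "brk H \<Longrightarrow> v \<in> fst H \<Longrightarrow> {Inr H, Inl v} \<in> snd BT"
  unfolding BT_edges by blast

lemma BT_edge_cases:
  assumes "{a, b} \<in> snd BT"
  obtains e x y where "brdg e" "ends e = {x, y}" "x \<noteq> y" "x \<in> V" "y \<in> V" "a = Inl x" "b = Inl y"
  | H v where "brk H" "v \<in> fst H" "a = Inr H" "b = Inl v"
  | H v where "brk H" "v \<in> fst H" "a = Inl v" "b = Inr H"
proof -
  from assms consider e where "{a, b} = Inl ` ends e" "brdg e" | H v where "{a, b} = {Inr H, Inl v}" "brk H" "v \<in> fst H"
    unfolding BT_edges by blast
  then show thesis
  proof cases
    case 1
    then have "e \<in> D" by (simp add: bridge_def)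
    then obtain x y where xy: "x \<in> V" "y \<in> V" "x \<noteq> y" "ends e = {x, y}" using two_ends by blast
    then have "a = Inl x \<and> b = Inl y \<or> a = Inl y \<and> b = Inl x" using 1(1) by (auto simp: doubleton_eq_iff)
    then show thesis using that(1)[of e x y] that(1)[of e y x] 1(2) xy by (auto simp: insert_commute)
  next
    case 2
    then have "a = Inr H \<and> b = Inl v \<or> a = Inl v \<and> b = Inr H" by (simp add: doubleton_eq_iff)
    then show thesis using that(2)[of H v] that(3)[of H v] 2(2,3) by blast
  qed
qed

lemma brick_block: "brk H \<Longrightarrow> blk H"
  by (simp add: brick_def)

lemma BT_edge_vertices: "{a, b} \<in> snd BT \<Longrightarrow> a \<in> fst BT \<and> b \<in> fst BT \<and> a \<noteq> b"
proof (erule BT_edge_cases)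
  fix H v assume H: "brk H" "v \<in> fst H"
  then have "v \<in> V" using blockD[OF brick_block[OF H(1)]] by (auto simp: subgraph_def)
  then have "Inl v \<in> fst BT" "Inr H \<in> fst BT" using H unfolding BT_vertices by auto
  then show "a = Inr H \<Longrightarrow> b = Inl v \<Longrightarrow> a \<in> fst BT \<and> b \<in> fst BT \<and> a \<noteq> b"
    "a = Inl v \<Longrightarrow> b = Inr H \<Longrightarrow> a \<in> fst BT \<and> b \<in> fst BT \<and> a \<noteq> b" by auto
qed (auto simp: BT_vertices)

text \<open>Labels a neighbour of \<open>v\<close> in the tree by the block through \<open>v\<close>
  that it comes from: a bridge with its ends, or the brick itself.\<close>

definition neighbour :: "'v \<Rightarrow> 'v + ('v, 'e) graph \<Rightarrow> ('v, 'e) graph \<Rightarrow> bool" where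
  "neighbour v t K \<longleftrightarrow> blk K \<and> v \<in> fst K \<and>
     ((\<exists>w e. t = Inl w \<and> w \<noteq> v \<and> brdg e \<and> ends e = {v, w} \<and> K = (ends e, {e})) \<or> t = Inr K \<and> brk K)"

lemma neighbour_ex:
  assumes "{Inl v, t} \<in> snd BT" shows "\<exists>K. neighbour v t K"
  using assms
proof (cases rule: BT_edge_cases)
  case (1 e x y)
  then have "neighbour v t (ends e, {e})" using bridge_block[OF 1(1)] by (auto simp: neighbour_def)
  then show ?thesis ..
next
  case (3 H w)
  then have "neighbour v t H" using brick_block[OF 3(1)] by (simp add: neighbour_def)
  then show ?thesis ..
qed simp

lemma neighbour_unique: "neighbour v t K \<Longrightarrow> neighbour v t' K \<Longrightarrow> t = t'"
  unfolding neighbour_def brick_def by (auto simp: doubleton_eq_iff)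

text \<open>The vertices of the graph that a vertex of the tree stands for once \<open>v\<close> is
  deleted.\<close>

definition rep :: "'v \<Rightarrow> 'v + ('v, 'e) graph \<Rightarrow> 'v set" where
  "rep v t = (case t of Inl x \<Rightarrow> {x} | Inr H \<Rightarrow> fst H - {v})"

text \<open>A walk in the tree that avoids \<open>v\<close> is followed by one in the graph: bridges
  are edges, and a brick stays connected after deletion of \<open>v\<close>.\<close>

lemma BT_joined_rep:
  assumes "(a, b) \<in> (edge_rel BT (fst BT - {Inl v}))\<^sup>*" "a \<in> fst BT" "a \<noteq> Inl v" "x \<in> rep v a" "y \<in> rep v b"
  shows "J D (V - {v}) x y"
  using assms(1,5)
proof (induction arbitrary: y rule: rtrancl_induct)
  case base
  show ?case
  proof (cases a)
    case (Inl z)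
    then show ?thesis using assms(4) base by (simp add: rep_def)
  next
    case (Inr H)
    then have H: "blk H" "x \<in> fst H - {v}" "y \<in> fst H - {v}" using assms(2,4) base by (auto simp: rep_def BT_vertices brick_block)
    then have "J (snd H) (fst H - {v}) x y" using nonsep_joined blockD by blast
    then show ?thesis by (rule joined_mono) (use blockD[OF H(1)] in \<open>auto simp: subgraph_def\<close>)
  qed
next
  case (step b c)
  have bc: "{b, c} \<in> snd BT" "b \<noteq> Inl v" "c \<noteq> Inl v" using step.hyps(2) by (auto simp: edge_rel_def)
  from bc(1) show ?case
  proof (cases rule: BT_edge_cases)
    case (1 e z z')
    then have "J D (V - {v}) x z" "y = z'" using step by (auto simp: rep_def)
    moreover have "J D (V - {v}) z z'" by (rule joined_edge[of e]) (use 1 bc in \<open>auto simp: bridge_def\<close>)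
    ultimately show ?thesis by (metis rtrancl_trans)
  next
    case (2 H z)
    then have "y \<in> rep v b" using step.prems bc(3) by (auto simp: rep_def)
    then show ?thesis by (rule step.IH)
  next
    case (3 H z)
    then have "J D (V - {v}) x z" using step.IH by (simp add: rep_def)
    moreover have "J D (V - {v}) z y"
    proof -
      have H: "blk H" "z \<in> fst H - {v}" "y \<in> fst H - {v}" using 3 bc(2) step.prems by (auto simp: rep_def brick_block)
      then have "J (snd H) (fst H - {v}) z y" using nonsep_joined blockD by blast
      then show ?thesis by (rule joined_mono) (use blockD[OF H(1)] in \<open>auto simp: subgraph_def\<close>)
    qed
    ultimately show ?thesis by (rule rtrancl_trans)
  qed
qed

text \<open>Were two neighbours joined without \<open>v\<close>, their blocks would contain vertices
  joined without \<open>v\<close> and so coincide by \<open>blocks_eq\<close>; but distinct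
  neighbours come from distinct blocks.\<close>

lemma BT_neighbours_separated:
  assumes t: "{Inl v, t} \<in> snd BT" and t': "{Inl v, t'} \<in> snd BT" and ne: "t \<noteq> t'"
  shows "(t, t') \<notin> (edge_rel BT (fst BT - {Inl v}))\<^sup>*"
proof
  assume j: "(t, t') \<in> (edge_rel BT (fst BT - {Inl v}))\<^sup>*"
  obtain K where K: "neighbour v t K" using neighbour_ex[OF t] by blast
  obtain K' where K': "neighbour v t' K'" using neighbour_ex[OF t'] by blast
  \<comment> \<open>The first step of the walk supplies a vertex of the brick other than
    \<open>v\<close>, which a brick reduced to \<open>v\<close> would not have.\<close>
  have inner: "\<exists>x. x \<in> rep v s \<and> x \<in> fst N - {v}"
    if N: "neighbour v s N" and j: "(s, s') \<in> (edge_rel BT (fst BT - {Inl v}))\<^sup>*" and ne: "s \<noteq> s'" for s s' N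
  proof (cases s)
    case (Inl w)
    then show ?thesis using N by (auto simp: neighbour_def rep_def)
  next
    case (Inr H)
    obtain c where "(s, c) \<in> edge_rel BT (fst BT - {Inl v})" using j ne by (metis converse_rtranclE)
    then have c: "{s, c} \<in> snd BT" "c \<noteq> Inl v" by (auto simp: edge_rel_def)
    from c(1) obtain y where "c = Inl y" "y \<in> fst H" by (cases rule: BT_edge_cases) (use Inr in auto)
    then show ?thesis using c(2) Inr N by (auto simp: neighbour_def rep_def)
  qed
  obtain x where x: "x \<in> rep v t" "x \<in> fst K - {v}" using inner[OF K j ne] by blast
  obtain y where y: "y \<in> rep v t'" "y \<in> fst K' - {v}" using inner[OF K' edge_rel_rtrancl_sym[OF j] ne[symmetric]] by blast
  have "J D (V - {v}) x y" using BT_joined_rep[OF j _ _ x(1) y(1)] BT_edge_vertices[OF t] by blast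
  then have "K = K'" using blocks_eq[of K K' v x y] K K' x(2) y(2) by (auto simp: neighbour_def)
  then show False using neighbour_unique K K' ne by blast
qed

text \<open>Every edge of the tree has an end \<open>Inl v\<close>. A detour around it would leave
  \<open>v\<close> towards another neighbour and reach the first one without passing
  \<open>v\<close> again, against the separation of neighbours.\<close>

lemma BT_bridges:
  assumes e: "{a, b} \<in> snd BT"
  shows "(a, b) \<notin> (edge_rel (fst BT, snd BT - {{a, b}}) (fst BT))\<^sup>*"
proof -
  let ?T = "(fst BT, snd BT - {{a, b}})"
  have main: "(t, Inl v) \<notin> (edge_rel ?T (fst BT))\<^sup>*" if t: "{a, b} = {Inl v, t}" for v t
  proof
    assume j: "(t, Inl v) \<in> (edge_rel ?T (fst BT))\<^sup>*"
    have tv: "{Inl v, t} \<in> snd BT" "t \<noteq> Inl v" "t \<in> fst BT" using e t BT_edge_vertices by auto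
    obtain p where p: "spath ?T t p (Inl v)" using rtrancl_spath[OF j tv(3)] by auto
    then have "spath ?T (Inl v) (rev p) t" by (rule spath_rev)
    moreover obtain q where q: "rev p = Inl v # q" using calculation by (cases "rev p") (auto simp: spath_Cons)
    ultimately have q': "q \<noteq> []" "Inl v \<notin> set q" "{Inl v, hd q} \<in> snd BT" "{Inl v, hd q} \<noteq> {a, b}" "spath ?T (hd q) q t"
      using tv(2) by (auto simp: spath_Cons split: if_splits)
    have "spath BT (hd q) q t" using q'(5) by (auto simp: spath_def)
    moreover have "set q \<subseteq> fst BT - {Inl v}" using q'(2,5) by (auto simp: spath_def)
    ultimately have "(hd q, t) \<in> (edge_rel BT (fst BT - {Inl v}))\<^sup>*" by (rule spath_rtrancl)
    moreover have "hd q \<noteq> t" using q'(4) t by auto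
    ultimately show False using BT_neighbours_separated[OF q'(3) tv(1)] by blast
  qed
  from e show ?thesis
  proof (cases rule: BT_edge_cases)
    case (1 e x y)
    then show ?thesis using main[of y a] by (simp add: insert_commute)
  next
    case (2 H v)
    then show ?thesis using main[of v a] by (simp add: insert_commute)
  next
    case (3 H v)
    then have "(b, a) \<notin> (edge_rel ?T (fst BT))\<^sup>*" using main[of v b] by simp
    then show ?thesis using edge_rel_rtrancl_sym[of a b] by blast
  qed
qed

lemma BT_joined_edge:
  assumes e: "e \<in> D" "ends e = {x, y}" and B: "Inl x \<in> B" "Inl y \<in> B" "\<And>H. brk H \<Longrightarrow> Inr H \<in> B"
  shows "(Inl x, Inl y) \<in> (edge_rel BT B)\<^sup>*"
  using bridge_or_brick[OF e(1)]
proof (elim disjE exE conjE)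
  assume "brdg e"
  then have "(Inl x, Inl y) \<in> edge_rel BT B" using BT_bridge[OF _ e(2)] B by (auto simp: edge_rel_def)
  then show ?thesis by (rule r_into_rtrancl)
next
  fix H assume H: "brk H" "ends e \<subseteq> fst H"
  then have "(Inl x, Inr H) \<in> edge_rel BT B" "(Inr H, Inl y) \<in> edge_rel BT B"
    using BT_brick[of H x] BT_brick[of H y] B e(2) by (auto simp: edge_rel_def insert_commute)
  then show ?thesis by (meson r_into_rtrancl rtrancl_into_rtrancl)
qed

lemma BT_joined_of_joined:
  assumes "J D A x y" and B: "\<And>x. x \<in> A \<Longrightarrow> Inl x \<in> B" "\<And>H. brk H \<Longrightarrow> Inr H \<in> B"
  shows "(Inl x, Inl y) \<in> (edge_rel BT B)\<^sup>*"
  using assms(1)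
proof (induction rule: rtrancl_induct)
  case (step y z)
  then obtain e where "e \<in> D" "ends e = {y, z}" "y \<in> A" "z \<in> A" by (auto simp: edge_rel_def)
  then have "(Inl y, Inl z) \<in> (edge_rel BT B)\<^sup>*" using B by (intro BT_joined_edge) auto
  then show ?case using step.IH rtrancl_trans by metis
qed simp

lemma BT_separation:
  assumes "x \<in> V - {v}" "y \<in> V - {v}"
  shows "(Inl x, Inl y) \<in> (edge_rel BT (fst BT - {Inl v}))\<^sup>* \<longleftrightarrow> J D (V - {v}) x y"
proof
  assume "(Inl x, Inl y) \<in> (edge_rel BT (fst BT - {Inl v}))\<^sup>*"
  then show "J D (V - {v}) x y" by (rule BT_joined_rep) (use assms in \<open>auto simp: rep_def BT_vertices\<close>)
qed (erule BT_joined_of_joined, auto simp: BT_vertices)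

lemma BT_rooted_tree:
  assumes r: "r \<in> V" shows "rooted_tree BT (Inl r)"
proof
  show "Inl r \<in> fst BT" using r by (auto simp: BT_vertices)
  show "\<And>x y. {x, y} \<in> snd BT \<Longrightarrow> x \<in> fst BT \<and> y \<in> fst BT \<and> x \<noteq> y" by (rule BT_edge_vertices)
  show "\<exists>x y. e = {x, y}" if "e \<in> snd BT" for e
    using that two_ends unfolding BT_edges bridge_def by fastforce
  show "p = q" if "spath BT (Inl r) p x" "spath BT (Inl r) q x" for x p q
    by (rule spath_unique[OF _ that]) (rule BT_bridges)
  show "\<exists>p. spath BT (Inl r) p x" if x: "x \<in> fst BT" for x
  proof -
    have V: "(Inl r, Inl y) \<in> (edge_rel BT (fst BT))\<^sup>*" if "y \<in> V" for y
      by (rule BT_joined_of_joined[OF joined_all[OF r that]]) (auto simp: BT_vertices)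
    have "(Inl r, x) \<in> (edge_rel BT (fst BT))\<^sup>*"
    proof (cases x)
      case (Inl y)
      then show ?thesis using V x by (auto simp: BT_vertices)
    next
      case (Inr H)
      then have H: "brk H" using x by (auto simp: BT_vertices)
      then obtain y where y: "y \<in> fst H" "y \<in> V" using blockD[OF brick_block[OF H]] by (auto simp: subgraph_def)
      then have "(Inl y, x) \<in> edge_rel BT (fst BT)" using BT_brick[OF H y(1)] x Inr y(2)
        by (simp add: edge_rel_def BT_vertices insert_commute)
      with V[OF y(2)] show ?thesis by (rule rtrancl_into_rtrancl)
    qed
    then obtain p where "spath BT (Inl r) p x" by (rule rtrancl_spath) (use r in \<open>auto simp: BT_vertices\<close>)
    then show ?thesis by blast
  qed
qed

text \<open>A vertex on at most one edge lies in a single block: two blocks with further vertices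
  would both contain the other end of this edge.\<close>

lemma BT_leaf:
  assumes l: "\<And>e e'. e \<in> D \<Longrightarrow> e' \<in> D \<Longrightarrow> v \<in> ends e \<Longrightarrow> v \<in> ends e' \<Longrightarrow> e = e'"
    and t: "{Inl v, t} \<in> snd BT" "{Inl v, t'} \<in> snd BT"
  shows "t = t'"
proof -
  have eq: "K = K'" if K: "blk K" "v \<in> fst K" and K': "blk K'" "v \<in> fst K'" for K K'
  proof -
    have sub: "K = ({v}, {}) \<or> (\<exists>e w. e \<in> D \<and> ends e = {v, w} \<and> w \<in> fst K - {v})" if K: "blk K" "v \<in> fst K" for K
    proof (cases "fst K = {v}")
      case True
      have "snd K = {}" using subD[of K] blockD[OF K(1)] two_ends True by fastforce
      then show ?thesis using True by (simp add: prod_eq_iff)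
    next
      case False
      then obtain w where w: "w \<in> fst K" "w \<noteq> v" using K(2) by blast
      note k = blockD[OF K(1)]
      have "J (snd K) (fst K) v w" using k nonsep_iff[of K] K(2) w by blast
      then obtain c where "(v, c) \<in> edge_rel (UNIV, ends ` snd K) (fst K)" using w(2) by (metis converse_rtranclE)
      then obtain e where e: "e \<in> snd K" "ends e = {v, c}" "c \<in> fst K" by (auto simp: edge_rel_def)
      have "e \<in> D" using subD[of K] k e(1) by blast
      moreover have "c \<noteq> v" using two_ends[OF \<open>e \<in> D\<close>] e(2) by auto
      ultimately show ?thesis using e by blast
    qed
    \<comment> \<open>A block reduced to \<open>v\<close> is, by maximality, the only block through
      \<open>v\<close>.\<close>
    have small: "K = K'" if KK: "blk K" "v \<in> fst K" "K' = ({v}, {})" "blk K'" for K K'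
      using block_max[OF KK(4), of K] blockD[OF KK(1)] KK(2,3) by simp
    from sub[OF K] sub[OF K'] show ?thesis
    proof (elim disjE exE conjE)
      fix e w e' w' assume e: "e \<in> D" "ends e = {v, w}" "w \<in> fst K - {v}" "e' \<in> D" "ends e' = {v, w'}" "w' \<in> fst K' - {v}"
      have "e = e'" using l[OF e(1,4)] e(2,5) by simp
      then have "w = w'" using e by (auto simp: doubleton_eq_iff)
      then show ?thesis using blocks_eq[OF K(1) K'(1) K(2) K'(2) e(3)] e(6) by simp
    qed (use small K K' in metis)+
  qed
  obtain K where K: "neighbour v t K" using neighbour_ex[OF t(1)] by blast
  obtain K' where K': "neighbour v t' K'" using neighbour_ex[OF t(2)] by blast
  have "K = K'" using eq K K' unfolding neighbour_def by blast
  then show ?thesis using neighbour_unique K K' by blast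
qed

lemma BT_edge_orig: "{a, b} \<in> snd BT \<Longrightarrow> (\<exists>v. a = Inl v) \<or> (\<exists>v. b = Inl v)"
  by (erule BT_edge_cases) auto

end

section \<open>Intersection numbers of branches\<close>

text \<open>The numbers \<open>h\<close> and \<open>c\<close> are kept abstract here, so that the
  case without exceptional components is an instance as well.\<close>

lemma branch_ball_tree:
  fixes \<A> :: "('m::t2_space) atlas" and \<pi> :: "'m \<Rightarrow> complex ^ 'n" and I :: "('m, 'n) comp \<Rightarrow> ('m, 'n) comp \<Rightarrow> int"
    and \<E> :: "'m set set" and \<F> :: "'n formal_branch set"
    and h :: "'m set \<Rightarrow> 'n formal_branch \<Rightarrow> rat" and c :: "'m set \<Rightarrow> rat"
  defines "D \<equiv> snd (dual_graph \<A> \<pi> \<E> \<F>)" and "p \<equiv> branch_inter I \<E> \<F>"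
  assumes mg: "multigraph snd (comps \<E> \<F>) D"
    and fin: "finite \<F>" and L: "L \<in> \<F>"
    and leaf: "\<And>A e e'. A \<in> \<F> \<Longrightarrow> e \<in> D \<Longrightarrow> e' \<in> D \<Longrightarrow> Inr A \<in> snd e \<Longrightarrow> Inr A \<in> snd e' \<Longrightarrow> e = e'"
    and few: "\<And>H. Inr H \<in> fst (Conv \<A> \<pi> \<E> \<F>) \<Longrightarrow> \<not> 4 \<le> valency (Conv \<A> \<pi> \<E> \<F>) (Inr H)"
    and p_sym: "\<And>A B. A \<in> \<F> \<Longrightarrow> B \<in> \<F> \<Longrightarrow> A \<noteq> B \<Longrightarrow> p A B = p B A"
    and p_pos: "\<And>A B. A \<in> \<F> \<Longrightarrow> B \<in> \<F> \<Longrightarrow> A \<noteq> B \<Longrightarrow> 0 < p A B"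
    and c_pos: "\<And>E. E \<in> \<E> \<Longrightarrow> 0 < c E"
    and h_pos: "\<And>E A. E \<in> \<E> \<Longrightarrow> A \<in> \<F> \<Longrightarrow> 0 < h E A"
    and h_le: "\<And>E A B. E \<in> \<E> \<Longrightarrow> A \<in> \<F> \<Longrightarrow> B \<in> \<F> \<Longrightarrow> A \<noteq> B \<Longrightarrow> h E A * h E B \<le> c E * p A B"
    and h_eq: "\<And>E A B. E \<in> \<E> \<Longrightarrow> A \<in> \<F> \<Longrightarrow> B \<in> \<F> \<Longrightarrow> A \<noteq> B \<Longrightarrow>
      h E A * h E B = c E * p A B \<longleftrightarrow> \<not> joined snd D (comps \<E> \<F> - {Inl E}) (Inr A) (Inr B)"
  shows "ultrametric_on (\<F> - {L}) (u_fun I \<E> \<F> L) \<and>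
    rooted_S_tree_iso \<F>
      (\<lambda>A. if A = L then None else Some {A}) (ball_tree (\<F> - {L}) (u_fun I \<E> \<F> L)) None
      branch_vertex (smoothing (branch_vertex ` \<F>) (Conv \<A> \<pi> \<E> \<F>)) (branch_vertex L)"
proof -
  interpret G: multigraph snd "comps \<E> \<F>" D by (rule mg)
  have dg: "dual_graph \<A> \<pi> \<E> \<F> = (comps \<E> \<F>, D)" by (simp add: D_def dual_graph_def)
  define T where "T = brick_vertex_tree snd (comps \<E> \<F>, D)"
  have C: "Conv \<A> \<pi> \<E> \<F> = convex_hull T (branch_vertex ` \<F>)" by (simp add: Conv_def dg T_def)
  have V: "Inr A \<in> comps \<E> \<F>" if "A \<in> \<F>" for A using that by (simp add: comps_def)
  have bt: "branch_tree T branch_vertex L \<F>"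
    unfolding branch_tree_def branch_tree_axioms_def
  proof (intro conjI allI impI)
    show "rooted_tree T (branch_vertex L)" unfolding T_def by (rule G.BT_rooted_tree[OF V[OF L]])
    show "inj_on branch_vertex \<F>" by (simp add: inj_on_def)
    show "branch_vertex A \<in> fst T" if "A \<in> \<F>" for A unfolding T_def G.BT_vertices using V[OF that] by blast
    show "x = y" if "A \<in> \<F>" "{branch_vertex A, x} \<in> snd T" "{branch_vertex A, y} \<in> snd T" for A x y
      by (rule G.BT_leaf[OF _ that(2,3)[unfolded T_def]]) (rule leaf[OF that(1)])
  qed (use fin L in auto)
  \<comment> \<open>The value 0 is a default; by \<open>exc\<close> the original vertices at which a
    weight is demanded are exceptional components.\<close>
  define H where "H v A = (case v of Inl (Inl E) \<Rightarrow> of_rat (h E A) | _ \<Rightarrow> (0 :: real))"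
    for v :: "('m, 'n) comp + (('m, 'n) comp, 'm \<times> ('m, 'n) comp set) graph" and A
  define K where "K v = (case v of Inl (Inl E) \<Rightarrow> of_rat (c E) | _ \<Rightarrow> (0 :: real))"
    for v :: "('m, 'n) comp + (('m, 'n) comp, 'm \<times> ('m, 'n) comp set) graph"
  have exc: "\<exists>E\<in>\<E>. v = Inl (Inl E)" if "v \<in> fst T" "\<exists>x. v = Inl x" "v \<notin> branch_vertex ` \<F>" for v
    using that unfolding T_def G.BT_vertices unfolding comps_def by auto
  have sep: "(branch_vertex A, branch_vertex B) \<in> (edge_rel T (fst T - {Inl (Inl E)}))\<^sup>* \<longleftrightarrow>
      joined snd D (comps \<E> \<F> - {Inl E}) (Inr A) (Inr B)" if "A \<in> \<F>" "B \<in> \<F>" for A B E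
    unfolding T_def by (rule G.BT_separation) (use V that in auto)
  have w: "weighted_branch_tree T branch_vertex L \<F> (\<lambda>v. \<exists>x. v = Inl x) (\<lambda>A B. of_rat (p A B)) H K"
    unfolding weighted_branch_tree_def weighted_branch_tree_axioms_def
  proof (intro conjI allI impI bt)
    show "(\<exists>v. x = Inl v) \<or> (\<exists>v. y = Inl v)" if "{x, y} \<in> snd T" for x y
      using G.BT_edge_orig that unfolding T_def by blast
    show "valency (convex_hull T (branch_vertex ` \<F>)) v < 4"
      if vC: "v \<in> fst (convex_hull T (branch_vertex ` \<F>))" and vr: "\<not> (\<exists>x. v = Inl x)" for v
    proof -
      obtain N where N: "v = Inr N" by (cases v) (use vr in auto)
      show ?thesis using few[of N] vC unfolding C N by simp
    qed
    fix v A B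
    assume AB: "A \<in> \<F>" "B \<in> \<F>" "A \<noteq> B"
    show "real_of_rat (p A B) = real_of_rat (p B A)" using p_sym[OF AB] by simp
    show "0 < real_of_rat (p A B)" using p_pos[OF AB] by simp
    assume v: "v \<in> fst T" "\<exists>x. v = Inl x" "v \<notin> branch_vertex ` \<F>"
    obtain E where E: "E \<in> \<E>" "v = Inl (Inl E)" using exc[OF v] by blast
    show "H v A * H v B \<le> K v * real_of_rat (p A B)"
      using h_le[OF E(1) AB] by (simp add: H_def K_def E(2) of_rat_mult[symmetric] of_rat_less_eq)
    have "H v A * H v B = K v * real_of_rat (p A B) \<longleftrightarrow> h E A * h E B = c E * p A B"
      by (simp add: H_def K_def E(2) of_rat_mult[symmetric])
    then show "(H v A * H v B = K v * real_of_rat (p A B)) =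
        ((branch_vertex A, branch_vertex B) \<notin> (edge_rel T (fst T - {v}))\<^sup>*)"
      using h_eq[OF E(1) AB] sep[OF AB(1,2)] E(2) by simp
  next
    fix v A assume v: "v \<in> fst T" "\<exists>x. v = Inl x" "v \<notin> branch_vertex ` \<F>"
    obtain E where E: "E \<in> \<E>" "v = Inl (Inl E)" using exc[OF v] by blast
    show "0 < K v" using c_pos[OF E(1)] by (simp add: K_def E(2))
    show "0 < H v A" if "A \<in> \<F>" using h_pos[OF E(1) that] by (simp add: H_def E(2))
  qed
  interpret B: weighted_branch_tree T branch_vertex L \<F> "\<lambda>v. \<exists>x. v = Inl x" "\<lambda>A B. of_rat (p A B)" H K by (rule w)
  have "u_fun I \<E> \<F> L = B.u" by (intro ext) (simp add: u_fun_def B.u_def p_def[symmetric] of_rat_mult of_rat_divide)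
  then show ?thesis using B.ultrametric B.ball_tree_conv unfolding C by simp
qed

lemma sum_comps:
  "finite \<E> \<Longrightarrow> finite \<F> \<Longrightarrow> (\<Sum>C\<in>comps \<E> \<F>. f C) = (\<Sum>E\<in>\<E>. f (Inl E)) + (\<Sum>A\<in>\<F>. f (Inr A))"
  unfolding comps_def by (subst sum.union_disjoint) (auto simp: sum.reindex)

text \<open>The configuration for a non-empty exceptional set. As at most two components share a
  point, each branch meets exactly one exceptional component, at a point that no other branch
  occupies.\<close>

locale crossing_components =
  fixes \<A> :: "('m::t2_space) atlas" and \<pi> :: "'m \<Rightarrow> complex ^ 'n" and self :: "'m set \<Rightarrow> int"
    and \<E> :: "'m set set" and \<F> :: "'n formal_branch set" and m :: "'m set \<Rightarrow> nat"
  assumes finE: "finite \<E>" and finF: "finite \<F>" and neE: "\<E> \<noteq> {}"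
    and finI: "E \<in> \<E> \<Longrightarrow> E' \<in> \<E> \<Longrightarrow> E \<noteq> E' \<Longrightarrow> finite (E \<inter> E')"
    and linked: "S \<subseteq> \<E> \<Longrightarrow> S \<noteq> {} \<Longrightarrow> S \<noteq> \<E> \<Longrightarrow> \<exists>E\<in>S. \<exists>E'\<in>\<E> - S. E \<inter> E' \<noteq> {}"
    and on_one: "A \<in> \<F> \<Longrightarrow> \<exists>!E. E \<in> \<E> \<and> strict_point \<A> \<pi> A \<in> E"
    and pts: "inj_on (strict_point \<A> \<pi>) \<F>"
    and m_pos: "E \<in> \<E> \<Longrightarrow> 0 < m E"
    and m_super: "E \<in> \<E> \<Longrightarrow> int (m E) * self E + (\<Sum>E'\<in>\<E> - {E}. int (m E') * int (card (E \<inter> E'))) \<le> 0"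
    and m_strict: "\<exists>E\<in>\<E>. int (m E) * self E + (\<Sum>E'\<in>\<E> - {E}. int (m E') * int (card (E \<inter> E'))) \<noteq> 0"
begin

abbreviation "pt \<equiv> strict_point \<A> \<pi>"
abbreviation "I \<equiv> comp_inter \<A> \<pi> self"

definition on :: "'n formal_branch \<Rightarrow> 'm set" where "on A = (THE E. E \<in> \<E> \<and> pt A \<in> E)"

lemma on: "A \<in> \<F> \<Longrightarrow> on A \<in> \<E> \<and> pt A \<in> on A"
  unfolding on_def by (rule theI'[OF on_one])

lemma on_eq: "A \<in> \<F> \<Longrightarrow> E \<in> \<E> \<Longrightarrow> pt A \<in> E \<longleftrightarrow> E = on A"
  using on_one[of A] on[of A] by blast

definition D where "D = snd (dual_graph \<A> \<pi> \<E> \<F>)"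

lemma D_iff: "e \<in> D \<longleftrightarrow> (\<exists>E E' p. E \<in> \<E> \<and> E' \<in> \<E> \<and> E \<noteq> E' \<and> p \<in> E \<inter> E' \<and> e = (p, {Inl E, Inl E'})) \<or>
    (\<exists>A\<in>\<F>. e = (pt A, {Inl (on A), Inr A}))"
proof
  assume "e \<in> D"
  then obtain p X Y where e: "e = (p, {X, Y})" "X \<in> comps \<E> \<F>" "Y \<in> comps \<E> \<F>" "X \<noteq> Y"
    "p \<in> support \<A> \<pi> X" "p \<in> support \<A> \<pi> Y" unfolding D_def dual_graph_def by auto
  show "(\<exists>E E' p. E \<in> \<E> \<and> E' \<in> \<E> \<and> E \<noteq> E' \<and> p \<in> E \<inter> E' \<and> e = (p, {Inl E, Inl E'})) \<or>
      (\<exists>A\<in>\<F>. e = (pt A, {Inl (on A), Inr A}))"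
  proof (cases X)
    case X: (Inl E)
    show ?thesis
    proof (cases Y)
      case (Inl E')
      then show ?thesis using e X by (auto simp: comps_def support_def)
    next
      case (Inr A)
      then have A: "A \<in> \<F>" "E \<in> \<E>" "p \<in> E" "p = pt A" using e X by (auto simp: comps_def support_def)
      then have "e = (pt A, {Inl (on A), Inr A})" using on_eq[OF A(1,2)] e(1) X Inr by simp
      then show ?thesis using A(1) by blast
    qed
  next
    case X: (Inr A)
    show ?thesis
    proof (cases Y)
      case (Inl E)
      then have A: "A \<in> \<F>" "E \<in> \<E>" "p \<in> E" "p = pt A" using e X by (auto simp: comps_def support_def)
      then have "e = (pt A, {Inl (on A), Inr A})" using on_eq[OF A(1,2)] e(1) X Inl by (simp add: insert_commute)
      then show ?thesis using A(1) by blast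
    next
      case (Inr B)
      then have "A \<in> \<F>" "B \<in> \<F>" "pt A = pt B" "A \<noteq> B" using e X by (auto simp: comps_def support_def)
      then show ?thesis using pts by (auto dest: inj_onD)
    qed
  qed
next
  assume "(\<exists>E E' p. E \<in> \<E> \<and> E' \<in> \<E> \<and> E \<noteq> E' \<and> p \<in> E \<inter> E' \<and> e = (p, {Inl E, Inl E'})) \<or>
    (\<exists>A\<in>\<F>. e = (pt A, {Inl (on A), Inr A}))"
  then show "e \<in> D"
  proof (elim disjE exE bexE conjE)
    fix E E' p assume a: "E \<in> \<E>" "E' \<in> \<E>" "E \<noteq> E'" "p \<in> E \<inter> E'" "e = (p, {Inl E, Inl E'})"
    show ?thesis unfolding D_def dual_graph_def snd_conv mem_Collect_eq
      by (rule exI[of _ p], rule exI[of _ "Inl E"], rule exI[of _ "Inl E'"]) (use a in \<open>simp add: comps_def support_def\<close>)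
  next
    fix A assume a: "A \<in> \<F>" "e = (pt A, {Inl (on A), Inr A})"
    show ?thesis unfolding D_def dual_graph_def snd_conv mem_Collect_eq
      by (rule exI[of _ "pt A"], rule exI[of _ "Inl (on A)"], rule exI[of _ "Inr A"])
        (use a on[OF a(1)] in \<open>simp add: comps_def support_def\<close>)
  qed
qed

lemma D_exc: "E \<in> \<E> \<Longrightarrow> E' \<in> \<E> \<Longrightarrow> E \<noteq> E' \<Longrightarrow> p \<in> E \<inter> E' \<Longrightarrow> (p, {Inl E, Inl E'}) \<in> D"
  unfolding D_iff by blast

lemma D_branch: "A \<in> \<F> \<Longrightarrow> (pt A, {Inl (on A), Inr A}) \<in> D"
  unfolding D_iff by blast

lemma finite_D: "finite D"
proof -
  have "D \<subseteq> (\<Union>(E, E')\<in>{(E, E'). E \<in> \<E> \<and> E' \<in> \<E> \<and> E \<noteq> E'}. (\<lambda>p. (p, {Inl E, Inl E'})) ` (E \<inter> E')) \<union>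
      (\<lambda>A. (pt A, {Inl (on A), Inr A})) ` \<F>"
    by (rule subsetI, unfold D_iff) (elim disjE exE conjE bexE, blast, blast)
  moreover have "finite {(E, E'). E \<in> \<E> \<and> E' \<in> \<E> \<and> E \<noteq> E'}"
    by (rule finite_subset[of _ "\<E> \<times> \<E>"]) (use finE in auto)
  then have "finite (\<Union>(E, E')\<in>{(E, E'). E \<in> \<E> \<and> E' \<in> \<E> \<and> E \<noteq> E'}. (\<lambda>p. (p, {Inl E, Inl E' :: ('m, 'n) comp})) ` (E \<inter> E'))"
    using finI by (intro finite_UN_I) auto
  ultimately show ?thesis using finF by (meson finite_UnI finite_imageI finite_subset)
qed

text \<open>By \<open>linked\<close>, the components reached from \<open>E0\<close> cannot form a
  proper subset of \<open>\<E>\<close>, and each branch hangs on the component that it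
  meets.\<close>

lemma multigraph: "multigraph snd (comps \<E> \<F>) D"
proof
  show "finite (comps \<E> \<F>)" using finE finF by (simp add: comps_def)
  show "finite D" by (rule finite_D)
  show two: "\<exists>x y. x \<in> comps \<E> \<F> \<and> y \<in> comps \<E> \<F> \<and> x \<noteq> y \<and> snd e = {x, y}" if e: "e \<in> D" for e
  proof -
    obtain p X Y where "e = (p, {X, Y})" "X \<in> comps \<E> \<F>" "Y \<in> comps \<E> \<F>" "X \<noteq> Y"
      using e unfolding D_def dual_graph_def snd_conv mem_Collect_eq by (elim exE conjE)
    then show ?thesis by (intro exI[of _ X] exI[of _ Y]) simp
  qed
  let ?V = "comps \<E> \<F>"
  obtain E0 where E0: "E0 \<in> \<E>" using neE by blast
  have exc: "joined snd D ?V (Inl E0) (Inl E)" if E: "E \<in> \<E>" for E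
  proof (rule ccontr)
    assume n: "\<not> joined snd D ?V (Inl E0) (Inl E)"
    define S where "S = {E\<in>\<E>. joined snd D ?V (Inl E0) (Inl E)}"
    have "S \<subseteq> \<E>" "S \<noteq> {}" "S \<noteq> \<E>" using E0 E n by (auto simp: S_def)
    from linked[OF this] obtain F F' p where F: "F \<in> S" "F' \<in> \<E> - S" "p \<in> F \<inter> F'" by blast
    have Fs: "F \<in> \<E>" "F' \<in> \<E>" "F \<noteq> F'" "joined snd D ?V (Inl E0) (Inl F)" using F by (auto simp: S_def)
    have "joined snd D ?V (Inl F) (Inl F')"
      by (rule joined_edge[OF D_exc[OF Fs(1-3) F(3)]]) (use Fs in \<open>auto simp: comps_def\<close>)
    with Fs(4) have "joined snd D ?V (Inl E0) (Inl F')" by (rule rtrancl_trans)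
    then show False using F(2) by (simp add: S_def)
  qed
  have all: "joined snd D ?V (Inl E0) x" if x: "x \<in> ?V" for x
  proof (cases x)
    case (Inr A)
    then have A: "A \<in> \<F>" using x by (auto simp: comps_def)
    have "joined snd D ?V (Inl (on A)) (Inr A)"
      by (rule joined_edge[OF D_branch[OF A]]) (use on[OF A] A in \<open>auto simp: comps_def\<close>)
    with exc[OF conjunct1[OF on[OF A]]] show ?thesis unfolding Inr by (rule rtrancl_trans)
  next
    case (Inl E)
    then show ?thesis using x exc[of E] by (auto simp: comps_def)
  qed
  have "joined snd D ?V x y" if "x \<in> ?V" "y \<in> ?V" for x y
    by (rule rtrancl_trans[OF joined_sym[OF all[OF that(1)]] all[OF that(2)]])
  moreover have "cells_connected snd ?V D \<longleftrightarrow> (\<forall>x\<in>?V. \<forall>y\<in>?V. joined snd D ?V x y)"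
    by (rule cells_connected_iff) (use two in blast)
  ultimately show "cells_connected snd ?V D" by simp
qed

lemma branch_edge_unique: "e \<in> D \<Longrightarrow> Inr A \<in> snd e \<Longrightarrow> e = (pt A, {Inl (on A), Inr A})"
  unfolding D_iff by auto

section \<open>Intersection numbers in terms of Green functions\<close>

definition a :: "'m set \<Rightarrow> 'm set \<Rightarrow> rat" where "a E E' = of_int (I (Inl E) (Inl E'))"

lemma a_simps: "a E E = of_int (self E)" "E \<noteq> E' \<Longrightarrow> a E E' = of_nat (card (E \<inter> E'))"
  by (simp_all add: a_def comp_inter_def support_def)

lemma super_eq:
  assumes E: "E \<in> \<E>"
  shows "(\<Sum>E'\<in>\<E>. a E E' * of_nat (m E')) =
    of_int (int (m E) * self E + (\<Sum>E'\<in>\<E> - {E}. int (m E') * int (card (E \<inter> E'))))"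
proof -
  have "(\<Sum>E'\<in>\<E>. a E E' * of_nat (m E')) = a E E * of_nat (m E) + (\<Sum>E'\<in>\<E> - {E}. a E E' * of_nat (m E'))"
    by (rule sum.remove[OF finE E])
  also have "(\<Sum>E'\<in>\<E> - {E}. a E E' * of_nat (m E')) = (\<Sum>E'\<in>\<E> - {E}. of_int (int (m E') * int (card (E \<inter> E'))))"
    by (rule sum.cong[OF refl]) (simp add: a_simps(2)[OF not_sym])
  finally show ?thesis by (simp add: a_simps mult.commute)
qed

sublocale form: intersection_form \<E> a "\<lambda>E. of_nat (m E)"
proof
  show "finite \<E>" by (rule finE)
  show "a x y = a y x" for x y by (cases "x = y") (simp_all add: a_simps inf_commute)
  show "\<And>x y. x \<in> \<E> \<Longrightarrow> y \<in> \<E> \<Longrightarrow> x \<noteq> y \<Longrightarrow> 0 \<le> a x y" by (simp add: a_simps)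
  show "\<And>x. x \<in> \<E> \<Longrightarrow> 0 < (of_nat (m x) :: rat)" using m_pos by simp
  show "(\<Sum>z\<in>\<E>. a x z * of_nat (m z)) \<le> 0" if "x \<in> \<E>" for x
    unfolding super_eq[OF that] of_int_le_0_iff by (rule m_super[OF that])
  obtain x where x: "x \<in> \<E>" "int (m x) * self x + (\<Sum>E'\<in>\<E> - {x}. int (m E') * int (card (x \<inter> E'))) \<noteq> 0"
    using m_strict by (rule bexE)
  have "(\<Sum>z\<in>\<E>. a x z * of_nat (m z)) \<noteq> 0" unfolding super_eq[OF x(1)] of_int_eq_0_iff by (rule x(2))
  then show "\<exists>x\<in>\<E>. (\<Sum>z\<in>\<E>. a x z * of_nat (m z)) \<noteq> 0" using x(1) by (rule bexI)
  fix S assume S: "S \<subseteq> \<E>" "S \<noteq> {}" "S \<noteq> \<E>"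
  obtain E E' where E: "E \<in> S" "E' \<in> \<E> - S" "E \<inter> E' \<noteq> {}" using linked[OF S] by (elim bexE)
  have ne: "E \<noteq> E'" using E by auto
  have "finite (E \<inter> E')" by (rule finI) (use S E ne in auto)
  then have "a E E' \<noteq> 0" using E(3) ne by (simp add: a_simps)
  then show "\<exists>x\<in>S. \<exists>y\<in>\<E> - S. a x y \<noteq> 0" using E(1,2) by (intro bexI)
qed

lemma I_branch: "A \<in> \<F> \<Longrightarrow> E \<in> \<E> \<Longrightarrow> I (Inr A) (Inl E) = (if E = on A then 1 else 0)"
  using on_eq[of A E] by (auto simp: comp_inter_def support_def)

lemma I_sym: "I X Y = I Y X"
  by (simp add: comp_inter_def inf_commute)

lemma exceptional_inter:
  assumes E: "E \<in> \<E>" and A: "A \<in> \<F>" and X: "\<And>B. X (Inr B) = (if B = A then 1 else 0)"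
  shows "(\<Sum>C\<in>comps \<E> \<F>. X C * of_int (I (Inl E) C)) = (\<Sum>E'\<in>\<E>. a E E' * X (Inl E')) + (if E = on A then 1 else 0)"
proof -
  have "(\<Sum>B\<in>\<F>. X (Inr B) * of_int (I (Inl E) (Inr B))) = (\<Sum>B\<in>\<F>. if B = A then (if E = on A then 1 else 0) else 0)"
    by (rule sum.cong) (use I_branch[OF A E] I_sym[of "Inl E" "Inr A"] in \<open>auto simp: X\<close>)
  also have "\<dots> = (if E = on A then 1 else 0)" using finF A by simp
  finally have B: "(\<Sum>B\<in>\<F>. X (Inr B) * of_int (I (Inl E) (Inr B))) = (if E = on A then 1 else (0::rat))" .
  show ?thesis unfolding sum_comps[OF finE finF] B by (simp add: a_def mult.commute)
qed

lemma div_inter_exc: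
  assumes "E \<in> \<E>"
  shows "div_inter I (comps \<E> \<F>) X (\<lambda>C. if C = Inl E then 1 else 0) = (\<Sum>C\<in>comps \<E> \<F>. X C * of_int (I (Inl E) C))"
proof -
  have "finite (comps \<E> \<F>)" "Inl E \<in> comps \<E> \<F>" using finE finF assms by (auto simp: comps_def)
  then have "(\<Sum>C'\<in>comps \<E> \<F>. X C * (if C' = Inl E then 1 else 0) * of_int (I C C')) = X C * of_int (I (Inl E) C)" for C
    by (simp add: if_distrib if_distribR cong: if_cong) (simp add: I_sym)
  then show ?thesis by (simp add: div_inter_def)
qed

text \<open>Orthogonality to the exceptional components is the equation of the Green function with
  pole \<open>on A\<close>, since the strict transform of \<open>A\<close> meets this component
  only, and once.\<close>

lemma total_transform:
  assumes A: "A \<in> \<F>"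
  shows "total_transform I \<E> \<F> A =
    (\<lambda>C. case C of Inl E \<Rightarrow> if E \<in> \<E> then form.green (on A) E else 0 | Inr B \<Rightarrow> if B = A then 1 else 0)" (is "_ = ?X")
  unfolding total_transform_def
proof (rule the_equality)
  have "div_inter I (comps \<E> \<F>) ?X (\<lambda>C. if C = Inl E then 1 else 0) = 0" if E: "E \<in> \<E>" for E
  proof -
    have "(\<Sum>E'\<in>\<E>. a E E' * ?X (Inl E')) = (\<Sum>E'\<in>\<E>. a E E' * form.green (on A) E')" by (rule sum.cong) auto
    then show ?thesis unfolding div_inter_exc[OF E]
      by (subst exceptional_inter[OF E A]) (use form.green[of E "on A"] on[OF A] E in auto)
  qed
  then show "(\<forall>B. ?X (Inr B) = (if B = A then 1 else 0)) \<and> (\<forall>E. E \<notin> \<E> \<longrightarrow> ?X (Inl E) = 0) \<and>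
      (\<forall>E\<in>\<E>. div_inter I (comps \<E> \<F>) ?X (\<lambda>C. if C = Inl E then 1 else 0) = 0)" by simp
  fix X assume "(\<forall>B. X (Inr B) = (if B = A then 1 else 0)) \<and> (\<forall>E. E \<notin> \<E> \<longrightarrow> X (Inl E) = 0) \<and>
      (\<forall>E\<in>\<E>. div_inter I (comps \<E> \<F>) X (\<lambda>C. if C = Inl E then 1 else 0) = (0::rat))"
  then have X: "\<And>B. X (Inr B) = (if B = A then 1 else 0)" "\<And>E. E \<notin> \<E> \<Longrightarrow> X (Inl E) = 0"
    "\<And>E. E \<in> \<E> \<Longrightarrow> div_inter I (comps \<E> \<F>) X (\<lambda>C. if C = Inl E then 1 else 0) = 0" by blast+
  have sol: "(\<Sum>E'\<in>\<E>. a E E' * X (Inl E')) = (if E = on A then - 1 else 0)" if E: "E \<in> \<E>" for E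
    using X(3)[OF E] unfolding div_inter_exc[OF E] exceptional_inter[OF E A X(1)] by (auto split: if_splits)
  have "X (Inl E) = form.green (on A) E" if "E \<in> \<E>" for E
    by (rule form.green_unique[of "\<lambda>E. X (Inl E)", OF sol that])
  then show "X = ?X" by (intro ext) (auto simp: X split: sum.split)
qed

text \<open>The total transform of \<open>B\<close> is orthogonal to every exceptional component, so
  only the strict transform of \<open>A\<close> contributes, with the coefficient of
  \<open>on A\<close> in the total transform of \<open>B\<close>.\<close>

lemma branch_inter:
  assumes A: "A \<in> \<F>" and B: "B \<in> \<F>" and ne: "A \<noteq> B"
  shows "branch_inter I \<E> \<F> A B = form.green (on B) (on A)"
proof -
  define X where "X = total_transform I \<E> \<F> A"
  define Y where "Y = total_transform I \<E> \<F> B"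
  note tX = total_transform[OF A, folded X_def] and tY = total_transform[OF B, folded Y_def]
  define f where "f C = (\<Sum>C'\<in>comps \<E> \<F>. Y C' * of_int (I C C'))" for C
  have f0: "f (Inl E) = 0" if E: "E \<in> \<E>" for E
  proof -
    have "(\<Sum>E'\<in>\<E>. a E E' * Y (Inl E')) = (\<Sum>E'\<in>\<E>. a E E' * form.green (on B) E')" by (rule sum.cong) (auto simp: tY)
    then show ?thesis unfolding f_def
      by (subst exceptional_inter[OF E B]) (use form.green[of E "on B"] on[OF B] E in \<open>auto simp: tY\<close>)
  qed
  have fA: "f (Inr A) = form.green (on B) (on A)"
  proof -
    have "(\<Sum>E\<in>\<E>. Y (Inl E) * of_int (I (Inr A) (Inl E))) = (\<Sum>E\<in>\<E>. if E = on A then form.green (on B) (on A) else 0)"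
      by (rule sum.cong) (auto simp: tY I_branch[OF A])
    also have "\<dots> = form.green (on B) (on A)" using finE on[OF A] by simp
    finally have E: "(\<Sum>E\<in>\<E>. Y (Inl E) * of_int (I (Inr A) (Inl E))) = form.green (on B) (on A)" .
    have "pt A \<noteq> pt B" using pts A B ne by (auto dest: inj_onD)
    then have "I (Inr A) (Inr B) = 0" using ne by (simp add: comp_inter_def support_def)
    then have "(\<Sum>C\<in>\<F>. Y (Inr C) * of_int (I (Inr A) (Inr C))) = 0" by (intro sum.neutral) (auto simp: tY)
    then show ?thesis unfolding f_def sum_comps[OF finE finF] E by simp
  qed
  have "branch_inter I \<E> \<F> A B = (\<Sum>C\<in>comps \<E> \<F>. X C * f C)"
    unfolding branch_inter_def div_inter_def X_def[symmetric] Y_def[symmetric] f_def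
    by (simp add: sum_distrib_left mult.assoc)
  also have "\<dots> = (\<Sum>C\<in>\<F>. X (Inr C) * f (Inr C))" unfolding sum_comps[OF finE finF] using f0 by simp
  also have "\<dots> = (\<Sum>C\<in>\<F>. if C = A then f (Inr A) else 0)" by (rule sum.cong) (auto simp: tX)
  also have "\<dots> = f (Inr A)" using finF A by simp
  finally show ?thesis using fA by simp
qed

text \<open>A branch vertex hangs on the vertex of its component alone and is cut off when that
  component is the removed vertex; this accounts for the two inequations on the right.\<close>

lemma branch_separation:
  assumes A: "A \<in> \<F>" and B: "B \<in> \<F>" and ne: "A \<noteq> B"
  shows "joined snd D (comps \<E> \<F> - {Inl v}) (Inr A) (Inr B) \<longleftrightarrow>
    on A \<noteq> v \<and> on B \<noteq> v \<and> (on A, on B) \<in> (form.avoiding v)\<^sup>*"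
proof
  \<comment> \<open>Replaces a branch by the component that it meets, so that a walk in the dual
    graph projects to a walk among exceptional components.\<close>
  define rep where "rep = case_sum (\<lambda>E. E) on"
  assume "joined snd D (comps \<E> \<F> - {Inl v}) (Inr A) (Inr B)"
  then have "Inr B = (Inr A :: ('m, 'n) comp) \<or>
      on A \<noteq> v \<and> rep (Inr B) \<noteq> v \<and> (on A, rep (Inr B)) \<in> (form.avoiding v)\<^sup>*"
  proof (induction rule: rtrancl_induct)
    case (step y z)
    then obtain e0 where "e0 \<in> D" "snd e0 = {y, z}" and yz: "y \<noteq> Inl v" "z \<noteq> Inl v" by (auto simp: edge_rel_def)
    then have "(fst e0, {y, z}) \<in> D" by (metis prod.collapse)
    then obtain p where e: "(p, {y, z}) \<in> D" "y \<noteq> Inl v" "z \<noteq> Inl v" using yz by blast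
    from e(1) have "(\<exists>E E'. E \<in> \<E> \<and> E' \<in> \<E> \<and> E \<noteq> E' \<and> p \<in> E \<inter> E' \<and> y = Inl E \<and> z = Inl E') \<or>
        (\<exists>C. y = Inl (on C) \<and> z = Inr C) \<or> (\<exists>C. y = Inr C \<and> z = Inl (on C))"
      unfolding D_iff by (elim disjE exE conjE bexE) (auto simp: doubleton_eq_iff)
    then show ?case
    proof (elim disjE exE conjE)
      fix E E' assume E: "E \<in> \<E>" "E' \<in> \<E>" "E \<noteq> E'" "p \<in> E \<inter> E'" "y = Inl E" "z = Inl E'"
      have "a E E' \<noteq> 0" using E finI[OF E(1-3)] by (auto simp: a_simps)
      then have ee: "(E, E') \<in> form.avoiding v" using E e by (auto simp: form.avoiding_def)
      have ih: "on A \<noteq> v" "(on A, E) \<in> (form.avoiding v)\<^sup>*" using step.IH E(5) by (simp_all add: rep_def)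
      have "(on A, E') \<in> (form.avoiding v)\<^sup>*" by (rule rtrancl_into_rtrancl[OF ih(2) ee])
      then show ?thesis using ih(1) E(6) e(3) by (simp add: rep_def)
    next
      fix C assume "y = Inl (on C)" "z = Inr C"
      then show ?thesis using step.IH by (simp add: rep_def)
    next
      fix C assume "y = Inr C" "z = Inl (on C)"
      then show ?thesis using step.IH e(3) by (auto simp: rep_def)
    qed
  qed simp
  then show "on A \<noteq> v \<and> on B \<noteq> v \<and> (on A, on B) \<in> (form.avoiding v)\<^sup>*" using ne by (simp add: rep_def)
next
  let ?V = "comps \<E> \<F> - {Inl v}"
  assume r: "on A \<noteq> v \<and> on B \<noteq> v \<and> (on A, on B) \<in> (form.avoiding v)\<^sup>*"
  have link: "joined snd D ?V (Inl (on C)) (Inr C)" if C: "C \<in> \<F>" "on C \<noteq> v" for C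
    by (rule joined_edge[OF D_branch[OF C(1)]]) (use on[OF C(1)] C in \<open>auto simp: comps_def\<close>)
  have reach: "joined snd D ?V (Inl (on A)) (Inl E)" if "(on A, E) \<in> (form.avoiding v)\<^sup>*" for E
    using that
  proof (induction rule: rtrancl_induct)
    case (step E E')
    then have E: "E \<in> \<E>" "E' \<in> \<E>" "E \<noteq> E'" "E \<noteq> v" "E' \<noteq> v" "a E E' \<noteq> 0" by (auto simp: form.avoiding_def)
    have "E \<inter> E' \<noteq> {}" using E(6) unfolding a_simps(2)[OF E(3)] by (rule contrapos_nn) simp
    then obtain p where p: "p \<in> E \<inter> E'" by blast
    have "joined snd D ?V (Inl E) (Inl E')" by (rule joined_edge[OF D_exc[OF E(1-3) p]]) (use E in \<open>auto simp: comps_def\<close>)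
    with step.IH show ?case by (rule rtrancl_trans)
  qed simp
  have oA: "on A \<noteq> v" and oB: "on B \<noteq> v" and AB: "joined snd D ?V (Inl (on A)) (Inl (on B))"
    using r reach[of "on B"] by simp_all
  show "joined snd D ?V (Inr A) (Inr B)"
    by (rule rtrancl_trans[OF joined_sym[OF link[OF A oA]] rtrancl_trans[OF AB link[OF B oB]]])
qed

text \<open>The cases \<open>x = v\<close> and \<open>b = v\<close> in the equality statement of
  \<open>green_separation\<close> match the branches that hang on the removed component.\<close>

theorem crossing_ball_tree:
  assumes L: "L \<in> \<F>"
    and few: "\<And>H. Inr H \<in> fst (Conv \<A> \<pi> \<E> \<F>) \<Longrightarrow> \<not> 4 \<le> valency (Conv \<A> \<pi> \<E> \<F>) (Inr H)"
  shows "ultrametric_on (\<F> - {L}) (u_fun I \<E> \<F> L) \<and>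
    rooted_S_tree_iso \<F>
      (\<lambda>A. if A = L then None else Some {A}) (ball_tree (\<F> - {L}) (u_fun I \<E> \<F> L)) None
      branch_vertex (smoothing (branch_vertex ` \<F>) (Conv \<A> \<pi> \<E> \<F>)) (branch_vertex L)"
proof (rule branch_ball_tree[where c = "\<lambda>E. form.green E E" and h = "\<lambda>E A. form.green E (on A)"], fold D_def)
  show "e = e'" if "e \<in> D" "e' \<in> D" "Inr A \<in> snd e" "Inr A \<in> snd e'" for A e e'
    using branch_edge_unique[OF that(1,3)] branch_edge_unique[OF that(2,4)] by simp
  fix A B assume AB: "A \<in> \<F>" "B \<in> \<F>" "A \<noteq> B"
  note o = conjunct1[OF on[OF AB(1)]] conjunct1[OF on[OF AB(2)]]
  show "branch_inter I \<E> \<F> A B = branch_inter I \<E> \<F> B A"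
    using branch_inter[OF AB] branch_inter[OF AB(2,1)] AB(3) form.green_sym[OF o] by simp
  show "0 < branch_inter I \<E> \<F> A B" using branch_inter[OF AB] form.green_pos o by simp
  fix E assume E: "E \<in> \<E>"
  note s = form.green_separation[OF E o(2) o(1)] form.green_sym[OF o(2) E]
  show "form.green E (on A) * form.green E (on B) \<le> form.green E E * branch_inter I \<E> \<F> A B"
    using s(1,3) by (simp add: branch_inter[OF AB] mult.commute)
  show "form.green E (on A) * form.green E (on B) = form.green E E * branch_inter I \<E> \<F> A B \<longleftrightarrow>
      \<not> joined snd D (comps \<E> \<F> - {Inl E}) (Inr A) (Inr B)"
    using s(2,3) unfolding branch_separation[OF AB] branch_inter[OF AB] by (auto simp: mult.commute)
next
  fix E A assume "E \<in> \<E>"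
  then show "0 < form.green E E" by (simp add: form.green_pos)
  show "0 < form.green E (on A)" if "A \<in> \<F>" using form.green_pos \<open>E \<in> \<E>\<close> on[OF that] by blast
qed (fact multigraph finF L few)+

end

text \<open>Constant coefficients are compared: those of the arc below are the coordinates of
  \<open>\<pi> p\<close>, and a change of parameter without constant term preserves the origin
  \<open>x0\<close>.\<close>

lemma lift_over_branch:
  assumes l: "lift \<A> \<pi> A p U \<phi> \<delta>" and A: "branch X x0 A"
  shows "\<pi> p = x0"
proof -
  have c: "chart \<A> U \<phi>" and p: "p \<in> U" and d: "\<And>i. fps_nth (\<delta> $ i) 0 = \<phi> p $ i"
    and in_A: "(\<chi> i. arc_compose (\<lambda>z. \<pi> (inv_into U \<phi> z) $ i) \<delta>) \<in> A" using l by (auto simp: lift_def)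
  have "inv_into U \<phi> (\<phi> p) = p" using c p by (auto simp: chart_def homeomorphism_def)
  moreover have "(\<chi> i. fps_nth (\<delta> $ i) 0) = \<phi> p" by (simp add: d vec_eq_iff)
  ultimately have 0: "fps_nth (arc_compose (\<lambda>z. \<pi> (inv_into U \<phi> z) $ i) \<delta>) 0 = \<pi> p $ i" for i
    by (simp add: arc_compose_def)
  obtain \<gamma> where g: "\<And>i. fps_nth (\<gamma> $ i) 0 = x0 $ i"
    "A = {(\<chi> i. fps_compose (\<gamma> $ i) \<tau>) | \<tau>. fps_nth \<tau> 0 = 0 \<and> fps_nth \<tau> 1 \<noteq> 0}"
    using A by (auto simp: branch_def)
  then obtain \<tau> where "(\<chi> i. arc_compose (\<lambda>z. \<pi> (inv_into U \<phi> z) $ i) \<delta>) = (\<chi> i. fps_compose (\<gamma> $ i) \<tau>)"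
    using in_A by auto
  then have "arc_compose (\<lambda>z. \<pi> (inv_into U \<phi> z) $ i) \<delta> = fps_compose (\<gamma> $ i) \<tau>" for i
    by (simp add: vec_eq_iff)
  then have "\<pi> p $ i = x0 $ i" for i using 0[of i] g(1)[of i] by simp
  then show ?thesis by (simp add: vec_eq_iff)
qed

lemma strict_point_fibre:
  assumes "embedded_resolution \<A> \<pi> \<E> \<F>" "A \<in> \<F>" "branch X x0 A"
  shows "\<pi> (strict_point \<A> \<pi> A) = x0"
proof -
  obtain U \<phi> \<delta> where "lift \<A> \<pi> A (strict_point \<A> \<pi> A) U \<phi> \<delta>"
    using bspec[OF conjunct1[OF conjunct2[OF assms(1)[unfolded embedded_resolution_def]]] assms(2)]
    by (elim exE conjE)
  then show ?thesis using assms(3) by (rule lift_over_branch)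
qed

section \<open>The two cases: without and with exceptional components\<close>

lemma at_most_two_components:
  assumes "embedded_resolution \<A> \<pi> \<E> \<F>" "finite \<E>" "finite \<F>"
    and "S \<subseteq> comps \<E> \<F>" "\<And>C. C \<in> S \<Longrightarrow> p \<in> support \<A> \<pi> C"
  shows "card S \<le> 2"
proof -
  have "S \<subseteq> {C \<in> comps \<E> \<F>. p \<in> support \<A> \<pi> C}" using assms(4,5) by blast
  moreover have "finite (comps \<E> \<F>)" using assms(2,3) by (simp add: comps_def)
  ultimately have "card S \<le> card {C \<in> comps \<E> \<F>. p \<in> support \<A> \<pi> C}" by (intro card_mono) auto
  also have "\<dots> \<le> 2" using assms(1) unfolding embedded_resolution_def by (elim conjE) (erule allE)
  finally show ?thesis .
qed

text \<open>When \<open>\<pi>\<close> is an isomorphism there are at most two branches, and they cross at the only point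
  of the fibre.\<close>

lemma smooth_point_ball_tree:
  fixes \<A> :: "('m::t2_space) atlas" and \<pi> :: "'m \<Rightarrow> complex ^ 'n" and \<F> :: "'n formal_branch set"
  assumes fin: "finite \<F>" and L: "L \<in> \<F>" and card: "card \<F> \<le> 2"
    and pt: "\<And>A. A \<in> \<F> \<Longrightarrow> strict_point \<A> \<pi> A = p"
    and few: "\<And>H. Inr H \<in> fst (Conv \<A> \<pi> {} \<F>) \<Longrightarrow> \<not> 4 \<le> valency (Conv \<A> \<pi> {} \<F>) (Inr H)"
  shows "ultrametric_on (\<F> - {L}) (u_fun (comp_inter \<A> \<pi> self) {} \<F> L) \<and>
    rooted_S_tree_iso \<F>
      (\<lambda>A. if A = L then None else Some {A}) (ball_tree (\<F> - {L}) (u_fun (comp_inter \<A> \<pi> self) {} \<F> L)) None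
      branch_vertex (smoothing (branch_vertex ` \<F>) (Conv \<A> \<pi> {} \<F>)) (branch_vertex L)"
proof -
  let ?I = "comp_inter \<A> \<pi> self"
  define D where "D = snd (dual_graph \<A> \<pi> {} \<F>)"
  have V: "comps {} \<F> = (Inr ` \<F> :: ('m, 'n) comp set)" by (simp add: comps_def)
  have D: "e \<in> D \<longleftrightarrow> (\<exists>A\<in>\<F>. \<exists>B\<in>\<F>. A \<noteq> B \<and> e = (p, {Inr A, Inr B}))" for e
  proof
    assume "e \<in> D"
    then obtain q X Y where e: "e = (q, {X, Y})" "X \<in> Inr ` \<F>" "Y \<in> Inr ` \<F>" "X \<noteq> Y" "q \<in> support \<A> \<pi> X"
      unfolding D_def dual_graph_def V snd_conv mem_Collect_eq Int_iff by (elim exE conjE)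
    from e(2,3) obtain A B where AB: "A \<in> \<F>" "B \<in> \<F>" "X = Inr A" "Y = Inr B" by (elim imageE)
    then have "A \<noteq> B" "e = (p, {Inr A, Inr B})" using e pt by (auto simp: support_def)
    then show "\<exists>A\<in>\<F>. \<exists>B\<in>\<F>. A \<noteq> B \<and> e = (p, {Inr A, Inr B})" using AB(1,2) by (intro bexI conjI)
  next
    assume "\<exists>A\<in>\<F>. \<exists>B\<in>\<F>. A \<noteq> B \<and> e = (p, {Inr A, Inr B})"
    then obtain A B where AB: "A \<in> \<F>" "B \<in> \<F>" "A \<noteq> B" "e = (p, {Inr A, Inr B})" by (elim bexE conjE)
    show "e \<in> D" unfolding D_def dual_graph_def V snd_conv mem_Collect_eq
      by (rule exI[of _ p], rule exI[of _ "Inr A"], rule exI[of _ "Inr B"]) (use AB pt in \<open>simp add: support_def\<close>)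
  qed
  have third: "B = B'" if "A \<in> \<F>" "B \<in> \<F>" "B' \<in> \<F>" "A \<noteq> B" "A \<noteq> B'" for A B B'
  proof (rule ccontr)
    assume "B \<noteq> B'"
    then have "card {A, B, B'} = 3" using that by simp
    moreover have "card {A, B, B'} \<le> card \<F>" using that fin by (intro card_mono) auto
    ultimately show False using card by simp
  qed
  have mg: "multigraph snd (comps {} \<F> :: ('m, 'n) comp set) D"
  proof
    show "finite (comps {} \<F> :: ('m, 'n) comp set)" using fin by (simp add: V)
    have "D \<subseteq> (\<lambda>(A, B). (p, {Inr A, Inr B})) ` (\<F> \<times> \<F>)" using D by force
    then show "finite D" using fin by (meson finite_SigmaI finite_imageI finite_subset)
    show two: "\<exists>x y. x \<in> comps {} \<F> \<and> y \<in> comps {} \<F> \<and> x \<noteq> y \<and> snd e = {x, y}" if "e \<in> D" for e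
      using that unfolding D V by fastforce
    have "joined snd D (comps {} \<F>) x y" if xy: "x \<in> comps {} \<F>" "y \<in> comps {} \<F>" for x y
    proof (cases "x = y")
      case False
      obtain A B where "A \<in> \<F>" "B \<in> \<F>" "x = Inr A" "y = Inr B" using xy V by auto
      then have "(p, {x, y}) \<in> D" using False D by blast
      then show ?thesis using xy by (intro joined_edge[of "(p, {x, y})"]) auto
    qed simp
    moreover have "cells_connected snd (comps {} \<F>) D \<longleftrightarrow>
        (\<forall>x\<in>comps {} \<F>. \<forall>y\<in>comps {} \<F>. joined snd D (comps {} \<F>) x y)"
      by (rule cells_connected_iff) (use two in blast)
    ultimately show "cells_connected snd (comps {} \<F>) D" by simp
  qed
  have leaf: "e = e'" if "A \<in> \<F>" "e \<in> D" "e' \<in> D" "Inr A \<in> snd e" "Inr A \<in> snd e'" for A e e'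
  proof -
    have "\<exists>B\<in>\<F>. A \<noteq> B \<and> e = (p, {Inr A, Inr B})" if "e \<in> D" "Inr A \<in> snd e" for e
      using that unfolding D by (auto simp: insert_commute)
    then show ?thesis using third[OF that(1)] that by metis
  qed
  \<comment> \<open>There is no exceptional part: the total transform of a branch is the branch
    itself, and two branches cross once, at \<open>p\<close>.\<close>
  have inter: "branch_inter ?I {} \<F> A B = 1" if AB: "A \<in> \<F>" "B \<in> \<F>" "A \<noteq> B" for A B
  proof -
    have tt: "total_transform ?I {} \<F> E = (\<lambda>C. if C = Inr E then 1 else 0)" for E
      unfolding total_transform_def
    proof (rule the_equality)
      fix X :: "('m, 'n) comp \<Rightarrow> rat"
      assume X: "(\<forall>B. X (Inr B) = (if B = E then 1 else 0)) \<and> (\<forall>E. E \<notin> {} \<longrightarrow> X (Inl E) = 0) \<and>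
        (\<forall>E\<in>{}. div_inter ?I (comps {} \<F>) X (\<lambda>C. if C = Inl E then 1 else 0) = 0)"
      show "X = (\<lambda>C. if C = Inr E then 1 else 0)"
      proof
        fix C show "X C = (if C = Inr E then 1 else 0)" by (cases C) (use X in auto)
      qed
    qed auto
    have "branch_inter ?I {} \<F> A B = (\<Sum>C\<in>\<F>. \<Sum>C'\<in>\<F>. if C = A then if C' = B then of_int (?I (Inr C) (Inr C')) else 0 else 0)"
      unfolding branch_inter_def div_inter_def tt V
      by (simp add: sum.reindex) (intro sum.cong; auto)
    also have "\<dots> = (\<Sum>C\<in>\<F>. if C = A then of_int (?I (Inr C) (Inr B)) else 0)"
      by (rule sum.cong[OF refl]) (use fin AB in auto)
    also have "\<dots> = of_int (?I (Inr A) (Inr B))" using fin AB by simp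
    also have "\<dots> = 1" using AB pt by (simp add: comp_inter_def support_def)
    finally show ?thesis .
  qed
  show ?thesis
  proof (rule branch_ball_tree[where c = "\<lambda>_. 1" and h = "\<lambda>_ _. 1"], fold D_def)
    fix A B assume AB: "A \<in> \<F>" "B \<in> \<F>" "A \<noteq> B"
    show "0 < branch_inter ?I {} \<F> A B" by (simp add: inter[OF AB])
    show "branch_inter ?I {} \<F> A B = branch_inter ?I {} \<F> B A" using inter[OF AB] inter[OF AB(2,1) not_sym[OF AB(3)]] by simp
  qed (fact mg fin L leaf few | simp only: empty_iff)+
qed

theorem theorem2:
  fixes X :: "(complex ^ 'n) set" and x0 :: "complex ^ 'n"
    and \<A> :: "('m::t2_space) atlas" and \<pi> :: "'m \<Rightarrow> complex ^ 'n"
    and \<E> :: "'m set set" and self :: "'m set \<Rightarrow> int"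
    and \<F> :: "'n formal_branch set" and L :: "'n formal_branch"
  defines "u \<equiv> u_fun (comp_inter \<A> \<pi> self) \<E> \<F> L"
  assumes "normal_surface X" and "x0 \<in> X"
    and "finite \<F>" and "\<And>A. A \<in> \<F> \<Longrightarrow> branch X x0 A" and "L \<in> \<F>"
    and "resolution X x0 \<A> \<pi>"
    and "exceptional_components \<A> \<pi> x0 \<E>"
    and "\<And>E. E \<in> \<E> \<Longrightarrow> self_intersection \<A> E (self E)"
    and "embedded_resolution \<A> \<pi> \<E> \<F>"
    and "\<And>H. Inr H \<in> fst (Conv \<A> \<pi> \<E> \<F>) \<Longrightarrow> \<not> 4 \<le> valency (Conv \<A> \<pi> \<E> \<F>) (Inr H)"
  shows "ultrametric_on (\<F> - {L}) u \<and>
    rooted_S_tree_iso \<F>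
      (\<lambda>A. if A = L then None else Some {A}) (ball_tree (\<F> - {L}) u) None
      branch_vertex (smoothing (branch_vertex ` \<F>) (Conv \<A> \<pi> \<E> \<F>)) (branch_vertex L)"
proof -
  note surface = assms(2,3) and branches = assms(4-6) and res = assms(7) and exc = assms(8)
    and si = assms(9) and emb = assms(10) and few = assms(11)
  interpret surface_resolution X x0 \<A> \<pi> by unfold_locales (fact surface res)+
  have pt0: "strict_point \<A> \<pi> A \<in> \<pi> -` {x0}" if "A \<in> \<F>" for A
    using strict_point_fibre[OF emb that branches(2)[OF that]] by simp
  have finE: "finite \<E>" and curve: "\<And>E. E \<in> \<E> \<Longrightarrow> smooth_curve \<A> E"
    and fibre: "\<Union>\<E> = \<pi> -` {x0} \<or> \<E> = {} \<and> (\<exists>p. \<pi> -` {x0} = {p})"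
    using exc unfolding exceptional_components_def by (elim conjE, simp)+
  note two = at_most_two_components[OF emb finE branches(1)]
  show ?thesis
  proof (cases "\<E> = {}")
    case True
    then obtain p where p: "\<pi> -` {x0} = {p}" using fibre pt0[OF branches(3)] by auto
    have pt: "strict_point \<A> \<pi> A = p" if "A \<in> \<F>" for A using pt0[OF that] p by simp
    \<comment> \<open>All branches pass through \<open>p\<close>, and normal crossings allow only
      two components there.\<close>
    have "card ((Inr :: _ \<Rightarrow> ('m, 'n) comp) ` \<F>) \<le> 2"
      by (rule two[where p = p]) (use pt in \<open>auto simp: comps_def support_def\<close>)
    then have "card \<F> \<le> 2" by (simp add: card_image)
    show ?thesis unfolding u_def True
      by (rule smooth_point_ball_tree[where p = p]) (fact branches \<open>card \<F> \<le> 2\<close> pt few[unfolded True])+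
  next
    case False
    then have cover: "\<Union>\<E> = \<pi> -` {x0}" using fibre by blast
    obtain m :: "'m set \<Rightarrow> nat" where m: "\<And>E. E \<in> \<E> \<Longrightarrow> 0 < m E"
      "\<And>E. E \<in> \<E> \<Longrightarrow> int (m E) * self E + (\<Sum>E'\<in>\<E> - {E}. int (m E') * int (card (E \<inter> E'))) \<le> 0"
      "\<exists>E\<in>\<E>. int (m E) * self E + (\<Sum>E'\<in>\<E> - {E}. int (m E') * int (card (E \<inter> E'))) \<noteq> 0"
      "\<And>E E'. E \<in> \<E> \<Longrightarrow> E' \<in> \<E> \<Longrightarrow> E \<noteq> E' \<Longrightarrow> finite (E \<inter> E')"
      by (rule exceptional_weights[OF exc False si emb branches(1)], assumption) (rule that)
    \<comment> \<open>Otherwise the connected fibre would be the union of two disjoint non-empty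
      closed sets.\<close>
    have linked: "\<exists>E\<in>S. \<exists>E'\<in>\<E> - S. E \<inter> E' \<noteq> {}" if S: "S \<subseteq> \<E>" "S \<noteq> {}" "S \<noteq> \<E>" for S
    proof (rule ccontr)
      assume n: "\<not> (\<exists>E\<in>S. \<exists>E'\<in>\<E> - S. E \<inter> E' \<noteq> {})"
      have cl: "closed (\<Union>S')" if "S' \<subseteq> \<E>" for S'
        by (rule closed_Union) (use finite_subset[OF that finE] that curve in \<open>auto simp: smooth_curve_def\<close>)
      have ne: "\<Union>S' \<noteq> {}" if S': "S' \<subseteq> \<E>" "S' \<noteq> {}" for S'
      proof -
        obtain E where "E \<in> S'" using S'(2) by blast
        moreover have "E \<noteq> {}" using curve[of E] S'(1) calculation by (auto simp: smooth_curve_def)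
        ultimately show ?thesis by blast
      qed
      have "\<Union>S \<inter> \<Union>(\<E> - S) \<inter> \<pi> -` {x0} = {}" "\<pi> -` {x0} \<subseteq> \<Union>S \<union> \<Union>(\<E> - S)" using n cover by blast+
      moreover have "\<Union>S \<inter> \<pi> -` {x0} = \<Union>S" "\<Union>(\<E> - S) \<inter> \<pi> -` {x0} = \<Union>(\<E> - S)" using S(1) cover by blast+
      moreover have S': "\<E> - S \<subseteq> \<E>" "\<E> - S \<noteq> {}" using S(1,3) by blast+
      ultimately have "\<not> connected (\<pi> -` {x0})"
        unfolding connected_closed not_not using cl[OF S(1)] cl[OF S'(1)] ne[OF S(1,2)] ne[OF S']
        by (intro exI[of _ "\<Union>S"] exI[of _ "\<Union>(\<E> - S)"] conjI) simp_all
      then show False using connected_fibre by (rule notE)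
    qed
    have one: "E = E'" if "A \<in> \<F>" "E \<in> \<E>" "E' \<in> \<E>" "strict_point \<A> \<pi> A \<in> E \<inter> E'" for A E E'
    proof (rule ccontr)
      assume "E \<noteq> E'"
      \<comment> \<open>Three components through one point are excluded by normal crossings.\<close>
      have "card {Inr A, Inl E, Inl E'} \<le> 2"
        by (rule two[where p = "strict_point \<A> \<pi> A"]) (use that in \<open>auto simp: comps_def support_def\<close>)
      then show False using \<open>E \<noteq> E'\<close> by simp
    qed
    have "crossing_components \<A> \<pi> self \<E> \<F> m"
    proof
      show "\<exists>!E. E \<in> \<E> \<and> strict_point \<A> \<pi> A \<in> E" if A: "A \<in> \<F>" for A
      proof -
        obtain E where "E \<in> \<E>" "strict_point \<A> \<pi> A \<in> E" using pt0[OF A] cover by blast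
        then show ?thesis using one[OF A] by blast
      qed
      show "inj_on (strict_point \<A> \<pi>) \<F>"
      proof (rule inj_onI, rule ccontr)
        fix A B assume AB: "A \<in> \<F>" "B \<in> \<F>" "strict_point \<A> \<pi> A = strict_point \<A> \<pi> B" "A \<noteq> B"
        obtain E where E: "E \<in> \<E>" "strict_point \<A> \<pi> A \<in> E" using pt0[OF AB(1)] cover by blast
        have "card {Inr A, Inr B, Inl E} \<le> 2"
          by (rule two[where p = "strict_point \<A> \<pi> A"]) (use AB E in \<open>auto simp: comps_def support_def\<close>)
        then show False using AB(4) by simp
      qed
    qed (fact finE branches(1) False linked m)+
    then show ?thesis unfolding u_def
      by (rule crossing_components.crossing_ball_tree) (fact branches few)+
  qed
qed

end
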